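(* Let $f$ be a nonzero modular form of weight $r>0$ for a finite index subgroup $\Gamma$ of $\mathrm{SL}_2(\mathbb Z)$ (setting as in the context), let $\alpha>\alpha_0$, let $x$ be an irrational number, and let $\beta(x),\beta^*(x),\beta^{**}(x)$ be the Hölder exponents at $x$ of any one of $f_\alpha$, $\Re f_\alpha$, $\Im f_\alpha$. Then: (1) If $f$ is a cusp form, $\beta(x)=\beta^*(x)=\beta^{**}(x)=\alpha-r/2$. (2) If $f$ is not a cusp form, then $\beta(x)=\alpha-(1-1/\tau_x)r$; $\beta^*(x)=[\alpha-r]+\min(1,\{\alpha-r\}+r/\tau_x)$ if $\alpha-r\notin\mathbb Z$ and $\beta^*(x)=\alpha-r$ if $\alpha-r\in\mathbb Z$; and $\beta^{**}(x)=\alpha-r$.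
   Context: Let $\Gamma$ be a subgroup of finite index of $\mathrm{SL}_2(\mathbb Z)$, $r>0$ real, and $\{\mu_\gamma\}$ a multiplier system of unimodular complex numbers. $f$ is a nonzero modular form of weight $r$: holomorphic on $\mathbb H$, $f(\gamma z)=\mu_\gamma(cz+d)^rf(z)$ for all $\gamma=\begin{pmatrix}a&b\\c&d\end{pmatrix}\in\Gamma$, at most polynomial growth as $\Im z\to0^+$. Powers use the branch $-\pi<\arg z\le\pi$; $f^\gamma(z)=(\det\gamma)^{r/2}f(\gamma z)/(cz+d)^r$. Cusps: $\mathbb Q\cup\{\infty\}$, with width $m_{\mathfrak a}$ (order of the stabilizer of $\mathfrak a$ in $\mathrm{SL}_2(\mathbb Z)$ modulo $\Gamma$). Scaling matrix $\sigma_{\mathfrak a}=\gamma\,\mathrm{diag}(\sqrt{m_{\mathfrak a}},1/\sqrt{m_{\mathfrak a}})$ with $\gamma\in\mathrm{SL}_2(\mathbb Z)$, $\gamma(\infty)=\mathfrak a$; $f^{\sigma_{\mathfrak a}}(z)=\sum_{n\ge0}a_n^{\mathfrak a}e^{2\pi i(n+\kappa_{\mathfrak a})z}$, $0\le\kappa_{\mathfrak a}<1$ assumed rational. $f$ is cuspidal at $\mathfrak a$ if $\kappa_{\mathfrak a}>0$ or $a_0^{\mathfrak a}=0$; a rational is non-cuspidal if $f$ is not cuspidal at it; $f$ is a cusp form if cuspidal everywhere. With $m=m_\infty,\kappa=\kappa_\infty$, $f(mz)=\sum a_ne^{2\pi i(n+\kappa)z}$ and $f_\alpha(mx)=\sum_{n+\kappa>0}a_n(n+\kappa)^{-\alpha}e^{2\pi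 i(n+\kappa)x}$. $\alpha_0=r/2$ if $f$ is a cusp form, $\alpha_0=r$ otherwise. $[s],\{s\}$ are integer and fractional parts. $\tau_x=\sup\{\tau:$ there is $C>0$ with $|x-p/q|\le Cq^{-\tau}$ for infinitely many non-cuspidal rationals $p/q\}$ (rationals in lowest terms, $q>0$). Hölder exponents of a continuous $g$ at $x_0$: $g\in\mathcal C^s(x_0)$ if some polynomial $P$ of degree $<s$ satisfies $|g(x)-P(x-x_0)|\le C|x-x_0|^s$ as $x\to x_0$; for $0\le s\le1$, $\Lambda^s(x_0)=\mathcal C^s(x_0)$ and $\Lambda^s(\Omega)$ denotes uniform $s$-Hölder continuous functions on $\Omega$; $g\in\mathcal C^{k,s}(x_0)$ if $g^{(k)}$ exists on an interval around $x_0$ and lies in $\Lambda^s(x_0)$; $g\in\mathcal C^{k,s}(I)$ if $g^{(k)}$ exists on the open interval $I$ and lies in $\Lambda^s(K)$ for each compact $K\subset I$. $\beta(x_0)=\sup\{s:g\in\mathcal C^s(x_0)\}$, $\beta^*(x_0)=\sup\{k+s:g\in\mathcal C^{k,s}(x_0)\}$, $\beta^{**}(x_0)=\lim_{I\to\{x_0\}}\sup\{k+s:g\in\mathcal C^{k,s}(I)\}$ over nested open intervals shrinking to $x_0$. *)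

theory Defs
  imports "HOL-Analysis.Analysis" "HOL-Computational_Algebra.Polynomial" "HOL-Algebra.Coset"
begin

text \<open>A matrix ((a,b),(c,d)) is represented as the tuple (a,b,c,d).\<close>
type_synonym mat2 = "int \<times> int \<times> int \<times> int"

definition mmul :: "mat2 \<Rightarrow> mat2 \<Rightarrow> mat2" where
  "mmul A B = (case A of (a,b,c,d) \<Rightarrow> case B of (a',b',c',d') \<Rightarrow>
      (a*a' + b*c', a*b' + b*d', c*a' + d*c', c*b' + d*d'))"

definition mneg :: "mat2 \<Rightarrow> mat2" where
  "mneg A = (case A of (a,b,c,d) \<Rightarrow> (-a,-b,-c,-d))"

definition minv :: "mat2 \<Rightarrow> mat2" where
  "minv A = (case A of (a,b,c,d) \<Rightarrow> (d,-b,-c,a))"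

definition SL2Z :: "mat2 monoid" where
  "SL2Z = \<lparr>carrier = {(a,b,c,d). a*d - b*c = 1}, mult = mmul, one = (1,0,0,1)\<rparr>"

definition finite_index_subgroup :: "mat2 set \<Rightarrow> bool" where
  "finite_index_subgroup \<Gamma> \<longleftrightarrow> subgroup \<Gamma> SL2Z \<and> finite (rcosets\<^bsub>SL2Z\<^esub> \<Gamma>)"

definition moebius :: "mat2 \<Rightarrow> complex \<Rightarrow> complex" where
  "moebius A z = (case A of (a,b,c,d) \<Rightarrow>
      (of_int a * z + of_int b) / (of_int c * z + of_int d))"

text \<open>Image of the cusp \<infinity> under a matrix; cusps are elements of rat option,
  with None standing for \<infinity>.\<close>
definition cusp_of :: "mat2 \<Rightarrow> rat option" where
  "cusp_of A = (case A of (a,b,c,d) \<Rightarrow> if c = 0 then None else Some (Fract a c))"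

definition cusp_width :: "mat2 set \<Rightarrow> mat2 \<Rightarrow> nat" where
  "cusp_width \<Gamma> \<gamma> = (LEAST m::nat. 0 < m \<and>
      (mmul (mmul \<gamma> (1, int m, 0, 1)) (minv \<gamma>) \<in> \<Gamma> \<or>
       mneg (mmul (mmul \<gamma> (1, int m, 0, 1)) (minv \<gamma>)) \<in> \<Gamma>))"

text \<open>The slash f^\<sigma> with \<sigma> = \<gamma> diag(sqrt m, 1/sqrt m) (det \<sigma> = 1);
  powers use the principal branch (complex powr, -pi < arg <= pi).\<close>
definition f_sigma :: "(complex \<Rightarrow> complex) \<Rightarrow> real \<Rightarrow> mat2 \<Rightarrow> nat \<Rightarrow> complex \<Rightarrow> complex" where
  "f_sigma f r \<gamma> m z = (case \<gamma> of (a,b,c,d) \<Rightarrow>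
      f (moebius \<gamma> (of_nat m * z)) /
      (complex_of_real (of_int c * sqrt (real m)) * z + complex_of_real (of_int d / sqrt (real m)))
        powr complex_of_real r)"

definition fourier_expansion_at ::
  "(complex \<Rightarrow> complex) \<Rightarrow> real \<Rightarrow> mat2 set \<Rightarrow> mat2 \<Rightarrow> real \<Rightarrow> (nat \<Rightarrow> complex) \<Rightarrow> bool" where
  "fourier_expansion_at f r \<Gamma> \<gamma> \<kappa> a \<longleftrightarrow> 0 \<le> \<kappa> \<and> \<kappa> < 1 \<and>
     (\<forall>z. 0 < Im z \<longrightarrow>
        (\<lambda>n. a n * exp (2 * pi * \<i> * complex_of_real (real n + \<kappa>) * z))
          sums f_sigma f r \<gamma> (cusp_width \<Gamma> \<gamma>) z)"

definition cuspidal_at :: "(complex \<Rightarrow> complex) \<Rightarrow> real \<Rightarrow> mat2 set \<Rightarrow> rat option \<Rightarrow> bool" where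
  "cuspidal_at f r \<Gamma> p \<longleftrightarrow> (\<exists>\<gamma>\<in>carrier SL2Z. cusp_of \<gamma> = p \<and>
      (\<exists>\<kappa> a. fourier_expansion_at f r \<Gamma> \<gamma> \<kappa> a \<and> (0 < \<kappa> \<or> a 0 = 0)))"

definition cusp_form :: "(complex \<Rightarrow> complex) \<Rightarrow> real \<Rightarrow> mat2 set \<Rightarrow> bool" where
  "cusp_form f r \<Gamma> \<longleftrightarrow> (\<forall>p. cuspidal_at f r \<Gamma> p)"

definition modular_form :: "mat2 set \<Rightarrow> (mat2 \<Rightarrow> complex) \<Rightarrow> real \<Rightarrow> (complex \<Rightarrow> complex) \<Rightarrow> bool" where
  "modular_form \<Gamma> \<mu> r f \<longleftrightarrow>
     finite_index_subgroup \<Gamma> \<and> 0 < r \<and>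
     (\<forall>\<gamma>\<in>\<Gamma>. cmod (\<mu> \<gamma>) = 1) \<and>
     f holomorphic_on {z. 0 < Im z} \<and>
     (\<forall>\<gamma>\<in>\<Gamma>. \<forall>z. 0 < Im z \<longrightarrow>
        f (moebius \<gamma> z) = \<mu> \<gamma> * (case \<gamma> of (a,b,c,d) \<Rightarrow>
           (of_int c * z + of_int d) powr complex_of_real r) * f z) \<and>
     (\<exists>C N \<delta>. 0 < \<delta> \<and> (\<forall>z. 0 < Im z \<and> Im z < \<delta> \<longrightarrow> cmod (f z) \<le> C * Im z powr (- N)))"

definition tau_exp :: "(complex \<Rightarrow> complex) \<Rightarrow> real \<Rightarrow> mat2 set \<Rightarrow> real \<Rightarrow> ereal" where
  "tau_exp f r \<Gamma> x = Sup {ereal t | t. \<exists>C>0. infinite {\<rho>::rat.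
      \<not> cuspidal_at f r \<Gamma> (Some \<rho>) \<and>
      \<bar>x - of_rat \<rho>\<bar> \<le> C * real_of_int (snd (quotient_of \<rho>)) powr (- t)}}"

definition f_alpha :: "nat \<Rightarrow> real \<Rightarrow> (nat \<Rightarrow> complex) \<Rightarrow> real \<Rightarrow> real \<Rightarrow> complex" where
  "f_alpha m \<kappa> a \<alpha> t = (\<Sum>n. if 0 < real n + \<kappa> then
      a n * complex_of_real ((real n + \<kappa>) powr (- \<alpha>)) *
      exp (2 * pi * \<i> * complex_of_real ((real n + \<kappa>) * (t / real m))) else 0)"

definition holder_pt :: "(real \<Rightarrow> complex) \<Rightarrow> real \<Rightarrow> real \<Rightarrow> bool" where
  "holder_pt g x0 s \<longleftrightarrow> (\<exists>P::complex poly. (P = 0 \<or> real (degree P) < s) \<and>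
     (\<exists>C. eventually (\<lambda>x. cmod (g x - poly P (complex_of_real (x - x0))) \<le> C * \<bar>x - x0\<bar> powr s) (at x0)))"

definition derivs_on :: "(real \<Rightarrow> complex) \<Rightarrow> nat \<Rightarrow> (nat \<Rightarrow> real \<Rightarrow> complex) \<Rightarrow> real set \<Rightarrow> bool" where
  "derivs_on g k D I \<longleftrightarrow> (\<forall>x\<in>I. D 0 x = g x) \<and>
     (\<forall>j<k. \<forall>x\<in>I. (D j has_vector_derivative D (Suc j) x) (at x))"

definition holder_ks_pt :: "(real \<Rightarrow> complex) \<Rightarrow> real \<Rightarrow> nat \<Rightarrow> real \<Rightarrow> bool" where
  "holder_ks_pt g x0 k s \<longleftrightarrow> 0 \<le> s \<and> s \<le> 1 \<and>
     (\<exists>\<delta>>0. \<exists>D. derivs_on g k D {x0 - \<delta><..<x0 + \<delta>} \<and> holder_pt (D k) x0 s)"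

definition unif_holder :: "(real \<Rightarrow> complex) \<Rightarrow> real set \<Rightarrow> real \<Rightarrow> bool" where
  "unif_holder h K s \<longleftrightarrow> (\<exists>C. \<forall>x\<in>K. \<forall>y\<in>K. cmod (h x - h y) \<le> C * \<bar>x - y\<bar> powr s)"

definition holder_ks_int :: "(real \<Rightarrow> complex) \<Rightarrow> real set \<Rightarrow> nat \<Rightarrow> real \<Rightarrow> bool" where
  "holder_ks_int g I k s \<longleftrightarrow> 0 \<le> s \<and> s \<le> 1 \<and>
     (\<exists>D. derivs_on g k D I \<and> (\<forall>K. compact K \<and> K \<subseteq> I \<longrightarrow> unif_holder (D k) K s))"

definition holder_beta :: "(real \<Rightarrow> complex) \<Rightarrow> real \<Rightarrow> ereal" where
  "holder_beta g x0 = Sup (ereal ` {s. holder_pt g x0 s})"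

definition holder_beta_star :: "(real \<Rightarrow> complex) \<Rightarrow> real \<Rightarrow> ereal" where
  "holder_beta_star g x0 = Sup {ereal (real k + s) | k s. holder_ks_pt g x0 k s}"

definition holder_beta_2star :: "(real \<Rightarrow> complex) \<Rightarrow> real \<Rightarrow> ereal" where
  "holder_beta_2star g x0 = Lim (at_left x0 \<times>\<^sub>F at_right x0)
      (\<lambda>(a,b). Sup {ereal (real k + s) | k s. holder_ks_int g {a<..<b} k s})"

end

theory Submission
  imports Defs "HOL-Complex_Analysis.Complex_Analysis"
begin

text \<open>
  After rescaling, \<open>f\<close> minus its constant term is a series \<open>\<Phi>(w) = \<Sum>j c\<^sub>j e\<^sup>i\<^sup>j\<^sup>w\<close>, and the fractional integral
  of order \<open>\<alpha>\<close> has boundary values \<open>g(x) = \<Sum>j c\<^sub>j j powr (-\<alpha>) e\<^sup>i\<^sup>j\<^sup>x\<close>.  Two Tauberian facts tie the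
  pointwise regularity of \<open>g\<close> to the growth of \<open>\<Phi>\<close>.  First, since \<open>g(x)\<close> is up to a Gamma factor the
  integral of \<open>y powr (\<alpha>-1) \<Phi>(x + iy)\<close>, a bound
  \<open>\<bar>\<Phi>(x+h+iy)\<bar> \<le> C y powr (-\<sigma>) (\<bar>h\<bar> + y) powr \<theta>\<close> gives a Taylor polynomial of \<open>g\<close> at \<open>x\<close> with error
  \<open>\<bar>h\<bar> powr (\<alpha>-\<sigma>+\<theta>)\<close>, uniformly in \<open>x\<close>.  Second, \<open>\<Phi>(x + iy)\<close> is recovered by integrating \<open>g\<close> against a
  kernel of size \<open>\<bar>w\<bar> powr (-\<alpha>-1)\<close> having only nonnegative frequencies; it annihilates both \<open>cnj g\<close>
  and (almost) the Taylor polynomial, so an exponent \<open>s\<close> of \<open>g\<close>, of \<open>Re g\<close> or of \<open>Im g\<close> forces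
  \<open>\<Phi> = O(y powr (s-\<alpha>))\<close> near \<open>x\<close>.

  The growth of \<open>f\<close> comes from moving points by \<open>SL2Z\<close> and Dirichlet approximation.  Near an irrational,
  \<open>\<bar>f\<bar>\<close> is of size at least \<open>y powr (-r/2)\<close> along some sequence, which is optimal for cusp forms; near
  a non-cuspidal \<open>p/q\<close> it is of size \<open>\<bar>qz - p\<bar> powr (-r)\<close>, so that the exponent at \<open>x\<close> is dictated by how
  well \<open>x\<close> is approximated by non-cuspidal rationals.  The exponents \<open>\<beta>*\<close> and \<open>\<beta>**\<close> follow by applying
  this to the derivatives of \<open>g\<close>, which are again of the same shape with \<open>\<alpha>\<close> lowered, and
  by noting that no derivative beyond order \<open>\<alpha> - r\<close> can exist at the non-cuspidal rationals near \<open>x\<close>.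
\<close>

section \<open>Boundary values of fractional integrals\<close>

text \<open>Only \<open>\<rho>\<close>-growth of the series is known, and for
  \<open>\<alpha>\<close> just above the threshold the boundary series need not converge absolutely.
  Everything on the real line therefore goes through bounds for partial sums, and sum and vertical
  integral are exchanged only after Abel summation. Rationality of kappa makes all frequencies
  multiples of a single one, so the series is a power series in one exponential and the kernel
  integral runs over one period. Multipliers and branches of powers disappear because only the
  modulus of \<open>f\<close> enters; kappa at another cusp is recovered from two holomorphic
  functions of equal modulus. Integer exponents are excluded from the Taylor step; suprema do not
  notice, since non-integers are dense. The one borderline that cannot be approached this way is
  integral \<open>\<alpha> - r\<close>: an exponent-1 bound of the last derivative at a non-cuspidal
  rational is then consistent with the growth of \<open>f\<close>, and only the o-estimate contained
  in differentiability leads to a contradiction. This is why the kernel estimate is kept linear in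
  the Hoelder constant.\<close>

lemma norm_one_minus_polar:
  fixes R t :: real
  shows "(norm (1 - of_real R * cis t))\<^sup>2 = (1 - R)\<^sup>2 + 4 * R * (sin (t/2))\<^sup>2"
proof -
  define u where "u = (sin (t/2))\<^sup>2"
  have c: "cos t = 1 - 2 * u"
    using cos_double_sin[of "t/2"] by (simp add: u_def)
  have "(norm (1 - of_real R * cis t))\<^sup>2 = (1 - R * cos t)\<^sup>2 + (R * sin t)\<^sup>2"
    by (simp add: cmod_power2)
  also have "\<dots> = 1 - 2 * R * cos t + R\<^sup>2 * ((cos t)\<^sup>2 + (sin t)\<^sup>2)"
    by (simp add: power2_diff power_mult_distrib distrib_left del: sin_cos_squared_add sin_cos_squared_add2)
  also have "\<dots> = 1 - 2 * R * cos t + R\<^sup>2"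
    by simp
  also have "\<dots> = (1 - R)\<^sup>2 + 4 * R * u"
    by (simp add: c power2_eq_square algebra_simps)
  finally show ?thesis by (simp add: u_def)
qed

text \<open>The sine is concave, so it lies above its chord on [0, pi/2]. With
  \<open>norm_one_minus_polar\<close> this bounds the modulus of 1 - R exp(it) from below linearly
  in \<open>t\<close> over a whole period.\<close>

lemma abs_sin_half_ge:
  fixes t :: real
  assumes "\<bar>t\<bar> \<le> pi"
  shows "\<bar>t\<bar> / pi \<le> \<bar>sin (t/2)\<bar>"
proof -
  have concave: "concave_on {0..pi} sin"
  proof (rule f''_le0_imp_concave)
    show "(sin has_real_derivative cos x) (at x)" for x :: real by (rule DERIV_sin)
    show "(cos has_real_derivative - sin x) (at x)" for x :: real by (rule DERIV_cos)
    show "- sin x \<le> 0" if "x \<in> {0..pi}" for x using that by (simp add: sin_ge_zero)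
  qed auto
  define u where "u = \<bar>t\<bar> / pi"
  have u: "0 \<le> u" "u \<le> 1" using assms pi_gt_zero by (auto simp: u_def divide_simps)
  have "sin ((1-u) *\<^sub>R 0 + u *\<^sub>R (pi/2)) \<ge> (1-u) * sin 0 + u * sin (pi/2)"
    by (rule concave_onD[OF concave]) (use u in auto)
  then have "u \<le> sin (\<bar>t\<bar>/2)" by (simp add: u_def)
  then show ?thesis
    unfolding u_def by (cases "0 \<le> t") auto
qed

section \<open>Fourier coefficients, Gamma integrals and power weights\<close>

lemma has_integral_cis_int:
  fixes m :: int
  shows "((\<lambda>t. cis (of_int m * t)) has_integral (if m = 0 then of_real (2*pi) else 0)) {-pi..pi}"
proof (cases "m = 0")
  case True
  have "((\<lambda>t::real. 1::complex) has_integral (pi - (-pi)) *\<^sub>R 1) {-pi..pi}"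
    using has_integral_const_real[of "1::complex" "-pi" pi] by simp
  with True show ?thesis by (simp add: scaleR_conv_of_real)
next
  case False
  define F where "F t = cis (of_int m * t) / (\<i> * of_int m)" for t :: real
  have "((\<lambda>t. cis (of_int m * t)) has_integral (F pi - F (-pi))) {-pi..pi}"
  proof (rule fundamental_theorem_of_calculus)
    fix x :: real
    have "((\<lambda>z. exp (\<i> * of_int m * z) / (\<i> * of_int m)) has_field_derivative exp (\<i> * of_int m * of_real x)) (at (of_real x))"
      using False by (auto intro!: derivative_eq_intros)
    from has_vector_derivative_real_field[OF this]
    have "((\<lambda>t. exp (\<i> * of_int m * of_real t) / (\<i> * of_int m)) has_vector_derivative exp (\<i> * of_int m * of_real x)) (at x)"
      by simp
    then show "(F has_vector_derivative cis (of_int m * x)) (at x within {-pi..pi})"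
      unfolding F_def cis_conv_exp by (simp add: mult.assoc has_vector_derivative_at_within)
  qed simp
  moreover have "cis (of_int m * pi) = cis (- (of_int m * pi))"
    by (simp add: complex_eq_iff sin_zero_iff_int2)
  ultimately show ?thesis using False by (simp add: F_def)
qed

text \<open>Uniform convergence permits integration term by term. The test function is
  \<open>cis (m t)\<close>, so frequency \<open>l\<close> is picked out by \<open>m = -l\<close>;
  that every positive \<open>m\<close> gives 0 is the one-sidedness of the spectrum, later
  responsible for the disappearance of the complex conjugate.\<close>

lemma fourier_coefficient_has_integral:
  fixes b :: "nat \<Rightarrow> complex" and m :: int
  assumes "uniform_limit {-pi..pi} (\<lambda>n t. \<Sum>l<n. b l * cis t ^ l) G sequentially"
  shows "((\<lambda>t. G t * cis (of_int m * t)) has_integral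
           (of_real (2*pi) * (if m \<le> 0 then b (nat (- m)) else 0))) {-pi..pi}"
proof -
  let ?f = "\<lambda>n t. (\<Sum>l<n. b l * cis t ^ l) * cis (of_int m * t)"
  have fi: "(?f n has_integral (\<Sum>l<n. b l * (if int l + m = 0 then of_real (2*pi) else 0))) {-pi..pi}" for n
  proof -
    have "((\<lambda>t. \<Sum>l<n. b l * cis (of_int (int l + m) * t)) has_integral
       (\<Sum>l<n. b l * (if int l + m = 0 then of_real (2*pi) else 0))) {-pi..pi}"
      by (intro has_integral_sum has_integral_mult_right has_integral_cis_int) auto
    moreover have "(\<Sum>l<n. b l * cis (of_int (int l + m) * t)) = ?f n t" for t
      by (simp add: sum_distrib_right Complex.DeMoivre mult.assoc cis_mult distrib_right)
    ultimately show ?thesis by simp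
  qed
  have ul: "uniform_limit {-pi..pi} ?f (\<lambda>t. G t * cis (of_int m * t)) sequentially"
  proof (rule uniform_limitI)
    fix e :: real assume "e > 0"
    from uniform_limitD[OF assms this]
    show "\<forall>\<^sub>F n in sequentially. \<forall>t\<in>{-pi..pi}. dist (?f n t) (G t * cis (of_int m * t)) < e"
      by (auto simp: dist_norm left_diff_distrib[symmetric] norm_mult elim!: eventually_mono)
  qed
  have cf: "continuous_on {-pi..pi} (?f n)" for n
    by (intro continuous_intros)
  obtain I J where IJ: "\<And>n. (?f n has_integral I n) {-pi..pi}"
     "((\<lambda>t. G t * cis (of_int m * t)) has_integral J) {-pi..pi}" "(I \<longlongrightarrow> J) sequentially"
    using uniform_limit_integral[OF ul cf sequentially_bot] by blast
  have "I n = (\<Sum>l<n. b l * (if int l + m = 0 then of_real (2*pi) else 0))" for n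
    using has_integral_unique[OF IJ(1) fi] .
  moreover have "(\<lambda>n. \<Sum>l<n. b l * (if int l + m = 0 then of_real (2*pi) else 0)) \<longlonglongrightarrow>
     of_real (2*pi) * (if m \<le> 0 then b (nat (- m)) else 0)"
  proof (rule tendsto_eventually)
    show "\<forall>\<^sub>F n in sequentially. (\<Sum>l<n. b l * (if int l + m = 0 then of_real (2*pi) else 0)) =
       of_real (2*pi) * (if m \<le> 0 then b (nat (- m)) else 0)"
      using eventually_gt_at_top[of "nat \<bar>m\<bar>"]
    proof eventually_elim
      case (elim n)
      have "(\<Sum>l<n. b l * (if int l + m = 0 then of_real (2*pi) else 0)) =
        (\<Sum>l<n. if m \<le> 0 \<and> l = nat (-m) then b l * of_real (2*pi) else 0)"
        by (intro sum.cong) auto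
      also have "\<dots> = of_real (2*pi) * (if m \<le> 0 then b (nat (- m)) else 0)"
        using elim by (cases "m \<le> 0") (auto simp: sum.delta')
      finally show ?case .
    qed
  qed
  ultimately have "J = of_real (2*pi) * (if m \<le> 0 then b (nat (- m)) else 0)"
    using IJ(3) LIMSEQ_unique by (metis (no_types, lifting) ext)
  with IJ(2) show ?thesis by simp
qed

lemma has_integral_Gamma_scaled:
  fixes a b :: real
  assumes a: "0 < a" and b: "0 < b"
  shows "((\<lambda>y. y powr (a-1) * exp (- (b*y))) has_integral (Gamma a * b powr (-a))) {0<..}"
proof -
  let ?f = "\<lambda>y::real. indicator {0..} y * y powr (a - 1) / exp y"
  have "has_bochner_integral lborel ?f (Gamma a)"
    by (rule has_bochner_integral_nn_integral)
      (use a Gamma_conv_nn_integral_real[OF a] Gamma_real_pos[OF a] in auto)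
  then have "has_bochner_integral lborel (\<lambda>y. ?f (0 + b * y)) (Gamma a /\<^sub>R \<bar>b\<bar>)"
    using b by (subst (asm) lborel_has_bochner_integral_real_affine_iff[where t=0 and c=b]) auto
  then have "((\<lambda>y. ?f (b * y)) has_integral (Gamma a /\<^sub>R b)) UNIV"
    using b has_integral_integral_lborel[of "\<lambda>y. ?f (0 + b * y)"] unfolding has_bochner_integral_iff by simp
  then have "((\<lambda>y. b powr (1-a) * ?f (b * y)) has_integral (b powr (1-a) * (Gamma a /\<^sub>R b))) UNIV"
    by (rule has_integral_mult_right)
  moreover have "b powr (1-a) * (Gamma a /\<^sub>R b) = Gamma a * b powr (-a)"
    using b by (simp add: powr_diff powr_minus scaleR_conv_of_real divide_simps)
  moreover have "b powr (1-a) * ?f (b * y) = (if y \<in> {0<..} then y powr (a-1) * exp (- (b*y)) else 0)" for y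
  proof (cases "y > 0")
    case True
    have "b powr (1-a) * (b * y) powr (a-1) = y powr (a-1)"
      using b True by (simp add: powr_mult powr_diff powr_minus field_simps)
    then show ?thesis using True b by (simp add: exp_minus field_simps)
  next
    case False
    then have "b * y \<le> 0" using b by (simp add: mult_le_0_iff)
    with False b show ?thesis by (cases "y = 0") (auto simp: indicator_def zero_le_mult_iff)
  qed
  ultimately have "((\<lambda>y. if y \<in> {0<..} then y powr (a-1) * exp (- (b*y)) else 0) has_integral Gamma a * b powr (-a)) UNIV"
    by (simp only:)
  then show ?thesis by (subst (asm) has_integral_restrict_UNIV)
qed

lemma absolutely_integrable_Gamma_scaled:
  fixes a b :: real
  assumes "0 < a" "0 < b"
  shows "(\<lambda>y. y powr (a-1) * exp (- (b*y))) absolutely_integrable_on {0<..}"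
  by (rule nonnegative_absolutely_integrable_1)
     (use has_integral_Gamma_scaled[OF assms] in \<open>auto simp: has_integral_integrable\<close>)

lemma absolutely_integrable_abs_powr:
  fixes e :: real
  assumes e: "0 < e" and M: "0 \<le> M"
  shows "(\<lambda>t. \<bar>t\<bar> powr (e-1)) absolutely_integrable_on {-M..M}"
proof -
  have 1: "(\<lambda>t. t powr (e-1)) integrable_on {0..M}"
    using has_integral_powr_from_0[of "e-1" M] assms by (auto simp: has_integral_integrable)
  have 2: "(\<lambda>t. \<bar>t\<bar> powr (e-1)) integrable_on {0..M}"
    by (rule integrable_eq[OF 1]) auto
  have 3: "(\<lambda>t. \<bar>t\<bar> powr (e-1)) integrable_on {-M..0}"
    using Henstock_Kurzweil_Integration.integrable_reflect_real[where f="\<lambda>t. \<bar>t\<bar> powr (e-1)" and a=0 and b=M] 2 by simp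
  show ?thesis
    by (rule nonnegative_absolutely_integrable_1)
      (use Henstock_Kurzweil_Integration.integrable_combine[of "-M" 0 M, OF _ _ 3 2] M in auto)
qed

text \<open>The constant term is removed so that the series decays exponentially upwards and
  vertical integrals converge at infinity. Growth is therefore needed only up to height 1. The
  exponent \<open>\<rho>\<close> is later r/2 for cusp forms and r otherwise.\<close>

locale boundary_series =
  fixes c :: "nat \<Rightarrow> complex" and \<rho> K :: real
  assumes c0: "c 0 = 0"
    and summable_disc: "\<And>q. norm q < 1 \<Longrightarrow> summable (\<lambda>j. c j * q ^ j)"
    and rho_pos: "0 < \<rho>"
    and growth: "\<And>w. 0 < Im w \<Longrightarrow> Im w \<le> 1 \<Longrightarrow>
        norm (\<Sum>j. c j * exp (\<i> * w) ^ j) \<le> K * Im w powr (-\<rho>)"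
begin

definition \<Phi> :: "complex \<Rightarrow> complex" where
  "\<Phi> w = (\<Sum>j. c j * exp (\<i> * w) ^ j)"

definition psum :: "nat \<Rightarrow> real \<Rightarrow> complex" where
  "psum N x = (\<Sum>j\<le>N. c j * cis x ^ j)"

definition bdry :: "real \<Rightarrow> real \<Rightarrow> complex" where
  "bdry \<alpha> x = (\<Sum>j. c j * of_real (real j powr (-\<alpha>)) * cis x ^ j)"

lemma norm_Phi_le: "0 < Im w \<Longrightarrow> Im w \<le> 1 \<Longrightarrow> norm (\<Phi> w) \<le> K * Im w powr (-\<rho>)"
  using growth by (simp add: \<Phi>_def)

lemma K_nonneg: "0 \<le> K"
  using norm_Phi_le[of \<i>] norm_ge_zero[of "\<Phi> \<i>"] by (simp del: norm_ge_zero)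

lemma summable_norm_disc:
  fixes q :: complex
  assumes "norm q < 1"
  shows "summable (\<lambda>j. norm (c j) * norm q ^ j)"
proof -
  obtain t where t: "norm q < t" "t < 1" using assms dense by blast
  then have t0: "0 < t" using norm_ge_zero[of q] by linarith
  from powser_insidea[OF summable_disc[of "of_real t"], of q] t t0
  show ?thesis by (simp add: norm_mult norm_power)
qed

lemma exp_Complex: "exp (\<i> * Complex x y) = of_real (exp (-y)) * cis x"
  by (simp add: exp_eq_polar)

lemma Phi_sums:
  assumes "0 < y"
  shows "(\<lambda>j. c j * of_real (exp (- (real j * y))) * cis x ^ j) sums \<Phi> (Complex x y)"
proof -
  have "norm (exp (\<i> * Complex x y)) < 1" using assms by simp
  from summable_sums[OF summable_disc[OF this]]
  show ?thesis by (simp add: \<Phi>_def exp_Complex power_mult_distrib exp_of_nat_mult[symmetric] mult_ac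
      flip: of_real_power)
qed

lemma summable_norm_exp:
  assumes "0 < y"
  shows "summable (\<lambda>j. norm (c j) * exp (- (real j * y)))"
proof -
  have "norm (of_real (exp (-y)) :: complex) < 1" using assms by simp
  from summable_norm_disc[OF this] show ?thesis
    by (simp add: exp_of_nat_mult[symmetric])
qed

lemma uniform_limit_Phi:
  assumes "0 < y"
  shows "uniform_limit UNIV (\<lambda>n t. \<Sum>l<n. (c l * of_real (exp (- (real l * y))) * cis x ^ l) * cis t ^ l)
           (\<lambda>t. \<Phi> (Complex (x + t) y)) sequentially"
proof -
  have "uniform_limit UNIV (\<lambda>n t. \<Sum>l<n. (c l * of_real (exp (- (real l * y))) * cis x ^ l) * cis t ^ l)
     (\<lambda>t. \<Sum>l. (c l * of_real (exp (- (real l * y))) * cis x ^ l) * cis t ^ l) sequentially"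
    by (rule Weierstrass_m_test[OF _ summable_norm_exp[OF assms]])
      (simp add: norm_mult norm_power)
  moreover have "(\<Sum>l. (c l * of_real (exp (- (real l * y))) * cis x ^ l) * cis t ^ l) = \<Phi> (Complex (x + t) y)" for t
    using Phi_sums[OF assms, of "x+t"] by (simp add: sums_iff cis_mult[symmetric] power_mult_distrib mult.assoc)
  ultimately show ?thesis by simp
qed

text \<open>At height \<open>\<eta>\<close> the coefficients are damped by exp(-j
  \<open>\<eta>\<close>); the kernel undoes this, so its ratio has modulus
  exp(\<open>\<eta>\<close>) > 1. With \<open>\<eta> = 1/N\<close> the amplification of each of the
  terms stays below e.\<close>

lemma psum_integral:
  assumes "0 < \<eta>"
  shows "((\<lambda>t. \<Phi> (Complex (x + t) \<eta>) * (\<Sum>j\<le>N. (of_real (exp \<eta>) * cis (-t)) ^ j)) has_integral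
            (of_real (2*pi) * psum N x)) {-pi..pi}"
proof -
  have 1: "((\<lambda>t. \<Phi> (Complex (x + t) \<eta>) * cis (of_int (- int j) * t)) has_integral
      of_real (2*pi) * (c j * of_real (exp (- (real j * \<eta>))) * cis x ^ j)) {-pi..pi}" for j
    using fourier_coefficient_has_integral[OF uniform_limit_on_subset[OF uniform_limit_Phi[OF assms] subset_UNIV], where m="- int j"]
    by simp
  have "((\<lambda>t. \<Sum>j\<le>N. of_real (exp (real j * \<eta>)) * (\<Phi> (Complex (x + t) \<eta>) * cis (of_int (- int j) * t))) has_integral
      (\<Sum>j\<le>N. of_real (exp (real j * \<eta>)) * (of_real (2*pi) * (c j * of_real (exp (- (real j * \<eta>))) * cis x ^ j)))) {-pi..pi}"
    by (intro has_integral_sum has_integral_mult_right 1) auto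
  moreover have "(\<Sum>j\<le>N. of_real (exp (real j * \<eta>)) * (of_real (2*pi) * (c j * of_real (exp (- (real j * \<eta>))) * cis x ^ j)))
     = of_real (2*pi) * psum N x"
  proof -
    have "exp (real j * \<eta>) * exp (- (real j * \<eta>)) = 1" for j
      by (rule exp_minus_inverse)
    then have "of_real (exp (real j * \<eta>)) * of_real (exp (- (real j * \<eta>))) = (1::complex)" for j
      by (metis of_real_1 of_real_mult)
    then have "of_real (exp (real j * \<eta>)) * (of_real (2*pi) * (c j * of_real (exp (- (real j * \<eta>))) * cis x ^ j))
       = of_real (2*pi) * (c j * cis x ^ j)" for j
      by (metis (no_types, lifting) mult.assoc mult.left_commute mult.right_neutral)
    then show ?thesis
      unfolding psum_def sum_distrib_left by (intro sum.cong refl)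
  qed
  moreover have "(\<Sum>j\<le>N. of_real (exp (real j * \<eta>)) * (\<Phi> (Complex (x + t) \<eta>) * cis (of_int (- int j) * t)))
     = \<Phi> (Complex (x + t) \<eta>) * (\<Sum>j\<le>N. (of_real (exp \<eta>) * cis (-t)) ^ j)" for t
    unfolding exp_of_nat_mult
    by (simp add: sum_distrib_left power_mult_distrib Complex.DeMoivre mult_ac)
  ultimately show ?thesis by simp
qed

end

text \<open>The sum is bounded by a multiple of N trivially and by a multiple of 1/|t| through the
  closed form of the geometric sum. The weighted geometric mean of both bounds, with weights
  \<open>\<epsilon>\<close> and 1 - \<open>\<epsilon>\<close>, is integrable in \<open>t\<close> and
  costs only \<open>N powr \<epsilon>\<close>.\<close>

lemma dirichlet_kernel_bound:
  fixes \<eta> t \<epsilon> :: real and N :: nat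
  assumes N: "N \<ge> 1" "\<eta> = 1 / real N" and t: "\<bar>t\<bar> \<le> pi" "t \<noteq> 0" and e: "0 < \<epsilon>" "\<epsilon> < 1"
  shows "norm (\<Sum>j\<le>N. (of_real (exp \<eta>) * cis (-t)) ^ j :: complex) \<le>
     (exp 2 + 1) * pi * (2 * real N) powr \<epsilon> * \<bar>t\<bar> powr (\<epsilon> - 1)"
proof -
  define q where "q = of_real (exp \<eta>) * cis (-t)"
  define D where "D = norm (\<Sum>j\<le>N. q ^ j)"
  have eta: "\<eta> > 0" "\<eta> * real N = 1" "\<eta> \<le> 1" using N unfolding N(2) by (auto simp: divide_simps)
  have nq: "norm q = exp \<eta>" by (simp add: q_def norm_mult)
  have pw: "exp \<eta> ^ j = exp (real j * \<eta>)" for j by (simp add: exp_of_nat_mult)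
  have D1: "D \<le> exp 1 * (2 * real N)"
  proof -
    have "D \<le> (\<Sum>j\<le>N. norm (q ^ j))" unfolding D_def by (rule norm_sum)
    also have "\<dots> \<le> (\<Sum>j\<le>N. exp 1)"
    proof (rule sum_mono)
      fix j assume "j \<in> {..N}"
      then have "real j * \<eta> \<le> real N * \<eta>" using eta by (intro mult_right_mono) auto
      then show "norm (q ^ j) \<le> exp 1" using eta by (simp add: norm_power nq pw mult.commute)
    qed
    also have "\<dots> \<le> exp 1 * (2 * real N)" using N by simp
    finally show ?thesis .
  qed
  have "(norm (1 - q))\<^sup>2 \<ge> (2 * \<bar>t\<bar> / pi)\<^sup>2"
  proof -
    have "(\<bar>t\<bar> / pi)\<^sup>2 \<le> \<bar>sin (t/2)\<bar>\<^sup>2"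
      by (rule power_mono[OF abs_sin_half_ge[OF t(1)]]) simp
    then have "4 * (\<bar>t\<bar> / pi)\<^sup>2 \<le> 4 * 1 * (sin (t/2))\<^sup>2" by simp
    also have "\<dots> \<le> 4 * exp \<eta> * (sin (t/2))\<^sup>2"
      using eta by (intro mult_right_mono mult_left_mono) auto
    also have "\<dots> \<le> (norm (1 - q))\<^sup>2"
      using norm_one_minus_polar[of "exp \<eta>" "-t"] by (simp add: q_def)
    finally show ?thesis by (simp add: power_mult_distrib power_divide)
  qed
  then have n1q: "norm (1 - q) \<ge> 2 * \<bar>t\<bar> / pi"
    by (rule power2_le_imp_le) simp
  have pos: "2 * \<bar>t\<bar> / pi > 0" using t by simp
  then have q1: "q \<noteq> 1" using n1q by auto
  have D2: "D \<le> (exp 2 + 1) * pi / \<bar>t\<bar>"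
  proof -
    have "(\<Sum>j\<le>N. q ^ j) = (1 - q ^ Suc N) / (1 - q)"
      using sum_gp0[of q N] q1 by simp
    then have "D = norm (1 - q ^ Suc N) / norm (1 - q)"
      by (simp add: D_def norm_divide)
    also have "\<dots> \<le> (exp 2 + 1) / (2 * \<bar>t\<bar> / pi)"
    proof (rule frac_le)
      have "norm (1 - q ^ Suc N) \<le> 1 + exp \<eta> ^ Suc N"
        using norm_triangle_ineq4[of 1 "q ^ Suc N"] by (simp add: norm_mult norm_power nq)
      also have "exp \<eta> ^ Suc N = exp (1 + \<eta>)"
        unfolding pw using eta by (simp add: algebra_simps)
      also have "\<dots> \<le> exp 2" using eta by simp
      finally show "norm (1 - q ^ Suc N) \<le> exp 2 + 1" by simp
    qed (use n1q pos in auto)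
    also have "\<dots> \<le> (exp 2 + 1) * pi / \<bar>t\<bar>"
      using t by (simp add: divide_simps)
    finally show ?thesis .
  qed
  define B where "B = (exp 2 + 1) * pi"
  have B: "B > 0" by (simp add: B_def add_pos_pos)
  have "exp 1 \<le> B"
  proof -
    have "exp (1::real) \<le> exp 2 + 1" using exp_le_cancel_iff[of 1 "2::real"] by linarith
    also have "\<dots> \<le> (exp 2 + 1) * pi"
      using mult_left_mono[of 1 pi "exp 2 + 1 :: real"] pi_gt3 by (simp add: add_nonneg_nonneg)
    finally show ?thesis by (simp add: B_def)
  qed
  then have D1': "D \<le> B * (2 * real N)"
    using D1 by (smt (verit, best) mult_right_mono of_nat_0_le_iff)
  have D2': "D \<le> B * \<bar>t\<bar> powr (-1)" using D2 t by (simp add: B_def powr_minus divide_inverse)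
  have D0: "0 \<le> D" by (simp add: D_def)
  have "D \<le> D powr \<epsilon> * D powr (1 - \<epsilon>)" using D0 by (simp flip: powr_add)
  also have "\<dots> \<le> (B * (2 * real N)) powr \<epsilon> * (B * \<bar>t\<bar> powr (-1)) powr (1 - \<epsilon>)"
    by (intro mult_mono powr_mono2) (use D1' D2' D0 e B in auto)
  also have "\<dots> = B powr \<epsilon> * B powr (1 - \<epsilon>) * (2 * real N) powr \<epsilon> * \<bar>t\<bar> powr (\<epsilon> - 1)"
  proof -
    have "(B * \<bar>t\<bar> powr (-1)) powr (1 - \<epsilon>) = B powr (1 - \<epsilon>) * \<bar>t\<bar> powr (\<epsilon> - 1)"
      by (simp only: powr_mult powr_powr) simp
    then show ?thesis by (simp only: powr_mult mult_ac)
  qed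
  also have "\<dots> = B * (2 * real N) powr \<epsilon> * \<bar>t\<bar> powr (\<epsilon> - 1)"
    using B by (simp flip: powr_add)
  finally show ?thesis by (simp add: D_def q_def B_def)
qed

context boundary_series begin

text \<open>Integrate \<open>\<Phi>\<close> at height \<open>1/N\<close> against the Dirichlet kernel; \<open>\<epsilon>\<close> absorbs the logarithm.\<close>
lemma psum_bound:
  assumes e: "0 < \<epsilon>" "\<epsilon> < 1"
  obtains C where "0 \<le> C" "\<And>N x. norm (psum N x) \<le> C * real N powr (\<rho> + \<epsilon>)"
proof -
  define J where "J = integral {-pi..pi} (\<lambda>t. \<bar>t\<bar> powr (\<epsilon> - 1))"
  define C where "C = K * (exp 2 + 1) * pi * 2 powr \<epsilon> * J / (2 * pi)"
  have Jint: "(\<lambda>t. \<bar>t\<bar> powr (\<epsilon> - 1)) integrable_on {-pi..pi}"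
    using absolutely_integrable_abs_powr[of \<epsilon> pi] e set_lebesgue_integral_eq_integral(1) by auto
  have "J \<ge> 0" unfolding J_def by (rule Henstock_Kurzweil_Integration.integral_nonneg[OF Jint]) auto
  then have C: "C \<ge> 0" using K_nonneg by (simp add: C_def add_nonneg_nonneg)
  have "norm (psum N x) \<le> C * real N powr (\<rho> + \<epsilon>)" for N x
  proof (cases "N = 0")
    case True
    then show ?thesis using c0 by (simp add: psum_def)
  next
    case False
    then have N: "N \<ge> 1" by simp
    define \<eta> where "\<eta> = 1 / real N"
    have eta: "0 < \<eta>" "\<eta> \<le> 1" using N by (auto simp: \<eta>_def)
    define f where "f t = \<Phi> (Complex (x + t) \<eta>) * (\<Sum>j\<le>N. (of_real (exp \<eta>) * cis (-t)) ^ j)" for t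
    \<comment> \<open>The majorant \<open>\<bar>t\<bar> powr (\<epsilon> - 1)\<close> is 0 at t = 0,
      since 0 to any power is 0 here; the integrand is changed at that single point so that the
      comparison holds everywhere.\<close>
    define f' where "f' t = (if t = 0 then 0 else f t)" for t
    define B where "B = K * real N powr \<rho> * ((exp 2 + 1) * pi * (2 * real N) powr \<epsilon>)"
    have fI: "(f has_integral of_real (2*pi) * psum N x) {-pi..pi}"
      unfolding f_def by (rule psum_integral[OF eta(1)])
    have fI': "(f' has_integral of_real (2*pi) * psum N x) {-pi..pi}"
      by (rule has_integral_spike[OF _ _ fI, of "{0}"]) (auto simp: f'_def)
    have "norm (integral {-pi..pi} f') \<le> integral {-pi..pi} (\<lambda>t. B * \<bar>t\<bar> powr (\<epsilon> - 1))"
    proof (rule Henstock_Kurzweil_Integration.integral_norm_bound_integral)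
      fix t assume t: "t \<in> {-pi..pi}"
      show "norm (f' t) \<le> B * \<bar>t\<bar> powr (\<epsilon> - 1)"
      proof (cases "t = 0")
        case False
        have 1: "norm (\<Phi> (Complex (x + t) \<eta>)) \<le> K * real N powr \<rho>"
          using norm_Phi_le[of "Complex (x+t) \<eta>"] eta by (simp add: \<eta>_def powr_divide powr_minus_divide)
        have 2: "norm (\<Sum>j\<le>N. (of_real (exp \<eta>) * cis (-t)) ^ j :: complex) \<le>
             (exp 2 + 1) * pi * (2 * real N) powr \<epsilon> * \<bar>t\<bar> powr (\<epsilon> - 1)"
          by (rule dirichlet_kernel_bound[OF N \<eta>_def _ False e]) (use t in auto)
        show ?thesis
          using mult_mono[OF 1 2] K_nonneg False
          by (simp add: f'_def f_def norm_mult B_def mult.assoc)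
      qed (simp add: f'_def)
    qed (use fI' integrable_on_cmult_left[OF Jint] in \<open>auto simp: has_integral_integrable\<close>)
    then have "norm (of_real (2*pi) * psum N x) \<le> B * J"
      by (simp add: integral_unique[OF fI'] J_def)
    then have "2 * pi * norm (psum N x) \<le> B * J"
      by (simp add: norm_mult)
    also have "B * J = 2 * pi * (C * real N powr (\<rho> + \<epsilon>))"
      by (simp add: B_def C_def powr_add powr_mult)
    finally show ?thesis by simp
  qed
  with C that show thesis by blast
qed

end

section \<open>Convergence, derivatives and integral representation of the boundary values\<close>

lemma powr_neg_diff_bound:
  fixes \<alpha> :: real
  assumes a: "0 < \<alpha>" and j: "1 \<le> j"
  shows "0 \<le> real j powr (-\<alpha>) - real (Suc j) powr (-\<alpha>)"
    and "real j powr (-\<alpha>) - real (Suc j) powr (-\<alpha>) \<le> \<alpha> * real j powr (-\<alpha> - 1)"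
proof -
  show "0 \<le> real j powr (-\<alpha>) - real (Suc j) powr (-\<alpha>)"
    using a j by (simp add: powr_mono2')
  have "\<exists>z>real j. z < real (Suc j) \<and> real (Suc j) powr (-\<alpha>) - real j powr (-\<alpha>)
      = (real (Suc j) - real j) * (-\<alpha> * z powr (-\<alpha> - 1))"
    by (rule MVT2) (use j in \<open>auto intro!: derivative_eq_intros\<close>)
  then obtain z where z: "z > real j" "real j powr (-\<alpha>) - real (Suc j) powr (-\<alpha>) = \<alpha> * z powr (-\<alpha> - 1)"
    by fastforce
  have "z powr (-\<alpha> - 1) \<le> real j powr (-\<alpha> - 1)"
    using z j a by (intro powr_mono2') auto
  then show "real j powr (-\<alpha>) - real (Suc j) powr (-\<alpha>) \<le> \<alpha> * real j powr (-\<alpha> - 1)"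
    using z(2) a by simp
qed

context boundary_series begin

lemma psum_0 [simp]: "psum 0 x = 0"
  by (simp add: psum_def c0)

lemma summation_by_parts:
  fixes \<phi> :: "nat \<Rightarrow> complex"
  shows "(\<Sum>j\<le>N. c j * \<phi> j * cis x ^ j) = psum N x * \<phi> (Suc N) + (\<Sum>j\<le>N. psum j x * (\<phi> j - \<phi> (Suc j)))"
proof (induction N)
  case 0
  then show ?case by (simp add: c0)
next
  case (Suc N)
  have "psum (Suc N) x = psum N x + c (Suc N) * cis x ^ Suc N"
    by (simp add: psum_def)
  with Suc show ?case by (simp add: algebra_simps)
qed

text \<open>Half of the gap between \<open>\<rho>\<close> and \<open>\<alpha>\<close> (capped at
  1/2, because \<open>psum_bound\<close> wants \<open>\<epsilon> < 1\<close>) pays for the loss in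
  the partial sums. The Abel-summed terms are then of order
  \<open>j powr (\<rho> + e - \<alpha> - 1)\<close>, with exponent below -1, and the boundary term
  tends to 0, both uniformly in \<open>x\<close>.\<close>

lemma psum_diff_bound:
  assumes "\<rho> < \<alpha>"
  obtains B where "summable B"
    "\<And>j x. norm (psum j x) * \<bar>real j powr (-\<alpha>) - real (Suc j) powr (-\<alpha>)\<bar> \<le> B j"
    "\<And>x. uniform_limit UNIV (\<lambda>N x. psum N x * of_real (real (Suc N) powr (-\<alpha>))) (\<lambda>_. 0) sequentially"
proof -
  define e where "e = min ((\<alpha> - \<rho>) / 2) (1/2)"
  have e: "0 < e" "e < 1" "\<rho> + e < \<alpha>" using assms by (auto simp: e_def min_def field_simps)
  obtain C where C: "0 \<le> C" "\<And>N x. norm (psum N x) \<le> C * real N powr (\<rho> + e)"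
    using psum_bound[OF e(1,2)] by blast
  have a: "0 < \<alpha>" using assms rho_pos by linarith
  define B where "B j = C * \<alpha> * real j powr (\<rho> + e - \<alpha> - 1)" for j
  have 1: "summable B"
    unfolding B_def by (intro summable_mult) (use e in \<open>simp add: summable_real_powr_iff\<close>)
  have 2: "norm (psum j x) * \<bar>real j powr (-\<alpha>) - real (Suc j) powr (-\<alpha>)\<bar> \<le> B j" for j x
  proof (cases "j = 0")
    case False
    have "norm (psum j x) * \<bar>real j powr (-\<alpha>) - real (Suc j) powr (-\<alpha>)\<bar>
       \<le> (C * real j powr (\<rho> + e)) * (\<alpha> * real j powr (-\<alpha> - 1))"
      by (intro mult_mono C(2)) (use powr_neg_diff_bound[OF a, of j] False C in auto)
    also have "\<dots> = B j"
      using powr_add[of "real j" "\<rho> + e" "-\<alpha> - 1"] by (simp add: B_def algebra_simps)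
    finally show ?thesis .
  qed (simp add: B_def)
  have 3: "uniform_limit UNIV (\<lambda>N x. psum N x * of_real (real (Suc N) powr (-\<alpha>))) (\<lambda>_. 0) sequentially"
  proof (rule uniform_limitI)
    fix d :: real assume d: "d > 0"
    have "((\<lambda>n. real n powr (\<rho> + e - \<alpha>)) \<longlongrightarrow> 0) sequentially"
      by (rule tendsto_neg_powr[OF _ filterlim_real_sequentially]) (use e in simp)
    then have "((\<lambda>n. C * real n powr (\<rho> + e - \<alpha>)) \<longlongrightarrow> C * 0) sequentially"
      by (intro tendsto_intros)
    then have "\<forall>\<^sub>F n in sequentially. C * real n powr (\<rho> + e - \<alpha>) < d"
      using d by (auto dest: order_tendstoD)
    then show "\<forall>\<^sub>F N in sequentially. \<forall>x\<in>UNIV. dist (psum N x * of_real (real (Suc N) powr (-\<alpha>))) 0 < d"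
      using eventually_gt_at_top[of 0]
    proof eventually_elim
      case (elim N)
      have "norm (psum N x * of_real (real (Suc N) powr (-\<alpha>))) < d" for x
      proof -
        have "norm (psum N x * of_real (real (Suc N) powr (-\<alpha>))) \<le> (C * real N powr (\<rho> + e)) * real N powr (-\<alpha>)"
          unfolding norm_mult by (intro mult_mono C(2)) (use elim a C in \<open>auto intro!: powr_mono2'\<close>)
        also have "\<dots> = C * real N powr (\<rho> + e - \<alpha>)"
          using powr_add[of "real N" "\<rho> + e" "-\<alpha>"] by simp
        finally show ?thesis using elim by linarith
      qed
      then show ?case by simp
    qed
  qed
  show thesis using that[OF 1 2 3] .
qed

lemma uniform_limit_bdry_by_parts:
  assumes "\<rho> < \<alpha>"
  shows "uniform_limit UNIV (\<lambda>N x. \<Sum>j<N. c j * of_real (real j powr (-\<alpha>)) * cis x ^ j)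
     (\<lambda>x. \<Sum>j. psum j x * of_real (real j powr (-\<alpha>) - real (Suc j) powr (-\<alpha>))) sequentially"
proof -
  obtain B where B: "summable B"
    "\<And>j x. norm (psum j x) * \<bar>real j powr (-\<alpha>) - real (Suc j) powr (-\<alpha>)\<bar> \<le> B j"
    "uniform_limit UNIV (\<lambda>N x. psum N x * of_real (real (Suc N) powr (-\<alpha>))) (\<lambda>_. 0) sequentially"
    using psum_diff_bound[OF assms] by metis
  let ?g = "\<lambda>x. \<Sum>j. psum j x * of_real (real j powr (-\<alpha>) - real (Suc j) powr (-\<alpha>))"
  have u: "uniform_limit UNIV (\<lambda>N x. \<Sum>j<N. psum j x * of_real (real j powr (-\<alpha>) - real (Suc j) powr (-\<alpha>))) ?g sequentially"
    by (rule Weierstrass_m_test[OF _ B(1)]) (use B(2) in \<open>simp only: norm_mult norm_of_real\<close>)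
  then have "uniform_limit UNIV (\<lambda>N x. \<Sum>j<Suc N. psum j x * of_real (real j powr (-\<alpha>) - real (Suc j) powr (-\<alpha>))) ?g sequentially"
    by (subst (asm) filterlim_sequentially_Suc[symmetric])
  from uniform_limit_add[OF B(3) this]
  have "uniform_limit UNIV (\<lambda>N x. \<Sum>j<Suc N. c j * of_real (real j powr (-\<alpha>)) * cis x ^ j) ?g sequentially"
    using summation_by_parts[where \<phi>="\<lambda>j. of_real (real j powr (-\<alpha>))"]
    by (simp only: lessThan_Suc_atMost of_real_diff add_0_left)
  then show ?thesis by (subst filterlim_sequentially_Suc[symmetric])
qed

lemma bdry_sums_and_parts:
  assumes "\<rho> < \<alpha>"
  shows bdry_sums: "(\<lambda>j. c j * of_real (real j powr (-\<alpha>)) * cis x ^ j) sums bdry \<alpha> x"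
    and bdry_by_parts: "bdry \<alpha> x = (\<Sum>j. psum j x * of_real (real j powr (-\<alpha>) - real (Suc j) powr (-\<alpha>)))"
proof -
  have "(\<lambda>j. c j * of_real (real j powr (-\<alpha>)) * cis x ^ j) sums
      (\<Sum>j. psum j x * of_real (real j powr (-\<alpha>) - real (Suc j) powr (-\<alpha>)))"
    using tendsto_uniform_limitI[OF uniform_limit_bdry_by_parts[OF assms], of x] by (simp add: sums_def)
  then show "(\<lambda>j. c j * of_real (real j powr (-\<alpha>)) * cis x ^ j) sums bdry \<alpha> x"
    and "bdry \<alpha> x = (\<Sum>j. psum j x * of_real (real j powr (-\<alpha>) - real (Suc j) powr (-\<alpha>)))"
    by (auto simp: bdry_def sums_iff)
qed

lemma uniform_limit_bdry:
  assumes "\<rho> < \<alpha>"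
  shows "uniform_limit UNIV (\<lambda>N x. \<Sum>j<N. c j * of_real (real j powr (-\<alpha>)) * cis x ^ j) (bdry \<alpha>) sequentially"
  using uniform_limit_bdry_by_parts[OF assms] bdry_by_parts[OF assms] by (simp cong: uniform_limit_cong')

lemma continuous_on_bdry: "\<rho> < \<alpha> \<Longrightarrow> continuous_on A (bdry \<alpha>)"
  by (rule uniform_limit_theorem[OF _ uniform_limit_on_subset[OF uniform_limit_bdry subset_UNIV]])
    (auto intro!: continuous_intros always_eventually)

text \<open>Differentiating a term produces a factor \<open>\<i> * j\<close>, which lowers
  \<open>\<alpha>\<close> by one. The differentiated series still converges uniformly because
  \<open>\<alpha> - 1\<close> exceeds \<open>\<rho>\<close>, and this is what termwise
  differentiation requires.\<close>

lemma bdry_has_vector_derivative: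
  assumes "\<rho> < \<alpha> - 1"
  shows "(bdry \<alpha> has_vector_derivative \<i> * bdry (\<alpha> - 1) x) (at x)"
proof -
  have "\<exists>g. \<forall>x\<in>UNIV. (\<lambda>j. c j * of_real (real j powr (-\<alpha>)) * cis x ^ j) sums g x \<and>
     (g has_derivative (\<lambda>h. h *\<^sub>R (\<i> * bdry (\<alpha> - 1) x))) (at x within UNIV)"
  proof (rule has_derivative_series)
    fix n :: nat and x :: real
    have "((\<lambda>x. cis x ^ n) has_vector_derivative (of_nat n * \<i> * cis x ^ n)) (at x)"
    proof -
      have "((\<lambda>z. exp (of_nat n * \<i> * z)) has_field_derivative of_nat n * \<i> * exp (of_nat n * \<i> * of_real x)) (at (of_real x))"
        by (auto intro!: derivative_eq_intros)
      from has_vector_derivative_real_field[OF this] show ?thesis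
        by (simp add: cis_conv_exp flip: exp_of_nat_mult) (simp add: mult_ac)
    qed
    from has_vector_derivative_mult_right[OF this, of "c n * of_real (real n powr (-\<alpha>))"]
    have "((\<lambda>x. c n * of_real (real n powr (-\<alpha>)) * cis x ^ n) has_vector_derivative
        c n * of_real (real n powr (-\<alpha>)) * (of_nat n * \<i> * cis x ^ n)) (at x)" .
    moreover have "of_real (real n powr (-\<alpha>)) * of_nat n = (of_real (real n powr (-(\<alpha>-1))) :: complex)"
    proof -
      have "real n powr (-\<alpha>) * real n = real n powr (-(\<alpha>-1))"
        by (cases "n = 0") (simp_all add: powr_diff powr_minus field_simps)
      then show ?thesis by (metis of_real_mult of_real_of_nat_eq)
    qed
    then have "c n * of_real (real n powr (-\<alpha>)) * (of_nat n * \<i> * cis x ^ n) = \<i> * (c n * of_real (real n powr (-(\<alpha>-1))) * cis x ^ n)"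
      by (metis (no_types, opaque_lifting) mult.assoc mult.left_commute)
    ultimately show "((\<lambda>x. c n * of_real (real n powr (-\<alpha>)) * cis x ^ n) has_derivative
         (\<lambda>h. h *\<^sub>R (\<i> * (c n * of_real (real n powr (-(\<alpha>-1))) * cis x ^ n)))) (at x within UNIV)"
      by (simp add: has_vector_derivative_def)
  next
    fix e :: real assume "e > 0"
    from uniform_limitD[OF uniform_limit_bdry[OF assms] this]
    show "\<forall>\<^sub>F n in sequentially. \<forall>x\<in>UNIV. \<forall>h.
        norm ((\<Sum>i<n. h *\<^sub>R (\<i> * (c i * of_real (real i powr (-(\<alpha>-1))) * cis x ^ i))) - h *\<^sub>R (\<i> * bdry (\<alpha> - 1) x)) \<le> e * norm h"
    proof eventually_elim
      case (elim n)
      have "norm ((\<Sum>i<n. h *\<^sub>R (\<i> * (c i * of_real (real i powr (-(\<alpha>-1))) * cis x ^ i))) - h *\<^sub>R (\<i> * bdry (\<alpha> - 1) x)) \<le> e * norm h" for x h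
      proof -
        have "(\<Sum>i<n. h *\<^sub>R (\<i> * (c i * of_real (real i powr (-(\<alpha>-1))) * cis x ^ i))) - h *\<^sub>R (\<i> * bdry (\<alpha> - 1) x)
          = h *\<^sub>R (\<i> * ((\<Sum>i<n. c i * of_real (real i powr (-(\<alpha>-1))) * cis x ^ i) - bdry (\<alpha> - 1) x))"
          by (simp add: scaleR_sum_right sum_distrib_left algebra_simps)
        then have "norm ((\<Sum>i<n. h *\<^sub>R (\<i> * (c i * of_real (real i powr (-(\<alpha>-1))) * cis x ^ i))) - h *\<^sub>R (\<i> * bdry (\<alpha> - 1) x))
           = \<bar>h\<bar> * norm ((\<Sum>i<n. c i * of_real (real i powr (-(\<alpha>-1))) * cis x ^ i) - bdry (\<alpha> - 1) x)"
          by (simp only: norm_scaleR norm_mult norm_ii mult_1_left)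
        also have "\<dots> \<le> \<bar>h\<bar> * e"
        proof (rule mult_left_mono)
          show "norm ((\<Sum>i<n. c i * of_real (real i powr (-(\<alpha>-1))) * cis x ^ i) - bdry (\<alpha> - 1) x) \<le> e"
            using elim by (simp add: dist_norm less_imp_le)
        qed simp
        finally show ?thesis by (simp add: mult.commute)
      qed
      then show ?case by blast
    qed
  next
    show "(\<lambda>j. c j * of_real (real j powr (-\<alpha>)) * cis 0 ^ j) sums bdry \<alpha> 0"
      by (rule bdry_sums) (use assms in simp)
  qed auto
  then obtain g where g: "\<And>x. (\<lambda>j. c j * of_real (real j powr (-\<alpha>)) * cis x ^ j) sums g x"
     "\<And>x. (g has_derivative (\<lambda>h. h *\<^sub>R (\<i> * bdry (\<alpha> - 1) x))) (at x)"
    by auto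
  have "g = bdry \<alpha>" using g(1) by (auto simp: bdry_def sums_iff)
  with g(2) show ?thesis by (simp add: has_vector_derivative_def)
qed

text \<open>A crude counterpart of \<open>psum_bound\<close>: absolute convergence at height
  \<open>y\<close> suffices, and exponential growth of arbitrarily small rate is harmless against
  the damping at a fixed height.\<close>

lemma psum_exp_bound:
  assumes "0 < y"
  obtains M where "0 \<le> M" "\<And>j x. norm (psum j x) \<le> M * exp (real j * y)"
proof
  define M where "M = (\<Sum>j. norm (c j) * exp (- (real j * y)))"
  have s: "summable (\<lambda>j. norm (c j) * exp (- (real j * y)))" by (rule summable_norm_exp[OF assms])
  show "0 \<le> M" unfolding M_def by (rule suminf_nonneg[OF s]) simp
  fix j x
  have "norm (psum j x) \<le> (\<Sum>l\<le>j. norm (c l))"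
    unfolding psum_def by (rule sum_norm_le) (simp add: norm_mult norm_power)
  also have "\<dots> \<le> (\<Sum>l\<le>j. norm (c l) * exp (- (real l * y)) * exp (real j * y))"
  proof (rule sum_mono)
    fix l assume "l \<in> {..j}"
    then have "real l * y \<le> real j * y" using assms by (intro mult_right_mono) auto
    then have "1 \<le> exp (- (real l * y)) * exp (real j * y)" by (simp flip: exp_add)
    then show "norm (c l) \<le> norm (c l) * exp (- (real l * y)) * exp (real j * y)"
      by (simp add: mult.assoc mult_le_cancel_left1)
  qed
  also have "\<dots> = (\<Sum>l\<le>j. norm (c l) * exp (- (real l * y))) * exp (real j * y)"
    by (simp add: sum_distrib_right)
  also have "\<dots> \<le> M * exp (real j * y)"
    unfolding M_def by (intro mult_right_mono sum_le_suminf s) auto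
  finally show "norm (psum j x) \<le> M * exp (real j * y)" .
qed

text \<open>The same Abel summation inside the half plane. The weights exp(-jy) - exp(-(j+1)y) are
  nonnegative, so the norms of the terms can later be integrated over \<open>y\<close>
  exactly.\<close>

lemma Phi_by_parts:
  assumes y: "0 < y"
  shows "summable (\<lambda>j. norm (psum j x) * (exp (- (real j * y)) - exp (- (real (Suc j) * y))))"
    and "(\<lambda>j. psum j x * of_real (exp (- (real j * y)) - exp (- (real (Suc j) * y)))) sums \<Phi> (Complex x y)"
proof -
  \<comment> \<open>Half of the damping exp(-jy) is spent on the partial sums; the other half leaves
    a geometric majorant.\<close>
  obtain M where M: "0 \<le> M" "\<And>j x. norm (psum j x) \<le> M * exp (real j * (y/2))"
    using psum_exp_bound[of "y/2"] y by auto
  have geo: "summable (\<lambda>j. M * exp (- (y/2)) ^ j)"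
    using y by (intro summable_mult summable_geometric) simp
  have bd: "norm (psum j x) * exp (- (real j * y)) \<le> M * exp (- (y/2)) ^ j" for j
  proof -
    have "norm (psum j x) * exp (- (real j * y)) \<le> M * exp (real j * (y/2)) * exp (- (real j * y))"
      by (intro mult_right_mono M(2)) simp
    also have "\<dots> = M * exp (real j * (- (y/2)))"
      by (simp add: mult.assoc flip: exp_add)
    finally show ?thesis unfolding exp_of_nat_mult .
  qed
  show "summable (\<lambda>j. norm (psum j x) * (exp (- (real j * y)) - exp (- (real (Suc j) * y))))"
  proof (rule summable_comparison_test'[OF geo])
    fix j :: nat
    have "0 \<le> exp (- (real j * y)) - exp (- (real (Suc j) * y))" using y by (simp add: algebra_simps)
    moreover have "norm (psum j x) * (exp (- (real j * y)) - exp (- (real (Suc j) * y))) \<le> norm (psum j x) * exp (- (real j * y))"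
      by (intro mult_left_mono) auto
    ultimately show "norm (norm (psum j x) * (exp (- (real j * y)) - exp (- (real (Suc j) * y)))) \<le> M * exp (- (y/2)) ^ j"
      using bd[of j] by (simp add: abs_mult)
  qed
  have "(\<lambda>N. \<Sum>j\<le>N. c j * of_real (exp (- (real j * y))) * cis x ^ j) \<longlonglongrightarrow> \<Phi> (Complex x y)"
    using Phi_sums[OF y] by (simp add: sums_def_le)
  moreover have "(\<lambda>N. psum N x * of_real (exp (- (real (Suc N) * y)))) \<longlonglongrightarrow> 0"
  proof (rule Lim_null_comparison[OF _ summable_LIMSEQ_zero[OF geo]])
    show "\<forall>\<^sub>F N in sequentially. norm (psum N x * of_real (exp (- (real (Suc N) * y)))) \<le> M * exp (- (y/2)) ^ N"
    proof (intro always_eventually allI)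
      fix N
      have "norm (psum N x * of_real (exp (- (real (Suc N) * y)))) \<le> norm (psum N x) * exp (- (real N * y))"
        unfolding norm_mult by (intro mult_left_mono) (use y in \<open>auto simp: algebra_simps\<close>)
      then show "norm (psum N x * of_real (exp (- (real (Suc N) * y)))) \<le> M * exp (- (y/2)) ^ N"
        using bd[of N] by linarith
    qed
  qed
  ultimately have "(\<lambda>N. (\<Sum>j\<le>N. c j * of_real (exp (- (real j * y))) * cis x ^ j) - psum N x * of_real (exp (- (real (Suc N) * y)))) \<longlonglongrightarrow> \<Phi> (Complex x y) - 0"
    by (rule tendsto_diff)
  then show "(\<lambda>j. psum j x * of_real (exp (- (real j * y)) - exp (- (real (Suc j) * y)))) sums \<Phi> (Complex x y)"
    unfolding sums_def_le
    using summation_by_parts[where \<phi>="\<lambda>j. of_real (exp (- (real j * y)))"] by simp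
qed

text \<open>The integral of \<open>y powr (\<alpha>-1)\<close> against exp(-jy) is
  Gamma(\<open>\<alpha>\<close>) times \<open>j powr (-\<alpha>)\<close>. Termwise integration of
  the original series is not justified by absolute convergence, but after Abel summation the
  integrals of the norms are summable by \<open>psum_diff_bound\<close>.\<close>

lemma bdry_integral:
  assumes "\<rho> < \<alpha>"
  shows Phi_absolutely_integrable: "(\<lambda>y. of_real (y powr (\<alpha>-1)) * \<Phi> (Complex x y)) absolutely_integrable_on {0<..}"
    and bdry_has_integral: "((\<lambda>y. of_real (y powr (\<alpha>-1)) * \<Phi> (Complex x y)) has_integral of_real (Gamma \<alpha>) * bdry \<alpha> x) {0<..}"
proof -
  have a: "0 < \<alpha>" using assms rho_pos by linarith
  define w where "w j y = y powr (\<alpha>-1) * (exp (- (real j * y)) - exp (- (real (Suc j) * y)))" for j y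
  define d where "d j = real j powr (-\<alpha>) - real (Suc j) powr (-\<alpha>)" for j
  define f where "f j y = indicator {0<..} y *\<^sub>R (psum j x * of_real (w j y))" for j y
  have wI: "(w j has_integral Gamma \<alpha> * d j) {0<..}" if "j \<noteq> 0" for j
    using has_integral_diff[OF has_integral_Gamma_scaled[OF a, of "real j"] has_integral_Gamma_scaled[OF a, of "real (Suc j)"]] that
    by (simp add: w_def[abs_def] d_def right_diff_distrib)
  have w0: "0 \<le> w j y" if "y \<in> {0<..}" for j y
    using that by (simp add: w_def algebra_simps)
  have wA: "w j absolutely_integrable_on {0<..}" if "j \<noteq> 0" for j
    by (rule nonnegative_absolutely_integrable_1[OF has_integral_integrable[OF wI[OF that]] w0])
  have fA: "(\<lambda>y. psum j x * of_real (w j y)) absolutely_integrable_on {0<..}" for j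
  \<comment> \<open>For j = 0 the weight contains 1 - exp(-y), which does not decay, so
    \<open>w 0\<close> has to be kept out; its coefficient \<open>psum 0 x\<close> vanishes because
    \<open>c 0 = 0\<close>.\<close>
  proof (cases "j = 0")
    case False
    have "(\<lambda>y. complex_of_real (w j y)) absolutely_integrable_on {0<..}"
      using absolutely_integrable_linear[OF wA[OF False] bounded_linear_of_real] by (simp add: o_def)
    then show ?thesis by (rule set_integrable_mult_right)
  qed simp
  have fint: "integral\<^sup>L lebesgue (f j) = psum j x * of_real (Gamma \<alpha> * d j)" for j
  proof (cases "j = 0")
    case False
    have "((\<lambda>y. psum j x * of_real (w j y)) has_integral psum j x * of_real (Gamma \<alpha> * d j)) {0<..}"
      by (intro has_integral_mult_right has_integral_of_real wI False)
    then show ?thesis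
      using set_lebesgue_integral_eq_integral(2)[OF fA[of j]]
      unfolding f_def[abs_def] set_lebesgue_integral_def by (simp only: integral_unique)
  qed (simp add: f_def[abs_def])
  have nint: "(\<integral>y. norm (f j y) \<partial>lebesgue) = norm (psum j x) * (Gamma \<alpha> * \<bar>d j\<bar>)" for j
  proof (cases "j = 0")
    case False
    have d0: "0 \<le> d j" unfolding d_def using powr_neg_diff_bound(1)[OF a, of j] False by simp
    have "((\<lambda>y. norm (psum j x) * w j y) has_integral norm (psum j x) * (Gamma \<alpha> * d j)) {0<..}"
      by (intro has_integral_mult_right wI False)
    moreover have A: "(\<lambda>y. norm (psum j x) * w j y) absolutely_integrable_on {0<..}"
      using wA[OF False] by (rule set_integrable_mult_right)
    ultimately have "(LINT y:{0<..}|lebesgue. norm (psum j x) * w j y) = norm (psum j x) * (Gamma \<alpha> * d j)"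
      using set_lebesgue_integral_eq_integral(2)[OF A] by (simp only: integral_unique)
    then have "(\<integral>y. indicator {0<..} y *\<^sub>R (norm (psum j x) * w j y) \<partial>lebesgue) = norm (psum j x) * (Gamma \<alpha> * d j)"
      unfolding set_lebesgue_integral_def .
    moreover have "norm (f j y) = indicator {0<..} y *\<^sub>R (norm (psum j x) * w j y)" for y
      using w0[of y j] by (simp add: f_def norm_mult indicator_def)
    ultimately show ?thesis using d0 by simp
  qed (simp add: f_def[abs_def])
  have I1: "integrable lebesgue (f j)" for j
    using fA[of j] by (simp add: f_def[abs_def] set_integrable_def)
  have I2: "AE y in lebesgue. summable (\<lambda>j. norm (f j y))"
  proof (rule AE_I2)
    fix y :: real
    show "summable (\<lambda>j. norm (f j y))"
    proof (cases "y > 0")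
      case True
      have "norm (f j y) = y powr (\<alpha>-1) * (norm (psum j x) * (exp (- (real j * y)) - exp (- (real (Suc j) * y))))" for j
        using True w0[of y j] by (simp add: f_def norm_mult) (simp add: w_def)
      then show ?thesis using summable_mult[OF Phi_by_parts(1)[OF True]] by simp
    qed (simp add: f_def)
  qed
  have I3: "summable (\<lambda>j. \<integral>y. norm (f j y) \<partial>lebesgue)"
  proof -
    obtain B where B: "summable B"
      "\<And>j x. norm (psum j x) * \<bar>real j powr (-\<alpha>) - real (Suc j) powr (-\<alpha>)\<bar> \<le> B j"
      using psum_diff_bound[OF assms] by metis
    have "summable (\<lambda>j. norm (psum j x) * \<bar>d j\<bar>)"
      by (rule summable_comparison_test'[OF B(1)]) (use B(2) in \<open>simp add: d_def abs_mult\<close>)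
    from summable_mult[OF this, of "Gamma \<alpha>"] show ?thesis
      unfolding nint by (simp add: mult_ac)
  qed
  have S: "(\<Sum>j. f j y) = indicator {0<..} y *\<^sub>R (of_real (y powr (\<alpha>-1)) * \<Phi> (Complex x y))" for y
  proof (cases "y > 0")
    case True
    have "(\<lambda>j. of_real (y powr (\<alpha>-1)) * (psum j x * of_real (exp (- (real j * y)) - exp (- (real (Suc j) * y))))) sums (of_real (y powr (\<alpha>-1)) * \<Phi> (Complex x y))"
      by (rule sums_mult[OF Phi_by_parts(2)[OF True]])
    moreover have "f j y = of_real (y powr (\<alpha>-1)) * (psum j x * of_real (exp (- (real j * y)) - exp (- (real (Suc j) * y))))" for j
      using True by (simp add: f_def w_def)
    ultimately show ?thesis using True by (simp add: sums_iff)
  qed (simp add: f_def)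
  have 1: "integrable lebesgue (\<lambda>y. indicator {0<..} y *\<^sub>R (of_real (y powr (\<alpha>-1)) * \<Phi> (Complex x y)))"
    using integrable_suminf[OF I1 I2 I3] by (simp add: S)
  then show A: "(\<lambda>y. of_real (y powr (\<alpha>-1)) * \<Phi> (Complex x y)) absolutely_integrable_on {0<..}"
    by (simp add: set_integrable_def)
  have "(\<integral>y. indicator {0<..} y *\<^sub>R (of_real (y powr (\<alpha>-1)) * \<Phi> (Complex x y)) \<partial>lebesgue) = (\<Sum>j. psum j x * of_real (Gamma \<alpha> * d j))"
    using integral_suminf[OF I1 I2 I3] by (simp add: S fint)
  also have "\<dots> = (\<Sum>j. of_real (Gamma \<alpha>) * (psum j x * of_real (d j)))"
    by (simp add: mult_ac)
  also have "\<dots> = of_real (Gamma \<alpha>) * bdry \<alpha> x"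
  proof -
    obtain B where B: "summable B"
      "\<And>j x. norm (psum j x) * \<bar>real j powr (-\<alpha>) - real (Suc j) powr (-\<alpha>)\<bar> \<le> B j"
      using psum_diff_bound[OF assms] by metis
    have "summable (\<lambda>j. psum j x * of_real (d j))"
      by (rule summable_comparison_test'[OF B(1)]) (use B(2) in \<open>simp only: d_def norm_mult norm_of_real\<close>)
    then show ?thesis by (simp add: suminf_mult bdry_by_parts[OF assms] d_def)
  qed
  finally show "((\<lambda>y. of_real (y powr (\<alpha>-1)) * \<Phi> (Complex x y)) has_integral of_real (Gamma \<alpha>) * bdry \<alpha> x) {0<..}"
    using has_integral_set_lebesgue[OF A] by (simp add: set_lebesgue_integral_def)
qed

end

section \<open>Local growth, Cauchy estimates and Taylor polynomials at the boundary\<close>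

lemma powr_exp_bound:
  fixes s y d :: real
  assumes "0 < s" "0 < d" "0 \<le> y"
  shows "y powr s \<le> (s / d) powr s * exp (d * y)"
proof -
  have "d * y / s \<le> exp (d * y / s)" using exp_ge_add_one_self[of "d * y / s"] by linarith
  then have "y \<le> (s / d) * exp (d * y / s)" using assms by (simp add: field_simps)
  then have "y powr s \<le> ((s / d) * exp (d * y / s)) powr s" using assms by (intro powr_mono2) auto
  also have "\<dots> = (s / d) powr s * exp (d * y)" using assms by (subst powr_mult) (simp add: exp_powr_real)
  finally show ?thesis .
qed

context boundary_series begin

lemma Phi_holomorphic: "\<Phi> holomorphic_on {w. 0 < Im w}"
proof -
  have "(\<lambda>q. \<Sum>j. c j * q ^ j) holomorphic_on ball 0 1"
  proof (rule power_series_holomorphic)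
    fix w :: complex assume "w \<in> ball 0 1"
    then show "(\<lambda>n. c n * (w - 0) ^ n) sums (\<Sum>j. c j * w ^ j)"
      using summable_sums[OF summable_disc[of w]] by simp
  qed
  moreover have "(\<lambda>w. exp (\<i> * w)) holomorphic_on {w. 0 < Im w}"
    by (intro holomorphic_intros)
  moreover have "(\<lambda>w. exp (\<i> * w)) ` {w. 0 < Im w} \<subseteq> ball 0 1" by auto
  ultimately have "((\<lambda>q. \<Sum>j. c j * q ^ j) \<circ> (\<lambda>w. exp (\<i> * w))) holomorphic_on {w. 0 < Im w}"
    by (meson holomorphic_on_compose holomorphic_on_subset)
  then show ?thesis by (simp add: o_def \<Phi>_def[abs_def])
qed

lemma open_upper: "open {w. 0 < Im w}"
  by (rule open_halfspace_Im_gt)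

lemma Phi_higher_deriv:
  assumes "0 < Im w"
  shows "((deriv ^^ i) \<Phi> has_field_derivative (deriv ^^ Suc i) \<Phi> w) (at w)"
  using holomorphic_derivI[OF holomorphic_higher_deriv[OF Phi_holomorphic open_upper] open_upper, of w i] assms
  by simp

text \<open>Every occurring frequency is at least 1 because \<open>c 0 = 0\<close>, so exp(1/2 - Im
  w) factors out of the comparison with the absolutely convergent series at height 1/2.\<close>

lemma Phi_decay:
  obtains E where "0 \<le> E" "\<And>w. 1/2 \<le> Im w \<Longrightarrow> norm (\<Phi> w) \<le> E * exp (- Im w)"
proof
  define E where "E = exp (1/2) * (\<Sum>j. norm (c j) * exp (- (real j * (1/2))))"
  have s: "summable (\<lambda>j. norm (c j) * exp (- (real j * (1/2))))"
    by (rule summable_norm_exp) simp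
  show "0 \<le> E" unfolding E_def by (intro mult_nonneg_nonneg suminf_nonneg[OF s]) auto
  fix w :: complex assume w: "1/2 \<le> Im w"
  have le: "norm (c j) * exp (- (real j * Im w)) \<le> exp (1/2 - Im w) * (norm (c j) * exp (- (real j * (1/2))))" for j
  proof (cases "j = 0")
    case False
    then have "1 * (Im w - 1/2) \<le> real j * (Im w - 1/2)" using w by (intro mult_right_mono) auto
    then have "- (real j * Im w) \<le> (1/2 - Im w) + - (real j * (1/2))" by (simp add: algebra_simps)
    then have "exp (- (real j * Im w)) \<le> exp (1/2 - Im w) * exp (- (real j * (1/2)))"
      by (simp flip: exp_add)
    from mult_left_mono[OF this norm_ge_zero[of "c j"]] show ?thesis by (simp only: mult_ac)
  qed (simp add: c0)
  have "norm (\<Phi> w) \<le> (\<Sum>j. norm (c j * of_real (exp (- (real j * Im w))) * cis (Re w) ^ j))"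
  proof -
    have "(\<lambda>j. c j * of_real (exp (- (real j * Im w))) * cis (Re w) ^ j) sums \<Phi> w"
      using Phi_sums[of "Im w" "Re w"] w by (simp add: complex_surj)
    moreover have "summable (\<lambda>j. norm (c j * of_real (exp (- (real j * Im w))) * cis (Re w) ^ j))"
      using summable_norm_exp[of "Im w"] w by (simp add: norm_mult norm_power)
    ultimately show ?thesis using summable_norm by (metis sums_unique)
  qed
  also have "\<dots> = (\<Sum>j. norm (c j) * exp (- (real j * Im w)))"
    by (simp add: norm_mult norm_power)
  also have "\<dots> \<le> (\<Sum>j. exp (1/2 - Im w) * (norm (c j) * exp (- (real j * (1/2)))))"
  proof (rule suminf_le[OF le])
    show "summable (\<lambda>j. norm (c j) * exp (- (real j * Im w)))" by (rule summable_norm_exp) (use w in simp)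
  qed (rule summable_mult[OF s])
  also have "\<dots> = E * exp (- Im w)"
  proof -
    have "exp (1/2 - Im w) = exp (1/2) * exp (- Im w)" by (simp flip: exp_add)
    then show ?thesis by (subst suminf_mult[OF s]) (simp only: E_def mult_ac)
  qed
  finally show "norm (\<Phi> w) \<le> E * exp (- Im w)" .
qed

text \<open>The factor \<open>exp (- y / 2)\<close> makes the bound usable for all heights \<open>y\<close>, not only for \<open>y \<le> 1\<close>.\<close>
definition local_growth :: "real \<Rightarrow> real \<Rightarrow> real \<Rightarrow> real \<Rightarrow> bool" where
  "local_growth x C \<sigma> \<theta> \<longleftrightarrow> (\<forall>h y. 0 < y \<longrightarrow>
     norm (\<Phi> (Complex (x + h) y)) \<le> C * y powr (-\<sigma>) * (\<bar>h\<bar> + y) powr \<theta> * exp (- y / 2))"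

text \<open>For y > 1 the factor \<open>(\<bar>h\<bar> + y) powr \<theta>\<close> is at least 1, and
  half of the exponential decay absorbs \<open>y powr \<sigma>\<close>. The new constant is chosen
  before \<open>x\<close>, which keeps later Hoelder estimates uniform in the point.\<close>

lemma local_growthI:
  assumes C: "0 \<le> C" and s: "0 < \<sigma>" "0 \<le> \<theta>"
  obtains C' where "0 \<le> C'" "\<And>x. (\<forall>h y. 0 < y \<longrightarrow> y \<le> 1 \<longrightarrow>
     norm (\<Phi> (Complex (x + h) y)) \<le> C * y powr (-\<sigma>) * (\<bar>h\<bar> + y) powr \<theta>) \<Longrightarrow> local_growth x C' \<sigma> \<theta>"
proof -
  obtain E where E: "0 \<le> E" "\<And>w. 1/2 \<le> Im w \<Longrightarrow> norm (\<Phi> w) \<le> E * exp (- Im w)"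
    using Phi_decay by blast
  define C' where "C' = C * exp (1/2) + E * (\<sigma> / (1/2)) powr \<sigma>"
  have C': "0 \<le> C'" using C E by (simp add: C'_def)
  show thesis
  proof (rule that[OF C'])
    fix x assume H: "\<forall>h y. 0 < y \<longrightarrow> y \<le> 1 \<longrightarrow>
       norm (\<Phi> (Complex (x + h) y)) \<le> C * y powr (-\<sigma>) * (\<bar>h\<bar> + y) powr \<theta>"
    show "local_growth x C' \<sigma> \<theta>"
      unfolding local_growth_def
    proof (intro allI impI)
      fix h y :: real assume y: "0 < y"
      show "norm (\<Phi> (Complex (x + h) y)) \<le> C' * y powr (-\<sigma>) * (\<bar>h\<bar> + y) powr \<theta> * exp (- y / 2)"
      proof (cases "y \<le> 1")
        case True
        have "norm (\<Phi> (Complex (x + h) y)) \<le> C * y powr (-\<sigma>) * (\<bar>h\<bar> + y) powr \<theta>"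
          using H y True by blast
        also have "\<dots> \<le> C * y powr (-\<sigma>) * (\<bar>h\<bar> + y) powr \<theta> * (exp (1/2) * exp (- y / 2))"
        proof -
          have "1 \<le> exp (1/2) * exp (- y / 2)" using True by (simp flip: exp_add)
          then have "C * y powr (-\<sigma>) * (\<bar>h\<bar> + y) powr \<theta> * 1 \<le> C * y powr (-\<sigma>) * (\<bar>h\<bar> + y) powr \<theta> * (exp (1/2) * exp (- y / 2))"
            by (rule mult_left_mono) (use C in simp)
          then show ?thesis by simp
        qed
        also have "\<dots> = (C * exp (1/2)) * (y powr (-\<sigma>) * (\<bar>h\<bar> + y) powr \<theta> * exp (- y / 2))"
          by simp
        also have "\<dots> \<le> C' * (y powr (-\<sigma>) * (\<bar>h\<bar> + y) powr \<theta> * exp (- y / 2))"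
          by (rule mult_right_mono) (use E in \<open>auto simp: C'_def\<close>)
        finally show ?thesis by simp
      next
        case False
        have "norm (\<Phi> (Complex (x + h) y)) \<le> E * exp (- y)"
          using E(2)[of "Complex (x+h) y"] False by simp
        also have "\<dots> \<le> E * ((\<sigma> / (1/2)) powr \<sigma> * y powr (-\<sigma>) * exp (- y / 2))"
        proof (rule mult_left_mono[OF _ E(1)])
          have "y powr \<sigma> \<le> (\<sigma> / (1/2)) powr \<sigma> * exp (1/2 * y)"
            using s y by (intro powr_exp_bound) auto
          then have 1: "y powr \<sigma> * (y powr (-\<sigma>) * exp (- y)) \<le> (\<sigma> / (1/2)) powr \<sigma> * exp (1/2 * y) * (y powr (-\<sigma>) * exp (- y))"
            by (rule mult_right_mono) simp
          have "exp (- y) = y powr \<sigma> * (y powr (-\<sigma>) * exp (- y))"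
            using y by (simp add: powr_minus)
          also note 1
          also have "(\<sigma> / (1/2)) powr \<sigma> * exp (1/2 * y) * (y powr (-\<sigma>) * exp (- y)) = (\<sigma> / (1/2)) powr \<sigma> * y powr (-\<sigma>) * (exp (1/2 * y) * exp (- y))"
            by (simp only: mult_ac)
          also have "exp (1/2 * y) * exp (- y) = exp (- y / 2)" by (simp flip: exp_add)
          finally show "exp (- y) \<le> (\<sigma> / (1/2)) powr \<sigma> * y powr (-\<sigma>) * exp (- y / 2)" .
        qed
        also have "\<dots> = (E * (\<sigma> / (1/2)) powr \<sigma>) * (y powr (-\<sigma>) * exp (- y / 2)) * 1"
          by simp
        also have "\<dots> \<le> C' * (y powr (-\<sigma>) * exp (- y / 2)) * (\<bar>h\<bar> + y) powr \<theta>"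
        proof (intro mult_mono mult_right_mono)
          show "1 \<le> (\<bar>h\<bar> + y) powr \<theta>" using False s by (intro ge_one_powr_ge_zero) auto
        qed (use C C' in \<open>auto simp: C'_def\<close>)
        finally show ?thesis by (simp add: mult_ac)
      qed
    qed
  qed
qed

text \<open>Cauchy's estimate on the disc of radius y/2. On its boundary the height stays between
  y/2 and 3y/2 and \<open>\<bar>h'\<bar> + Im w\<close> is at most 2(|h| + y), which accounts for
  the powers of 2 and for the weaker exponential.\<close>

lemma local_growth_deriv:
  assumes g: "local_growth x C \<sigma> \<theta>" and C: "0 \<le> C" and s: "0 < \<sigma>" "0 \<le> \<theta>" and y: "0 < y"
  shows "norm ((deriv ^^ n) \<Phi> (Complex (x + h) y)) \<le>
     fact n * C * 2 powr (\<sigma> + \<theta> + real n) * y powr (-\<sigma> - real n) * (\<bar>h\<bar> + y) powr \<theta> * exp (- y / 4)"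
proof -
  let ?z = "Complex (x + h) y"
  define B where "B = C * (y/2) powr (-\<sigma>) * (2 * (\<bar>h\<bar> + y)) powr \<theta> * exp (- y / 4)"
  have sub: "cball ?z (y/2) \<subseteq> {w. 0 < Im w}"
  proof
    fix w assume "w \<in> cball ?z (y/2)"
    then have "Im (?z - w) \<le> y/2" using abs_Im_le_cmod[of "?z - w"] by (simp add: dist_norm)
    then have "y - Im w \<le> y/2" by simp
    then show "w \<in> {w. 0 < Im w}" using y by simp
  qed
  have "norm ((deriv ^^ n) \<Phi> ?z) \<le> fact n * B / (y/2) ^ n"
  proof (rule Cauchy_inequality)
    show "\<Phi> holomorphic_on ball ?z (y/2)"
      by (rule holomorphic_on_subset[OF Phi_holomorphic subset_trans[OF ball_subset_cball sub]])
    show "continuous_on (cball ?z (y/2)) \<Phi>"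
      by (rule continuous_on_subset[OF holomorphic_on_imp_continuous_on[OF Phi_holomorphic] sub])
    show "0 < y/2" using y by simp
    fix w assume w: "norm (?z - w) = y/2"
    define h' where "h' = Re w - x"
    have "\<bar>Re (?z - w)\<bar> \<le> y/2" "\<bar>Im (?z - w)\<bar> \<le> y/2"
      using abs_Re_le_cmod[of "?z - w"] abs_Im_le_cmod[of "?z - w"] w by auto
    then have "\<bar>h - h'\<bar> \<le> y/2" "\<bar>y - Im w\<bar> \<le> y/2" by (simp_all add: h'_def algebra_simps)
    then have im: "y/2 \<le> Im w" "Im w \<le> 3 * y / 2" and re: "\<bar>h'\<bar> \<le> \<bar>h\<bar> + y/2" by linarith+
    have w': "w = Complex (x + h') (Im w)" by (simp add: h'_def)
    have "norm (\<Phi> w) \<le> C * Im w powr (-\<sigma>) * (\<bar>h'\<bar> + Im w) powr \<theta> * exp (- Im w / 2)"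
    proof -
      have "0 < Im w" using im y by linarith
      from g[unfolded local_growth_def, rule_format, OF this, of h'] show ?thesis by (simp only: w'[symmetric])
    qed
    also have "\<dots> \<le> B"
    proof -
      have 1: "Im w powr (-\<sigma>) \<le> (y/2) powr (-\<sigma>)" by (rule powr_mono2') (use s y im in auto)
      have 2: "(\<bar>h'\<bar> + Im w) powr \<theta> \<le> (2 * (\<bar>h\<bar> + y)) powr \<theta>"
      proof (rule powr_mono2[OF s(2)])
        show "0 \<le> \<bar>h'\<bar> + Im w" using im y by linarith
        show "\<bar>h'\<bar> + Im w \<le> 2 * (\<bar>h\<bar> + y)" using im(2) re abs_ge_zero[of h] by argo
      qed
      have 3: "exp (- Im w / 2) \<le> exp (- y / 4)" using im by simp
      show ?thesis unfolding B_def
        by (intro mult_mono[OF mult_mono[OF mult_left_mono[OF 1 C] 2] 3] mult_nonneg_nonneg C) simp_all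
    qed
    finally show "norm (\<Phi> w) \<le> B" .
  qed
  also have "\<dots> = fact n * C * 2 powr (\<sigma> + \<theta> + real n) * y powr (-\<sigma> - real n) * (\<bar>h\<bar> + y) powr \<theta> * exp (- y / 4)"
  proof -
    have 1: "(y/2) powr (-\<sigma>) = y powr (-\<sigma>) * 2 powr \<sigma>"
      using y by (simp add: powr_divide powr_minus_divide)
    have 2: "B / (y/2) ^ n = B * (2 powr real n * y powr (- real n))"
      using y by (simp add: powr_realpow power_divide powr_minus_divide)
    have 3: "(2 * (\<bar>h\<bar> + y)) powr \<theta> = 2 powr \<theta> * (\<bar>h\<bar> + y) powr \<theta>"
      using y by (subst powr_mult) auto
    have 4: "2 powr (\<sigma> + \<theta> + real n) = (2::real) powr \<sigma> * 2 powr \<theta> * 2 powr real n"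
      "y powr (-\<sigma> - real n) = y powr (-\<sigma>) * y powr (- real n)"
      by (simp_all flip: powr_add)
    show ?thesis
      unfolding times_divide_eq_right[symmetric] 2 unfolding B_def 1 3 4 by (simp only: mult_ac)
  qed
  finally show ?thesis .
qed

text \<open>Complex Taylor formula along the horizontal segment at height \<open>y\<close>. The
  restriction \<open>\<bar>h\<bar> \<le> y\<close> makes |u| + y at most 2y on the segment, so that
  the factor with exponent \<open>\<theta>\<close> becomes a pure power of \<open>y\<close>.\<close>

lemma Phi_taylor:
  assumes g: "local_growth x C \<sigma> \<theta>" and C: "0 \<le> C" and s: "0 < \<sigma>" "0 \<le> \<theta>" and y: "0 < y" and h: "\<bar>h\<bar> \<le> y"
  shows "norm (\<Phi> (Complex (x + h) y) - (\<Sum>i\<le>k. (deriv ^^ i) \<Phi> (Complex x y) * of_real h ^ i / fact i))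
     \<le> (real k + 1) * C * 2 powr (\<sigma> + 2 * \<theta> + real k + 1) * y powr (\<theta> - \<sigma> - real k - 1) * \<bar>h\<bar> ^ Suc k"
proof -
  define S where "S = closed_segment (Complex x y) (Complex (x + h) y)"
  define B where "B = fact (Suc k) * C * 2 powr (\<sigma> + 2 * \<theta> + real k + 1) * y powr (\<theta> - \<sigma> - real k - 1)"
  have S: "\<exists>u. w = Complex (x + u) y \<and> \<bar>u\<bar> \<le> \<bar>h\<bar>" if "w \<in> S" for w
  proof -
    from that obtain t where t: "0 \<le> t" "t \<le> 1" "w = (1 - t) *\<^sub>R Complex x y + t *\<^sub>R Complex (x + h) y"
      unfolding S_def in_segment by blast
    have "w = Complex (x + t * h) y" using t(3) by (simp add: complex_eq_iff algebra_simps)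
    moreover have "\<bar>t * h\<bar> \<le> 1 * \<bar>h\<bar>" unfolding abs_mult using t by (intro mult_right_mono) auto
    ultimately show ?thesis by auto
  qed
  have "norm ((deriv ^^ 0) \<Phi> (Complex (x + h) y) - (\<Sum>i\<le>k. (deriv ^^ i) \<Phi> (Complex x y) * (Complex (x + h) y - Complex x y) ^ i / fact i))
     \<le> B * norm (Complex (x + h) y - Complex x y) ^ Suc k / fact k"
  proof (rule complex_Taylor)
    show "convex S" by (simp add: S_def)
    fix i w assume "w \<in> S"
    then have "0 < Im w" using S y by fastforce
    then show "((deriv ^^ i) \<Phi> has_field_derivative (deriv ^^ Suc i) \<Phi> w) (at w within S)"
      using Phi_higher_deriv has_field_derivative_at_within by blast
  next
    fix w assume "w \<in> S"
    then obtain u where u: "w = Complex (x + u) y" "\<bar>u\<bar> \<le> \<bar>h\<bar>" using S by blast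
    have "norm ((deriv ^^ Suc k) \<Phi> w) \<le> fact (Suc k) * C * 2 powr (\<sigma> + \<theta> + real (Suc k)) * y powr (-\<sigma> - real (Suc k)) * (\<bar>u\<bar> + y) powr \<theta> * exp (- y / 4)"
      unfolding u(1) by (rule local_growth_deriv[OF g C s y])
    also have "\<dots> \<le> fact (Suc k) * C * 2 powr (\<sigma> + \<theta> + real (Suc k)) * y powr (-\<sigma> - real (Suc k)) * (2 * y) powr \<theta> * 1"
      by (intro mult_mono powr_mono2 order.refl mult_nonneg_nonneg) (use C s y h u in auto)
    also have "\<dots> = B"
    proof -
      have 1: "(2::real) powr (\<sigma> + 2 * \<theta> + real k + 1) = 2 powr (\<sigma> + \<theta> + real (Suc k)) * 2 powr \<theta>"
        by (subst powr_add[symmetric]) (simp add: algebra_simps)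
      have 2: "y powr (\<theta> - \<sigma> - real k - 1) = y powr (-\<sigma> - real (Suc k)) * y powr \<theta>"
        by (subst powr_add[symmetric]) (simp add: algebra_simps)
      have 3: "(2 * y) powr \<theta> = 2 powr \<theta> * y powr \<theta>" using y by (subst powr_mult) auto
      show ?thesis unfolding B_def 1 2 3 by (simp only: mult_ac mult_1_right)
    qed
    finally show "norm ((deriv ^^ Suc k) \<Phi> w) \<le> B" .
  qed (auto simp: S_def)
  moreover have "Complex (x + h) y - Complex x y = of_real h" by (simp add: complex_eq_iff)
  moreover have "B * \<bar>h\<bar> ^ Suc k / fact k = (real k + 1) * C * 2 powr (\<sigma> + 2 * \<theta> + real k + 1) * y powr (\<theta> - \<sigma> - real k - 1) * \<bar>h\<bar> ^ Suc k"
  proof -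
    have "fact (Suc k) = (real k + 1) * fact k" by simp
    then show ?thesis unfolding B_def by simp
  qed
  ultimately show ?thesis by (simp only: norm_of_real funpow_0)
qed

end

lemma has_integral_powr_left:
  fixes a \<delta> :: real
  assumes "-1 < a" "0 \<le> \<delta>"
  shows "((\<lambda>u. if u \<le> \<delta> then u powr a else 0) has_integral (\<delta> powr (a+1) / (a+1))) {0<..}"
proof -
  have "((\<lambda>u. u powr a) has_integral (\<delta> powr (a+1) / (a+1))) {0..\<delta>}"
    by (rule has_integral_powr_from_0[OF assms])
  then have "((\<lambda>u. if u \<in> {0..\<delta>} then u powr a else 0) has_integral (\<delta> powr (a+1) / (a+1))) UNIV"
    by (subst has_integral_restrict_UNIV)
  moreover have "(\<lambda>u. if u \<in> {0..\<delta>} then u powr a else 0) = (\<lambda>u. if u \<in> {0<..} then if u \<le> \<delta> then u powr a else 0 else 0)"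
    by (auto simp: fun_eq_iff)
  ultimately show ?thesis by (subst has_integral_restrict_UNIV[symmetric]) (simp only:)
qed

lemma has_integral_powr_right:
  fixes b \<delta> :: real
  assumes "b < -1" "0 < \<delta>"
  shows "((\<lambda>u. if u \<le> \<delta> then 0 else u powr b) has_integral (\<delta> powr (b+1) / (-(b+1)))) {0<..}"
proof -
  have "((\<lambda>u. u powr b) has_integral (-(\<delta> powr (b+1)) / (b+1))) {\<delta>..}"
    by (rule has_integral_powr_to_inf[OF assms])
  then have "((\<lambda>u. if u \<in> {\<delta>..} then u powr b else 0) has_integral (-(\<delta> powr (b+1)) / (b+1))) UNIV"
    by (subst has_integral_restrict_UNIV)
  then have "((\<lambda>u. if u \<in> {0<..} then if u \<le> \<delta> then 0 else u powr b else 0) has_integral (-(\<delta> powr (b+1)) / (b+1))) UNIV"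
    by (rule has_integral_spike[of "{\<delta>}", rotated 2]) (use assms in auto)
  then have "((\<lambda>u. if u \<le> \<delta> then 0 else u powr b) has_integral (-(\<delta> powr (b+1)) / (b+1))) {0<..}"
    by (subst (asm) has_integral_restrict_UNIV)
  moreover have "-(\<delta> powr (b+1)) / (b+1) = \<delta> powr (b+1) / (-(b+1))"
    by (metis divide_minus_left divide_minus_right)
  ultimately show ?thesis by (simp only:)
qed

context boundary_series begin

text \<open>On the vertical line over \<open>x\<close> itself (h = 0) the derivative of order
  \<open>i\<close> is of size \<open>y powr (\<theta> - \<sigma> - i)\<close>. The gain
  \<open>\<theta>\<close> at the single point \<open>x\<close> thus yields candidate Taylor
  coefficients of orders beyond \<open>\<alpha> - \<sigma>\<close>, where derivatives of the
  boundary function need not exist.\<close>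

lemma Phi_deriv_integrable:
  assumes g: "local_growth x C \<sigma> \<theta>" and C: "0 \<le> C" and s: "0 < \<sigma>" "0 \<le> \<theta>" and i: "real i < \<alpha> - \<sigma> + \<theta>"
  shows "(\<lambda>y. of_real (y powr (\<alpha>-1)) * (deriv ^^ i) \<Phi> (Complex x y)) absolutely_integrable_on {0<..}"
proof (rule measurable_bounded_by_integrable_imp_absolutely_integrable)
  define a where "a = \<alpha> - \<sigma> + \<theta> - real i"
  have a: "0 < a" using i by (simp add: a_def)
  define D where "D = fact i * C * 2 powr (\<sigma> + \<theta> + real i)"
  show "(\<lambda>y. D * (y powr (a - 1) * exp (- (1/4 * y)))) integrable_on {0<..}"
    by (rule has_integral_integrable[OF has_integral_mult_right[OF has_integral_Gamma_scaled[OF a]]]) simp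
  fix y :: real assume y: "y \<in> {0<..}"
  have "norm ((deriv ^^ i) \<Phi> (Complex (x + 0) y)) \<le>
     fact i * C * 2 powr (\<sigma> + \<theta> + real i) * y powr (-\<sigma> - real i) * (\<bar>0\<bar> + y) powr \<theta> * exp (- y / 4)"
    by (rule local_growth_deriv[OF g C s]) (use y in simp)
  then have "norm ((deriv ^^ i) \<Phi> (Complex x y)) \<le> D * (y powr (-\<sigma> - real i) * y powr \<theta> * exp (- y / 4))"
    by (simp add: D_def mult.assoc)
  then have "y powr (\<alpha>-1) * norm ((deriv ^^ i) \<Phi> (Complex x y)) \<le> y powr (\<alpha>-1) * (D * (y powr (-\<sigma> - real i) * y powr \<theta> * exp (- y / 4)))"
    by (rule mult_left_mono) simp
  also have "\<dots> = D * ((y powr (\<alpha>-1) * y powr (-\<sigma> - real i) * y powr \<theta>) * exp (- (1/4 * y)))"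
    by simp
  also have "y powr (\<alpha>-1) * y powr (-\<sigma> - real i) * y powr \<theta> = y powr (a - 1)"
    by (simp add: a_def algebra_simps flip: powr_add)
  finally show "norm (of_real (y powr (\<alpha>-1)) * (deriv ^^ i) \<Phi> (Complex x y)) \<le> D * (y powr (a - 1) * exp (- (1/4 * y)))"
    by (simp add: norm_mult)
next
  have "continuous_on {0<..} ((deriv ^^ i) \<Phi> \<circ> (\<lambda>y. Complex x y))"
  proof (rule continuous_on_compose2[OF holomorphic_on_imp_continuous_on[OF holomorphic_higher_deriv[OF Phi_holomorphic open_upper]], unfolded o_def[symmetric]])
    show "continuous_on {0<..} (Complex x)"
      unfolding Complex_eq by (intro continuous_intros)
  qed auto
  then have "continuous_on {0<..} (\<lambda>y. of_real (y powr (\<alpha>-1)) * (deriv ^^ i) \<Phi> (Complex x y))"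
    by (intro continuous_intros) (auto simp: o_def)
  then show "(\<lambda>y. of_real (y powr (\<alpha>-1)) * (deriv ^^ i) \<Phi> (Complex x y)) \<in> borel_measurable (lebesgue_on {0<..})"
    by (rule continuous_imp_measurable_on_sets_lebesgue) auto
qed auto

text \<open>Split \<open>\<integral> y powr (\<alpha>-1) \<Phi>(x+h+iy) dy\<close> at \<open>y = \<bar>h\<bar>\<close>: above, expand \<open>\<Phi>\<close> in powers of \<open>h\<close>; below, estimate
  each term of the Taylor polynomial and \<open>\<Phi>\<close> separately.\<close>
lemma bdry_taylor:
  assumes \<alpha>: "\<rho> < \<alpha>" "\<sigma> < \<alpha>" and \<sigma>: "0 < \<sigma>" and \<theta>: "0 \<le> \<theta>"
    and s: "s = \<alpha> - \<sigma> + \<theta>" "real k < s" "s < real k + 1"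
  obtains M where "0 \<le> M" "\<And>x C. 0 \<le> C \<Longrightarrow> local_growth x C \<sigma> \<theta> \<Longrightarrow>
     \<exists>p. p 0 = bdry \<alpha> x \<and> (\<forall>h. norm (bdry \<alpha> (x + h) - (\<Sum>i\<le>k. p i * of_real h ^ i)) \<le> M * C * \<bar>h\<bar> powr s)"
proof -
  define A where "A i = 2 powr (\<sigma> + \<theta> + real i)" for i :: nat
  define T where "T = (real k + 1) * 2 powr (\<sigma> + 2 * \<theta> + real k + 1)"
  define M where "M = (2 powr \<theta> / (\<alpha> - \<sigma>) + (\<Sum>i\<le>k. A i / (s - real i)) + T / (real k + 1 - s)) / Gamma \<alpha>"
  have a0: "0 < \<alpha>" using \<alpha>(2) \<sigma> by linarith
  have G0: "0 < Gamma \<alpha>" using a0 by (rule Gamma_real_pos)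
  have "0 \<le> M"
    unfolding M_def using s \<alpha> G0 by (intro divide_nonneg_nonneg add_nonneg_nonneg sum_nonneg) (auto simp: A_def T_def)
  moreover have "\<exists>p. p 0 = bdry \<alpha> x \<and> (\<forall>h. norm (bdry \<alpha> (x + h) - (\<Sum>i\<le>k. p i * of_real h ^ i)) \<le> M * C * \<bar>h\<bar> powr s)"
    if C: "0 \<le> C" and g: "local_growth x C \<sigma> \<theta>" for x C
  proof -
    define f where "f i y = of_real (y powr (\<alpha>-1)) * (deriv ^^ i) \<Phi> (Complex x y)" for i y
    \<comment> \<open>The coefficients are vertical integrals of derivatives of
      \<open>\<Phi>\<close>, divided by Gamma(\<open>\<alpha>\<close>) and i!; they are not claimed
      to be derivatives of \<open>bdry \<alpha>\<close>, except for the value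
      \<open>p 0\<close>.\<close>
    define p where "p i = integral {0<..} (f i) / (of_real (Gamma \<alpha>) * fact i)" for i
    have fint: "(f i has_integral (of_real (Gamma \<alpha>) * fact i * p i)) {0<..}" if "i \<le> k" for i
    proof -
      have "f i absolutely_integrable_on {0<..}"
        unfolding f_def by (rule Phi_deriv_integrable[OF g C \<sigma> \<theta>]) (use that s in simp)
      then have "f i integrable_on {0<..}" by (rule set_lebesgue_integral_eq_integral(1))
      then show ?thesis using G0 by (simp add: p_def integrable_integral)
    qed
    have p0: "p 0 = bdry \<alpha> x"
    proof -
      have "of_real (Gamma \<alpha>) * fact 0 * p 0 = of_real (Gamma \<alpha>) * bdry \<alpha> x"
        by (rule has_integral_unique[OF fint]) (use bdry_has_integral[OF \<alpha>(1), of x] in \<open>simp_all add: f_def[abs_def]\<close>)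
      then show ?thesis using G0 by simp
    qed
    have "norm (bdry \<alpha> (x + h) - (\<Sum>i\<le>k. p i * of_real h ^ i)) \<le> M * C * \<bar>h\<bar> powr s" for h
    proof (cases "h = 0")
      case True
      have "(\<Sum>i\<le>k. p i * of_real h ^ i) = (\<Sum>i\<in>{0}. p i * of_real h ^ i)"
        using True by (intro sum.mono_neutral_right) auto
      then show ?thesis using True p0 by simp
    next
      case False
      define \<delta> where "\<delta> = \<bar>h\<bar>"
      have d: "0 < \<delta>" using False by (simp add: \<delta>_def)
      define F where "F y = of_real (y powr (\<alpha>-1)) * \<Phi> (Complex (x + h) y) - (\<Sum>i\<le>k. f i y * (of_real h ^ i / fact i))" for y
      \<comment> \<open>Each of the three parts integrates to a multiple of
        \<open>\<delta> powr s\<close>. Convergence at 0 uses \<open>\<sigma> < \<alpha>\<close> and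
        i <= k < s; convergence at infinity uses s < k + 1. The two strict inequalities exclude
        integral \<open>s\<close>.\<close>
      define b where "b y = C * ((2 * \<delta>) powr \<theta> * (if y \<le> \<delta> then y powr (\<alpha> - \<sigma> - 1) else 0)
         + (\<Sum>i\<le>k. A i * \<delta> ^ i * (if y \<le> \<delta> then y powr (s - real i - 1) else 0))
         + T * \<delta> ^ Suc k * (if y \<le> \<delta> then 0 else y powr (s - real k - 2)))" for y
      define I where "I = C * ((2 * \<delta>) powr \<theta> * (\<delta> powr (\<alpha> - \<sigma> - 1 + 1) / (\<alpha> - \<sigma> - 1 + 1))
         + (\<Sum>i\<le>k. A i * \<delta> ^ i * (\<delta> powr (s - real i - 1 + 1) / (s - real i - 1 + 1)))
         + T * \<delta> ^ Suc k * (\<delta> powr (s - real k - 2 + 1) / (-(s - real k - 2 + 1))))"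
      have bI: "(b has_integral I) {0<..}"
        unfolding b_def I_def
        by (intro has_integral_mult_right has_integral_add has_integral_sum has_integral_powr_left has_integral_powr_right)
          (use \<alpha> s d in auto)
      have FI: "(F has_integral (of_real (Gamma \<alpha>) * bdry \<alpha> (x + h) - (\<Sum>i\<le>k. of_real (Gamma \<alpha>) * fact i * p i * (of_real h ^ i / fact i)))) {0<..}"
        unfolding F_def
        by (intro has_integral_diff bdry_has_integral[OF \<alpha>(1)] has_integral_sum has_integral_mult_left fint) auto
      have Fb: "norm (F y) \<le> b y" if "y \<in> {0<..}" for y
      proof -
        have y: "0 < y" using that by simp
        have Feq: "F y = of_real (y powr (\<alpha>-1)) * (\<Phi> (Complex (x + h) y) - (\<Sum>i\<le>k. (deriv ^^ i) \<Phi> (Complex x y) * of_real h ^ i / fact i))"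
          by (simp add: F_def f_def right_diff_distrib sum_distrib_left mult.assoc)
        show ?thesis
        proof (cases "y \<le> \<delta>")
          case False
          have "norm (F y) = y powr (\<alpha>-1) * norm (\<Phi> (Complex (x + h) y) - (\<Sum>i\<le>k. (deriv ^^ i) \<Phi> (Complex x y) * of_real h ^ i / fact i))"
            by (simp add: Feq norm_mult)
          also have "\<dots> \<le> y powr (\<alpha>-1) * ((real k + 1) * C * 2 powr (\<sigma> + 2 * \<theta> + real k + 1) * y powr (\<theta> - \<sigma> - real k - 1) * \<bar>h\<bar> ^ Suc k)"
            by (intro mult_left_mono Phi_taylor[OF g C \<sigma> \<theta> y]) (use False in \<open>auto simp: \<delta>_def\<close>)
          also have "\<dots> = C * (T * \<delta> ^ Suc k * (y powr (\<alpha>-1) * y powr (\<theta> - \<sigma> - real k - 1)))"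
            by (simp add: T_def \<delta>_def mult_ac)
          also have "y powr (\<alpha>-1) * y powr (\<theta> - \<sigma> - real k - 1) = y powr (s - real k - 2)"
            by (simp add: s algebra_simps flip: powr_add)
          finally show ?thesis using False by (simp add: b_def)
        next
          case True
          have 1: "norm (\<Phi> (Complex (x + h) y)) \<le> C * (y powr (-\<sigma>) * (2 * \<delta>) powr \<theta>)"
          proof -
            have "norm (\<Phi> (Complex (x + h) y)) \<le> C * y powr (-\<sigma>) * (\<bar>h\<bar> + y) powr \<theta> * exp (- y / 2)"
              using g y unfolding local_growth_def by blast
            also have "\<dots> \<le> C * y powr (-\<sigma>) * (2 * \<delta>) powr \<theta> * 1"
              by (intro mult_mono powr_mono2 order.refl mult_nonneg_nonneg) (use C \<theta> y True in \<open>auto simp: \<delta>_def\<close>)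
            finally show ?thesis by simp
          qed
          have 2: "norm (f i y * (of_real h ^ i / fact i)) \<le> C * (A i * \<delta> ^ i * y powr (s - real i - 1))" for i
          proof -
            have "norm ((deriv ^^ i) \<Phi> (Complex (x + 0) y)) \<le>
               fact i * C * 2 powr (\<sigma> + \<theta> + real i) * y powr (-\<sigma> - real i) * (\<bar>0\<bar> + y) powr \<theta> * exp (- y / 4)"
              by (rule local_growth_deriv[OF g C \<sigma> \<theta> y])
            also have "\<dots> \<le> fact i * C * 2 powr (\<sigma> + \<theta> + real i) * y powr (-\<sigma> - real i) * (\<bar>0\<bar> + y) powr \<theta> * 1"
              by (intro mult_left_mono mult_nonneg_nonneg) (use C y in auto)
            finally have "norm ((deriv ^^ i) \<Phi> (Complex x y)) \<le> fact i * C * A i * (y powr (-\<sigma> - real i) * y powr \<theta>)"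
              using y by (simp add: A_def mult.assoc)
            then have "y powr (\<alpha>-1) * norm ((deriv ^^ i) \<Phi> (Complex x y)) * (\<delta> ^ i / fact i)
               \<le> y powr (\<alpha>-1) * (fact i * C * A i * (y powr (-\<sigma> - real i) * y powr \<theta>)) * (\<delta> ^ i / fact i)"
              by (intro mult_right_mono mult_left_mono) (use d in auto)
            also have "\<dots> = C * (A i * \<delta> ^ i * (y powr (\<alpha>-1) * y powr (-\<sigma> - real i) * y powr \<theta>))"
              by simp
            also have "y powr (\<alpha>-1) * y powr (-\<sigma> - real i) * y powr \<theta> = y powr (s - real i - 1)"
              by (simp add: s algebra_simps flip: powr_add)
            finally show ?thesis by (simp add: f_def norm_mult norm_divide norm_power \<delta>_def)
          qed
          have "norm (F y) \<le> norm (of_real (y powr (\<alpha>-1)) * \<Phi> (Complex (x + h) y)) + norm (\<Sum>i\<le>k. f i y * (of_real h ^ i / fact i))"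
            unfolding F_def by (rule norm_triangle_ineq4)
          also have "\<dots> \<le> y powr (\<alpha>-1) * (C * (y powr (-\<sigma>) * (2 * \<delta>) powr \<theta>)) + (\<Sum>i\<le>k. C * (A i * \<delta> ^ i * y powr (s - real i - 1)))"
            using mult_left_mono[OF 1, of "y powr (\<alpha>-1)"]
            by (intro add_mono sum_norm_le 2) (simp add: norm_mult)
          also have "\<dots> = C * ((2 * \<delta>) powr \<theta> * (y powr (\<alpha>-1) * y powr (-\<sigma>)) + (\<Sum>i\<le>k. A i * \<delta> ^ i * y powr (s - real i - 1)))"
            by (simp add: distrib_left sum_distrib_left mult_ac)
          also have "y powr (\<alpha>-1) * y powr (-\<sigma>) = y powr (\<alpha> - \<sigma> - 1)"
            by (simp add: algebra_simps flip: powr_add)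
          finally show ?thesis using True by (simp add: b_def)
        qed
      qed
      have "norm (integral {0<..} F) \<le> integral {0<..} b"
        by (rule Henstock_Kurzweil_Integration.integral_norm_bound_integral[OF has_integral_integrable[OF FI] has_integral_integrable[OF bI] Fb])
      then have 3: "norm (of_real (Gamma \<alpha>) * bdry \<alpha> (x + h) - (\<Sum>i\<le>k. of_real (Gamma \<alpha>) * fact i * p i * (of_real h ^ i / fact i))) \<le> I"
        by (simp only: integral_unique[OF FI] integral_unique[OF bI])
      have "of_real (Gamma \<alpha>) * bdry \<alpha> (x + h) - (\<Sum>i\<le>k. of_real (Gamma \<alpha>) * fact i * p i * (of_real h ^ i / fact i))
        = of_real (Gamma \<alpha>) * (bdry \<alpha> (x + h) - (\<Sum>i\<le>k. p i * of_real h ^ i))"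
        by (simp add: right_diff_distrib sum_distrib_left mult_ac)
      then have 4: "Gamma \<alpha> * norm (bdry \<alpha> (x + h) - (\<Sum>i\<le>k. p i * of_real h ^ i)) \<le> I"
        using 3 G0 by (simp only: norm_mult norm_of_real abs_of_pos)
      have e1: "(2 * \<delta>) powr \<theta> * \<delta> powr (\<alpha> - \<sigma> - 1 + 1) = 2 powr \<theta> * \<delta> powr s"
        using d by (simp add: powr_mult s mult.assoc flip: powr_add) (simp add: algebra_simps)
      have e2: "\<delta> ^ i * \<delta> powr (s - real i - 1 + 1) = \<delta> powr s" for i
        using d by (simp add: flip: powr_realpow powr_add)
      have e3: "\<delta> ^ Suc k * \<delta> powr (s - real k - 2 + 1) = \<delta> powr s"
        using d by (simp add: flip: powr_realpow powr_add del: power_Suc)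
      have "I = C * (2 powr \<theta> / (\<alpha> - \<sigma>) * \<delta> powr s + (\<Sum>i\<le>k. A i / (s - real i) * \<delta> powr s) + T / (real k + 1 - s) * \<delta> powr s)"
      proof -
        have "A i * \<delta> ^ i * (\<delta> powr (s - real i - 1 + 1) / (s - real i - 1 + 1)) = A i / (s - real i) * \<delta> powr s" for i
          using e2[of i] by (simp add: field_simps)
        moreover have "(2 * \<delta>) powr \<theta> * (\<delta> powr (\<alpha> - \<sigma> - 1 + 1) / (\<alpha> - \<sigma> - 1 + 1)) = 2 powr \<theta> / (\<alpha> - \<sigma>) * \<delta> powr s"
          using e1 by (simp add: field_simps)
        moreover have "T * \<delta> ^ Suc k * (\<delta> powr (s - real k - 2 + 1) / (-(s - real k - 2 + 1))) = T / (real k + 1 - s) * \<delta> powr s"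
          unfolding mult.assoc times_divide_eq_right e3 by simp
        ultimately show ?thesis unfolding I_def by (simp only:)
      qed
      also have "\<dots> = Gamma \<alpha> * (M * C * \<bar>h\<bar> powr s)"
      proof -
        have "Gamma \<alpha> * M = 2 powr \<theta> / (\<alpha> - \<sigma>) + (\<Sum>i\<le>k. A i / (s - real i)) + T / (real k + 1 - s)"
          using G0 by (simp add: M_def)
        then have "Gamma \<alpha> * (M * C * \<delta> powr s) = (2 powr \<theta> / (\<alpha> - \<sigma>) + (\<Sum>i\<le>k. A i / (s - real i)) + T / (real k + 1 - s)) * C * \<delta> powr s"
          by (simp only: mult.assoc[symmetric])
        then show ?thesis unfolding sum_distrib_right[symmetric] distrib_right[symmetric] \<delta>_def by (simp only: mult_ac)
      qed
      finally show ?thesis using 4 G0 by (simp only: mult_le_cancel_left_pos)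
    qed
    with p0 show ?thesis by blast
  qed
  ultimately show thesis using that by blast
qed

end

section \<open>Recovering the series from its boundary values\<close>

lemma summable_nat_power_geometric:
  fixes q :: "'a :: {real_normed_field, banach}"
  assumes "norm q < 1"
  shows "summable (\<lambda>n. of_nat n ^ k * q ^ n)"
proof -
  have "\<forall>q::'a. norm q < 1 \<longrightarrow> summable (\<lambda>n. of_nat n ^ k * q ^ n)"
  proof (induction k)
    case 0
    then show ?case by (auto intro: summable_geometric)
  next
    case (Suc k)
    show ?case
    proof (intro allI impI)
      fix q :: 'a assume q: "norm q < 1"
      have "summable (\<lambda>n. diffs (\<lambda>n. of_nat n ^ k) n * q ^ n)"
        by (rule termdiff_converges[OF q]) (use Suc in auto)
      then have "summable (\<lambda>n. q * (of_nat (Suc n) ^ Suc k * q ^ n))"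
        by (intro summable_mult) (simp add: diffs_def)
      then have "summable (\<lambda>n. of_nat (Suc n) ^ Suc k * q ^ Suc n)" by (simp add: mult_ac)
      then show "summable (\<lambda>n. of_nat n ^ Suc k * q ^ n)" by (subst summable_Suc_iff[symmetric])
    qed
  qed
  with assms show ?thesis by blast
qed

text \<open>Expanding n^k = ((n+1) - 1)^k expresses (1 - q) times the series of order k through
  those of lower order, so every step of the induction costs one factor 1/|1 - q|; the powers of 2
  bring lower orders to the common denominator. The factor |q| is retained because it gives the
  decay for q near 0.\<close>

lemma nat_power_series_bound:
  obtains C where "0 \<le> C" "\<And>q::complex. norm q < 1 \<Longrightarrow>
      norm (\<Sum>n. of_nat (Suc n) ^ k * q ^ Suc n) \<le> C * norm q / norm (1 - q) ^ Suc k"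
proof -
  define D where "D k q = (\<Sum>n. of_nat (Suc n) ^ k * q ^ Suc n)" for k and q :: complex
  have sm: "summable (\<lambda>n. of_nat (Suc n) ^ k * q ^ Suc n)" if "norm q < 1" for k and q :: complex
    using summable_nat_power_geometric[OF that, of k] by (subst summable_Suc_iff)
  have "\<exists>C\<ge>0. \<forall>q::complex. norm q < 1 \<longrightarrow> norm (D k q) \<le> C * norm q / norm (1 - q) ^ Suc k"
  proof (induction k rule: less_induct)
    case (less k)
    show ?case
    proof (cases "k = 0")
      case True
      have "D 0 q = q / (1 - q)" if "norm q < 1" for q
      proof -
        have "(\<lambda>n. q * q ^ n) sums (q * (1 / (1 - q)))"
          by (intro sums_mult geometric_sums that)
        then show ?thesis by (simp add: D_def sums_iff)
      qed
      then show ?thesis using True by (intro exI[of _ 1]) (simp add: norm_divide)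
    next
      case False
      from less obtain C where C: "\<And>i. i < k \<Longrightarrow> 0 \<le> C i"
        "\<And>i q. i < k \<Longrightarrow> norm q < 1 \<Longrightarrow> norm (D i q) \<le> C i * norm q / norm (1 - q) ^ Suc i"
        by metis
      define C' where "C' = (\<Sum>i<k. real (k choose i) * C i * 2 ^ (k - Suc i))"
      have "norm (D k q) \<le> C' * norm q / norm (1 - q) ^ Suc k" if q: "norm q < 1" for q
      proof -
        have q1: "0 < norm (1 - q)" using q by auto
        have q2: "norm (1 - q) \<le> 2" using norm_triangle_ineq4[of 1 q] q by simp
        have *: "of_nat n ^ k = (\<Sum>i\<le>k. of_nat (k choose i) * of_nat (Suc n) ^ i * (-1) ^ (k - i) :: complex)" for n
          using binomial_ring[of "of_nat (Suc n) :: complex" "-1" k] by simp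
        have "(1 - q) * D k q = (\<Sum>n. of_nat (Suc n) ^ k * q ^ Suc n) - (\<Sum>n. of_nat n ^ k * q ^ Suc n)"
        proof -
          have "(\<Sum>n. of_nat n ^ k * q ^ Suc n) = (\<Sum>n. q * (of_nat n ^ k * q ^ n))" by (simp add: mult_ac)
          also have "\<dots> = q * (\<Sum>n. of_nat n ^ k * q ^ n)"
            by (rule suminf_mult[OF summable_nat_power_geometric[OF q]])
          also have "(\<Sum>n. of_nat n ^ k * q ^ n) = D k q"
            using suminf_split_head[OF summable_nat_power_geometric[OF q], of k] False by (simp add: D_def)
          finally show ?thesis by (simp add: D_def algebra_simps)
        qed
        also have "\<dots> = (\<Sum>n. of_nat (Suc n) ^ k * q ^ Suc n - of_nat n ^ k * q ^ Suc n)"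
        proof (rule suminf_diff[OF sm[OF q]])
          have "summable (\<lambda>n. q * (of_nat n ^ k * q ^ n))"
            by (intro summable_mult summable_nat_power_geometric q)
          then show "summable (\<lambda>n. of_nat n ^ k * q ^ Suc n)" by (simp add: mult_ac)
        qed
        also have "\<dots> = (\<Sum>n. \<Sum>i<k. - (of_nat (k choose i) * (-1) ^ (k - i)) * (of_nat (Suc n) ^ i * q ^ Suc n))"
        proof -
          have "of_nat (Suc n) ^ k * q ^ Suc n - of_nat n ^ k * q ^ Suc n =
             (\<Sum>i<k. - (of_nat (k choose i) * (-1) ^ (k - i)) * (of_nat (Suc n) ^ i * q ^ Suc n))" for n
          proof -
            have "of_nat n ^ k = (\<Sum>i<k. of_nat (k choose i) * of_nat (Suc n) ^ i * (-1) ^ (k - i)) + (of_nat (Suc n) ^ k :: complex)"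
              by (rule trans[OF *], subst lessThan_Suc_atMost[symmetric]) (simp only: sum.lessThan_Suc binomial_n_n diff_self_eq_0 power_0 of_nat_1 mult_1 mult_1_right)
            then show ?thesis by (simp only: sum_distrib_right sum_negf[symmetric] distrib_right) (simp add: sum_negf mult_ac sum_distrib_right)
          qed
          then show ?thesis by (simp only:)
        qed
        also have "\<dots> = (\<Sum>i<k. \<Sum>n. - (of_nat (k choose i) * (-1) ^ (k - i)) * (of_nat (Suc n) ^ i * q ^ Suc n))"
          by (rule suminf_sum) (intro summable_mult sm q)
        also have "\<dots> = (\<Sum>i<k. - (of_nat (k choose i) * (-1) ^ (k - i)) * D i q)"
          unfolding D_def by (intro sum.cong refl suminf_mult sm q)
        finally have "norm (1 - q) * norm (D k q) = norm (\<Sum>i<k. - (of_nat (k choose i) * (-1) ^ (k - i)) * D i q)"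
          by (metis norm_mult)
        also have "\<dots> \<le> (\<Sum>i<k. real (k choose i) * C i * 2 ^ (k - Suc i) * norm q / norm (1 - q) ^ k)"
        proof (rule sum_norm_le)
          fix i assume i: "i \<in> {..<k}"
          have "norm (- (of_nat (k choose i) * (-1) ^ (k - i)) * D i q) = real (k choose i) * norm (D i q)"
            by (simp add: norm_mult norm_power)
          also have "\<dots> \<le> real (k choose i) * (C i * norm q / norm (1 - q) ^ Suc i)"
            using i C(2) q by (intro mult_left_mono) auto
          also have "\<dots> = real (k choose i) * C i * norm q * (norm (1 - q) ^ (k - Suc i) / norm (1 - q) ^ k)"
          proof -
            have "norm (1 - q) ^ k = norm (1 - q) ^ Suc i * norm (1 - q) ^ (k - Suc i)"
              using i by (subst power_add[symmetric]) auto
            then show ?thesis using q1 by simp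
          qed
          also have "\<dots> \<le> real (k choose i) * C i * norm q * (2 ^ (k - Suc i) / norm (1 - q) ^ k)"
            using q1 q2 i C(1) by (intro mult_left_mono divide_right_mono power_mono) auto
          finally show "norm (- (of_nat (k choose i) * (-1) ^ (k - i)) * D i q) \<le> real (k choose i) * C i * 2 ^ (k - Suc i) * norm q / norm (1 - q) ^ k"
            by (simp add: mult_ac)
        qed
        also have "\<dots> = C' * norm q / norm (1 - q) ^ k"
          by (simp add: C'_def sum_distrib_right sum_divide_distrib)
        finally show ?thesis using q1 by (simp add: field_simps)
      qed
      moreover have "0 \<le> C'" unfolding C'_def using C by (intro sum_nonneg) auto
      ultimately show ?thesis by blast
    qed
  qed
  then show thesis using that unfolding D_def by blast
qed

text \<open>Near 0 the quantity 1 - exp(iw) is comparable to w, but high up it tends to 1 while |w|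
  is unbounded. The factor exp(-Im w / m) compensates; raised to the power m it amounts to exactly
  the one factor |q| offered by \<open>nat_power_series_bound\<close>.\<close>

lemma norm_one_minus_exp_ge:
  fixes w :: complex and m :: nat
  assumes t: "\<bar>Re w\<bar> \<le> pi" and y: "0 < Im w" and m: "0 < m"
  shows "norm w * exp (- Im w / real m) \<le> 2 * (4 + real m) * norm (1 - exp (\<i> * w))"
proof -
  define t where "t = Re w"
  define y where "y = Im w"
  have y0: "0 < y" and t': "\<bar>t\<bar> \<le> pi" using assms by (auto simp: y_def t_def)
  have e: "exp (\<i> * w) = of_real (exp (-y)) * cis t"
    by (simp add: exp_eq_polar y_def t_def)
  have e1: "exp (1::real) \<le> 3" using exp_le by simp
  show ?thesis
  proof (cases "y \<le> 1")
    case True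
    have R: "1/3 \<le> exp (-y)"
    proof -
      have "exp y \<le> exp 1" using True by simp
      then have "exp y \<le> 3" using e1 by linarith
      then show ?thesis by (simp add: exp_minus field_simps)
    qed
    have "y/3 \<le> 1 - exp (-y)"
    proof -
      have "1 + y \<le> exp y" by (rule exp_ge_add_one_self)
      then have "(1 + y) * exp (-y) \<le> 1" by (simp add: exp_minus field_simps)
      then have "y * exp (-y) \<le> 1 - exp (-y)" by (simp add: algebra_simps)
      moreover have "y * (1/3) \<le> y * exp (-y)" using R y0 by (intro mult_left_mono) auto
      ultimately show ?thesis by simp
    qed
    then have 1: "(y/3)\<^sup>2 \<le> (1 - exp (-y))\<^sup>2" using y0 by (intro power_mono) auto
    have "(\<bar>t\<bar> / pi)\<^sup>2 \<le> \<bar>sin (t/2)\<bar>\<^sup>2"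
      by (rule power_mono[OF abs_sin_half_ge[OF t']]) simp
    then have s: "(t/pi)\<^sup>2 \<le> (sin (t/2))\<^sup>2" by (simp add: power_divide)
    have "pi \<le> 3.2" using pi_approx by simp
    then have "pi\<^sup>2 \<le> 3.2\<^sup>2" by (intro power_mono) auto
    then have "pi\<^sup>2 \<le> 12" by (simp add: power2_eq_square)
    then have "t\<^sup>2 * pi\<^sup>2 \<le> t\<^sup>2 * 12" by (rule mult_left_mono) simp
    then have "(t/3)\<^sup>2 \<le> 4 * (1/3) * (t/pi)\<^sup>2" by (simp add: power_divide field_simps)
    also have "\<dots> \<le> 4 * exp (-y) * (sin (t/2))\<^sup>2" using R s by (intro mult_mono) auto
    finally have "(t/3)\<^sup>2 + (y/3)\<^sup>2 \<le> (norm (1 - exp (\<i> * w)))\<^sup>2"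
      using 1 norm_one_minus_polar[of "exp (-y)" t] by (simp add: e)
    moreover have "(norm w / 3)\<^sup>2 = (t/3)\<^sup>2 + (y/3)\<^sup>2"
      by (simp add: cmod_power2 power_divide t_def y_def add_divide_distrib)
    ultimately have "norm w / 3 \<le> norm (1 - exp (\<i> * w))"
      by (metis norm_ge_zero power2_le_imp_le)
    then have "norm w \<le> 3 * norm (1 - exp (\<i> * w))" by simp
    also have "\<dots> \<le> 2 * (4 + real m) * norm (1 - exp (\<i> * w))" by (intro mult_right_mono) auto
    finally have "norm w \<le> 2 * (4 + real m) * norm (1 - exp (\<i> * w))" .
    moreover have "norm w * exp (- Im w / real m) \<le> norm w * 1" using y by (intro mult_left_mono) auto
    ultimately show ?thesis by linarith
  next
    case False
    have "exp (-y) \<le> exp (-1)" using False by simp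
    moreover have "exp (-1::real) \<le> 1/2" using exp_ge_add_one_self[of "1::real"] by (simp add: exp_minus field_simps)
    ultimately have "exp (-y) \<le> 1/2" by linarith
    then have "1/2 \<le> 1 - norm (exp (\<i> * w))" by (simp add: y_def)
    also have "\<dots> \<le> norm (1 - exp (\<i> * w))" using norm_triangle_ineq2[of 1 "exp (\<i> * w)"] by simp
    finally have h: "1/2 \<le> norm (1 - exp (\<i> * w))" .
    have "norm w \<le> \<bar>t\<bar> + \<bar>y\<bar>" unfolding t_def y_def by (rule cmod_le)
    also have "\<dots> \<le> 4 + y" using t' y0 pi_less_4 by simp
    also have "\<dots> \<le> (4 + real m) * (1 + y / real m)" using m y0 by (simp add: field_simps)
    also have "\<dots> \<le> (4 + real m) * exp (y / real m)" by (intro mult_left_mono exp_ge_add_one_self) auto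
    finally have "norm w * exp (- y / real m) \<le> (4 + real m) * exp (y / real m) * exp (- y / real m)"
      by (intro mult_right_mono) auto
    also have "\<dots> = (4 + real m) * 1" by (simp add: mult.assoc flip: exp_add)
    also have "\<dots> \<le> (4 + real m) * (2 * norm (1 - exp (\<i> * w)))" using h by (intro mult_left_mono) auto
    finally show ?thesis by (simp only: y_def mult_ac)
  qed
qed

text \<open>The case \<open>j = 0\<close> vanishes because \<open>0 powr \<alpha> = 0\<close>, even for \<open>\<alpha> = 0\<close>.\<close>
definition frac_kernel :: "real \<Rightarrow> complex \<Rightarrow> complex" where
  "frac_kernel \<alpha> w = (\<Sum>j. of_real (real j powr \<alpha>) * exp (\<i> * w) ^ j)"

lemma summable_powr_geometric:
  assumes "0 \<le> R" "R < 1"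
  shows "summable (\<lambda>j. real j powr \<alpha> * R ^ j)"
proof -
  define k where "k = nat \<lceil>\<alpha>\<rceil>"
  have k: "\<alpha> \<le> real k" unfolding k_def by linarith
  have "summable (\<lambda>j. of_nat j ^ k * R ^ j)"
    by (rule summable_nat_power_geometric) (use assms in simp)
  then show ?thesis
  proof (rule summable_comparison_test')
    fix j :: nat
    show "norm (real j powr \<alpha> * R ^ j) \<le> of_nat j ^ k * R ^ j"
    proof (cases "j = 0")
      case False
      then have "real j powr \<alpha> \<le> real j powr real k" using k by (intro powr_mono) auto
      then show ?thesis using False assms by (simp add: powr_realpow mult_right_mono)
    qed (use assms in auto)
  qed
qed

text \<open>Writing \<open>j powr \<alpha>\<close> as j^k times
  \<open>j powr (-(k - \<alpha>))\<close> and the latter as a Gamma integral turns the kernel into a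
  vertical fractional integral of the kernel with integer power k. Only the size is wanted, hence an
  inequality of norms.\<close>

lemma frac_kernel_integral:
  fixes w :: complex
  assumes a: "\<alpha> < real k" and w: "0 < Im w"
  shows "Gamma (real k - \<alpha>) * norm (frac_kernel \<alpha> w) \<le>
     norm (integral\<^sup>L lebesgue (\<lambda>u. indicator {0<..} u *\<^sub>R (of_real (u powr (real k - \<alpha> - 1)) *
        (\<Sum>n. of_nat (Suc n) ^ k * exp (\<i> * (w + \<i> * of_real u)) ^ Suc n))))" (is "?A \<le> _")
    and "(\<lambda>u. of_real (u powr (real k - \<alpha> - 1)) *
        (\<Sum>n. of_nat (Suc n) ^ k * exp (\<i> * (w + \<i> * of_real u)) ^ Suc n)) absolutely_integrable_on {0<..}"
proof -
  define l where "l = real k - \<alpha>"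
  have l: "0 < l" using a by (simp add: l_def)
  define q where "q = exp (\<i> * w)"
  have nq: "norm q < 1" using w by (simp add: q_def)
  define v where "v n u = of_nat (Suc n) ^ k * q ^ Suc n * of_real (u powr (l - 1) * exp (- (real (Suc n) * u)))" for n u
  define f where "f n u = indicator {0<..} u *\<^sub>R v n u" for n u
  have wA: "(\<lambda>u. u powr (l - 1) * exp (- (real (Suc n) * u))) absolutely_integrable_on {0<..}" for n
    by (rule absolutely_integrable_Gamma_scaled) (use l in auto)
  have wI: "((\<lambda>u. u powr (l - 1) * exp (- (real (Suc n) * u))) has_integral (Gamma l * real (Suc n) powr (-l))) {0<..}" for n
    by (rule has_integral_Gamma_scaled) (use l in auto)
  have vA: "v n absolutely_integrable_on {0<..}" for n
  proof -
    have "(\<lambda>u. complex_of_real (u powr (l - 1) * exp (- (real (Suc n) * u)))) absolutely_integrable_on {0<..}"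
      using absolutely_integrable_linear[OF wA bounded_linear_of_real] by (simp add: o_def)
    then show ?thesis unfolding v_def by (rule set_integrable_mult_right)
  qed
  have pk: "real (Suc n) ^ k * real (Suc n) powr (-l) = real (Suc n) powr \<alpha>" for n
    by (simp add: l_def powr_diff powr_minus powr_realpow del: of_nat_Suc)
  have fint: "integral\<^sup>L lebesgue (f n) = of_real (Gamma l) * (of_real (real (Suc n) powr \<alpha>) * q ^ Suc n)" for n
  proof -
    have "(v n has_integral of_nat (Suc n) ^ k * q ^ Suc n * of_real (Gamma l * real (Suc n) powr (-l))) {0<..}"
      unfolding v_def by (intro has_integral_mult_right has_integral_of_real wI)
    then have "integral\<^sup>L lebesgue (f n) = of_nat (Suc n) ^ k * q ^ Suc n * of_real (Gamma l * real (Suc n) powr (-l))"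
      using set_lebesgue_integral_eq_integral(2)[OF vA[of n]]
      unfolding f_def[abs_def] set_lebesgue_integral_def by (simp only: integral_unique)
    also have "\<dots> = of_real (Gamma l) * (of_real (real (Suc n) ^ k * real (Suc n) powr (-l)) * q ^ Suc n)"
      by (simp only: of_real_mult of_real_power of_real_of_nat_eq mult_ac)
    finally show ?thesis by (simp only: pk)
  qed
  have nint: "(\<integral>u. norm (f n u) \<partial>lebesgue) = Gamma l * (real (Suc n) powr \<alpha> * norm q ^ Suc n)" for n
  proof -
    have H: "((\<lambda>u. real (Suc n) ^ k * norm q ^ Suc n * (u powr (l - 1) * exp (- (real (Suc n) * u)))) has_integral real (Suc n) ^ k * norm q ^ Suc n * (Gamma l * real (Suc n) powr (-l))) {0<..}"
      by (intro has_integral_mult_right wI)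
    have A: "(\<lambda>u. real (Suc n) ^ k * norm q ^ Suc n * (u powr (l - 1) * exp (- (real (Suc n) * u)))) absolutely_integrable_on {0<..}"
      using wA by (rule set_integrable_mult_right)
    have "(LINT u:{0<..}|lebesgue. real (Suc n) ^ k * norm q ^ Suc n * (u powr (l - 1) * exp (- (real (Suc n) * u)))) = real (Suc n) ^ k * norm q ^ Suc n * (Gamma l * real (Suc n) powr (-l))"
      using set_lebesgue_integral_eq_integral(2)[OF A] H by (simp only: integral_unique)
    moreover have "norm (f n u) = indicator {0<..} u *\<^sub>R (real (Suc n) ^ k * norm q ^ Suc n * (u powr (l - 1) * exp (- (real (Suc n) * u))))" for u
    proof -
      have "norm (v n u) = real (Suc n) ^ k * norm q ^ Suc n * (u powr (l - 1) * exp (- (real (Suc n) * u)))"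
        unfolding v_def norm_mult norm_power norm_of_nat norm_of_real by simp
      then show ?thesis by (simp add: f_def indicator_def)
    qed
    ultimately have "(\<integral>u. norm (f n u) \<partial>lebesgue) = real (Suc n) ^ k * norm q ^ Suc n * (Gamma l * real (Suc n) powr (-l))"
      unfolding set_lebesgue_integral_def by (simp only:)
    also have "\<dots> = Gamma l * ((real (Suc n) ^ k * real (Suc n) powr (-l)) * norm q ^ Suc n)"
      by (simp only: mult_ac)
    finally show ?thesis by (simp only: pk)
  qed
  have I1: "integrable lebesgue (f n)" for n
    using vA[of n] by (simp add: f_def[abs_def] set_integrable_def)
  have S: "(\<lambda>n. v n u) sums (of_real (u powr (l - 1)) * (\<Sum>n. of_nat (Suc n) ^ k * exp (\<i> * (w + \<i> * of_real u)) ^ Suc n))"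
    and Sn: "summable (\<lambda>n. norm (v n u))" if u: "0 < u" for u
  proof -
    have e: "exp (\<i> * (w + \<i> * of_real u)) = q * of_real (exp (-u))"
      by (simp add: q_def distrib_left exp_diff exp_of_real exp_minus divide_inverse)
    have lt: "norm (q * of_real (exp (-u))) < 1"
    proof -
      have "norm q * exp (-u) \<le> norm q * 1" using u by (intro mult_left_mono) auto
      then show ?thesis using nq by (simp add: norm_mult)
    qed
    have veq: "v n u = of_real (u powr (l - 1)) * (of_nat (Suc n) ^ k * (q * of_real (exp (-u))) ^ Suc n)" for n
    proof -
      have "exp (- (real (Suc n) * u)) = exp (-u) ^ Suc n"
        by (metis exp_of_nat_mult mult_minus_right)
      then show ?thesis by (simp only: v_def power_mult_distrib of_real_mult of_real_power mult_ac)
    qed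
    have sm: "summable (\<lambda>n. of_nat (Suc n) ^ k * (q * of_real (exp (-u))) ^ Suc n)"
      using summable_nat_power_geometric[OF lt, of k] by (subst summable_Suc_iff)
    show "(\<lambda>n. v n u) sums (of_real (u powr (l - 1)) * (\<Sum>n. of_nat (Suc n) ^ k * exp (\<i> * (w + \<i> * of_real u)) ^ Suc n))"
      unfolding veq e by (intro sums_mult summable_sums sm)
    have lt': "norm (norm (q * of_real (exp (-u)))) < 1" using lt by simp
    have "summable (\<lambda>n. of_nat (Suc n) ^ k * norm (q * of_real (exp (-u))) ^ Suc n)"
      using summable_nat_power_geometric[OF lt', of k] by (subst summable_Suc_iff)
    from summable_mult[OF this, of "norm (complex_of_real (u powr (l-1)))"] show "summable (\<lambda>n. norm (v n u))"
      unfolding veq norm_mult[of "of_real (u powr (l-1))"] norm_mult[of "of_nat (Suc n) ^ k" for n] norm_power norm_of_nat .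
  qed
  have I2: "AE u in lebesgue. summable (\<lambda>n. norm (f n u))"
  proof (rule AE_I2)
    fix u :: real
    show "summable (\<lambda>n. norm (f n u))"
      using Sn[of u] by (cases "u > 0") (auto simp: f_def)
  qed
  have sm: "summable (\<lambda>n. real (Suc n) powr \<alpha> * norm q ^ Suc n)"
    using summable_powr_geometric[OF norm_ge_zero nq, of \<alpha>] by (subst summable_Suc_iff)
  have I3: "summable (\<lambda>n. \<integral>u. norm (f n u) \<partial>lebesgue)"
    unfolding nint by (intro summable_mult sm)
  have feq: "(\<Sum>n. f n u) = indicator {0<..} u *\<^sub>R (of_real (u powr (l - 1)) * (\<Sum>n. of_nat (Suc n) ^ k * exp (\<i> * (w + \<i> * of_real u)) ^ Suc n))" for u
    using S[of u] by (cases "u > 0") (simp_all add: f_def sums_iff del: power_Suc of_nat_Suc)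
  show "(\<lambda>u. of_real (u powr (real k - \<alpha> - 1)) *
        (\<Sum>n. of_nat (Suc n) ^ k * exp (\<i> * (w + \<i> * of_real u)) ^ Suc n)) absolutely_integrable_on {0<..}"
    using integrable_suminf[OF I1 I2 I3] unfolding feq set_integrable_def l_def .
  have "(\<integral>u. indicator {0<..} u *\<^sub>R (of_real (u powr (l - 1)) * (\<Sum>n. of_nat (Suc n) ^ k * exp (\<i> * (w + \<i> * of_real u)) ^ Suc n)) \<partial>lebesgue)
     = (\<Sum>n. of_real (Gamma l) * (of_real (real (Suc n) powr \<alpha>) * q ^ Suc n))"
    using integral_suminf[OF I1 I2 I3] unfolding feq fint .
  also have "\<dots> = of_real (Gamma l) * frac_kernel \<alpha> w"
  proof -
    have s: "summable (\<lambda>n. of_real (real n powr \<alpha>) * q ^ n)"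
      by (rule summable_norm_cancel) (use summable_powr_geometric[OF norm_ge_zero nq, of \<alpha>] in \<open>simp add: norm_mult norm_power\<close>)
    then have "summable (\<lambda>n. of_real (real (Suc n) powr \<alpha>) * q ^ Suc n)" by (subst summable_Suc_iff)
    moreover have "(\<Sum>n. of_real (real (Suc n) powr \<alpha>) * q ^ Suc n) = frac_kernel \<alpha> w"
      using suminf_split_head[OF s] by (simp add: frac_kernel_def q_def)
    ultimately show ?thesis by (simp only: suminf_mult)
  qed
  finally show "?A \<le> norm (integral\<^sup>L lebesgue (\<lambda>u. indicator {0<..} u *\<^sub>R (of_real (u powr (real k - \<alpha> - 1)) *
        (\<Sum>n. of_nat (Suc n) ^ k * exp (\<i> * (w + \<i> * of_real u)) ^ Suc n))))"
    using Gamma_real_pos[OF l] by (simp only: l_def[symmetric] norm_mult norm_of_real abs_of_pos)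
qed

text \<open>In the vertical integral the point w + iu has modulus at least max(|w|, u), so the
  integer-power bound is used with |w| for u <= |w| and with u beyond. Both ranges contribute a
  multiple of \<open>norm w powr (-\<alpha> - 1)\<close>.\<close>

lemma frac_kernel_bound:
  assumes a: "0 < \<alpha>"
  obtains C where "0 \<le> C" "\<And>w. \<bar>Re w\<bar> \<le> pi \<Longrightarrow> 0 < Im w \<Longrightarrow> norm (frac_kernel \<alpha> w) \<le> C * norm w powr (-\<alpha> - 1)"
proof -
  define k where "k = Suc (nat \<lceil>\<alpha>\<rceil>)"
  have k: "\<alpha> < real k" unfolding k_def by linarith
  obtain C where C: "0 \<le> C" "\<And>q::complex. norm q < 1 \<Longrightarrow>
      norm (\<Sum>n. of_nat (Suc n) ^ k * q ^ Suc n) \<le> C * norm q / norm (1 - q) ^ Suc k"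
    using nat_power_series_bound by blast
  define l where "l = real k - \<alpha>"
  have l: "0 < l" "l < real k + 1" using k a by (auto simp: l_def)
  define E where "E = C * (2 * (4 + real (Suc k))) ^ Suc k"
  have E: "0 \<le> E" using C by (simp add: E_def)
  have Dk: "norm (\<Sum>n. of_nat (Suc n) ^ k * exp (\<i> * w) ^ Suc n) \<le> E * norm w powr (- (real k + 1))"
    if w: "\<bar>Re w\<bar> \<le> pi" "0 < Im w" for w
  proof -
    define q where "q = exp (\<i> * w)"
    have q: "norm q < 1" "norm q = exp (- Im w)" using w by (auto simp: q_def)
    have n0: "0 < norm w" using w by auto
    have q1: "0 < norm (1 - q)" using q(1) by auto
    have "(norm w * exp (- Im w / real (Suc k))) ^ Suc k \<le> (2 * (4 + real (Suc k)) * norm (1 - q)) ^ Suc k"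
      unfolding q_def by (intro power_mono norm_one_minus_exp_ge w) auto
    also have "(norm w * exp (- Im w / real (Suc k))) ^ Suc k = norm w ^ Suc k * norm q"
      by (simp add: power_mult_distrib q(2) exp_of_nat_mult[symmetric] del: power_Suc of_nat_Suc)
    finally have 1: "norm w ^ Suc k * norm q \<le> (2 * (4 + real (Suc k))) ^ Suc k * norm (1 - q) ^ Suc k"
      by (simp only: power_mult_distrib)
    have "norm (\<Sum>n. of_nat (Suc n) ^ k * q ^ Suc n) \<le> C * (norm q / norm (1 - q) ^ Suc k)"
      using C(2)[OF q(1)] by simp
    also have "\<dots> \<le> C * ((2 * (4 + real (Suc k))) ^ Suc k / norm w ^ Suc k)"
    proof (rule mult_left_mono[OF _ C(1)])
      have "0 < norm (1 - q) ^ Suc k" "0 < norm w ^ Suc k" using q1 n0 by (simp_all only: zero_less_power)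
      then show "norm q / norm (1 - q) ^ Suc k \<le> (2 * (4 + real (Suc k))) ^ Suc k / norm w ^ Suc k"
        using 1 by (simp add: divide_le_eq le_divide_eq mult.commute del: power_Suc of_nat_Suc)
    qed
    also have "\<dots> = E * (1 / norm w ^ Suc k)" by (simp add: E_def)
    also have "1 / norm w ^ Suc k = norm w powr (- (real k + 1))"
    proof -
      have "norm w powr (- (real k + 1)) = norm w powr (- real (Suc k))" by (simp add: add.commute)
      then show ?thesis using n0 by (simp only: powr_minus_divide powr_realpow)
    qed
    finally show ?thesis by (simp add: q_def)
  qed
  define M where "M = E * (1 / l + 1 / (real k + 1 - l)) / Gamma l"
  have G0: "0 < Gamma l" using l by (intro Gamma_real_pos)
  have "0 \<le> M" using E l G0 by (simp add: M_def)
  moreover have "norm (frac_kernel \<alpha> w) \<le> M * norm w powr (-\<alpha> - 1)" if w: "\<bar>Re w\<bar> \<le> pi" "0 < Im w" for w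
  proof -
    define d where "d = norm w"
    have d: "0 < d" using w by (auto simp: d_def)
    define F where "F u = of_real (u powr (real k - \<alpha> - 1)) *
        (\<Sum>n. of_nat (Suc n) ^ k * exp (\<i> * (w + \<i> * of_real u)) ^ Suc n)" for u
    define b where "b u = E * (d powr (- (real k + 1)) * (if u \<le> d then u powr (l - 1) else 0) + (if u \<le> d then 0 else u powr (l - real k - 2)))" for u
    define I where "I = E * (d powr (- (real k + 1)) * (d powr (l - 1 + 1) / (l - 1 + 1)) + (d powr (l - real k - 2 + 1) / (-(l - real k - 2 + 1))))"
    have bI: "(b has_integral I) {0<..}"
      unfolding b_def I_def
      by (intro has_integral_mult_right has_integral_add has_integral_powr_left has_integral_powr_right) (use l d in auto)
    have FA: "F absolutely_integrable_on {0<..}"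
      unfolding F_def by (rule frac_kernel_integral(2)[OF k w(2)])
    have Fb: "norm (F u) \<le> b u" if "u \<in> {0<..}" for u
    proof -
      have u: "0 < u" using that by simp
      define w' where "w' = w + \<i> * of_real u"
      have w': "Re w' = Re w" "Im w' = Im w + u" by (simp_all add: w'_def)
      have nw: "d \<le> norm w'" "u \<le> norm w'"
      proof -
        show "d \<le> norm w'" unfolding d_def cmod_def w' using w u by (intro real_sqrt_le_mono add_left_mono power_mono) auto
        show "u \<le> norm w'" using abs_Im_le_cmod[of w'] w' w u by linarith
      qed
      have "norm (F u) \<le> u powr (l - 1) * (E * norm w' powr (- (real k + 1)))"
        unfolding F_def norm_mult norm_of_real w'_def[symmetric] l_def[symmetric]
        by (intro mult_mono Dk) (use w w' u in auto)
      also have "\<dots> \<le> b u"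
      proof (cases "u \<le> d")
        case True
        have "norm w' powr (- (real k + 1)) \<le> d powr (- (real k + 1))" using nw d by (intro powr_mono2') auto
        then have "u powr (l - 1) * (E * norm w' powr (- (real k + 1))) \<le> u powr (l - 1) * (E * d powr (- (real k + 1)))"
          using E by (intro mult_left_mono) auto
        then show ?thesis using True by (simp add: b_def mult_ac)
      next
        case False
        have "norm w' powr (- (real k + 1)) \<le> u powr (- (real k + 1))" using nw u by (intro powr_mono2') auto
        then have "u powr (l - 1) * (E * norm w' powr (- (real k + 1))) \<le> u powr (l - 1) * (E * u powr (- (real k + 1)))"
          using E by (intro mult_left_mono) auto
        also have "\<dots> = E * (u powr (l - 1) * u powr (- (real k + 1)))" by simp
        also have "u powr (l - 1) * u powr (- (real k + 1)) = u powr (l - real k - 2)"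
          by (subst powr_add[symmetric]) simp
        finally show ?thesis using False by (simp add: b_def)
      qed
      finally show ?thesis .
    qed
    have "Gamma l * norm (frac_kernel \<alpha> w) \<le> norm (integral\<^sup>L lebesgue (\<lambda>u. indicator {0<..} u *\<^sub>R F u))"
      unfolding F_def l_def by (rule frac_kernel_integral(1)[OF k w(2)])
    also have "\<dots> = norm (integral {0<..} F)"
      using set_lebesgue_integral_eq_integral(2)[OF FA] by (simp add: set_lebesgue_integral_def)
    also have "\<dots> \<le> integral {0<..} b"
      by (rule Henstock_Kurzweil_Integration.integral_norm_bound_integral[OF set_lebesgue_integral_eq_integral(1)[OF FA] has_integral_integrable[OF bI] Fb])
    also have "\<dots> = I" by (rule integral_unique[OF bI])
    also have "I = Gamma l * (M * d powr (-\<alpha> - 1))"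
    proof -
      have 1: "d powr (- (real k + 1)) * d powr (l - 1 + 1) = d powr (-\<alpha> - 1)"
      proof -
        have "- (real k + 1) + (l - 1 + 1) = -\<alpha> - 1" by (simp add: l_def)
        then show ?thesis by (simp only: powr_add[symmetric])
      qed
      have 2: "d powr (l - real k - 2 + 1) = d powr (-\<alpha> - 1)"
      proof -
        have "l - real k - 2 + 1 = -\<alpha> - 1" by (simp add: l_def)
        then show ?thesis by (simp only:)
      qed
      have "I = E * (d powr (-\<alpha> - 1) / l + d powr (-\<alpha> - 1) / (real k + 1 - l))"
        unfolding I_def times_divide_eq_right 1 2 by simp
      also have "\<dots> = Gamma l * (M * d powr (-\<alpha> - 1))"
      proof -
        have "Gamma l * M = E * (1 / l + 1 / (real k + 1 - l))" using G0 by (simp add: M_def)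
        then have "Gamma l * (M * d powr (-\<alpha> - 1)) = E * (1 / l + 1 / (real k + 1 - l)) * d powr (-\<alpha> - 1)"
          by (simp only: mult.assoc[symmetric])
        then show ?thesis by (simp add: distrib_left distrib_right)
      qed
      finally show ?thesis .
    qed
    finally show ?thesis using G0 by (simp only: mult_le_cancel_left_pos d_def)
  qed
  ultimately show thesis using that by blast
qed

text \<open>Substitutes \<open>v = 1 - e\<^sup>-\<^sup>i\<^sup>h\<close> in the truncated logarithm \<open>h \<approx> \<Sum> v\<^sup>n / (i n)\<close>; nonpositive frequencies are
  needed because these are the ones annihilated by the kernel.\<close>
lemma trig_poly_approx:
  fixes P :: "complex poly" and N :: nat
  obtains q C where "0 \<le> C"
    "\<And>h::real. \<bar>h\<bar> \<le> 1 \<Longrightarrow> norm (poly P (of_real h) - poly q (cis (-h))) \<le> C * \<bar>h\<bar> ^ N"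
proof -
  define L where "L = (\<Sum>n<N. monom (1 / (\<i> * of_nat (Suc n))) (Suc n))"
  have L: "poly L v = (\<Sum>n<N. v ^ Suc n / (\<i> * of_nat (Suc n)))" for v
    by (simp add: L_def poly_sum poly_monom)
  define v where "v z = 1 - exp (- \<i> * z)" for z :: complex
  have vcis: "v (of_real h) = 1 - cis (-h)" for h
    by (simp add: v_def cis_conv_exp)
  have nv: "norm (v (of_real h)) \<le> \<bar>h\<bar>" for h
  proof -
    have "(norm (v (of_real h)))\<^sup>2 = 4 * (sin (h/2))\<^sup>2"
      using norm_one_minus_polar[of 1 "-h"] by (simp add: vcis)
    also have "\<dots> \<le> 4 * (\<bar>h/2\<bar>)\<^sup>2"
      using abs_sin_x_le_abs_x[of "h/2"] by (metis abs_ge_zero mult_left_mono power2_abs power_mono zero_le_numeral)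
    also have "\<dots> = \<bar>h\<bar>\<^sup>2" by (simp add: power_divide)
    finally show ?thesis by (rule power2_le_imp_le) simp
  qed
  have app: "norm (of_real h - poly L (v (of_real h))) \<le> \<bar>h\<bar> ^ N * \<bar>h\<bar>" for h :: real
  proof -
    define \<phi> where "\<phi> z = z - poly L (v z)" for z
    \<comment> \<open>Since v' = i(1 - v), the derivative of the truncated logarithm is (1 - v)
      times a finite geometric sum in v, that is 1 - v^N; only v^N survives, and |v| <= |h| on the
      real axis.\<close>
    have der: "(\<phi> has_field_derivative (v z ^ N)) (at z within S)" for z S
    proof -
      have dv: "(v has_field_derivative \<i> * (1 - v z)) (at z within S)"
        unfolding v_def by (auto intro!: derivative_eq_intros)
      have "((\<lambda>z. v z ^ Suc n / (\<i> * of_nat (Suc n))) has_field_derivative (1 - v z) * v z ^ n) (at z within S)" for n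
      proof (rule DERIV_cong[OF DERIV_cdivide[OF DERIV_power_Suc[OF dv]]])
        have "1 + of_nat n = (of_nat (Suc n) :: complex)" by simp
        then show "(1 + of_nat n) * (\<i> * (1 - v z) * v z ^ n) / (\<i> * of_nat (Suc n)) = (1 - v z) * v z ^ n"
          by (simp del: of_nat_Suc flip: mult.assoc)
      qed
      then have "((\<lambda>z. \<Sum>n<N. v z ^ Suc n / (\<i> * of_nat (Suc n))) has_field_derivative (\<Sum>n<N. (1 - v z) * v z ^ n)) (at z within S)"
        by (rule DERIV_sum)
      then have "(\<phi> has_field_derivative (1 - (\<Sum>n<N. (1 - v z) * v z ^ n))) (at z within S)"
        unfolding \<phi>_def L by (rule DERIV_diff[OF DERIV_ident])
      also have "(\<Sum>n<N. (1 - v z) * v z ^ n) = (1 - v z) * (\<Sum>n<N. v z ^ n)"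
        by (rule sum_distrib_left[symmetric])
      also have "\<dots> = 1 - v z ^ N" by (rule one_diff_power_eq[symmetric])
      finally show ?thesis by simp
    qed
    have "norm (\<phi> (of_real h) - \<phi> 0) \<le> \<bar>h\<bar> ^ N * norm (of_real h - (0::complex))"
    proof (rule field_differentiable_bound[where S="closed_segment 0 (of_real h)"])
      fix z :: complex assume "z \<in> closed_segment 0 (of_real h)"
      then obtain t where t: "0 \<le> t" "t \<le> 1" "z = of_real (t * h)"
        unfolding in_segment by (auto simp: scaleR_conv_of_real)
      have "norm (v z) \<le> \<bar>t * h\<bar>" unfolding t(3) by (rule nv)
      also have "\<dots> \<le> 1 * \<bar>h\<bar>" unfolding abs_mult using t by (intro mult_right_mono) auto
      finally show "norm (v z ^ N) \<le> \<bar>h\<bar> ^ N" by (simp add: norm_power power_mono)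
    qed (simp_all add: der)
    moreover have "\<phi> 0 = 0" by (simp add: \<phi>_def L v_def)
    ultimately show ?thesis by (simp add: \<phi>_def)
  qed
  have "bounded (poly (pderiv P) ` cball 0 2)"
    by (intro compact_imp_bounded compact_continuous_image continuous_intros) auto
  then obtain B where B: "0 < B" "\<And>z. z \<in> cball 0 2 \<Longrightarrow> norm (poly (pderiv P) z) \<le> B"
    unfolding bounded_pos by auto
  show thesis
  proof (rule that[of B "pcompose (pcompose P L) [:1, -1:]"])
    show "0 \<le> B" using B by simp
    fix h :: real assume h: "\<bar>h\<bar> \<le> 1"
    have p1: "\<bar>h\<bar> ^ N * \<bar>h\<bar> \<le> \<bar>h\<bar> ^ N" using h by (simp add: mult_left_le)
    have p2: "\<bar>h\<bar> ^ N \<le> 1" using h by (simp add: power_le_one)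
    have 1: "norm (of_real h - poly L (v (of_real h))) \<le> \<bar>h\<bar> ^ N" using app[of h] p1 by linarith
    have "norm (poly L (v (of_real h))) \<le> norm (complex_of_real h) + norm (of_real h - poly L (v (of_real h)))"
      by (metis norm_minus_commute norm_triangle_sub)
    then have 2: "norm (poly L (v (of_real h))) \<le> 2" using 1 p2 h by simp
    have "norm (poly P (of_real h) - poly P (poly L (v (of_real h)))) \<le> B * norm (of_real h - poly L (v (of_real h)))"
      by (rule field_differentiable_bound[where S="cball 0 2"])
        (use B 2 h in \<open>auto intro: poly_DERIV has_field_derivative_at_within\<close>)
    also have "\<dots> \<le> B * \<bar>h\<bar> ^ N" using 1 B by (intro mult_left_mono) auto
    finally show "norm (poly P (of_real h) - poly (pcompose (pcompose P L) [:1, -1:]) (cis (-h))) \<le> B * \<bar>h\<bar> ^ N"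
      by (simp add: poly_pcompose vcis)
  qed
qed

section \<open>Pairing boundary values with the kernel\<close>

lemma has_integral_mult_abs_series:
  fixes G :: "real \<Rightarrow> complex"
  assumes G: "continuous_on {-pi..pi} G"
    and J: "\<And>j. ((\<lambda>u. G u * cis (of_int (- int j) * u)) has_integral J j) {-pi..pi}"
    and d: "summable (\<lambda>j. norm (d j))"
  shows "((\<lambda>u. G u * (\<Sum>j. d j * cis (-u) ^ j)) has_integral (\<Sum>j. d j * J j)) {-pi..pi}"
proof -
  have u1: "uniform_limit {-pi..pi} (\<lambda>n u. \<Sum>j<n. d j * cis (-u) ^ j) (\<lambda>u. \<Sum>j. d j * cis (-u) ^ j) sequentially"
    by (rule Weierstrass_m_test[OF _ d]) (simp add: norm_mult norm_power)
  have c1: "continuous_on {-pi..pi} (\<lambda>u. \<Sum>j. d j * cis (-u) ^ j)"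
    by (rule uniform_limit_theorem[OF _ u1]) (auto intro!: continuous_intros always_eventually)
  have u2: "uniform_limit {-pi..pi} (\<lambda>n u. G u * (\<Sum>j<n. d j * cis (-u) ^ j)) (\<lambda>u. G u * (\<Sum>j. d j * cis (-u) ^ j)) sequentially"
    by (intro uniform_lim_mult uniform_limit_const u1 compact_imp_bounded compact_continuous_image G c1) auto
  have c2: "continuous_on {-pi..pi} (\<lambda>u. G u * (\<Sum>j<n. d j * cis (-u) ^ j))" for n
    by (intro continuous_intros G)
  obtain I J' where IJ: "\<And>n. ((\<lambda>u. G u * (\<Sum>j<n. d j * cis (-u) ^ j)) has_integral I n) {-pi..pi}"
     "((\<lambda>u. G u * (\<Sum>j. d j * cis (-u) ^ j)) has_integral J') {-pi..pi}" "(I \<longlongrightarrow> J') sequentially"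
    using uniform_limit_integral[OF u2 c2 sequentially_bot] by blast
  have "((\<lambda>u. G u * (\<Sum>j<n. d j * cis (-u) ^ j)) has_integral (\<Sum>j<n. d j * J j)) {-pi..pi}" for n
  proof -
    have "((\<lambda>u. \<Sum>j<n. d j * (G u * cis (of_int (- int j) * u))) has_integral (\<Sum>j<n. d j * J j)) {-pi..pi}"
      by (intro has_integral_sum has_integral_mult_right J) auto
    moreover have "(\<Sum>j<n. d j * (G u * cis (of_int (- int j) * u))) = G u * (\<Sum>j<n. d j * cis (-u) ^ j)" for u
      by (simp add: sum_distrib_left Complex.DeMoivre mult_ac)
    ultimately show ?thesis by simp
  qed
  then have "I = (\<lambda>n. \<Sum>j<n. d j * J j)" using has_integral_unique[OF IJ(1)] by blast
  then have "(\<lambda>j. d j * J j) sums J'" using IJ(3) by (simp add: sums_def)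
  then show ?thesis using IJ(2) by (simp add: sums_iff)
qed

lemma frac_kernel_coeffs:
  assumes y: "0 < y"
  shows "summable (\<lambda>j. norm (complex_of_real (real j powr \<alpha> * exp (- (real j * y)))))"
    and "frac_kernel \<alpha> (Complex (-u) y) = (\<Sum>j. of_real (real j powr \<alpha> * exp (- (real j * y))) * cis (-u) ^ j)"
proof -
  have pw: "exp (- (real j * y)) = exp (-y) ^ j" for j
    by (metis exp_of_nat_mult mult_minus_right)
  show "summable (\<lambda>j. norm (complex_of_real (real j powr \<alpha> * exp (- (real j * y)))))"
    unfolding norm_of_real abs_mult pw using summable_powr_geometric[of "exp (-y)" \<alpha>] y by simp
  have "exp (\<i> * Complex (-u) y) = of_real (exp (-y)) * cis (-u)"
    by (simp add: exp_eq_polar)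
  then show "frac_kernel \<alpha> (Complex (-u) y) = (\<Sum>j. of_real (real j powr \<alpha> * exp (- (real j * y))) * cis (-u) ^ j)"
    unfolding frac_kernel_def pw by (simp add: power_mult_distrib mult.assoc)
qed

lemma has_integral_abs_plus_powr:
  fixes e y :: real
  assumes e: "e < -1" and y: "0 < y"
  obtains I where "((\<lambda>u. (\<bar>u\<bar> + y) powr e) has_integral I) {-pi..pi}" "I \<le> 2 * y powr (e+1) / (-(e+1))"
proof -
  define F where "F u = (u + y) powr (e+1) / (e+1)" for u
  have 1: "((\<lambda>u. (u + y) powr e) has_integral (F pi - F 0)) {0..pi}"
  proof (rule fundamental_theorem_of_calculus)
    fix u assume "u \<in> {0..pi}"
    then have "(F has_real_derivative (u + y) powr e) (at u)"
      unfolding F_def using y e by (auto intro!: derivative_eq_intros)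
    then show "(F has_vector_derivative (u + y) powr e) (at u within {0..pi})"
      using has_real_derivative_iff_has_vector_derivative has_vector_derivative_at_within by blast
  qed simp
  have 2: "((\<lambda>u. (\<bar>u\<bar> + y) powr e) has_integral (F pi - F 0)) {0..pi}"
    by (rule has_integral_eq[OF _ 1]) auto
  have 3: "((\<lambda>u. (\<bar>u\<bar> + y) powr e) has_integral (F pi - F 0)) {-pi..0}"
    using has_integral_reflect_real[where f="\<lambda>u. (\<bar>u\<bar> + y) powr e" and a=0 and b=pi and i="F pi - F 0"] 2 by simp
  have 4: "((\<lambda>u. (\<bar>u\<bar> + y) powr e) has_integral ((F pi - F 0) + (F pi - F 0))) {-pi..pi}"
    by (rule Henstock_Kurzweil_Integration.has_integral_combine[OF _ _ 3 2]) auto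
  have "F pi \<le> 0" unfolding F_def using e by (intro divide_nonneg_neg) auto
  moreover have "- F 0 = y powr (e+1) / (-(e+1))" unfolding F_def by (simp only: add_0_left minus_divide_right)
  ultimately have "(F pi - F 0) + (F pi - F 0) \<le> 2 * y powr (e+1) / (-(e+1))" by simp
  with 4 that show thesis by blast
qed

context boundary_series begin

lemma fourier_bdry:
  assumes "\<rho> < \<alpha>"
  shows "((\<lambda>u. bdry \<alpha> (x + u) * cis (of_int m * u)) has_integral
           (of_real (2*pi) * (if m \<le> 0 then c (nat (- m)) * of_real (real (nat (-m)) powr (-\<alpha>)) * cis x ^ nat (-m) else 0))) {-pi..pi}"
proof -
  have "uniform_limit {-pi..pi} (\<lambda>n t. \<Sum>l<n. (c l * of_real (real l powr (-\<alpha>)) * cis x ^ l) * cis t ^ l) (\<lambda>u. bdry \<alpha> (x + u)) sequentially"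
  proof (rule uniform_limitI)
    fix e :: real assume "e > 0"
    from uniform_limitD[OF uniform_limit_bdry[OF assms] this]
    show "\<forall>\<^sub>F n in sequentially. \<forall>t\<in>{-pi..pi}. dist (\<Sum>l<n. (c l * of_real (real l powr (-\<alpha>)) * cis x ^ l) * cis t ^ l) (bdry \<alpha> (x + t)) < e"
    proof eventually_elim
      case (elim n)
      show ?case
      proof
        fix t
        have "(\<Sum>l<n. (c l * of_real (real l powr (-\<alpha>)) * cis x ^ l) * cis t ^ l) = (\<Sum>l<n. c l * of_real (real l powr (-\<alpha>)) * cis (x + t) ^ l)"
          by (simp add: cis_mult[symmetric] power_mult_distrib mult.assoc)
        then show "dist (\<Sum>l<n. (c l * of_real (real l powr (-\<alpha>)) * cis x ^ l) * cis t ^ l) (bdry \<alpha> (x + t)) < e"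
          using elim by simp
      qed
    qed
  qed
  from fourier_coefficient_has_integral[OF this, of m] show ?thesis .
qed

text \<open>The multiplier \<open>j powr \<alpha>\<close> of the kernel cancels
  \<open>j powr (-\<alpha>)\<close> in the boundary series and leaves the damping exp(-jy) of height
  \<open>y\<close>. At j = 0 the cancellation fails, but \<open>c 0 = 0\<close>.\<close>

lemma kernel_reproduces:
  assumes a: "\<rho> < \<alpha>" and y: "0 < y"
  shows "((\<lambda>u. bdry \<alpha> (x + u) * frac_kernel \<alpha> (Complex (-u) y)) has_integral (of_real (2*pi) * \<Phi> (Complex x y))) {-pi..pi}"
proof -
  have "((\<lambda>u. bdry \<alpha> (x + u) * frac_kernel \<alpha> (Complex (-u) y)) has_integral
    (\<Sum>j. of_real (real j powr \<alpha> * exp (- (real j * y))) * (of_real (2*pi) * (c j * of_real (real j powr (-\<alpha>)) * cis x ^ j)))) {-pi..pi}"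
    unfolding frac_kernel_coeffs(2)[OF y]
  proof (rule has_integral_mult_abs_series[OF _ _ frac_kernel_coeffs(1)[OF y]])
    show "continuous_on {-pi..pi} (\<lambda>u. bdry \<alpha> (x + u))"
      by (rule continuous_on_compose2[OF continuous_on_bdry[OF a, of UNIV]]) (auto intro!: continuous_intros)
    show "((\<lambda>u. bdry \<alpha> (x + u) * cis (of_int (- int j) * u)) has_integral of_real (2*pi) * (c j * of_real (real j powr (-\<alpha>)) * cis x ^ j)) {-pi..pi}" for j
      using fourier_bdry[OF a, of x "- int j"] by simp
  qed
  also have "(\<Sum>j. of_real (real j powr \<alpha> * exp (- (real j * y))) * (of_real (2*pi) * (c j * of_real (real j powr (-\<alpha>)) * cis x ^ j)))
     = of_real (2*pi) * \<Phi> (Complex x y)"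
  proof -
    have "of_real (real j powr \<alpha> * exp (- (real j * y))) * (of_real (2*pi) * (c j * of_real (real j powr (-\<alpha>)) * cis x ^ j))
       = of_real (2*pi) * (c j * of_real (exp (- (real j * y))) * cis x ^ j)" for j
    proof (cases "j = 0")
      case False
      have "real j powr \<alpha> * real j powr (-\<alpha>) = 1" using False by (simp flip: powr_add)
      then have "of_real (real j powr \<alpha>) * of_real (real j powr (-\<alpha>)) = (1::complex)" by (metis of_real_1 of_real_mult)
      then show ?thesis by (simp add: algebra_simps)
    qed (simp add: c0)
    then show ?thesis using sums_mult[OF Phi_sums[OF y, of x], of "of_real (2*pi)"] by (simp only: sums_iff)
  qed
  finally show ?thesis .
qed

text \<open>In the variable \<open>u\<close> both factors have only nonpositive frequencies, so
  frequency 0 could arise only from j = 0 in both, and there \<open>c 0 = 0\<close>. This is what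
  makes the real and the imaginary part as informative as the function itself.\<close>

lemma kernel_annihilates_cnj:
  assumes a: "\<rho> < \<alpha>" and y: "0 < y"
  shows "((\<lambda>u. cnj (bdry \<alpha> (x + u)) * frac_kernel \<alpha> (Complex (-u) y)) has_integral 0) {-pi..pi}"
proof -
  have "((\<lambda>u. cnj (bdry \<alpha> (x + u)) * frac_kernel \<alpha> (Complex (-u) y)) has_integral
    (\<Sum>j. of_real (real j powr \<alpha> * exp (- (real j * y))) * 0)) {-pi..pi}"
    unfolding frac_kernel_coeffs(2)[OF y]
  proof (rule has_integral_mult_abs_series[OF _ _ frac_kernel_coeffs(1)[OF y]])
    show "continuous_on {-pi..pi} (\<lambda>u. cnj (bdry \<alpha> (x + u)))"
      by (intro continuous_intros continuous_on_compose2[OF continuous_on_bdry[OF a, of UNIV]]) auto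
    fix j :: nat
    have "((\<lambda>u. bdry \<alpha> (x + u) * cis (of_int (int j) * u)) has_integral 0) {-pi..pi}"
      using fourier_bdry[OF a, of x "int j"] c0 by (cases "j = 0") auto
    from has_integral_linear[OF this bounded_linear_cnj]
    show "((\<lambda>u. cnj (bdry \<alpha> (x + u)) * cis (of_int (- int j) * u)) has_integral 0) {-pi..pi}"
      by (simp add: o_def cis_cnj)
  qed
  then show ?thesis by simp
qed

end

text \<open>Again only frequency 0 in both factors could contribute; here the polynomial may have a
  constant term, but the kernel has none because \<open>0 powr \<alpha> = 0\<close>.\<close>

lemma kernel_annihilates_trig:
  assumes y: "0 < y"
  shows "((\<lambda>u. poly q (cis (-(x + u))) * frac_kernel \<alpha> (Complex (-u) y)) has_integral 0) {-pi..pi}"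
proof -
  define J where "J j = (\<Sum>l\<le>degree q. coeff q l * cis (-x) ^ l * (if - int (l + j) = 0 then of_real (2*pi) else 0))" for j
  have "((\<lambda>u. poly q (cis (-(x + u))) * frac_kernel \<alpha> (Complex (-u) y)) has_integral
    (\<Sum>j. of_real (real j powr \<alpha> * exp (- (real j * y))) * J j)) {-pi..pi}"
    unfolding frac_kernel_coeffs(2)[OF y]
  proof (rule has_integral_mult_abs_series[OF _ _ frac_kernel_coeffs(1)[OF y]])
    show "continuous_on {-pi..pi} (\<lambda>u. poly q (cis (-(x + u))))"
      by (intro continuous_intros)
    fix j :: nat
    have "((\<lambda>u. \<Sum>l\<le>degree q. coeff q l * cis (-x) ^ l * cis (of_int (- int (l + j)) * u)) has_integral J j) {-pi..pi}"
      unfolding J_def by (intro has_integral_sum has_integral_mult_right has_integral_cis_int) auto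
    moreover have "(\<Sum>l\<le>degree q. coeff q l * cis (-x) ^ l * cis (of_int (- int (l + j)) * u)) = poly q (cis (-(x + u))) * cis (of_int (- int j) * u)" for u
    proof -
      have "cis (-x) ^ l * cis (of_int (- int (l + j)) * u) = cis (-(x + u)) ^ l * cis (of_int (- int j) * u)" for l
        by (simp add: Complex.DeMoivre cis_mult algebra_simps)
      then show ?thesis unfolding poly_altdef sum_distrib_right mult.assoc by (simp only:)
    qed
    ultimately show "((\<lambda>u. poly q (cis (-(x + u))) * cis (of_int (- int j) * u)) has_integral J j) {-pi..pi}" by simp
  qed
  moreover have "of_real (real j powr \<alpha> * exp (- (real j * y))) * J j = 0" for j
    by (cases "j = 0") (simp_all add: J_def)
  ultimately show ?thesis by (simp only: suminf_zero)
qed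

context boundary_series begin

text \<open>The polynomial is replaced by a trigonometric one, which the kernel kills. The region
  near \<open>x\<close> contributes the integral of (|u| + y) to the power s -
  \<open>\<alpha>\<close> - 1, of order \<open>y powr (s - \<alpha>)\<close> as s <
  \<open>\<alpha>\<close>; the rest is bounded and goes into \<open>B\<close>. \<open>K0\<close> is
  fixed before the Hoelder constant \<open>\<omega>\<close> and the point, and
  \<open>\<omega>\<close> enters linearly, so a small \<open>\<omega>\<close> gives a small leading
  term. No degree bound on \<open>P\<close> is imposed.\<close>

lemma holder_imp_Phi_bound:
  assumes \<alpha>: "\<rho> < \<alpha>" and s: "0 \<le> s" "s < \<alpha>" and A: "0 \<le> A"
  obtains K0 where "0 \<le> K0"
    "\<And>x P \<omega> \<delta> l1 l2. 0 < \<omega> \<Longrightarrow> 0 < \<delta> \<Longrightarrow>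
      (\<forall>h. h \<noteq> 0 \<and> \<bar>h\<bar> < \<delta> \<longrightarrow> norm (l1 * bdry \<alpha> (x + h) + l2 * cnj (bdry \<alpha> (x + h)) - poly P (of_real h)) \<le> \<omega> * \<bar>h\<bar> powr s)
      \<Longrightarrow> \<exists>B \<delta>'. 0 < \<delta>' \<and> (\<forall>u y. 0 < y \<and> y \<le> \<delta>' \<and> \<bar>u\<bar> \<le> A * y \<longrightarrow>
         norm l1 * norm (\<Phi> (Complex (x + u) y)) \<le> K0 * \<omega> * y powr (s - \<alpha>) + B)"
proof -
  have a0: "0 < \<alpha>" using \<alpha> rho_pos by linarith
  obtain Ck where Ck: "0 \<le> Ck" "\<And>w. \<bar>Re w\<bar> \<le> pi \<Longrightarrow> 0 < Im w \<Longrightarrow> norm (frac_kernel \<alpha> w) \<le> Ck * norm w powr (-\<alpha> - 1)"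
    using frac_kernel_bound[OF a0] by blast
  define e where "e = s - \<alpha> - 1"
  have e: "e < -1" using s by (simp add: e_def)
  define T where "T = 2 * Ck * (1 + A) powr s * 2 powr (-e)"
  define K0 where "K0 = T * (2 / (-(e+1))) / (2*pi)"
  have T0: "0 \<le> T" using Ck by (simp add: T_def)
  have K0: "0 \<le> K0" unfolding K0_def using T0 e by (intro divide_nonneg_nonneg mult_nonneg_nonneg) auto
  moreover have "\<exists>B \<delta>'. 0 < \<delta>' \<and> (\<forall>u y. 0 < y \<and> y \<le> \<delta>' \<and> \<bar>u\<bar> \<le> A * y \<longrightarrow>
         norm l1 * norm (\<Phi> (Complex (x + u) y)) \<le> K0 * \<omega> * y powr (s - \<alpha>) + B)"
    if \<omega>: "0 < \<omega>" and \<delta>: "0 < \<delta>" and H: "\<forall>h. h \<noteq> 0 \<and> \<bar>h\<bar> < \<delta> \<longrightarrow>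
       norm (l1 * bdry \<alpha> (x + h) + l2 * cnj (bdry \<alpha> (x + h)) - poly P (of_real h)) \<le> \<omega> * \<bar>h\<bar> powr s"
    for x P \<omega> \<delta> l1 l2
  proof -
    \<comment> \<open>Order at least s + 1: the error of the trigonometric approximation then
      carries an extra factor |h|, made at most \<open>\<omega> / (C + 1)\<close> by
      \<open>\<delta>1\<close>, so it costs no more than
      \<open>\<omega> * \<bar>h\<bar> powr s\<close>.\<close>
    define N where "N = Suc (nat \<lceil>s\<rceil>)"
    have N: "s + 1 \<le> real N" unfolding N_def by linarith
    obtain q C where q: "0 \<le> C" "\<And>h::real. \<bar>h\<bar> \<le> 1 \<Longrightarrow> norm (poly P (of_real h) - poly q (cis (-h))) \<le> C * \<bar>h\<bar> ^ N"
      using trig_poly_approx by blast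
    define \<delta>1 where "\<delta>1 = min (min \<delta> 1) (\<omega> / (C + 1))"
    have d1: "0 < \<delta>1" "\<delta>1 \<le> \<delta>" "\<delta>1 \<le> 1" "\<delta>1 \<le> \<omega> / (C + 1)" using \<delta> \<omega> q(1) by (auto simp: \<delta>1_def)
    define G where "G t = l1 * bdry \<alpha> t + l2 * cnj (bdry \<alpha> t) - poly q (cis (-(t - x)))" for t
    have Gsmall: "norm (G (x + h)) \<le> 2 * \<omega> * \<bar>h\<bar> powr s" if h: "h \<noteq> 0" "\<bar>h\<bar> < \<delta>1" for h
    proof -
      have "norm (poly P (of_real h) - poly q (cis (-h))) \<le> C * \<bar>h\<bar> ^ N"
        by (rule q(2)) (use h d1 in simp)
      also have "\<bar>h\<bar> ^ N = \<bar>h\<bar> powr real N" using h by (simp add: powr_realpow)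
      also have "\<dots> \<le> \<bar>h\<bar> powr (s + 1)" using N h d1 by (intro powr_mono') auto
      also have "\<dots> = \<bar>h\<bar> powr s * \<bar>h\<bar>" using h by (simp add: powr_add)
      also have "C * (\<bar>h\<bar> powr s * \<bar>h\<bar>) \<le> C * (\<bar>h\<bar> powr s * (\<omega> / (C + 1)))"
        using h d1 q(1) by (intro mult_left_mono) auto
      also have "\<dots> = (C / (C + 1)) * (\<omega> * \<bar>h\<bar> powr s)" by simp
      also have "\<dots> \<le> 1 * (\<omega> * \<bar>h\<bar> powr s)" using q(1) \<omega> by (intro mult_right_mono) auto
      finally have 1: "norm (poly P (of_real h) - poly q (cis (-h))) \<le> \<omega> * \<bar>h\<bar> powr s"
        using mult_left_mono[OF _ q(1)] by simp
      have 2: "norm (l1 * bdry \<alpha> (x + h) + l2 * cnj (bdry \<alpha> (x + h)) - poly P (of_real h)) \<le> \<omega> * \<bar>h\<bar> powr s"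
        using H h d1 by auto
      have "G (x + h) = (l1 * bdry \<alpha> (x + h) + l2 * cnj (bdry \<alpha> (x + h)) - poly P (of_real h)) + (poly P (of_real h) - poly q (cis (-h)))"
        by (simp add: G_def)
      then show ?thesis using norm_triangle_le[OF add_mono[OF 2 1]] by simp
    qed
    obtain Bg where Bg: "\<And>t. x - A - pi \<le> t \<Longrightarrow> t \<le> x + A + pi \<Longrightarrow> norm (G t) \<le> Bg"
    proof -
      have "continuous_on {x - A - pi..x + A + pi} G"
        unfolding G_def by (intro continuous_intros continuous_on_bdry[OF \<alpha>])
      then have "bounded (G ` {x - A - pi..x + A + pi})"
        by (intro compact_imp_bounded compact_continuous_image) auto
      then obtain Bb where "\<forall>t\<in>G ` {x - A - pi..x + A + pi}. norm t \<le> Bb" unfolding bounded_iff by blast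
      then show thesis using that[of Bb] by auto
    qed
    have Bg0: "0 \<le> Bg" using Bg[of x] A pi_ge_zero norm_ge_zero[of "G x"] by linarith
    define B2 where "B2 = Bg * (Ck * (\<delta>1/2) powr (-\<alpha> - 1))"
    have B20: "0 \<le> B2" using Bg0 Ck by (simp add: B2_def)
    \<comment> \<open>Keeps the horizontal displacement below \<open>\<delta>1 / 2\<close>, so that
      far from \<open>x\<close> the kernel is evaluated with |u| at least
      \<open>\<delta>1 / 2\<close>, away from its singularity.\<close>
    define \<delta>' where "\<delta>' = min 1 (\<delta>1 / (2 * (A + 1)))"
    have "0 < \<delta>'" using d1 A by (simp add: \<delta>'_def)
    moreover have "norm l1 * norm (\<Phi> (Complex (x + v) y)) \<le> K0 * \<omega> * y powr (s - \<alpha>) + B2"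
      if y: "0 < y" "y \<le> \<delta>'" and v: "\<bar>v\<bar> \<le> A * y" for v y
    proof -
      have y1: "y \<le> 1" "y \<le> \<delta>1 / (2 * (A + 1))" using y by (auto simp: \<delta>'_def)
      have "A * y \<le> A * 1" using y1 A by (intro mult_left_mono) auto
      then have vA: "\<bar>v\<bar> \<le> A" using v by simp
      have "A * y \<le> (A + 1) * y" using y by simp
      also have "\<dots> \<le> \<delta>1 / 2" using y1(2) A by (simp add: field_simps)
      finally have vd: "\<bar>v\<bar> \<le> \<delta>1 / 2" using v by linarith
      define F where "F u = G (x + v + u) * frac_kernel \<alpha> (Complex (-u) y)" for u
      \<comment> \<open>At u = -v the boundary function is evaluated at \<open>x\<close> itself,
        where the hypothesis (for nonzero \<open>h\<close>) says nothing.\<close>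
      define F' where "F' u = (if u = - v then 0 else F u)" for u
      have FI: "(F has_integral (l1 * (of_real (2*pi) * \<Phi> (Complex (x + v) y)))) {-pi..pi}"
      proof -
        have "((\<lambda>u. l1 * (bdry \<alpha> ((x + v) + u) * frac_kernel \<alpha> (Complex (-u) y)) + l2 * (cnj (bdry \<alpha> ((x + v) + u)) * frac_kernel \<alpha> (Complex (-u) y))
             - poly q (cis (-(v + u))) * frac_kernel \<alpha> (Complex (-u) y)) has_integral
             (l1 * (of_real (2*pi) * \<Phi> (Complex (x + v) y)) + l2 * 0 - 0)) {-pi..pi}"
          by (intro has_integral_diff has_integral_add has_integral_mult_right kernel_reproduces[OF \<alpha> y(1)] kernel_annihilates_cnj[OF \<alpha> y(1)] kernel_annihilates_trig[OF y(1)])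
        moreover have "l1 * (bdry \<alpha> ((x + v) + u) * frac_kernel \<alpha> (Complex (-u) y)) + l2 * (cnj (bdry \<alpha> ((x + v) + u)) * frac_kernel \<alpha> (Complex (-u) y))
             - poly q (cis (-(v + u))) * frac_kernel \<alpha> (Complex (-u) y) = F u" for u
          by (simp add: F_def G_def algebra_simps)
        ultimately show ?thesis by simp
      qed
      have FI': "(F' has_integral (l1 * (of_real (2*pi) * \<Phi> (Complex (x + v) y)))) {-pi..pi}"
        by (rule has_integral_spike[OF _ _ FI, of "{-v}"]) (auto simp: F'_def)
      obtain I where I: "((\<lambda>u. (\<bar>u\<bar> + y) powr e) has_integral I) {-pi..pi}" "I \<le> 2 * y powr (e+1) / (-(e+1))"
        using has_integral_abs_plus_powr[OF e y(1)] by blast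
      have bI: "((\<lambda>u. T * \<omega> * (\<bar>u\<bar> + y) powr e + B2) has_integral (T * \<omega> * I + (pi - (-pi)) *\<^sub>R B2)) {-pi..pi}"
        using has_integral_const_real[of B2 "-pi" pi] by (intro has_integral_add has_integral_mult_right I(1)) simp
      have Fb: "norm (F' u) \<le> T * \<omega> * (\<bar>u\<bar> + y) powr e + B2" if u: "u \<in> {-pi..pi}" for u
      proof (cases "u = - v")
        case True
        then show ?thesis using T0 \<omega> B20 by (simp add: F'_def)
      next
        case False
        define w where "w = Complex (-u) y"
        have w: "\<bar>u\<bar> \<le> norm w" "y \<le> norm w" using abs_Re_le_cmod[of w] abs_Im_le_cmod[of w] y by (auto simp: w_def)
        have w0: "0 < norm w" using w y by linarith
        have D: "norm (frac_kernel \<alpha> w) \<le> Ck * norm w powr (-\<alpha> - 1)"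
          using Ck(2)[of w] u y by (simp add: w_def abs_le_iff)
        have Feq: "norm (F' u) = norm (G (x + (v + u))) * norm (frac_kernel \<alpha> w)"
          using False by (simp add: F'_def F_def w_def norm_mult add.assoc)
        show ?thesis
        proof (cases "\<bar>v + u\<bar> < \<delta>1")
          case True
          have hw: "\<bar>v + u\<bar> \<le> (1 + A) * norm w"
          proof -
            have "\<bar>v + u\<bar> \<le> \<bar>v\<bar> + \<bar>u\<bar>" by simp
            also have "\<dots> \<le> A * norm w + norm w" using v w mult_left_mono[OF w(2) A] by linarith
            finally show ?thesis by (simp add: algebra_simps)
          qed
          have "norm (G (x + (v + u))) \<le> 2 * \<omega> * \<bar>v + u\<bar> powr s"
            by (rule Gsmall) (use False True in auto)
          also have "\<dots> \<le> 2 * \<omega> * ((1 + A) * norm w) powr s"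
            using hw s \<omega> by (intro mult_left_mono powr_mono2) auto
          finally have g1: "norm (G (x + (v + u))) \<le> 2 * \<omega> * ((1 + A) powr s * norm w powr s)"
            using A by (simp add: powr_mult)
          have "norm (F' u) \<le> (2 * \<omega> * ((1 + A) powr s * norm w powr s)) * (Ck * norm w powr (-\<alpha> - 1))"
            unfolding Feq by (rule mult_mono[OF g1 D]) (use \<omega> in auto)
          also have "\<dots> = 2 * \<omega> * Ck * (1 + A) powr s * (norm w powr s * norm w powr (-\<alpha> - 1))"
            by (simp only: mult_ac)
          also have "norm w powr s * norm w powr (-\<alpha> - 1) = norm w powr e"
            unfolding powr_add[symmetric] e_def by (rule arg_cong[of _ _ "\<lambda>z. norm w powr z"]) simp
          also have "norm w powr e \<le> ((\<bar>u\<bar> + y) / 2) powr e"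
            by (rule powr_mono2') (use e w y in auto)
          also have "((\<bar>u\<bar> + y) / 2) powr e = 2 powr (-e) * (\<bar>u\<bar> + y) powr e"
            using y by (simp add: powr_divide powr_minus_divide)
          finally have "norm (F' u) \<le> 2 * \<omega> * Ck * (1 + A) powr s * (2 powr (-e) * (\<bar>u\<bar> + y) powr e)"
            using \<omega> Ck A by (simp add: mult_left_mono)
          then show ?thesis using B20 by (simp add: T_def mult_ac)
        next
          case False
          have g1: "norm (G (x + (v + u))) \<le> Bg"
            by (rule Bg) (use vA u in \<open>auto simp: abs_le_iff\<close>)
          have "\<delta>1 / 2 \<le> \<bar>u\<bar>" using False vd by linarith
          then have "norm w powr (-\<alpha> - 1) \<le> (\<delta>1/2) powr (-\<alpha> - 1)"
            using d1 w a0 by (intro powr_mono2') auto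
          then have "Ck * norm w powr (-\<alpha> - 1) \<le> Ck * (\<delta>1/2) powr (-\<alpha> - 1)"
            by (rule mult_left_mono[OF _ Ck(1)])
          then have D': "norm (frac_kernel \<alpha> w) \<le> Ck * (\<delta>1/2) powr (-\<alpha> - 1)" using D by linarith
          have "norm (F' u) \<le> B2" unfolding Feq B2_def by (rule mult_mono[OF g1 D' Bg0]) simp
          moreover have "0 \<le> T * \<omega> * (\<bar>u\<bar> + y) powr e" using T0 \<omega> by simp
          ultimately show ?thesis by linarith
        qed
      qed
      have "norm (integral {-pi..pi} F') \<le> integral {-pi..pi} (\<lambda>u. T * \<omega> * (\<bar>u\<bar> + y) powr e + B2)"
        by (rule Henstock_Kurzweil_Integration.integral_norm_bound_integral[OF has_integral_integrable[OF FI'] has_integral_integrable[OF bI] Fb])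
      then have "norm (l1 * (of_real (2*pi) * \<Phi> (Complex (x + v) y))) \<le> T * \<omega> * I + (pi - (-pi)) *\<^sub>R B2"
        by (simp only: integral_unique[OF FI'] integral_unique[OF bI])
      then have "2 * pi * (norm l1 * norm (\<Phi> (Complex (x + v) y))) \<le> T * \<omega> * I + 2 * pi * B2"
        by (simp add: norm_mult mult_ac)
      also have "T * \<omega> * I \<le> T * \<omega> * (2 * y powr (e+1) / (-(e+1)))"
        using T0 \<omega> by (intro mult_left_mono I(2)) auto
      also have "T * \<omega> * (2 * y powr (e+1) / (-(e+1))) = 2 * pi * (K0 * \<omega> * y powr (s - \<alpha>))"
        by (simp add: K0_def e_def)
      finally have "2 * pi * (norm l1 * norm (\<Phi> (Complex (x + v) y))) \<le> 2 * pi * (K0 * \<omega> * y powr (s - \<alpha>) + B2)"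
        by (simp add: distrib_left)
      then show ?thesis by (simp only: mult_le_cancel_left_pos pi_gt_zero mult_pos_pos zero_less_numeral)
    qed
    ultimately show ?thesis by blast
  qed
  ultimately show thesis using that by blast
qed

end

section \<open>Modular forms under the action of the modular group\<close>

definition cocycle :: "mat2 \<Rightarrow> complex \<Rightarrow> complex" where
  "cocycle A z = (case A of (a,b,c,d) \<Rightarrow> of_int c * z + of_int d)"

lemma SL2Z_iff: "(a,b,c,d) \<in> carrier SL2Z \<longleftrightarrow> a*d - b*c = 1"
  by (simp add: SL2Z_def)

lemma mmul_assoc: "mmul (mmul A B) C = mmul A (mmul B C)"
  by (cases A; cases B; cases C) (simp add: mmul_def algebra_simps)

lemma mmul_closed: "A \<in> carrier SL2Z \<Longrightarrow> B \<in> carrier SL2Z \<Longrightarrow> mmul A B \<in> carrier SL2Z"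
proof -
  assume AB: "A \<in> carrier SL2Z" "B \<in> carrier SL2Z"
  obtain a b c d where A: "A = (a,b,c,d)" by (cases A)
  obtain a' b' c' d' where B: "B = (a',b',c',d')" by (cases B)
  have "(a*a' + b*c') * (c*b' + d*d') - (a*b' + b*d') * (c*a' + d*c') = (a*d - b*c) * (a'*d' - b'*c')"
    by (simp add: algebra_simps)
  with AB show "mmul A B \<in> carrier SL2Z" by (simp add: A B mmul_def SL2Z_iff)
qed

lemma minv_closed: "A \<in> carrier SL2Z \<Longrightarrow> minv A \<in> carrier SL2Z"
  by (cases A) (simp add: minv_def SL2Z_iff algebra_simps)

lemma mmul_minv: "A \<in> carrier SL2Z \<Longrightarrow> mmul A (minv A) = (1,0,0,1)" "A \<in> carrier SL2Z \<Longrightarrow> mmul (minv A) A = (1,0,0,1)"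
  by (cases A; simp add: minv_def mmul_def SL2Z_iff algebra_simps)+

lemma mmul_one [simp]: "mmul A (1,0,0,1) = A" "mmul (1,0,0,1) A = A"
  by (cases A; simp add: mmul_def)+

lemma one_in_SL2Z: "(1,0,0,1) \<in> carrier SL2Z" and translation_in_SL2Z: "(1,n,0,1) \<in> carrier SL2Z"
  by (simp_all add: SL2Z_iff)

lemma mult_SL2Z: "A \<otimes>\<^bsub>SL2Z\<^esub> B = mmul A B" "\<one>\<^bsub>SL2Z\<^esub> = (1,0,0,1)"
  by (simp_all add: SL2Z_def)

lemma cocycle_nonzero:
  assumes "A \<in> carrier SL2Z" "0 < Im z"
  shows "cocycle A z \<noteq> 0"
proof
  obtain a b c d where A: "A = (a,b,c,d)" by (cases A)
  assume "cocycle A z = 0"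
  then have "Im (of_int c * z + of_int d) = 0" "Re (of_int c * z + of_int d) = 0" by (simp_all add: cocycle_def A)
  then have "c = 0" "d = 0" using assms(2) by auto
  then show False using assms(1) by (simp add: A SL2Z_iff)
qed

lemma moebius_eq: "moebius (a,b,c,d) z = (of_int a * z + of_int b) / cocycle (a,b,c,d) z"
  by (simp add: moebius_def cocycle_def)

lemma cocycle_mmul_moebius:
  assumes "A \<in> carrier SL2Z" "B \<in> carrier SL2Z" "0 < Im z"
  shows cocycle_mmul: "cocycle (mmul A B) z = cocycle A (moebius B z) * cocycle B z"
    and moebius_mmul: "moebius (mmul A B) z = moebius A (moebius B z)"
proof -
  obtain a b c d where A: "A = (a,b,c,d)" by (cases A)
  obtain a' b' c' d' where B: "B = (a',b',c',d')" by (cases B)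
  have nz: "cocycle B z \<noteq> 0" by (rule cocycle_nonzero[OF assms(2,3)])
  have m: "moebius B z * cocycle B z = of_int a' * z + of_int b'" using nz by (simp add: moebius_def cocycle_def B)
  have jB: "cocycle B z = of_int c' * z + of_int d'" by (simp add: cocycle_def B)
  have 1: "(of_int c * moebius B z + of_int d) * cocycle B z = of_int c * (of_int a' * z + of_int b') + of_int d * (of_int c' * z + of_int d')"
    by (simp add: distrib_right mult.assoc m jB[symmetric])
  then show j: "cocycle (mmul A B) z = cocycle A (moebius B z) * cocycle B z"
    by (simp add: A B cocycle_def mmul_def algebra_simps)
  have 2: "(of_int a * moebius B z + of_int b) * cocycle B z = of_int a * (of_int a' * z + of_int b') + of_int b * (of_int c' * z + of_int d')"
    by (simp add: distrib_right mult.assoc m jB[symmetric])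
  have "moebius (mmul A B) z = ((of_int a * moebius B z + of_int b) * cocycle B z) / cocycle (mmul A B) z"
    unfolding 2 by (simp add: A B moebius_def cocycle_def mmul_def algebra_simps)
  also have "\<dots> = moebius A (moebius B z)" using nz by (simp add: j) (simp add: A moebius_eq)
  finally show "moebius (mmul A B) z = moebius A (moebius B z)" .
qed

lemma Im_moebius:
  assumes "A \<in> carrier SL2Z" "0 < Im z"
  shows "Im (moebius A z) = Im z / (norm (cocycle A z))\<^sup>2"
proof -
  obtain a b c d where A: "A = (a,b,c,d)" by (cases A)
  have det: "real_of_int a * real_of_int d - real_of_int b * real_of_int c = 1"
    using assms(1) unfolding A SL2Z_iff by (metis of_int_1 of_int_diff of_int_mult)
  have "Im (moebius A z) = Im ((of_int a * z + of_int b) * cnj (cocycle A z)) / (norm (cocycle A z))\<^sup>2"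
    by (simp add: A moebius_eq complex_div_cnj[of _ "cocycle (a,b,c,d) z"] Im_divide_of_real flip: of_real_power)
  also have "Im ((of_int a * z + of_int b) * cnj (cocycle A z)) = (real_of_int a * real_of_int d - real_of_int b * real_of_int c) * Im z"
    by (simp add: cocycle_def A algebra_simps)
  finally show ?thesis by (simp add: det)
qed

lemma Im_moebius_pos: "A \<in> carrier SL2Z \<Longrightarrow> 0 < Im z \<Longrightarrow> 0 < Im (moebius A z)"
  by (simp add: Im_moebius cocycle_nonzero)

lemma moebius_one [simp]: "moebius (1,0,0,1) z = z" and cocycle_one [simp]: "cocycle (1,0,0,1) z = 1"
  by (simp_all add: moebius_def cocycle_def)

lemma moebius_minv:
  assumes "A \<in> carrier SL2Z" "0 < Im z"
  shows "moebius A (moebius (minv A) z) = z" and "cocycle A (moebius (minv A) z) * cocycle (minv A) z = 1"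
  using moebius_mmul[OF assms(1) minv_closed[OF assms(1)] assms(2)] cocycle_mmul[OF assms(1) minv_closed[OF assms(1)] assms(2)]
  by (simp_all add: mmul_minv assms)

lemma moebius_mneg [simp]: "moebius (mneg A) z = moebius A z" and cocycle_mneg [simp]: "cocycle (mneg A) z = - cocycle A z"
proof -
  obtain a b c d where A: "A = (a,b,c,d)" by (cases A)
  show "cocycle (mneg A) z = - cocycle A z" by (simp add: cocycle_def A mneg_def)
  have "moebius (mneg A) z = - (of_int a * z + of_int b) / - (of_int c * z + of_int d)"
    unfolding A mneg_def moebius_def by (simp del: minus_add_distrib add: minus_add)
  then show "moebius (mneg A) z = moebius A z" unfolding minus_divide_divide by (simp add: A moebius_def)
qed

lemma moebius_translation [simp]: "moebius (1,n,0,1) z = z + of_int n" and cocycle_translation [simp]: "cocycle (1,n,0,1) z = 1"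
  by (simp_all add: moebius_def cocycle_def)

lemma finite_index_representatives:
  assumes "finite_index_subgroup \<Gamma>"
  obtains R where "finite R" "R \<subseteq> carrier SL2Z" "\<And>A. A \<in> carrier SL2Z \<Longrightarrow> \<exists>\<gamma>\<in>\<Gamma>. \<exists>g\<in>R. A = mmul \<gamma> g"
proof -
  have fin: "finite (rcosets\<^bsub>SL2Z\<^esub> \<Gamma>)" and sub: "subgroup \<Gamma> SL2Z" using assms by (auto simp: finite_index_subgroup_def)
  have one: "(1,0,0,1) \<in> \<Gamma>" using subgroup.one_closed[OF sub] by (simp add: mult_SL2Z)
  define rep where "rep C = (SOME a. a \<in> carrier SL2Z \<and> C = \<Gamma> #>\<^bsub>SL2Z\<^esub> a)" for C
  have rep: "rep C \<in> carrier SL2Z \<and> C = \<Gamma> #>\<^bsub>SL2Z\<^esub> rep C" if "C \<in> rcosets\<^bsub>SL2Z\<^esub> \<Gamma>" for C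
    unfolding rep_def by (rule someI_ex) (use that in \<open>auto simp: RCOSETS_def\<close>)
  show thesis
  proof (rule that[of "rep ` (rcosets\<^bsub>SL2Z\<^esub> \<Gamma>)"])
    fix A assume A: "A \<in> carrier SL2Z"
    define C where "C = \<Gamma> #>\<^bsub>SL2Z\<^esub> A"
    have C: "C \<in> rcosets\<^bsub>SL2Z\<^esub> \<Gamma>" using A by (auto simp: C_def RCOSETS_def)
    have "A \<in> C" unfolding C_def r_coset_def using one by (force simp: mult_SL2Z)
    then have "A \<in> \<Gamma> #>\<^bsub>SL2Z\<^esub> rep C" using rep[OF C] by simp
    then show "\<exists>\<gamma>\<in>\<Gamma>. \<exists>g\<in>rep ` (rcosets\<^bsub>SL2Z\<^esub> \<Gamma>). A = mmul \<gamma> g"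
      using C by (auto simp: r_coset_def mult_SL2Z)
  qed (use fin rep in auto)
qed

text \<open>The least number in \<open>cusp_width\<close> is meaningful only once some positive one
  exists. Pigeonhole: the matrices A T^i, with T the unit translation, lie in finitely many cosets,
  and two in the same coset give a translation conjugate lying in \<open>\<Gamma>\<close>.\<close>

lemma cusp_width_props:
  assumes G: "finite_index_subgroup \<Gamma>" and A: "A \<in> carrier SL2Z"
  shows "0 < cusp_width \<Gamma> A"
    and "mmul (mmul A (1, int (cusp_width \<Gamma> A), 0, 1)) (minv A) \<in> \<Gamma> \<or>
       mneg (mmul (mmul A (1, int (cusp_width \<Gamma> A), 0, 1)) (minv A)) \<in> \<Gamma>"
proof -
  have fin: "finite (rcosets\<^bsub>SL2Z\<^esub> \<Gamma>)" and sub: "subgroup \<Gamma> SL2Z" using G by (auto simp: finite_index_subgroup_def)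
  have one: "(1,0,0,1) \<in> \<Gamma>" using subgroup.one_closed[OF sub] by (simp add: mult_SL2Z)
  define X where "X i = mmul A (1, int i, 0, 1)" for i :: nat
  have X: "X i \<in> carrier SL2Z" for i unfolding X_def by (intro mmul_closed A translation_in_SL2Z)
  have "\<not> inj (\<lambda>i. \<Gamma> #>\<^bsub>SL2Z\<^esub> X i)"
  proof
    assume "inj (\<lambda>i. \<Gamma> #>\<^bsub>SL2Z\<^esub> X i)"
    moreover have "range (\<lambda>i. \<Gamma> #>\<^bsub>SL2Z\<^esub> X i) \<subseteq> rcosets\<^bsub>SL2Z\<^esub> \<Gamma>" using X by (auto simp: RCOSETS_def)
    ultimately show False using fin by (meson finite_imageD finite_subset infinite_UNIV_nat)
  qed
  then obtain i j where ij: "i < j" "\<Gamma> #>\<^bsub>SL2Z\<^esub> X i = \<Gamma> #>\<^bsub>SL2Z\<^esub> X j"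
    unfolding inj_def by (metis linorder_neqE_nat)
  have "X j \<in> \<Gamma> #>\<^bsub>SL2Z\<^esub> X j" unfolding r_coset_def using one by (force simp: mult_SL2Z)
  then have "X j \<in> \<Gamma> #>\<^bsub>SL2Z\<^esub> X i" using ij(2) by simp
  then obtain h where h: "h \<in> \<Gamma>" "X j = mmul h (X i)" unfolding r_coset_def mult_SL2Z by blast
  have "h = mmul (mmul h (X i)) (minv (X i))" by (simp add: mmul_assoc mmul_minv X)
  also have "\<dots> = mmul (X j) (minv (X i))" by (simp add: h)
  also have "\<dots> = mmul (mmul A (1, int (j - i), 0, 1)) (minv A)"
    using ij(1) by (cases A) (simp add: X_def mmul_def minv_def of_nat_diff algebra_simps)
  finally have "0 < j - i \<and> (mmul (mmul A (1, int (j - i), 0, 1)) (minv A) \<in> \<Gamma> \<or>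
       mneg (mmul (mmul A (1, int (j - i), 0, 1)) (minv A)) \<in> \<Gamma>)" using h ij by simp
  from LeastI[of "\<lambda>m. 0 < m \<and> (mmul (mmul A (1, int m, 0, 1)) (minv A) \<in> \<Gamma> \<or>
       mneg (mmul (mmul A (1, int m, 0, 1)) (minv A)) \<in> \<Gamma>)", OF this]
  show "0 < cusp_width \<Gamma> A"
    and "mmul (mmul A (1, int (cusp_width \<Gamma> A), 0, 1)) (minv A) \<in> \<Gamma> \<or>
       mneg (mmul (mmul A (1, int (cusp_width \<Gamma> A), 0, 1)) (minv A)) \<in> \<Gamma>"
    unfolding cusp_width_def[symmetric] by auto
qed

text \<open>The matrix \<open>mmul (minv A) B\<close> fixes infinity; being integral with
  determinant 1, it is a translation up to sign.\<close>

lemma same_cusp: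
  assumes A: "A \<in> carrier SL2Z" and B: "B \<in> carrier SL2Z" and eq: "cusp_of A = cusp_of B"
  obtains n where "B = mmul A (1,n,0,1) \<or> B = mneg (mmul A (1,n,0,1))"
proof -
  obtain a b c d where A': "A = (a,b,c,d)" by (cases A)
  obtain a' b' c' d' where B': "B = (a',b',c',d')" by (cases B)
  have dA: "a * d - b * c = 1" and dB: "a' * d' - b' * c' = 1" using A B by (auto simp: A' B' SL2Z_iff)
  have z: "a * c' - c * a' = 0"
    using eq by (auto simp: cusp_of_def A' B' eq_rat split: if_splits)
  define u v t where "u = d * a' - b * c'" and "v = d * b' - b * d'" and "t = a * d' - c * b'"
  have M: "mmul (minv A) B = (u, v, 0, t)" using z by (simp add: A' B' mmul_def minv_def u_def v_def t_def algebra_simps)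
  have "u * t = 1"
    using mmul_closed[OF minv_closed[OF A] B] unfolding M SL2Z_iff by simp
  then have ut: "(u = 1 \<and> t = 1) \<or> (u = -1 \<and> t = -1)" by (simp add: zmult_eq_1_iff)
  have BM: "B = mmul A (u, v, 0, t)" unfolding M[symmetric] by (simp add: mmul_minv A flip: mmul_assoc)
  from ut show thesis
  proof
    assume "u = 1 \<and> t = 1"
    then show thesis using BM that[of v] by simp
  next
    assume "u = -1 \<and> t = -1"
    then have "B = mneg (mmul A (1, -v, 0, 1))" using BM by (simp add: A' mmul_def mneg_def)
    then show thesis using that by blast
  qed
qed

lemma cusp_of_surj:
  obtains A where "A \<in> carrier SL2Z" "cusp_of A = p"
proof (cases p)
  case None
  then show thesis using that[of "(1,0,0,1)"] by (simp add: one_in_SL2Z cusp_of_def)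
next
  case (Some x)
  obtain a c where ac: "quotient_of x = (a, c)" by (cases "quotient_of x")
  have "coprime a c" "0 < c" "x = Fract a c" using quotient_of_coprime[OF ac] quotient_of_denom_pos[OF ac] ac
    by (auto simp: Fract_of_int_quotient quotient_of_div[OF ac])
  then obtain u v where "u * a + v * c = 1" using bezout_int[of a c] by auto
  then have "(a, -v, c, u) \<in> carrier SL2Z" by (simp add: SL2Z_iff algebra_simps)
  then show thesis using that[of "(a,-v,c,u)"] Some \<open>0 < c\<close> \<open>x = Fract a c\<close> by (simp add: cusp_of_def)
qed

text \<open>Near a point where \<open>G\<close> does not vanish, H/G is holomorphic of modulus 1,
  hence constant by the maximum principle; the identity theorem carries the relation across the
  zeros of \<open>G\<close>. It recovers a multiplier from equality of moduli alone.\<close>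

lemma unimodular_ratio_constant:
  assumes S: "open S" "connected S" and h: "H holomorphic_on S" "G holomorphic_on S"
    and eq: "\<And>z. z \<in> S \<Longrightarrow> norm (H z) = norm (G z)" and z0: "z0 \<in> S" "G z0 \<noteq> 0"
  obtains \<epsilon> where "norm \<epsilon> = 1" "\<And>z. z \<in> S \<Longrightarrow> H z = \<epsilon> * G z"
proof -
  have "isCont G z0" using holomorphic_on_imp_continuous_on[OF h(2)] S(1) z0(1) by (simp add: continuous_on_eq_continuous_at)
  then have "\<forall>\<^sub>F z in at z0. G z \<noteq> 0" using z0(2) by (simp add: isCont_def tendsto_imp_eventually_ne)
  then obtain d1 where d1: "0 < d1" "\<And>z. z \<noteq> z0 \<Longrightarrow> dist z z0 < d1 \<Longrightarrow> G z \<noteq> 0" unfolding eventually_at by auto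
  obtain d2 where d2: "0 < d2" "ball z0 d2 \<subseteq> S" using S(1) z0(1) open_contains_ball by blast
  define U where "U = ball z0 (min d1 d2)"
  have U: "open U" "connected U" "z0 \<in> U" "U \<subseteq> S" "\<And>z. z \<in> U \<Longrightarrow> G z \<noteq> 0"
  proof -
    show "G z \<noteq> 0" if "z \<in> U" for z
      using that d1(2)[of z] z0(2) by (cases "z = z0") (auto simp: U_def dist_commute)
  qed (use d1 d2 in \<open>auto simp: U_def\<close>)
  have hq: "(\<lambda>z. H z / G z) holomorphic_on U"
    using U h by (intro holomorphic_intros) (auto intro: holomorphic_on_subset)
  have n1: "norm (H z / G z) = 1" if "z \<in> U" for z
    using eq[of z] that U by (auto simp: norm_divide)
  have "(\<lambda>z. H z / G z) constant_on U"
    by (rule maximum_modulus_principle[OF hq U(1,2) U(1) order.refl U(3)]) (use n1 U(3) in simp)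
  then obtain \<epsilon> where \<epsilon>: "\<And>z. z \<in> U \<Longrightarrow> H z / G z = \<epsilon>" unfolding constant_on_def by blast
  have "norm \<epsilon> = 1" using \<epsilon>[OF U(3)] n1[OF U(3)] by simp
  moreover have "H z = \<epsilon> * G z" if "z \<in> S" for z
  proof (rule analytic_continuation_open[OF U(1) S(1) _ S(2) U(4) h(1) _ _ that])
    show "U \<noteq> {}" using U(3) by blast
    show "(\<lambda>z. \<epsilon> * G z) holomorphic_on S" by (intro holomorphic_intros h)
    show "H z = \<epsilon> * G z" if "z \<in> U" for z using \<epsilon>[OF that] U(5)[OF that] by (auto simp: field_simps)
  qed
  ultimately show thesis using that by blast
qed

text \<open>In the variable q = exp(2 pi i z) the function lives on the punctured disc;
  \<open>lim\<close> says that q times it tends to 0, so the singularity is removable and the Taylor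
  series at 0 is the expansion. The strip |Re z| <= 1 suffices because the logarithm supplies a
  representative in it.\<close>

lemma periodic_power_series:
  fixes U :: "complex \<Rightarrow> complex"
  assumes hol: "U holomorphic_on {z. 0 < Im z}" and per: "\<And>z. 0 < Im z \<Longrightarrow> U (z + 1) = U z"
    and lim: "\<And>e. 0 < e \<Longrightarrow> \<exists>Y. \<forall>z. \<bar>Re z\<bar> \<le> 1 \<and> Y \<le> Im z \<longrightarrow> norm (U z) * exp (- 2 * pi * Im z) < e"
  obtains a where "\<And>z. 0 < Im z \<Longrightarrow> (\<lambda>n. a n * exp (2 * pi * \<i> * z) ^ n) sums U z"
proof -
  have perZ: "U (z + of_int k) = U z" if "0 < Im z" for z k
  proof (induction k rule: int_induct[of _ 0])
    case (step1 i)
    then show ?case using per[of "z + of_int i"] that by (simp add: add.assoc)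
  next
    case (step2 i)
    then show ?case using per[of "z + of_int (i - 1)"] that by simp
  qed simp
  define \<Psi> where "\<Psi> q = U (Ln q / (2 * pi * \<i>))" for q
  \<comment> \<open>A second logarithm with its cut along the positive axis. The two slit discs
    cover the punctured disc, and periodicity makes both definitions agree.\<close>
  define \<Psi>' where "\<Psi>' q = U ((Ln (- q) + \<i> * pi) / (2 * pi * \<i>))" for q
  have ImLn: "Im (w / (2 * pi * \<i>)) = - Re w / (2 * pi)" for w
  proof -
    have "w / (2 * pi * \<i>) = - \<i> * w / of_real (2 * pi)" by (simp add: field_simps)
    then show ?thesis by (simp only: Im_divide_of_real) simp
  qed
  have pos: "0 < Im (Ln q / (2 * pi * \<i>))" if "q \<noteq> 0" "norm q < 1" for q
    unfolding ImLn using that by (simp add: Re_Ln divide_neg_pos)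
  have pos': "0 < Im ((Ln (-q) + \<i> * pi) / (2 * pi * \<i>))" if "q \<noteq> 0" "norm q < 1" for q
    unfolding ImLn using that by (simp add: Re_Ln divide_neg_pos)
  have eq: "\<Psi>' q = \<Psi> q" if q: "q \<noteq> 0" "norm q < 1" for q
  proof -
    have "Ln (- q) + \<i> * pi = Ln q + 2 * pi * \<i> * 1 \<or> Ln (- q) + \<i> * pi = Ln q"
      using Ln_minus[OF q(1)] by (auto simp: algebra_simps)
    then show ?thesis
    proof
      assume "Ln (- q) + \<i> * pi = Ln q + 2 * pi * \<i> * 1"
      then have "(Ln (- q) + \<i> * pi) / (2 * pi * \<i>) = Ln q / (2 * pi * \<i>) + 1"
        by (simp only: add_divide_distrib) simp
      then show ?thesis using per[OF pos[OF q]] by (simp add: \<Psi>_def \<Psi>'_def)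
    qed (simp add: \<Psi>_def \<Psi>'_def)
  qed
  define S1 :: "complex set" where "S1 = ball 0 1 - \<real>\<^sub>\<le>\<^sub>0"
  define S2 :: "complex set" where "S2 = ball 0 1 - \<real>\<^sub>\<ge>\<^sub>0"
  have o1: "open S1" unfolding S1_def by (intro open_Diff) auto
  have o2: "open S2" unfolding S2_def by (intro open_Diff) auto
  have nz: "q \<noteq> 0" "norm q < 1" if "q \<in> S1 \<or> q \<in> S2" for q
    using that by (auto simp: S1_def S2_def)
  have h1: "\<Psi> holomorphic_on S1"
  proof -
    have "(U \<circ> (\<lambda>q. Ln q / (2 * pi * \<i>))) holomorphic_on S1"
    proof (rule holomorphic_on_compose)
      show "(\<lambda>q. Ln q / (2 * pi * \<i>)) holomorphic_on S1" by (intro holomorphic_intros) (auto simp: S1_def)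
      show "U holomorphic_on (\<lambda>q. Ln q / (2 * pi * \<i>)) ` S1"
        by (rule holomorphic_on_subset[OF hol]) (use nz pos in blast)
    qed
    then show ?thesis by (simp add: \<Psi>_def[abs_def] o_def)
  qed
  have h2: "\<Psi> holomorphic_on S2"
  proof -
    have "(U \<circ> (\<lambda>q. (Ln (- q) + \<i> * pi) / (2 * pi * \<i>))) holomorphic_on S2"
    proof (rule holomorphic_on_compose)
      show "(\<lambda>q. (Ln (- q) + \<i> * pi) / (2 * pi * \<i>)) holomorphic_on S2" by (intro holomorphic_intros) (auto simp: S2_def)
      show "U holomorphic_on (\<lambda>q. (Ln (- q) + \<i> * pi) / (2 * pi * \<i>)) ` S2"
        by (rule holomorphic_on_subset[OF hol]) (use nz pos' in blast)
    qed
    then have "\<Psi>' holomorphic_on S2" by (simp add: \<Psi>'_def[abs_def] o_def)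
    then show ?thesis by (rule holomorphic_transform) (use eq nz in blast)
  qed
  have "S1 \<union> S2 = ball 0 1 - {0}"
    by (auto simp: S1_def S2_def complex_nonpos_Reals_iff complex_nonneg_Reals_iff complex_eq_iff)
  then have h: "\<Psi> holomorphic_on (ball 0 1 - {0})"
    using holomorphic_on_Un[OF h1 h2 o1 o2] by simp
  have "((\<lambda>q. (q - 0) * \<Psi> q) \<longlongrightarrow> 0) (at 0)"
  proof (rule tendstoI)
    fix e :: real assume "0 < e"
    then obtain Y where Y: "\<And>z. \<bar>Re z\<bar> \<le> 1 \<Longrightarrow> Y \<le> Im z \<Longrightarrow> norm (U z) * exp (- 2 * pi * Im z) < e" using lim by blast
    have "dist ((q - 0) * \<Psi> q) 0 < e" if q: "q \<noteq> 0" "dist q 0 < exp (- 2 * pi * Y)" for q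
    proof -
      define z where "z = Ln q / (2 * pi * \<i>)"
      have im: "Im z = - ln (norm q) / (2 * pi)" unfolding z_def ImLn using q by (simp add: Re_Ln)
      have re: "Re z = Im (Ln q) / (2 * pi)"
      proof -
        have "z = - \<i> * Ln q / of_real (2 * pi)" by (simp add: z_def field_simps)
        then show ?thesis by (simp only: Re_divide_of_real) simp
      qed
      have "\<bar>Im (Ln q)\<bar> \<le> 2 * pi" using mpi_less_Im_Ln[OF q(1)] Im_Ln_le_pi[OF q(1)] pi_gt_zero by linarith
      then have 1: "\<bar>Re z\<bar> \<le> 1" by (simp add: re)
      have "ln (norm q) < - 2 * pi * Y" using q by (metis dist_0_norm dist_commute ln_exp ln_less_cancel_iff exp_gt_zero zero_less_norm_iff)
      then have 2: "Y \<le> Im z" by (simp add: im field_simps)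
      have "exp (- 2 * pi * Im z) = norm q" using q by (simp add: im)
      then show ?thesis using Y[OF 1 2] by (simp add: \<Psi>_def z_def norm_mult mult.commute)
    qed
    then show "\<forall>\<^sub>F q in at 0. dist ((q - 0) * \<Psi> q) 0 < e" unfolding eventually_at by (intro exI[of _ "exp (- 2 * pi * Y)"]) auto
  qed
  then obtain g where g: "g holomorphic_on ball 0 1" "\<And>q. q \<in> ball 0 1 - {0} \<Longrightarrow> g q = \<Psi> q"
    using holomorphic_on_extend_lim[OF h] by auto
  show thesis
  proof (rule that[of "\<lambda>n. (deriv ^^ n) g 0 / fact n"])
    fix z :: complex assume z: "0 < Im z"
    define q where "q = exp (2 * pi * \<i> * z)"
    have q: "q \<noteq> 0" "norm q < 1" using z by (auto simp: q_def)
    have "(\<lambda>n. (deriv ^^ n) g 0 / fact n * (q - 0) ^ n) sums g q"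
      by (rule holomorphic_power_series[OF g(1)]) (use q in simp)
    moreover have "g q = \<Psi> q" using g(2) q by simp
    moreover have "\<Psi> q = U z"
    proof -
      have "exp (Ln q) = exp (2 * pi * \<i> * z)" using q by (simp add: q_def)
      then obtain n :: int where n: "Ln q = 2 * pi * \<i> * z + (of_int (2 * n) * pi) * \<i>" by (auto simp: exp_eq)
      then have "Ln q = 2 * pi * \<i> * (z + of_int n)" by (simp add: algebra_simps)
      then have "Ln q / (2 * pi * \<i>) = z + of_int n" by simp
      then show ?thesis using perZ[OF z] by (simp add: \<Psi>_def)
    qed
    ultimately show "(\<lambda>n. (deriv ^^ n) g 0 / fact n * exp (2 * pi * \<i> * z) ^ n) sums U z" by (simp add: q_def)
  qed
qed

text \<open>The modulus of the weight-r slash of \<open>f\<close> by \<open>A\<close>. Unimodular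
  multipliers and the choice of branch drop out, so for a modular form it depends only on the coset
  of \<open>A\<close>.\<close>

definition slash_norm :: "(complex \<Rightarrow> complex) \<Rightarrow> real \<Rightarrow> mat2 \<Rightarrow> complex \<Rightarrow> real" where
  "slash_norm f r A w = norm (f (moebius A w)) / norm (cocycle A w) powr r"

text \<open>The height \<open>1/5\<close> is what Dirichlet approximation guarantees: every \<open>z\<close> of height at most 1 has
  \<open>\<bar>qz - p\<bar>\<^sup>2 \<le> 5 Im z\<close> for some coprime \<open>p\<close>, \<open>q\<close>, and is then an image of a point at height at least \<open>1/5\<close>.\<close>
definition decaying :: "(complex \<Rightarrow> complex) \<Rightarrow> real \<Rightarrow> mat2 \<Rightarrow> real \<Rightarrow> bool" where
  "decaying f r A C \<longleftrightarrow> 0 < C \<and> (\<forall>w. 1/5 \<le> Im w \<longrightarrow> slash_norm f r A w \<le> C * exp (- Im w / C))"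

text \<open>One constant serves as upper bound, as inverse lower bound and as threshold height, so
  enlarging it preserves the property; this allows finitely many cosets to share a constant.\<close>

definition nondecaying :: "(complex \<Rightarrow> complex) \<Rightarrow> real \<Rightarrow> mat2 \<Rightarrow> real \<Rightarrow> bool" where
  "nondecaying f r A C \<longleftrightarrow> 0 < C \<and> (\<forall>w. 1/5 \<le> Im w \<longrightarrow> slash_norm f r A w \<le> C) \<and> (\<forall>w. C \<le> Im w \<longrightarrow> 1 / C \<le> slash_norm f r A w)"

lemma slash_norm_nonneg [simp]: "0 \<le> slash_norm f r A w"
  by (simp add: slash_norm_def)

lemma decaying_mono:
  assumes "decaying f r A C" "C \<le> C'"
  shows "decaying f r A C'"
  unfolding decaying_def
proof (intro conjI allI impI)
  show "0 < C'" using assms by (simp add: decaying_def)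
  fix w :: complex assume w: "1/5 \<le> Im w"
  have "slash_norm f r A w \<le> C * exp (- Im w / C)" using assms w by (simp add: decaying_def)
  also have "\<dots> \<le> C' * exp (- Im w / C')"
  proof (intro mult_mono)
    have "Im w / C' \<le> Im w / C" using assms w by (intro divide_left_mono) (auto simp: decaying_def)
    then show "exp (- Im w / C) \<le> exp (- Im w / C')" by simp
  qed (use assms in \<open>auto simp: decaying_def\<close>)
  finally show "slash_norm f r A w \<le> C' * exp (- Im w / C')" .
qed

lemma nondecaying_mono:
  assumes "nondecaying f r A C" "C \<le> C'"
  shows "nondecaying f r A C'"
proof -
  have "1 / C' \<le> 1 / C" using assms by (intro divide_left_mono) (auto simp: nondecaying_def)
  then show ?thesis using assms unfolding nondecaying_def by (meson order_less_le_trans order_trans)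
qed

lemma not_decaying_and_nondecaying:
  assumes "decaying f r A C" "nondecaying f r A C'"
  shows False
proof -
  define y where "y = max (max C' (1/5)) (C * (C * C' + 1))"
  have C: "0 < C" "0 < C'" using assms by (auto simp: decaying_def nondecaying_def)
  have y: "C' \<le> y" "1/5 \<le> y" "C * (C * C' + 1) \<le> y" by (auto simp: y_def)
  have "1 / C' \<le> slash_norm f r A (Complex 0 y)" using assms y by (simp add: nondecaying_def)
  also have "\<dots> \<le> C * exp (- y / C)" using assms(1)[unfolded decaying_def] y(2) by (metis complex.sel(2))
  finally have 1: "exp (y / C) \<le> C * C'" using C by (simp add: exp_minus field_simps)
  have "C * C' + 1 \<le> y / C" using y C by (simp add: field_simps)
  also have "\<dots> < exp (y / C)" using exp_ge_add_one_self[of "y / C"] by linarith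
  finally show False using 1 by simp
qed

lemma slash_norm_translation:
  assumes "A \<in> carrier SL2Z" "0 < Im w"
  shows "slash_norm f r (mmul A (1,n,0,1)) w = slash_norm f r A (w + of_int n)"
  using assms by (simp add: slash_norm_def cocycle_mmul moebius_mmul translation_in_SL2Z)

lemma slash_norm_mneg [simp]: "slash_norm f r (mneg A) w = slash_norm f r A w"
  by (simp add: slash_norm_def)

lemma slash_norm_same_cusp:
  assumes "A \<in> carrier SL2Z" "B \<in> carrier SL2Z" "cusp_of A = cusp_of B"
  obtains n where "\<And>w. 0 < Im w \<Longrightarrow> slash_norm f r B w = slash_norm f r A (w + of_int n)"
  using same_cusp[OF assms] slash_norm_translation[OF assms(1)] slash_norm_mneg by metis

lemma decaying_same_cusp:
  assumes "A \<in> carrier SL2Z" "B \<in> carrier SL2Z" "cusp_of A = cusp_of B"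
  shows "decaying f r A C \<Longrightarrow> decaying f r B C" "nondecaying f r A C \<Longrightarrow> nondecaying f r B C"
proof -
  obtain n where n: "\<And>w. 0 < Im w \<Longrightarrow> slash_norm f r B w = slash_norm f r A (w + of_int n)" using slash_norm_same_cusp[OF assms] by blast
  show "decaying f r A C \<Longrightarrow> decaying f r B C" unfolding decaying_def
  proof (elim conjE, intro conjI allI impI)
    fix w :: complex assume H: "\<forall>w. 1 / 5 \<le> Im w \<longrightarrow> slash_norm f r A w \<le> C * exp (- Im w / C)" and w: "1 / 5 \<le> Im w"
    show "slash_norm f r B w \<le> C * exp (- Im w / C)" using H[rule_format, of "w + of_int n"] w n[of w] by simp
  qed
  show "nondecaying f r A C \<Longrightarrow> nondecaying f r B C" unfolding nondecaying_def
  proof (elim conjE, intro conjI allI impI)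
    fix w :: complex assume H: "\<forall>w. 1 / 5 \<le> Im w \<longrightarrow> slash_norm f r A w \<le> C" and w: "1 / 5 \<le> Im w"
    show "slash_norm f r B w \<le> C" using H[rule_format, of "w + of_int n"] w n[of w] by simp
  next
    fix w :: complex assume C: "0 < C" and H: "\<forall>w. C \<le> Im w \<longrightarrow> 1 / C \<le> slash_norm f r A w" and w: "C \<le> Im w"
    show "1 / C \<le> slash_norm f r B w" using H[rule_format, of "w + of_int n"] w n[of w] C by simp
  qed
qed

text \<open>Connects the scaling matrix with its square roots of the width to the unscaled slash:
  the square roots leave only the factor \<open>m powr (r/2)\<close>.\<close>

lemma norm_f_sigma:
  assumes "A \<in> carrier SL2Z" "0 < m" "0 < Im z"
  shows "norm (f_sigma f r A m z) = real m powr (r/2) * slash_norm f r A (of_nat m * z)"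
proof -
  obtain a b c d where A: "A = (a,b,c,d)" by (cases A)
  have m: "0 < real m" using assms(2) by simp
  have "complex_of_real (of_int c * sqrt (real m)) * z + complex_of_real (of_int d / sqrt (real m)) = cocycle A (of_nat m * z) / of_real (sqrt (real m))"
  proof -
    have "complex_of_real (sqrt (real m)) * complex_of_real (sqrt (real m)) = of_nat m"
      by (metis abs_of_nat of_real_mult of_real_of_nat_eq real_sqrt_abs2 real_sqrt_mult)
    then show ?thesis using m by (simp add: A cocycle_def field_simps)
  qed
  then have "norm (f_sigma f r A m z) = norm (f (moebius A (of_nat m * z))) / norm (cocycle A (of_nat m * z) / of_real (sqrt (real m))) powr r"
    unfolding f_sigma_def A by (simp add: norm_divide norm_powr_real_powr')
  also have "norm (cocycle A (of_nat m * z) / of_real (sqrt (real m))) powr r = norm (cocycle A (of_nat m * z)) powr r / real m powr (r/2)"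
    using m by (simp add: norm_divide powr_divide powr_half_sqrt[symmetric] powr_powr mult.commute)
  finally show ?thesis by (simp add: slash_norm_def)
qed

text \<open>If kappa > 0 or \<open>a 0 = 0\<close>, every surviving term contains a decaying
  exponential; otherwise the sum tends to the nonzero constant \<open>a 0\<close>. Absolute
  convergence at height 1/5 makes both statements uniform from that height on.\<close>

lemma fourier_expansion_dichotomy:
  assumes A: "A \<in> carrier SL2Z" and m: "0 < cusp_width \<Gamma> A" and F: "fourier_expansion_at f r \<Gamma> A \<kappa> a"
  shows "0 < \<kappa> \<or> a 0 = 0 \<Longrightarrow> \<exists>C. decaying f r A C"
    and "\<not> (0 < \<kappa> \<or> a 0 = 0) \<Longrightarrow> \<exists>C. nondecaying f r A C"
proof -
  define m where "m = cusp_width \<Gamma> A"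
  have m0: "0 < real m" using m by (simp add: m_def)
  define s where "s = 2 * pi / real m"
  have s0: "0 < s" using m0 by (simp add: s_def)
  define M where "M = real m powr (r/2)"
  have M0: "0 < M" using m0 by (simp add: M_def)
  define q where "q w = exp (\<i> * of_real s * w)" for w
  have nq: "norm (q w) = exp (- s * Im w)" for w by (simp add: q_def)
  define H where "H w = f_sigma f r A m (w / of_nat m)" for w
  have slash_norm: "slash_norm f r A w = norm (H w) / M" if "0 < Im w" for w
    using norm_f_sigma[OF A, of m "w / of_nat m" f r] m0 that M0 by (simp add: H_def M_def field_simps)
  have k: "0 \<le> \<kappa>" using F by (simp add: fourier_expansion_at_def)
  have S: "(\<lambda>n. exp (\<i> * of_real (s * \<kappa>) * w) * (a n * q w ^ n)) sums H w" if "0 < Im w" for w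
  proof -
    have "(\<lambda>n. a n * exp (2 * pi * \<i> * complex_of_real (real n + \<kappa>) * (w / of_nat m))) sums H w"
    proof -
      have "0 < Im (w / of_nat m)" using m0 that by simp
      then show ?thesis using F[unfolded fourier_expansion_at_def, folded m_def] unfolding H_def by blast
    qed
    moreover have "a n * exp (2 * pi * \<i> * complex_of_real (real n + \<kappa>) * (w / of_nat m)) = exp (\<i> * of_real (s * \<kappa>) * w) * (a n * q w ^ n)" for n
    proof -
      have "2 * pi * \<i> * complex_of_real (real n + \<kappa>) * (w / of_nat m) = \<i> * of_real (s * \<kappa>) * w + of_nat n * (\<i> * of_real s * w)"
        by (simp add: s_def field_simps add_divide_distrib)
      then show ?thesis by (simp add: q_def exp_add exp_of_nat_mult)
    qed
    ultimately show ?thesis by (simp only:)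
  qed
  have S': "summable (\<lambda>n. a n * q w ^ n)" if "0 < Im w" for w
    using sums_summable[OF S[OF that]] summable_mult_D exp_not_eq_zero by fastforce
  have Heq: "H w = exp (\<i> * of_real (s * \<kappa>) * w) * (\<Sum>n. a n * q w ^ n)" if "0 < Im w" for w
    using S[OF that] suminf_mult[OF S'[OF that]] by (simp add: sums_iff)
  \<comment> \<open>The modulus of \<open>q w\<close> at height 1/5. The coefficients are absolutely
    summable there because the expansion converges at the smaller height 1/10.\<close>
  define q0 where "q0 = exp (- s * (1/5))"
  have q0: "0 < q0" by (simp add: q0_def)
  have sn: "summable (\<lambda>n. norm (a n) * q0 ^ n)"
  proof -
    have "summable (\<lambda>n. norm (a n * of_real q0 ^ n))"
    proof (rule powser_insidea)
      show "summable (\<lambda>n. a n * q (Complex 0 (1/10)) ^ n)" by (rule S') simp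
      show "norm (complex_of_real q0) < norm (q (Complex 0 (1/10)))" using s0 by (simp add: nq q0_def)
    qed
    then show ?thesis using q0 by (simp add: norm_mult norm_power)
  qed
  define B where "B = (\<Sum>n. norm (a n) * q0 ^ n)"
  have B0: "0 \<le> B" unfolding B_def by (rule suminf_nonneg[OF sn]) (use q0 in auto)
  have sn1: "summable (\<lambda>n. norm (a (Suc n)) * q0 ^ n)"
  proof -
    have "summable (\<lambda>n. norm (a (Suc n)) * q0 ^ Suc n)" using sn by (subst summable_Suc_iff)
    then have "summable (\<lambda>n. q0 * (norm (a (Suc n)) * q0 ^ n))" by (simp add: mult_ac)
    then show ?thesis using q0 by (auto dest: summable_mult_D)
  qed
  define B1 where "B1 = (\<Sum>n. norm (a (Suc n)) * q0 ^ n)"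
  have B10: "0 \<le> B1" unfolding B1_def by (rule suminf_nonneg[OF sn1]) (use q0 in auto)
  have qw: "norm (q w) \<le> q0" if "1/5 \<le> Im w" for w
    unfolding nq q0_def using that s0 by simp
  have sumB: "norm (\<Sum>n. a n * q w ^ n) \<le> B" if w: "1/5 \<le> Im w" for w
  proof -
    have le: "norm (a n * q w ^ n) \<le> norm (a n) * q0 ^ n" for n
      unfolding norm_mult norm_power using qw[OF w] by (intro mult_left_mono power_mono) auto
    have sm: "summable (\<lambda>n. norm (a n * q w ^ n))"
      by (rule summable_comparison_test'[OF sn]) (use le in simp)
    show ?thesis unfolding B_def using summable_norm[OF sm] suminf_le[OF le sm sn] by linarith
  qed
  have sumB1: "norm ((\<Sum>n. a n * q w ^ n) - a 0) \<le> B1 * exp (- s * Im w)" if w: "1/5 \<le> Im w" for w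
  proof -
    have le: "norm (a (Suc n) * q w ^ n) \<le> norm (a (Suc n)) * q0 ^ n" for n
      unfolding norm_mult norm_power using qw[OF w] by (intro mult_left_mono power_mono) auto
    have sm: "summable (\<lambda>n. norm (a (Suc n) * q w ^ n))"
      by (rule summable_comparison_test'[OF sn1]) (use le in simp)
    have sw: "summable (\<lambda>n. a n * q w ^ n)" by (rule S') (use w in simp)
    have "(\<Sum>n. a n * q w ^ n) - a 0 = (\<Sum>n. a (Suc n) * q w ^ Suc n)" using suminf_split_head[OF sw] by simp
    also have "\<dots> = (\<Sum>n. q w * (a (Suc n) * q w ^ n))" by (simp add: mult_ac)
    also have "\<dots> = q w * (\<Sum>n. a (Suc n) * q w ^ n)" by (rule suminf_mult[OF summable_norm_cancel[OF sm]])
    finally have "norm ((\<Sum>n. a n * q w ^ n) - a 0) = exp (- s * Im w) * norm (\<Sum>n. a (Suc n) * q w ^ n)"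
      by (simp add: norm_mult nq)
    also have "norm (\<Sum>n. a (Suc n) * q w ^ n) \<le> B1"
      unfolding B1_def using summable_norm[OF sm] suminf_le[OF le sm sn1] by linarith
    finally show ?thesis by (simp add: mult.commute mult_left_mono)
  qed
  have ne: "norm (exp (\<i> * of_real (s * \<kappa>) * w)) = exp (- s * \<kappa> * Im w)" for w by simp
  show "\<exists>C. decaying f r A C" if "0 < \<kappa> \<or> a 0 = 0"
  proof -
    have "\<exists>t E. 0 < t \<and> 0 \<le> E \<and> (\<forall>w. 1/5 \<le> Im w \<longrightarrow> norm (H w) \<le> E * exp (- t * Im w))"
    proof (cases "0 < \<kappa>")
      case True
      have "norm (H w) \<le> B * exp (- (s * \<kappa>) * Im w)" if w: "1/5 \<le> Im w" for w
        using sumB[OF w] Heq[of w] w by (simp add: norm_mult mult.commute mult_left_mono)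
      then show ?thesis using True s0 B0 by (intro exI[of _ "s * \<kappa>"] exI[of _ B]) auto
    next
      case False
      then have "a 0 = 0" using that by simp
      have "norm (H w) \<le> B1 * exp (- s * Im w)" if w: "1/5 \<le> Im w" for w
      proof -
        have "norm (H w) = exp (- s * \<kappa> * Im w) * norm (\<Sum>n. a n * q w ^ n)" using Heq[of w] w by (simp add: norm_mult)
        also have "\<dots> \<le> 1 * norm (\<Sum>n. a n * q w ^ n)" using s0 k w by (intro mult_right_mono) auto
        finally show ?thesis using sumB1[OF w] \<open>a 0 = 0\<close> by simp
      qed
      then show ?thesis using s0 B10 by (intro exI[of _ s] exI[of _ B1]) auto
    qed
    then obtain t E where t: "0 < t" "0 \<le> E" "\<And>w. 1/5 \<le> Im w \<Longrightarrow> norm (H w) \<le> E * exp (- t * Im w)" by blast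
    define C where "C = max (E / M) (1 / t)"
    have C: "0 < C" "E / M \<le> C" "1 / t \<le> C" using t by (auto simp: C_def less_max_iff_disj)
    have "slash_norm f r A w \<le> C * exp (- Im w / C)" if w: "1/5 \<le> Im w" for w
    proof -
      have "slash_norm f r A w \<le> (E / M) * exp (- t * Im w)" using slash_norm[of w] w t(3)[OF w] M0 by (simp add: divide_right_mono)
      also have "\<dots> \<le> C * exp (- Im w / C)"
      proof (intro mult_mono)
        have "1 / C \<le> t" using C t by (simp add: field_simps)
        then have "Im w * (1 / C) \<le> Im w * t" using w by (intro mult_left_mono) auto
        then show "exp (- t * Im w) \<le> exp (- Im w / C)" by (simp add: mult.commute)
      qed (use C t M0 in auto)
      finally show ?thesis .
    qed
    then show ?thesis using C unfolding decaying_def by blast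
  qed
  show "\<exists>C. nondecaying f r A C" if "\<not> (0 < \<kappa> \<or> a 0 = 0)"
  proof -
    have k0: "\<kappa> = 0" and a0: "0 < norm (a 0)" using that k by auto
    \<comment> \<open>The terms serve, in order: the upper bound, the lower bound |a 0| / (2M),
      heights at least 1/5, and a height beyond which the tail is at most |a 0| / 2.\<close>
    define C where "C = max (max (B / M) (2 * M / norm (a 0))) (max (1/5) (2 * B1 / (norm (a 0) * s)))"
    have C: "B / M \<le> C" "2 * M / norm (a 0) \<le> C" "1/5 \<le> C" "2 * B1 / (norm (a 0) * s) \<le> C"
      by (simp_all only: C_def le_max_iff_disj order.refl simp_thms)
    have Hn: "norm (H w) = norm (\<Sum>n. a n * q w ^ n)" if "0 < Im w" for w using Heq[OF that] k0 by simp
    have "slash_norm f r A w \<le> C" if w: "1/5 \<le> Im w" for w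
    proof -
      have "slash_norm f r A w \<le> B / M" using slash_norm[of w] Hn[of w] sumB[OF w] w M0 by (simp add: divide_right_mono)
      then show ?thesis using C by linarith
    qed
    moreover have "1 / C \<le> slash_norm f r A w" if w: "C \<le> Im w" for w
    proof -
      have w5: "1/5 \<le> Im w" using w C by linarith
      have "B1 * exp (- s * Im w) \<le> norm (a 0) / 2"
      proof -
        have "2 * B1 / (norm (a 0) * s) \<le> Im w" using w C by linarith
        then have "2 * B1 \<le> norm (a 0) * (s * Im w)" using a0 s0 by (simp add: field_simps)
        also have "\<dots> \<le> norm (a 0) * exp (s * Im w)"
        proof (intro mult_left_mono)
          show "s * Im w \<le> exp (s * Im w)" using exp_ge_add_one_self[of "s * Im w"] by linarith
        qed simp
        finally show ?thesis by (simp add: exp_minus field_simps)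
      qed
      then have "norm ((\<Sum>n. a n * q w ^ n) - a 0) \<le> norm (a 0) / 2" using sumB1[OF w5] by linarith
      then have "norm (a 0) / 2 \<le> norm (\<Sum>n. a n * q w ^ n)"
        using norm_triangle_ineq3[of "\<Sum>n. a n * q w ^ n" "a 0"] by linarith
      from divide_right_mono[OF this, of M] have "norm (a 0) / 2 / M \<le> slash_norm f r A w" using slash_norm[of w] Hn[of w] w5 M0 by simp
      moreover have "1 / C \<le> norm (a 0) / 2 / M"
      proof -
        have "0 < 2 * M / norm (a 0)" using a0 M0 by simp
        then have "1 / C \<le> 1 / (2 * M / norm (a 0))" using C(2) by (intro divide_left_mono mult_pos_pos) linarith+
        then show ?thesis by simp
      qed
      ultimately show ?thesis by linarith
    qed
    ultimately show ?thesis using C unfolding nondecaying_def by (intro exI[of _ C]) (auto intro: less_le_trans[OF _ C(3)])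
  qed
qed

text \<open>The expansion at infinity is assumed and later read off from the given series of
  \<open>f\<close>. Expansions at finite cusps are derived in
  \<open>fourier_expansion_exists\<close> from the growth near the real line.\<close>

locale modform =
  fixes \<Gamma> :: "mat2 set" and \<mu> :: "mat2 \<Rightarrow> complex" and r :: real and f :: "complex \<Rightarrow> complex"
  assumes mf: "modular_form \<Gamma> \<mu> r f"
    and nonzero: "\<exists>z. 0 < Im z \<and> f z \<noteq> 0"
    and expansion_at_infinity: "\<exists>\<kappa> a. fourier_expansion_at f r \<Gamma> (1,0,0,1) \<kappa> a"
begin

section \<open>Expansions and uniform growth at all cusps\<close>

lemma finite_index: "finite_index_subgroup \<Gamma>" and r_pos: "0 < r" and f_holomorphic: "f holomorphic_on {z. 0 < Im z}"
  using mf by (auto simp: modular_form_def)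

lemma Gamma_subset: "\<gamma> \<in> \<Gamma> \<Longrightarrow> \<gamma> \<in> carrier SL2Z"
  using finite_index subgroup.subset by (fastforce simp: finite_index_subgroup_def)

lemma norm_automorphy:
  assumes "\<gamma> \<in> \<Gamma>" "0 < Im z"
  shows "norm (f (moebius \<gamma> z)) = norm (cocycle \<gamma> z) powr r * norm (f z)"
proof -
  obtain a b c d where g: "\<gamma> = (a,b,c,d)" by (cases \<gamma>)
  have "f (moebius \<gamma> z) = \<mu> \<gamma> * (case \<gamma> of (a,b,c,d) \<Rightarrow> (of_int c * z + of_int d) powr complex_of_real r) * f z"
    and "norm (\<mu> \<gamma>) = 1"
    using mf assms unfolding modular_form_def by blast+
  then show ?thesis by (simp add: g norm_mult cocycle_def norm_powr_real_powr')
qed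

lemma slash_norm_Gamma:
  assumes "\<gamma> \<in> \<Gamma>" "A \<in> carrier SL2Z" "0 < Im w"
  shows "slash_norm f r (mmul \<gamma> A) w = slash_norm f r A w"
proof -
  have g: "\<gamma> \<in> carrier SL2Z" using assms Gamma_subset by blast
  have "norm (cocycle \<gamma> (moebius A w)) powr r > 0"
    using cocycle_nonzero[OF g Im_moebius_pos[OF assms(2,3)]] by simp
  then show ?thesis
    by (simp add: slash_norm_def moebius_mmul[OF g assms(2,3)] cocycle_mmul[OF g assms(2,3)] norm_mult powr_mult
        norm_automorphy[OF assms(1) Im_moebius_pos[OF assms(2,3)]])
qed

text \<open>The conjugate by \<open>A\<close> of translation by the width lies in
  \<open>\<Gamma>\<close> up to sign, and the sign does not affect moduli.\<close>

lemma slash_norm_width: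
  assumes A: "A \<in> carrier SL2Z" and w: "0 < Im w"
  shows "slash_norm f r A (w + of_nat (cusp_width \<Gamma> A)) = slash_norm f r A w"
proof -
  define m where "m = cusp_width \<Gamma> A"
  define T where "T = mmul A (1, int m, 0, 1)"
  define h where "h = mmul T (minv A)"
  have hA: "mmul h A = T" by (simp add: h_def mmul_assoc mmul_minv A)
  have "slash_norm f r T w = slash_norm f r A w"
    using cusp_width_props(2)[OF finite_index A]
  proof
    assume "mmul (mmul A (1, int (cusp_width \<Gamma> A), 0, 1)) (minv A) \<in> \<Gamma>"
    then have "h \<in> \<Gamma>" by (simp add: h_def T_def m_def)
    then show ?thesis using slash_norm_Gamma[OF _ A w] hA by metis
  next
    assume "mneg (mmul (mmul A (1, int (cusp_width \<Gamma> A), 0, 1)) (minv A)) \<in> \<Gamma>"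
    then have "mneg h \<in> \<Gamma>" by (simp add: h_def T_def m_def)
    moreover have "mmul (mneg h) A = mneg T" unfolding hA[symmetric] by (cases h; cases A) (simp add: mmul_def mneg_def)
    ultimately show ?thesis using slash_norm_Gamma[OF _ A w] slash_norm_mneg by metis
  qed
  then show ?thesis using slash_norm_translation[OF A w, of f r "int m"] by (simp add: T_def m_def)
qed

lemma moebius_holomorphic:
  assumes "A \<in> carrier SL2Z"
  shows "moebius A holomorphic_on {z. 0 < Im z}"
proof -
  obtain a b c d where A: "A = (a,b,c,d)" by (cases A)
  show ?thesis unfolding A moebius_def
    using cocycle_nonzero[OF assms] by (auto simp: A cocycle_def intro!: holomorphic_intros)
qed

lemma f_moebius_holomorphic:
  assumes "A \<in> carrier SL2Z"
  shows "(\<lambda>w. f (moebius A w)) holomorphic_on {z. 0 < Im z}"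
proof -
  have "(f \<circ> moebius A) holomorphic_on {z. 0 < Im z}"
    by (rule holomorphic_on_compose[OF moebius_holomorphic[OF assms] holomorphic_on_subset[OF f_holomorphic]])
      (use Im_moebius_pos[OF assms] in auto)
  then show ?thesis by (simp add: o_def)
qed

lemma f_moebius_nonzero:
  assumes "A \<in> carrier SL2Z"
  obtains w where "0 < Im w" "f (moebius A w) \<noteq> 0"
proof -
  obtain z where z: "0 < Im z" "f z \<noteq> 0" using nonzero by blast
  show thesis
    by (rule that[of "moebius (minv A) z"])
      (use z assms in \<open>auto simp: moebius_minv intro!: Im_moebius_pos minv_closed\<close>)
qed

text \<open>At a finite cusp c is nonzero, so the denominator stays off the branch cut and the slash
  is holomorphic. Its modulus is periodic, so it is itself periodic up to a unimodular factor, whose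
  argument gives kappa. High points are sent close to the real line, where \<open>f\<close> grows at
  most polynomially; hence so does the slash, and no negative exponents occur.\<close>

lemma fourier_expansion_exists:
  assumes A: "A \<in> carrier SL2Z" and nz: "cusp_of A \<noteq> None"
  shows "\<exists>\<kappa> a. fourier_expansion_at f r \<Gamma> A \<kappa> a"
proof -
  obtain a b c d where A': "A = (a,b,c,d)" by (cases A)
  have c0: "c \<noteq> 0" using nz by (auto simp: A' cusp_of_def)
  define m where "m = cusp_width \<Gamma> A"
  have m: "0 < m" unfolding m_def by (rule cusp_width_props(1)[OF finite_index A])
  then have m1: "1 \<le> real m" by simp
  define S where "S = {z::complex. 0 < Im z}"
  have oS: "open S" and cS: "connected S"
    unfolding S_def by (auto intro: open_halfspace_Im_gt convex_connected convex_halfspace_Im_gt)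
  define H where "H = f_sigma f r A m"
  have Hn: "norm (H z) = real m powr (r/2) * slash_norm f r A (of_nat m * z)" if "0 < Im z" for z
    unfolding H_def by (rule norm_f_sigma[OF A m that])
  have Hhol: "H holomorphic_on S"
  proof -
    have h1: "((\<lambda>w. f (moebius A w)) \<circ> (\<lambda>z. of_nat m * z)) holomorphic_on S"
      by (rule holomorphic_on_compose[OF _ holomorphic_on_subset[OF f_moebius_holomorphic[OF A]]])
        (use m in \<open>auto simp: S_def intro!: holomorphic_intros\<close>)
    define den where "den z = complex_of_real (of_int c * sqrt (real m)) * z + complex_of_real (of_int d / sqrt (real m))" for z
    have den: "den z \<notin> \<real>\<^sub>\<le>\<^sub>0" if "z \<in> S" for z
      using that c0 m by (auto simp: S_def den_def complex_nonpos_Reals_iff)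
    then have den0: "den z \<noteq> 0" if "z \<in> S" for z using that by force
    have hden: "den holomorphic_on S" unfolding den_def by (intro holomorphic_intros)
    have "(\<lambda>z. den z powr complex_of_real r) holomorphic_on S"
      by (rule holomorphic_on_powr[OF hden holomorphic_on_const den])
    then have "(\<lambda>z. ((\<lambda>w. f (moebius A w)) \<circ> (\<lambda>z. of_nat m * z)) z / den z powr complex_of_real r) holomorphic_on S"
      by (rule holomorphic_on_divide[OF h1]) (use den0 in simp)
    then show ?thesis
      by (simp add: H_def f_sigma_def[abs_def] A' o_def den_def)
  qed
  have Hshift: "(\<lambda>z. H (z + 1)) holomorphic_on S"
  proof -
    have "(H \<circ> (\<lambda>z. z + 1)) holomorphic_on S"
      by (rule holomorphic_on_compose[OF _ holomorphic_on_subset[OF Hhol]]) (auto simp: S_def intro!: holomorphic_intros)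
    then show ?thesis by (simp add: o_def)
  qed
  have per: "norm (H (z + 1)) = norm (H z)" if "z \<in> S" for z
    using that slash_norm_width[OF A, of "of_nat m * z"] m by (simp add: S_def Hn distrib_left m_def)
  obtain z0 where z0: "z0 \<in> S" "H z0 \<noteq> 0"
  proof -
    obtain w where w: "0 < Im w" "f (moebius A w) \<noteq> 0" using f_moebius_nonzero[OF A] by blast
    have "0 < slash_norm f r A w" using w cocycle_nonzero[OF A w(1)] by (simp add: slash_norm_def)
    then have "norm (H (w / of_nat m)) \<noteq> 0" using Hn[of "w / of_nat m"] w m by simp
    then show thesis using that[of "w / of_nat m"] w m by (auto simp: S_def)
  qed
  obtain \<epsilon> where eps: "norm \<epsilon> = 1" "\<And>z. z \<in> S \<Longrightarrow> H (z + 1) = \<epsilon> * H z"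
    using unimodular_ratio_constant[OF oS cS Hshift Hhol per z0] by blast
  define \<kappa> where "\<kappa> = Arg2pi \<epsilon> / (2 * pi)"
  have k: "0 \<le> \<kappa>" "\<kappa> < 1" using Arg2pi[of \<epsilon>] by (auto simp: \<kappa>_def)
  have ek: "\<epsilon> = exp (2 * pi * \<i> * \<kappa>)"
    using Arg2pi_eq[of \<epsilon>] eps(1) by (simp add: \<kappa>_def mult_ac)
  define U where "U z = H z * exp (- (2 * pi * \<i> * \<kappa>) * z)" for z
  have Uhol: "U holomorphic_on {z. 0 < Im z}"
    unfolding U_def S_def[symmetric] by (intro holomorphic_intros Hhol)
  have Uper: "U (z + 1) = U z" if "0 < Im z" for z
  proof -
    have "exp (- (2 * pi * \<i> * \<kappa>) * (z + 1)) * \<epsilon> = exp (- (2 * pi * \<i> * \<kappa>) * z)"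
      unfolding ek exp_add[symmetric] by (simp add: algebra_simps)
    then show ?thesis using eps(2)[of z] that by (simp add: U_def S_def mult_ac)
  qed
  obtain C N \<delta> where gr: "0 < \<delta>" "\<And>z. 0 < Im z \<Longrightarrow> Im z < \<delta> \<Longrightarrow> norm (f z) \<le> C * Im z powr (- N)"
    using mf unfolding modular_form_def by blast
  define C' where "C' = max C 0"
  define N' where "N' = max N 0"
  define L where "L = 2 * \<bar>real_of_int c\<bar> * real m + \<bar>real_of_int d\<bar>"
  have c1: "1 \<le> \<bar>real_of_int c\<bar>" using c0 by linarith
  have L1: "1 \<le> L" using mult_mono[OF c1 m1] by (simp add: L_def)
  have Hb: "norm (H z) \<le> C' * (L * Im z) powr (2 * N')" if z: "\<bar>Re z\<bar> \<le> 1" "max 1 (2 / \<delta>) \<le> Im z" for z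
  proof -
    define y where "y = Im z"
    have y: "1 \<le> y" "2 / \<delta> \<le> y" using z by (auto simp: y_def)
    define w where "w = of_nat m * z"
    have imw: "Im w = real m * y" "0 < Im w" using m y by (auto simp: w_def y_def)
    define J where "J = norm (cocycle A w)"
    have J: "\<bar>real_of_int c\<bar> * (real m * y) \<le> J"
      using abs_Im_le_cmod[of "cocycle A w"] y m by (simp add: J_def A' cocycle_def w_def y_def abs_mult)
    have my: "1 \<le> real m * y" using mult_mono[OF m1 y(1)] by simp
    have J1: "real m * y \<le> J" using J mult_right_mono[OF c1, of "real m * y"] my by simp
    then have J2: "1 \<le> J" using my by linarith
    have JL: "J \<le> L * y"
    proof -
      have "J \<le> \<bar>real_of_int c\<bar> * norm w + \<bar>real_of_int d\<bar>"
        using norm_triangle_ineq[of "of_int c * w" "of_int d"] by (simp add: J_def A' cocycle_def norm_mult)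
      also have "norm w \<le> real m * (2 * y)"
        using cmod_le[of z] z y by (simp add: w_def norm_mult y_def mult_left_mono)
      also have "\<bar>real_of_int c\<bar> * (real m * (2 * y)) + \<bar>real_of_int d\<bar> \<le> \<bar>real_of_int c\<bar> * (real m * (2 * y)) + \<bar>real_of_int d\<bar> * y"
        using y by (simp add: mult_le_cancel_left1)
      also have "\<dots> = L * y" by (simp add: L_def algebra_simps)
      finally show ?thesis by (simp add: mult_left_mono)
    qed
    have im: "Im (moebius A w) = real m * y / J\<^sup>2" using Im_moebius[OF A imw(2)] by (simp add: imw J_def)
    have im0: "0 < Im (moebius A w)" by (rule Im_moebius_pos[OF A imw(2)])
    have my2: "(real m * y)\<^sup>2 \<le> J\<^sup>2" using J1 my by (intro power_mono) auto
    have "0 < (real m * y)\<^sup>2" by (rule zero_less_power) (use my in linarith)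
    then have "real m * y / J\<^sup>2 \<le> (real m * y) / (real m * y)\<^sup>2"
      using my2 my by (intro frac_le) auto
    also have "\<dots> = 1 / (real m * y)" using my by (simp add: power2_eq_square)
    also have "\<dots> \<le> 1 / y" using mult_right_mono[OF m1, of y] y my by (intro frac_le) auto
    finally have im1: "Im (moebius A w) \<le> 1 / y" by (simp add: im)
    have "1 / y \<le> \<delta> / 2" using y gr(1) by (simp add: field_simps)
    then have imd: "Im (moebius A w) < \<delta>" using im1 gr(1) by linarith
    have im1': "Im (moebius A w) \<le> 1" using im1 y by (simp add: order_trans[OF im1])
    have "norm (f (moebius A w)) \<le> C * Im (moebius A w) powr (- N)" by (rule gr(2)[OF im0 imd])
    also have "\<dots> \<le> C' * Im (moebius A w) powr (- N')"
      using im0 im1' by (intro mult_mono powr_mono') (auto simp: C'_def N'_def)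
    also have "\<dots> \<le> C' * (L * y) powr (2 * N')"
    proof (intro mult_left_mono)
      have "Im (moebius A w) powr (- N') = (J\<^sup>2 / (real m * y)) powr N'"
        using my J2 by (simp add: im powr_minus powr_divide)
      also have "\<dots> \<le> ((L * y)\<^sup>2) powr N'"
      proof (rule powr_mono2)
        have "J\<^sup>2 / (real m * y) \<le> J\<^sup>2 / 1" using my by (intro divide_left_mono) auto
        also have "\<dots> \<le> (L * y)\<^sup>2" using JL J2 by (simp add: power_mono)
        finally show "J\<^sup>2 / (real m * y) \<le> (L * y)\<^sup>2" .
      qed (use my in \<open>auto simp: N'_def\<close>)
      also have "((L * y)\<^sup>2) powr N' = (L * y) powr (2 * N')"
        using L1 y by (simp add: powr_powr flip: powr_numeral)
      finally show "Im (moebius A w) powr (- N') \<le> (L * y) powr (2 * N')" .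
    qed (simp add: C'_def)
    finally have fb: "norm (f (moebius A w)) \<le> C' * (L * y) powr (2 * N')" .
    have mr: "real m powr (r/2) \<le> J powr r"
    proof -
      have "real m powr (r/2) \<le> (real m * y) powr (r/2)" using y m1 r_pos by (intro powr_mono2) auto
      also have "\<dots> \<le> (real m * y) powr r" using my r_pos by (intro powr_mono) auto
      also have "\<dots> \<le> J powr r" using J1 my r_pos by (intro powr_mono2) auto
      finally show ?thesis .
    qed
    have "norm (H z) = norm (f (moebius A w)) * (real m powr (r/2) / J powr r)"
      using Hn[of z] y by (simp add: slash_norm_def w_def y_def J_def)
    also have "\<dots> \<le> norm (f (moebius A w)) * 1" using mr J2 by (intro mult_left_mono) auto
    finally show ?thesis using fb by (simp add: y_def)
  qed
  have lim: "\<exists>Y. \<forall>z. \<bar>Re z\<bar> \<le> 1 \<and> Y \<le> Im z \<longrightarrow> norm (U z) * exp (- 2 * pi * Im z) < e" if e: "0 < e" for e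
  proof -
    \<comment> \<open>Half of the available rate 2 pi (1 - kappa): one half absorbs the polynomial
      growth, and exp(-ty) remains.\<close>
    define t where "t = pi * (1 - \<kappa>)"
    have t: "0 < t" using k by (simp add: t_def)
    define s where "s = 2 * N' + 1"
    have s: "0 < s" by (simp add: s_def N'_def)
    define D where "D = C' * ((s / t) powr s * L powr s)"
    have D: "0 \<le> D" by (simp add: D_def C'_def)
    define Y where "Y = max (max 1 (2 / \<delta>)) (D / (e * t))"
    have "norm (U z) * exp (- 2 * pi * Im z) < e" if z: "\<bar>Re z\<bar> \<le> 1" "Y \<le> Im z" for z
    proof -
      define y where "y = Im z"
      have y: "max 1 (2 / \<delta>) \<le> y" "1 \<le> y" "D / (e * t) \<le> y" using z by (auto simp: Y_def y_def)
      have "norm (U z) = norm (H z) * exp (2 * pi * \<kappa> * y)" by (simp add: U_def norm_mult y_def)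
      also have "\<dots> \<le> C' * (L * y) powr (2 * N') * exp (2 * pi * \<kappa> * y)"
        using Hb[OF z(1)] y by (intro mult_right_mono) (auto simp: y_def)
      also have "\<dots> \<le> C' * ((s / t) powr s * exp (t * y) * L powr s) * exp (2 * pi * \<kappa> * y)"
      proof (intro mult_right_mono mult_left_mono)
        have "1 \<le> L * y" using mult_mono[OF L1 y(2)] L1 by simp
        then have "(L * y) powr (2 * N') \<le> (L * y) powr s" by (intro powr_mono) (auto simp: s_def)
        also have "\<dots> = y powr s * L powr s" using L1 y by (simp add: powr_mult)
        also have "\<dots> \<le> ((s / t) powr s * exp (t * y)) * L powr s"
          using s t y by (intro mult_right_mono powr_exp_bound) auto
        finally show "(L * y) powr (2 * N') \<le> (s / t) powr s * exp (t * y) * L powr s" .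
      qed (auto simp: C'_def)
      also have "\<dots> = D * (exp (t * y) * exp (2 * pi * \<kappa> * y))" by (simp add: D_def)
      finally have "norm (U z) * exp (- 2 * pi * y) \<le> D * (exp (t * y) * exp (2 * pi * \<kappa> * y)) * exp (- 2 * pi * y)"
        by (rule mult_right_mono) simp
      also have "\<dots> = D * (exp (t * y) * exp (2 * pi * \<kappa> * y) * exp (- 2 * pi * y))" by simp
      also have "exp (t * y) * exp (2 * pi * \<kappa> * y) * exp (- 2 * pi * y) = exp (- t * y)"
        by (simp add: t_def algebra_simps flip: exp_add)
      also have "D * exp (- t * y) < e"
      proof -
        have "D / e \<le> t * y" using y(3) t e by (simp add: field_simps)
        also have "\<dots> < exp (t * y)" using exp_ge_add_one_self[of "t * y"] by linarith
        finally show ?thesis using e by (simp add: exp_minus field_simps)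
      qed
      finally show ?thesis by (simp add: y_def)
    qed
    then show ?thesis by blast
  qed
  obtain a' where a': "\<And>z. 0 < Im z \<Longrightarrow> (\<lambda>n. a' n * exp (2 * pi * \<i> * z) ^ n) sums U z"
    using periodic_power_series[OF Uhol Uper lim] by blast
  have "(\<lambda>n. a' n * exp (2 * pi * \<i> * complex_of_real (real n + \<kappa>) * z)) sums H z" if "0 < Im z" for z
  proof -
    have "(\<lambda>n. exp (2 * pi * \<i> * \<kappa> * z) * (a' n * exp (2 * pi * \<i> * z) ^ n)) sums (exp (2 * pi * \<i> * \<kappa> * z) * U z)"
      by (intro sums_mult a' that)
    moreover have "exp (2 * pi * \<i> * \<kappa> * z) * U z = H z"
      by (simp add: U_def exp_minus field_simps)
    moreover have "exp (2 * pi * \<i> * \<kappa> * z) * (a' n * exp (2 * pi * \<i> * z) ^ n) = a' n * exp (2 * pi * \<i> * complex_of_real (real n + \<kappa>) * z)" for n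
    proof -
      have "2 * pi * \<i> * complex_of_real (real n + \<kappa>) * z = 2 * pi * \<i> * \<kappa> * z + of_nat n * (2 * pi * \<i> * z)"
        by (simp add: algebra_simps)
      then show ?thesis by (simp add: exp_add exp_of_nat_mult)
    qed
    ultimately show ?thesis by (simp only:)
  qed
  then show ?thesis using k unfolding fourier_expansion_at_def H_def m_def by blast
qed

text \<open>\<open>cuspidal_at\<close> asks for some matrix and some expansion. Growth does not
  depend on such choices, and since decay and non-decay exclude each other, the failure of
  cuspidality also acquires a quantitative form.\<close>

lemma cuspidal_iff_decaying:
  assumes A: "A \<in> carrier SL2Z"
  shows "cuspidal_at f r \<Gamma> (cusp_of A) \<longleftrightarrow> (\<exists>C. decaying f r A C)"
    and "\<not> cuspidal_at f r \<Gamma> (cusp_of A) \<longleftrightarrow> (\<exists>C. nondecaying f r A C)"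
proof -
  obtain B \<kappa> a where B: "B \<in> carrier SL2Z" "cusp_of B = cusp_of A" "fourier_expansion_at f r \<Gamma> B \<kappa> a"
  proof (cases "cusp_of A")
    case None
    then show thesis using that[OF one_in_SL2Z] expansion_at_infinity by (auto simp: cusp_of_def)
  next
    case (Some p)
    then show thesis using that[OF A] fourier_expansion_exists[OF A] by auto
  qed
  note dich = fourier_expansion_dichotomy[OF _ cusp_width_props(1)[OF finite_index]]
  have "\<exists>C. decaying f r A C" if "cuspidal_at f r \<Gamma> (cusp_of A)"
  proof -
    from that obtain G k b where G: "G \<in> carrier SL2Z" "cusp_of G = cusp_of A" "fourier_expansion_at f r \<Gamma> G k b" "0 < k \<or> b 0 = 0"
      unfolding cuspidal_at_def by blast
    then show ?thesis using dich(1)[OF G(1) G(1) G(3,4)] decaying_same_cusp(1)[OF G(1) A G(2)] by blast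
  qed
  moreover have "\<exists>C. nondecaying f r A C" if "\<not> cuspidal_at f r \<Gamma> (cusp_of A)"
  proof -
    have "\<not> (0 < \<kappa> \<or> a 0 = 0)" using that B unfolding cuspidal_at_def by metis
    then show ?thesis using dich(2)[OF B(1) B(1) B(3)] decaying_same_cusp(2)[OF B(1) A B(2)] by blast
  qed
  ultimately show "cuspidal_at f r \<Gamma> (cusp_of A) \<longleftrightarrow> (\<exists>C. decaying f r A C)"
    and "\<not> cuspidal_at f r \<Gamma> (cusp_of A) \<longleftrightarrow> (\<exists>C. nondecaying f r A C)"
    using not_decaying_and_nondecaying by blast+
qed

lemma decaying_Gamma:
  assumes "\<gamma> \<in> \<Gamma>" "A \<in> carrier SL2Z"
  shows "decaying f r (mmul \<gamma> A) C \<longleftrightarrow> decaying f r A C" "nondecaying f r (mmul \<gamma> A) C \<longleftrightarrow> nondecaying f r A C"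
proof -
  have eq: "slash_norm f r (mmul \<gamma> A) w = slash_norm f r A w" if "0 < Im w" for w using slash_norm_Gamma[OF assms that] .
  then have 1: "1/5 \<le> Im w \<Longrightarrow> slash_norm f r (mmul \<gamma> A) w = slash_norm f r A w" for w by simp
  show "decaying f r (mmul \<gamma> A) C \<longleftrightarrow> decaying f r A C" unfolding decaying_def using 1 by auto
  have "0 < C \<Longrightarrow> C \<le> Im w \<Longrightarrow> slash_norm f r (mmul \<gamma> A) w = slash_norm f r A w" for w using eq by simp
  then show "nondecaying f r (mmul \<gamma> A) C \<longleftrightarrow> nondecaying f r A C" unfolding nondecaying_def using 1 by auto
qed

lemma cuspidal_Gamma:
  assumes "\<gamma> \<in> \<Gamma>" "A \<in> carrier SL2Z"
  shows "cuspidal_at f r \<Gamma> (cusp_of (mmul \<gamma> A)) \<longleftrightarrow> cuspidal_at f r \<Gamma> (cusp_of A)"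
  using cuspidal_iff_decaying(1)[OF mmul_closed[OF Gamma_subset[OF assms(1)] assms(2)]]
    cuspidal_iff_decaying(1)[OF assms(2)] decaying_Gamma(1)[OF assms] by blast

text \<open>Both properties depend only on the coset of the matrix, and there are finitely many
  cosets, so the largest of finitely many constants serves all matrices at once.\<close>

lemma uniform_decay:
  obtains C where "0 < C"
    "\<And>A. A \<in> carrier SL2Z \<Longrightarrow> cuspidal_at f r \<Gamma> (cusp_of A) \<Longrightarrow> decaying f r A C"
    "\<And>A. A \<in> carrier SL2Z \<Longrightarrow> \<not> cuspidal_at f r \<Gamma> (cusp_of A) \<Longrightarrow> nondecaying f r A C"
proof -
  obtain R where R: "finite R" "R \<subseteq> carrier SL2Z" "\<And>A. A \<in> carrier SL2Z \<Longrightarrow> \<exists>\<gamma>\<in>\<Gamma>. \<exists>g\<in>R. A = mmul \<gamma> g"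
    using finite_index_representatives[OF finite_index] by blast
  have "\<forall>g\<in>R. \<exists>C. decaying f r g C \<or> nondecaying f r g C"
    using cuspidal_iff_decaying R(2) by blast
  then obtain D where D: "\<And>g. g \<in> R \<Longrightarrow> decaying f r g (D g) \<or> nondecaying f r g (D g)" by metis
  define C where "C = Max (insert 1 (D ` R))"
  have C: "1 \<le> C" "\<And>g. g \<in> R \<Longrightarrow> D g \<le> C" using R(1) by (auto simp: C_def)
  have DC: "decaying f r g C \<or> nondecaying f r g C" if "g \<in> R" for g
    using D[OF that] C(2)[OF that] decaying_mono nondecaying_mono by blast
  show thesis
  proof (rule that[of C])
    show "0 < C" using C by simp
    fix A assume A: "A \<in> carrier SL2Z"
    then obtain \<gamma> g where g: "\<gamma> \<in> \<Gamma>" "g \<in> R" "A = mmul \<gamma> g" using R(3) by blast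
    have g': "g \<in> carrier SL2Z" using g R by blast
    have "decaying f r A C \<or> nondecaying f r A C" using DC[OF g(2)] decaying_Gamma[OF g(1) g'] g(3) by blast
    then show "cuspidal_at f r \<Gamma> (cusp_of A) \<Longrightarrow> decaying f r A C" "\<not> cuspidal_at f r \<Gamma> (cusp_of A) \<Longrightarrow> nondecaying f r A C"
      using cuspidal_iff_decaying[OF A] by blast+
  qed
qed

text \<open>For each representative the zero set of the composed form has no interior, so finitely
  many such sets can be avoided by one point. Its images under all of \<open>SL2Z\<close> then carry
  a uniform lower bound, which is moved towards irrational points.\<close>

lemma common_nonzero_point:
  obtains w c where "0 < Im w" "0 < c" "\<And>A. A \<in> carrier SL2Z \<Longrightarrow> c \<le> slash_norm f r A w"
proof -
  obtain R where R: "finite R" "R \<subseteq> carrier SL2Z" "\<And>A. A \<in> carrier SL2Z \<Longrightarrow> \<exists>\<gamma>\<in>\<Gamma>. \<exists>g\<in>R. A = mmul \<gamma> g"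
    using finite_index_representatives[OF finite_index] by blast
  have "\<exists>V. open V \<and> V \<noteq> {} \<and> V \<subseteq> {z. 0 < Im z} \<and> (\<forall>g\<in>R. \<forall>w\<in>V. f (moebius g w) \<noteq> 0)"
    using R(1,2)
  proof (induction R rule: finite_induct)
    case empty
    have "\<i> \<in> {z. 0 < Im z}" by simp
    then show ?case using open_halfspace_Im_gt[of 0] by (intro exI[of _ "{z. 0 < Im z}"]) blast
  next
    case (insert g R)
    then obtain V where V: "open V" "V \<noteq> {}" "V \<subseteq> {z. 0 < Im z}" "\<forall>g\<in>R. \<forall>w\<in>V. f (moebius g w) \<noteq> 0" by auto
    have g: "g \<in> carrier SL2Z" using insert by simp
    have hol: "(\<lambda>w. f (moebius g w)) holomorphic_on {z. 0 < Im z}" by (rule f_moebius_holomorphic[OF g])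
    define W where "W = {w \<in> V. f (moebius g w) \<noteq> 0}"
    have "W \<noteq> {}"
    proof
      assume "W = {}"
      then have z: "\<And>w. w \<in> V \<Longrightarrow> f (moebius g w) = 0" by (auto simp: W_def)
      obtain w where w: "0 < Im w" "f (moebius g w) \<noteq> 0" using f_moebius_nonzero[OF g] by blast
      have "f (moebius g w) = 0"
        by (rule analytic_continuation_open[OF V(1) open_halfspace_Im_gt[of 0] V(2) _ V(3) hol holomorphic_on_const z])
          (use w in \<open>auto intro: convex_connected convex_halfspace_Im_gt\<close>)
      then show False using w by simp
    qed
    moreover have "open W"
    proof -
      have "continuous_on V (\<lambda>w. f (moebius g w))" using hol V(3) holomorphic_on_imp_continuous_on continuous_on_subset by blast
      moreover have "open (- {0::complex})" by (intro open_Compl) simp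
      ultimately have "open ((\<lambda>w. f (moebius g w)) -` (- {0}) \<inter> V)" using continuous_on_open_vimage[OF V(1)] by blast
      moreover have "(\<lambda>w. f (moebius g w)) -` (- {0}) \<inter> V = W" by (auto simp: W_def)
      ultimately show ?thesis by simp
    qed
    ultimately show ?case using V by (intro exI[of _ W]) (auto simp: W_def)
  qed
  then obtain w where w: "0 < Im w" "\<And>g. g \<in> R \<Longrightarrow> f (moebius g w) \<noteq> 0" by blast
  define c where "c = Min (insert 1 ((\<lambda>g. slash_norm f r g w) ` R))"
  have "0 < slash_norm f r g w" if "g \<in> R" for g
    using w(2)[OF that] cocycle_nonzero[of g w] w(1) that R(2) by (auto simp: slash_norm_def)
  then have c0: "0 < c" using R(1) by (auto simp: c_def)
  have "c \<le> slash_norm f r A w" if A: "A \<in> carrier SL2Z" for A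
  proof -
    obtain \<gamma> g where g: "\<gamma> \<in> \<Gamma>" "g \<in> R" "A = mmul \<gamma> g" using R(3)[OF A] by blast
    have "c \<le> slash_norm f r g w" using R(1) g(2) by (auto simp: c_def)
    then show ?thesis using slash_norm_Gamma[OF g(1) _ w(1), of g] g R(2) by auto
  qed
  with w(1) c0 that show thesis by blast
qed

end

section \<open>Growth of modular forms near the real line\<close>

lemma infinite_rational_approx:
  fixes x :: real
  assumes x: "x \<notin> \<rat>" and S: "\<And>e. 0 < e \<Longrightarrow> \<exists>\<rho>\<in>S. \<bar>x - of_rat \<rho>\<bar> < e"
  shows "infinite S"
proof
  assume fin: "finite S"
  define e where "e = Min (insert 1 ((\<lambda>\<rho>. \<bar>x - of_rat \<rho>\<bar>) ` S))"
  have "\<bar>x - of_rat \<rho>\<bar> > 0" for \<rho> using x by auto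
  then have "0 < e" using fin by (auto simp: e_def)
  then obtain \<rho> where "\<rho> \<in> S" "\<bar>x - of_rat \<rho>\<bar> < e" using S by blast
  moreover have "e \<le> \<bar>x - of_rat \<rho>\<bar>" if "\<rho> \<in> S" for \<rho> using fin that by (auto simp: e_def)
  ultimately show False by force
qed

text \<open>For fixed first column (p, q) the second column is determined only up to multiples of
  the first, so \<open>d\<close> can be moved into any prescribed interval of length q. Small
  \<open>d\<close> keeps cw + d comparable to q; large \<open>d\<close> prevents cancellation in a
  product of matrices.\<close>

lemma irrational_approx_matrix:
  fixes x :: real and M N :: int
  assumes x: "x \<notin> \<rat>"
  obtains p b q d where "(p,b,q,d) \<in> carrier SL2Z" "N \<le> q" "0 < q" "\<bar>x - of_int p / of_int q\<bar> \<le> 1 / (of_int q)\<^sup>2"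
    "M * q \<le> d" "d \<le> (M + 1) * q"
proof -
  have inf: "infinite (approx_set x)" using x rational_iff_finite_approx_set by blast
  define K where "K = \<lceil>\<bar>x\<bar>\<rceil> + 1"
  have K: "\<bar>x\<bar> + 1 \<le> of_int K" unfolding K_def by linarith
  have "\<exists>p q. (p,q) \<in> approx_set x \<and> N \<le> q"
  proof (rule ccontr)
    assume neg: "\<not> ?thesis"
    have "approx_set x \<subseteq> {- (K * N)..K * N} \<times> {0..N}"
    proof
      fix u assume "u \<in> approx_set x"
      then obtain h k where u: "u = (h,k)" "0 < k" "\<bar>x - of_int h / of_int k\<bar> < 1 / (of_int k)\<^sup>2" "(h,k) \<in> approx_set x"
        by (auto simp: approx_set_def)
      have k: "k < N" using neg u by force
      have "1 / (real_of_int k)\<^sup>2 \<le> 1" using u(2) by (simp add: divide_le_eq one_le_power)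
      then have "\<bar>of_int h / of_int k\<bar> \<le> \<bar>x\<bar> + 1" using u(3) by linarith
      then have "\<bar>real_of_int h\<bar> \<le> (\<bar>x\<bar> + 1) * of_int k" using u(2) by (simp add: abs_divide field_simps)
      also have "\<dots> \<le> of_int K * of_int k" using K u(2) by (intro mult_right_mono) auto
      also have "\<dots> \<le> of_int K * of_int N" using K k by (intro mult_left_mono) auto
      finally have "\<bar>h\<bar> \<le> K * N" by (metis of_int_abs of_int_le_iff of_int_mult)
      then show "u \<in> {- (K * N)..K * N} \<times> {0..N}" using u k by auto
    qed
    then show False using inf finite_subset by blast
  qed
  then obtain p q where pq: "(p,q) \<in> approx_set x" "N \<le> q" by blast
  then have q: "0 < q" "coprime p q" "\<bar>x - of_int p / of_int q\<bar> < 1 / (of_int q)\<^sup>2" by (auto simp: approx_set_def)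
  obtain u v where uv: "u * p + v * q = 1" using bezout_int[of p q] q(2) by auto
  define t where "t = M - u div q"
  have d: "u + t * q = u mod q + M * q" by (simp add: t_def algebra_simps minus_div_mult_eq_mod[symmetric])
  show thesis
  proof (rule that[of p "t * p - v" q "u + t * q"])
    have "p * (u + t * q) - (t * p - v) * q = u * p + v * q" by (simp add: algebra_simps)
    then show "(p, t * p - v, q, u + t * q) \<in> carrier SL2Z" by (simp only: SL2Z_iff uv)
    show "M * q \<le> u + t * q" "u + t * q \<le> (M + 1) * q"
      unfolding d using q(1) pos_mod_sign[of q u] pos_mod_bound[of q u] by (auto simp: distrib_right simp del: pos_mod_bound)
  qed (use pq q in auto)
qed

lemma quotient_of_cusp:
  assumes "(a,b,c,d) \<in> carrier SL2Z" "c \<noteq> 0"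
  shows "snd (quotient_of (Fract a c)) = \<bar>c\<bar>" and "(of_rat (Fract a c) :: real) = of_int a / of_int c"
proof -
  have "coprime a c"
  proof (rule coprimeI)
    fix e assume "e dvd a" "e dvd c"
    then have "e dvd a * d - b * c" by simp
    then show "is_unit e" using assms by (simp add: SL2Z_iff)
  qed
  then show "snd (quotient_of (Fract a c)) = \<bar>c\<bar>" using assms(2)
    by (auto simp: quotient_of_Fract Rat.normalize_def Let_def)
  show "(of_rat (Fract a c) :: real) = of_int a / of_int c" using assms(2) by (simp add: of_rat_rat)
qed

lemma matrix_of_rat:
  obtains p b q d where "(p,b,q,d) \<in> carrier SL2Z" "0 < q" "snd (quotient_of \<rho>) = q" "(of_rat \<rho> :: real) = of_int p / of_int q" "cusp_of (p,b,q,d) = Some \<rho>"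
proof -
  obtain A where A: "A \<in> carrier SL2Z" "cusp_of A = Some \<rho>" using cusp_of_surj by blast
  obtain a b c d where A': "A = (a,b,c,d)" by (cases A)
  have c: "c \<noteq> 0" "\<rho> = Fract a c" using A(2) by (auto simp: A' cusp_of_def split: if_splits)
  show thesis
  proof (cases "0 < c")
    case True
    then show thesis using that[of a b c d] A quotient_of_cusp[of a b c d] c by (simp add: A')
  next
    case False
    then show thesis using that[of "-a" "-b" "-c" "-d"] A quotient_of_cusp[of a b c d] c by (simp add: A' SL2Z_iff cusp_of_def)
  qed
qed

section \<open>Upper and lower bounds for modular forms\<close>

context modform begin

lemma norm_f_via_slash_norm:
  assumes A: "A \<in> carrier SL2Z" and z: "0 < Im z"
  shows "norm (f z) = slash_norm f r A (moebius (minv A) z) * norm (cocycle (minv A) z) powr (- r)"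
    and "Im (moebius (minv A) z) = Im z / (norm (cocycle (minv A) z))\<^sup>2"
proof -
  have J: "0 < norm (cocycle (minv A) z)" using cocycle_nonzero[OF minv_closed[OF A] z] by simp
  have "norm (cocycle A (moebius (minv A) z)) * norm (cocycle (minv A) z) = 1"
    using moebius_minv(2)[OF A z] by (metis norm_mult norm_one)
  then have "norm (cocycle A (moebius (minv A) z)) = 1 / norm (cocycle (minv A) z)" using J by (simp add: field_simps)
  then have "slash_norm f r A (moebius (minv A) z) = norm (f z) / (1 / norm (cocycle (minv A) z)) powr r"
    by (simp add: slash_norm_def moebius_minv(1)[OF A z])
  also have "(1 / norm (cocycle (minv A) z)) powr r = norm (cocycle (minv A) z) powr (- r)"
    using J by (simp add: powr_divide powr_minus_divide)
  finally have "slash_norm f r A (moebius (minv A) z) = norm (f z) / norm (cocycle (minv A) z) powr (- r)" .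
  then show "norm (f z) = slash_norm f r A (moebius (minv A) z) * norm (cocycle (minv A) z) powr (- r)" using J by simp
  show "Im (moebius (minv A) z) = Im z / (norm (cocycle (minv A) z))\<^sup>2" by (rule Im_moebius[OF minv_closed[OF A] z])
qed

text \<open>With J = |qz - p| one has |f(z)| equal to the slash at the moved point w times
  \<open>J powr (-r)\<close>, and Im w = Im z / J^2. At a cuspidal p/q exponential decay beats
  \<open>Im w powr (-(r/2))\<close>, in which the powers of J cancel; at a non-cuspidal one only
  boundedness is available and \<open>J powr (-r)\<close> remains.\<close>

lemma f_bound_dichotomy:
  obtains C where "0 \<le> C" "\<And>z. 0 < Im z \<Longrightarrow> Im z \<le> 1 \<Longrightarrow> norm (f z) \<le> C * Im z powr (- (r/2)) \<or>
    (\<exists>p b q d. (p,b,q,d) \<in> carrier SL2Z \<and> 0 < q \<and> \<not> cuspidal_at f r \<Gamma> (cusp_of (p,b,q,d)) \<and>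
       norm (f z) \<le> C * norm (of_int q * z - of_int p) powr (- r))"
proof -
  obtain C where C: "0 < C"
    "\<And>A. A \<in> carrier SL2Z \<Longrightarrow> cuspidal_at f r \<Gamma> (cusp_of A) \<Longrightarrow> decaying f r A C"
    "\<And>A. A \<in> carrier SL2Z \<Longrightarrow> \<not> cuspidal_at f r \<Gamma> (cusp_of A) \<Longrightarrow> nondecaying f r A C"
    using uniform_decay by blast
  define D where "D = C * (r/2 / (1/C)) powr (r/2)"
  have D: "0 \<le> D" using C by (simp add: D_def)
  have "norm (f z) \<le> (C + D) * Im z powr (- (r/2)) \<or>
    (\<exists>p b q d. (p,b,q,d) \<in> carrier SL2Z \<and> 0 < q \<and> \<not> cuspidal_at f r \<Gamma> (cusp_of (p,b,q,d)) \<and>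
       norm (f z) \<le> (C + D) * norm (of_int q * z - of_int p) powr (- r))" if z: "0 < Im z" "Im z \<le> 1" for z
  proof -
    define x y where "x = Re z" and "y = Im z"
    have y: "0 < y" "y \<le> 1" using z by (auto simp: y_def)
    \<comment> \<open>Dirichlet's parameter N is the integer part of s, which balances both parts of
      |qz - p|^2: the real part, below 1/N <= 2/s, contributes at most 4y, and the imaginary part qy
      with q <= s at most y.\<close>
    define s where "s = 1 / sqrt y"
    have s: "1 \<le> s" "s\<^sup>2 * y = 1" using y by (auto simp: s_def power_divide)
    define N where "N = nat \<lfloor>s\<rfloor>"
    have N: "0 < N" "real N \<le> s" "s < real N + 1" using s unfolding N_def by linarith+
    obtain p q where pq: "coprime p q" "0 < q" "q \<le> int N" "\<bar>of_int q * x - of_int p\<bar> < 1 / real N"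
      using Dirichlet_approx_coprime[OF N(1)] by blast
    obtain u v where uv: "u * p + v * q = 1" using bezout_int[of p q] pq(1) by auto
    define A where "A = (p, -v, q, u)"
    have A: "A \<in> carrier SL2Z" using uv by (simp add: A_def SL2Z_iff algebra_simps)
    define J where "J = norm (of_int q * z - of_int p)"
    have J: "norm (cocycle (minv A) z) = J"
      by (simp add: J_def A_def minv_def cocycle_def norm_minus_commute)
    have "0 < J" using cocycle_nonzero[OF minv_closed[OF A] z(1)] by (simp add: J[symmetric])
    have "J\<^sup>2 = (of_int q * x - of_int p)\<^sup>2 + (of_int q * y)\<^sup>2"
      by (simp add: J_def cmod_power2 x_def y_def)
    also have "\<dots> \<le> 4 * y + y"
    proof (rule add_mono)
      have "1 \<le> real N" using N(1) by linarith
      then have "s \<le> 2 * real N" using N(3) by linarith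
      then have "1 / real N \<le> 2 / s" using N(1) s by (simp add: field_simps)
      then have "\<bar>of_int q * x - of_int p\<bar> \<le> 2 / s" using pq(4) by linarith
      then have "\<bar>of_int q * x - of_int p\<bar>\<^sup>2 \<le> (2 / s)\<^sup>2" by (rule power_mono) simp
      also have "\<dots> = 4 * y" using s by (simp add: power_divide field_simps)
      finally show "(of_int q * x - of_int p)\<^sup>2 \<le> 4 * y" by simp
      have "of_int q \<le> real N" using pq(3) by linarith
      then have "(of_int q)\<^sup>2 \<le> s\<^sup>2" using N pq(2) by (intro power_mono) auto
      then have "(of_int q)\<^sup>2 * y * y \<le> s\<^sup>2 * y * y" using y by (intro mult_right_mono) auto
      also have "s\<^sup>2 * y * y = y" by (simp add: s(2))
      finally show "(of_int q * y)\<^sup>2 \<le> y" by (simp add: power2_eq_square mult_ac)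
    qed
    finally have J5: "J\<^sup>2 \<le> 5 * y" by simp
    define w where "w = moebius (minv A) z"
    have fz: "norm (f z) = slash_norm f r A w * J powr (- r)" and imw: "Im w = y / J\<^sup>2"
      using norm_f_via_slash_norm[OF A z(1)] by (simp_all add: w_def J y_def)
    have w5: "1/5 \<le> Im w" using J5 \<open>0 < J\<close> by (simp add: imw field_simps)
    show ?thesis
    proof (cases "cuspidal_at f r \<Gamma> (cusp_of A)")
      case True
      have "slash_norm f r A w \<le> C * exp (- Im w / C)" using C(2)[OF A True] w5 by (simp add: decaying_def)
      also have "\<dots> \<le> C * ((r/2 / (1/C)) powr (r/2) * Im w powr (- (r/2)))"
      proof (intro mult_left_mono)
        have "Im w powr (r/2) \<le> (r/2 / (1/C)) powr (r/2) * exp (1/C * Im w)"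
          using r_pos C w5 by (intro powr_exp_bound) auto
        then show "exp (- Im w / C) \<le> (r/2 / (1/C)) powr (r/2) * Im w powr (- (r/2))"
          using w5 by (simp add: exp_minus powr_minus field_simps)
      qed (use C in simp)
      also have "\<dots> = D * Im w powr (- (r/2))" by (simp add: D_def)
      also have "Im w powr (- (r/2)) = y powr (- (r/2)) * J powr r"
      proof -
        have "(J\<^sup>2) powr (- (r/2)) = J powr (- r)" using \<open>0 < J\<close> by (simp add: powr_powr flip: powr_numeral)
        then show ?thesis using \<open>0 < J\<close> y by (simp add: imw powr_divide powr_minus_divide)
      qed
      finally have "slash_norm f r A w * J powr (- r) \<le> (D * (y powr (- (r/2)) * J powr r)) * J powr (- r)"
        by (rule mult_right_mono) simp
      also have "\<dots> = D * y powr (- (r/2)) * (J powr r * J powr (- r))" by simp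
      also have "J powr r * J powr (- r) = 1" using \<open>0 < J\<close> by (simp add: powr_minus)
      finally have "norm (f z) \<le> D * y powr (- (r/2))" by (simp add: fz)
      also have "\<dots> \<le> (C + D) * y powr (- (r/2))" using C by (intro mult_right_mono) auto
      finally show ?thesis by (simp add: y_def)
    next
      case False
      have "slash_norm f r A w \<le> C" using C(3)[OF A False] w5 by (simp add: nondecaying_def)
      then have "norm (f z) \<le> (C + D) * J powr (- r)" unfolding fz using D by (intro mult_right_mono) auto
      then show ?thesis using A False pq(2) unfolding A_def J_def by blast
    qed
  qed
  moreover have "0 \<le> C + D" using C D by simp
  ultimately show thesis using that by blast
qed

lemma cusp_form_bound:
  assumes "cusp_form f r \<Gamma>"
  obtains C where "0 \<le> C" "\<And>z. 0 < Im z \<Longrightarrow> Im z \<le> 1 \<Longrightarrow> norm (f z) \<le> C * Im z powr (- (r/2))"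
proof -
  obtain C where C: "0 \<le> C" "\<And>z. 0 < Im z \<Longrightarrow> Im z \<le> 1 \<Longrightarrow> norm (f z) \<le> C * Im z powr (- (r/2)) \<or>
    (\<exists>p b q d. (p,b,q,d) \<in> carrier SL2Z \<and> 0 < q \<and> \<not> cuspidal_at f r \<Gamma> (cusp_of (p,b,q,d)) \<and>
       norm (f z) \<le> C * norm (of_int q * z - of_int p) powr (- r))"
    by (rule f_bound_dichotomy) (rule that)
  show thesis
    by (rule that[OF C(1)]) (use C(2) assms in \<open>auto simp: cusp_form_def\<close>)
qed

lemma noncusp_bound:
  obtains C where "0 \<le> C" "\<And>z. 0 < Im z \<Longrightarrow> Im z \<le> 1 \<Longrightarrow> norm (f z) \<le> C * Im z powr (- r)"
proof -
  obtain C where C: "0 \<le> C" "\<And>z. 0 < Im z \<Longrightarrow> Im z \<le> 1 \<Longrightarrow> norm (f z) \<le> C * Im z powr (- (r/2)) \<or>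
    (\<exists>p b q d. (p,b,q,d) \<in> carrier SL2Z \<and> 0 < q \<and> \<not> cuspidal_at f r \<Gamma> (cusp_of (p,b,q,d)) \<and>
       norm (f z) \<le> C * norm (of_int q * z - of_int p) powr (- r))"
    by (rule f_bound_dichotomy) (rule that)
  have "norm (f z) \<le> C * Im z powr (- r)" if z: "0 < Im z" "Im z \<le> 1" for z
    using C(2)[OF z]
  proof (elim disjE exE conjE)
    assume "norm (f z) \<le> C * Im z powr (- (r/2))"
    also have "\<dots> \<le> C * Im z powr (- r)" using C(1) z r_pos by (intro mult_left_mono powr_mono') auto
    finally show ?thesis .
  next
    fix p b q d assume q: "0 < (q::int)" and le: "norm (f z) \<le> C * norm (of_int q * z - of_int p) powr (- r)"
    have "1 * Im z \<le> of_int q * Im z" using q z by (intro mult_right_mono) auto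
    also have "\<dots> \<le> norm (of_int q * z - of_int p)" using abs_Im_le_cmod[of "of_int q * z - of_int p"] by simp
    finally have "norm (of_int q * z - of_int p) powr (- r) \<le> Im z powr (- r)" using z r_pos by (intro powr_mono2') auto
    then show ?thesis using mult_left_mono[OF _ C(1)] le order_trans by blast
  qed
  with C(1) that show thesis by blast
qed

text \<open>Move the common nonvanishing point w by matrices whose first columns approximate
  \<open>x\<close>. With J = |qw + d| of order q, the image has height of order 1/q^2, lies within
  the same order of p/q and of \<open>x\<close>, and |f| there is at least c times
  \<open>J powr r\<close>. Hence the sector |u| <= A y.\<close>

lemma irrational_lower_bound:
  assumes x: "x \<notin> \<rat>"
  obtains A c where "0 \<le> A" "0 < c" "\<And>\<eta>. 0 < \<eta> \<Longrightarrow>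
     \<exists>u y. 0 < y \<and> y \<le> \<eta> \<and> \<bar>u\<bar> \<le> A * y \<and> c * y powr (- (r/2)) \<le> norm (f (Complex (x + u) y))"
proof -
  obtain w c where w: "0 < Im w" "0 < c" "\<And>B. B \<in> carrier SL2Z \<Longrightarrow> c \<le> slash_norm f r B w" using common_nonzero_point by blast
  define v where "v = Im w"
  have v: "0 < v" using w by (simp add: v_def)
  define L where "L = norm w + 1"
  have L: "1 \<le> L" by (simp add: L_def)
  define A where "A = (L\<^sup>2 + L) / v"
  have "0 \<le> A" using v L by (simp add: A_def)
  moreover have "0 < c * v powr (r/2)" using w v by simp
  moreover have "\<exists>u y. 0 < y \<and> y \<le> \<eta> \<and> \<bar>u\<bar> \<le> A * y \<and> c * v powr (r/2) * y powr (- (r/2)) \<le> norm (f (Complex (x + u) y))" if e: "0 < \<eta>" for \<eta>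
  proof -
    define N where "N = \<lceil>1 / (v * \<eta>)\<rceil>"
    obtain p b q d where B: "(p,b,q,d) \<in> carrier SL2Z" "N \<le> q" "0 < q" "\<bar>x - of_int p / of_int q\<bar> \<le> 1 / (of_int q)\<^sup>2"
      "0 * q \<le> d" "d \<le> (0 + 1) * q"
      using irrational_approx_matrix[OF x] by metis
    define z where "z = moebius (p,b,q,d) w"
    define J where "J = norm (cocycle (p,b,q,d) w)"
    have q1: "1 \<le> real_of_int q" using B(3) by linarith
    have J1: "of_int q * v \<le> J" using abs_Im_le_cmod[of "cocycle (p,b,q,d) w"] B(3) v by (simp add: J_def cocycle_def v_def)
    have "0 < of_int q * v" using q1 v by simp
    then have J0: "0 < J" using J1 by linarith
    have J2: "J \<le> of_int q * L"
    proof -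
      have "J \<le> of_int q * norm w + \<bar>of_int d\<bar>" using norm_triangle_ineq[of "of_int q * w" "of_int d"] B(3)
        by (simp add: J_def cocycle_def norm_mult)
      also have "\<bar>real_of_int d\<bar> \<le> of_int q" using B(5,6) by simp
      finally show ?thesis by (simp add: L_def distrib_left)
    qed
    have imz: "Im z = v / J\<^sup>2" using Im_moebius[OF B(1) w(1)] by (simp add: z_def J_def v_def)
    have imz0: "0 < Im z" using v J0 by (simp add: imz)
    have le_eta: "Im z \<le> \<eta>"
    proof -
      have "(of_int q * v)\<^sup>2 \<le> J\<^sup>2" by (rule power_mono[OF J1]) (use \<open>0 < of_int q * v\<close> in linarith)
      moreover have "0 < (of_int q * v)\<^sup>2" by (rule zero_less_power[OF \<open>0 < of_int q * v\<close>])
      ultimately have "v / J\<^sup>2 \<le> v / (of_int q * v)\<^sup>2" using v by (intro frac_le) auto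
      also have "\<dots> = 1 / (of_int q * of_int q * v)" using v by (simp add: power2_eq_square)
      also have "\<dots> \<le> 1 / (1 * of_int q * v)" using q1 v by (intro divide_left_mono mult_right_mono mult_pos_pos) auto
      also have "\<dots> \<le> \<eta>"
      proof -
        have "1 / (v * \<eta>) \<le> of_int q" using B(2) unfolding N_def by linarith
        then show ?thesis using v e q1 by (simp add: field_simps)
      qed
      finally show ?thesis by (simp add: imz)
    qed
    have diff: "of_int p / of_int q - z = 1 / (of_int q * cocycle (p,b,q,d) w)"
    proof -
      have nz: "cocycle (p,b,q,d) w \<noteq> 0" using J0 by (auto simp: J_def)
      have "of_int q \<noteq> (0::complex)" using B(3) by simp
      then have "of_int p / of_int q - z = (of_int p * cocycle (p,b,q,d) w - of_int q * (of_int p * w + of_int b)) / (of_int q * cocycle (p,b,q,d) w)"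
        using nz by (simp add: z_def moebius_eq diff_frac_eq mult.commute)
      also have "of_int p * cocycle (p,b,q,d) w - of_int q * (of_int p * w + of_int b) = (of_int (p * d - b * q) :: complex)"
        by (simp add: cocycle_def algebra_simps)
      also have "p * d - b * q = 1" using B(1) by (simp add: SL2Z_iff)
      finally show ?thesis by (simp only: of_int_1)
    qed
    have "norm (of_int p / of_int q - z) = 1 / (of_int q * J)"
      unfolding diff using B(3) by (simp add: norm_divide norm_mult J_def)
    then have re: "\<bar>of_int p / of_int q - Re z\<bar> \<le> 1 / (of_int q * J)"
      using abs_Re_le_cmod[of "of_int p / of_int q - z"] by simp
    have "\<bar>Re z - x\<bar> \<le> 1 / (of_int q)\<^sup>2 + 1 / (of_int q * J)" using re B(4) by linarith
    also have "\<dots> \<le> L\<^sup>2 / J\<^sup>2 + L / J\<^sup>2"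
    proof (rule add_mono)
      have "J\<^sup>2 \<le> (of_int q * L)\<^sup>2" using J2 J0 by (intro power_mono) auto
      then show "1 / (real_of_int q)\<^sup>2 \<le> L\<^sup>2 / J\<^sup>2" using q1 J0 by (simp add: field_simps power_mult_distrib)
      have "J * J \<le> of_int q * L * J" using J2 J0 by (intro mult_right_mono) auto
      then show "1 / (real_of_int q * J) \<le> L / J\<^sup>2" using q1 J0 by (simp add: field_simps power2_eq_square)
    qed
    also have "\<dots> = A * Im z" using v by (simp add: A_def imz add_divide_distrib[symmetric])
    finally have u: "\<bar>Re z - x\<bar> \<le> A * Im z" .
    have "c * J powr r \<le> slash_norm f r (p,b,q,d) w * J powr r" using w(3)[OF B(1)] by (intro mult_right_mono) auto
    also have "\<dots> = norm (f z)" using J0 by (simp add: slash_norm_def J_def z_def)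
    also have "J powr r = v powr (r/2) * Im z powr (- (r/2))"
    proof -
      have "(J\<^sup>2) powr (r/2) = J powr r" using J0 by (simp add: powr_powr flip: powr_numeral)
      then show ?thesis using v J0 by (simp add: imz powr_divide powr_minus_divide)
    qed
    finally have "c * v powr (r/2) * Im z powr (- (r/2)) \<le> norm (f (Complex (x + (Re z - x)) (Im z)))" by simp
    then show ?thesis using imz0 le_eta u by blast
  qed
  ultimately show thesis using that by blast
qed

text \<open>Vertically above p/q the automorphy factor has modulus exactly qy and the moved point
  has height 1/(q^2 y); once this exceeds the threshold, non-decay bounds the slash from
  below.\<close>

lemma noncuspidal_lower_bound:
  obtains l c where "0 < l" "0 < c" "\<And>\<rho> y. \<not> cuspidal_at f r \<Gamma> (Some \<rho>) \<Longrightarrow> 0 < y \<Longrightarrow>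
     (of_int (snd (quotient_of \<rho>)))\<^sup>2 * y \<le> c \<Longrightarrow> l * (of_int (snd (quotient_of \<rho>)) * y) powr (- r) \<le> norm (f (Complex (of_rat \<rho>) y))"
proof -
  obtain C where C: "0 < C"
    "\<And>A. A \<in> carrier SL2Z \<Longrightarrow> cuspidal_at f r \<Gamma> (cusp_of A) \<Longrightarrow> decaying f r A C"
    "\<And>A. A \<in> carrier SL2Z \<Longrightarrow> \<not> cuspidal_at f r \<Gamma> (cusp_of A) \<Longrightarrow> nondecaying f r A C"
    using uniform_decay by blast
  have "1/C * (of_int (snd (quotient_of \<rho>)) * y) powr (- r) \<le> norm (f (Complex (of_rat \<rho>) y))"
    if nc: "\<not> cuspidal_at f r \<Gamma> (Some \<rho>)" and y: "0 < y" and le: "(of_int (snd (quotient_of \<rho>)))\<^sup>2 * y \<le> 1/C" for \<rho> y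
  proof -
    obtain p b q d where A: "(p,b,q,d) \<in> carrier SL2Z" "0 < q" "snd (quotient_of \<rho>) = q" "(of_rat \<rho> :: real) = of_int p / of_int q" "cusp_of (p,b,q,d) = Some \<rho>"
      using matrix_of_rat by blast
    define z where "z = Complex (of_rat \<rho>) y"
    have z: "0 < Im z" using y by (simp add: z_def)
    have q0: "0 < real_of_int q" using A(2) by simp
    have "cocycle (minv (p,b,q,d)) z = - \<i> * of_real (of_int q * y)"
      using A(2) by (simp add: z_def A(4) cocycle_def minv_def complex_eq_iff)
    then have J: "norm (cocycle (minv (p,b,q,d)) z) = of_int q * y" using q0 y by (simp add: norm_mult)
    have "Im (moebius (minv (p,b,q,d)) z) = y / (of_int q * y)\<^sup>2"
      using norm_f_via_slash_norm(2)[OF A(1) z] by (simp only: J) (simp add: z_def)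
    also have "\<dots> = 1 / ((of_int q)\<^sup>2 * y)" using y by (simp add: power2_eq_square)
    also have "\<dots> \<ge> C"
    proof -
      have "(of_int q)\<^sup>2 * y \<le> 1/C" using le A(3) by simp
      moreover have "0 < (real_of_int q)\<^sup>2 * y" using q0 y by simp
      ultimately show ?thesis using C(1) by (simp add: field_simps)
    qed
    finally have "1/C \<le> slash_norm f r (p,b,q,d) (moebius (minv (p,b,q,d)) z)"
      using C(3)[OF A(1)] nc A(5) by (simp add: nondecaying_def)
    then have "1/C * (of_int q * y) powr (- r) \<le> slash_norm f r (p,b,q,d) (moebius (minv (p,b,q,d)) z) * (of_int q * y) powr (- r)"
      by (rule mult_right_mono) simp
    also have "\<dots> = norm (f z)" using norm_f_via_slash_norm(1)[OF A(1) z] by (simp only: J)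
    finally show ?thesis by (simp add: z_def A(3))
  qed
  moreover have "0 < 1/C" using C by simp
  ultimately show thesis using that by blast
qed

text \<open>Write an approximating matrix as an element of \<open>\<Gamma>\<close> times a
  representative g. The same element of \<open>\<Gamma>\<close> moves a fixed non-cuspidal cusp
  \<open>A0\<close> to a cusp X which differs from the approximating one by g^(-1) A0, one of
  finitely many matrices. So X approximates \<open>x\<close> with exponent 2 as well, and tau is at
  least 2.\<close>

lemma noncuspidal_approximations:
  assumes x: "x \<notin> \<rat>" and nc: "\<not> cusp_form f r \<Gamma>"
  obtains C where "0 < C"
    "infinite {\<rho>. \<not> cuspidal_at f r \<Gamma> (Some \<rho>) \<and> \<bar>x - of_rat \<rho>\<bar> \<le> C * real_of_int (snd (quotient_of \<rho>)) powr (- 2)}"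
    "\<And>e. 0 < e \<Longrightarrow> \<exists>\<rho>. \<not> cuspidal_at f r \<Gamma> (Some \<rho>) \<and> \<bar>x - of_rat \<rho>\<bar> < e"
proof -
  obtain p0 where "\<not> cuspidal_at f r \<Gamma> p0" using nc unfolding cusp_form_def by blast
  then obtain A0 where A0: "A0 \<in> carrier SL2Z" "\<not> cuspidal_at f r \<Gamma> (cusp_of A0)" using cusp_of_surj by metis
  obtain R where R: "finite R" "R \<subseteq> carrier SL2Z" "\<And>A. A \<in> carrier SL2Z \<Longrightarrow> \<exists>\<gamma>\<in>\<Gamma>. \<exists>g\<in>R. A = mmul \<gamma> g"
    using finite_index_representatives[OF finite_index] by blast
  define e1 where "e1 A = (case A of (u,_,v,_) \<Rightarrow> max \<bar>u\<bar> \<bar>v\<bar>)" for A :: mat2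
  \<comment> \<open>Bounds the first columns of the finitely many matrices g^(-1) A0; only these
    columns enter the numerator and denominator of the new cusp.\<close>
  define U where "U = Max (insert 1 ((\<lambda>g. e1 (mmul (minv g) A0)) ` R))"
  have U: "1 \<le> U" "\<And>g. g \<in> R \<Longrightarrow> e1 (mmul (minv g) A0) \<le> U" using R(1) by (auto simp: U_def)
  define D where "D = U * (U + 3)"
  have D: "1 \<le> D" "real_of_int U + 1 \<le> of_int D"
  proof -
    have "U + 1 \<le> U * (U + 3)" using mult_mono[of 1 U 1 U] U(1) by (simp add: algebra_simps)
    then have "U + 1 \<le> D" by (simp add: D_def)
    then show "1 \<le> D" "real_of_int U + 1 \<le> of_int D" using U(1) by linarith+
  qed
  define C where "C = (real_of_int D)\<^sup>2 + of_int U * of_int D"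
  have C0: "0 < C" using D U unfolding C_def by (intro add_pos_nonneg) auto
  define S where "S = {\<rho>. \<not> cuspidal_at f r \<Gamma> (Some \<rho>) \<and> \<bar>x - of_rat \<rho>\<bar> \<le> C * real_of_int (snd (quotient_of \<rho>)) powr (- 2)}"
  have close: "\<exists>\<rho>\<in>S. \<bar>x - of_rat \<rho>\<bar> < e" if e: "0 < e" for e
  proof -
    define N where "N = \<lceil>(1 + of_int U) / e\<rceil> + 1"
    obtain p b q d where B: "(p,b,q,d) \<in> carrier SL2Z" "N \<le> q" "0 < q" "\<bar>x - of_int p / of_int q\<bar> \<le> 1 / (of_int q)\<^sup>2"
      "(U + 1) * q \<le> d" "d \<le> ((U + 1) + 1) * q"
      using irrational_approx_matrix[OF x] by metis
    obtain \<gamma> g where g: "\<gamma> \<in> \<Gamma>" "g \<in> R" "(p,b,q,d) = mmul \<gamma> g" using R(3)[OF B(1)] by blast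
    have g': "g \<in> carrier SL2Z" using g R by blast
    obtain u s v t where B': "mmul (minv g) A0 = (u,s,v,t)" by (cases "mmul (minv g) A0")
    have B'SL: "(u,s,v,t) \<in> carrier SL2Z" unfolding B'[symmetric] by (intro mmul_closed minv_closed g' A0)
    have uv: "\<bar>u\<bar> \<le> U" "\<bar>v\<bar> \<le> U" using U(2)[OF g(2)] by (auto simp: e1_def B')
    define Q where "Q = q * u + d * v"
    define P where "P = p * u + b * v"
    define X where "X = mmul (p,b,q,d) (u,s,v,t)"
    have XSL: "X \<in> carrier SL2Z" unfolding X_def by (intro mmul_closed B B'SL)
    have Xeq: "X = (P, p * s + b * t, Q, q * s + d * t)" by (simp add: X_def mmul_def P_def Q_def)
    have "mmul g (mmul (minv g) A0) = A0" by (simp add: mmul_minv g' flip: mmul_assoc)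
    then have "X = mmul \<gamma> A0" unfolding X_def g(3) by (simp only: mmul_assoc B'[symmetric])
    then have Xnc: "\<not> cuspidal_at f r \<Gamma> (cusp_of X)" using cuspidal_Gamma[OF g(1) A0(1)] A0(2) by simp
    \<comment> \<open>The choice \<open>d >= (U + 1) q\<close> matters here: if v is nonzero, d|v|
      exceeds q|u| <= qU by at least q, so the new denominator cannot be small.\<close>
    have Qge: "q \<le> \<bar>Q\<bar>"
    proof (cases "v = 0")
      case True
      then have "\<bar>u\<bar> = 1" using B'SL by (auto simp: SL2Z_iff zmult_eq_1_iff)
      then show ?thesis using True B(3) by (simp add: Q_def abs_mult)
    next
      case False
      have "d * 1 \<le> d * \<bar>v\<bar>" using False B(3,5) U(1) by (intro mult_left_mono) (auto intro: order_trans[OF _ B(5)])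
      moreover have "q * \<bar>u\<bar> \<le> q * U" using uv B(3) by (intro mult_left_mono) auto
      moreover have "\<bar>d * v\<bar> - \<bar>q * u\<bar> \<le> \<bar>Q\<bar>" by (simp add: Q_def)
      moreover have "0 \<le> d" using B(3,5) U(1) by (auto intro: order_trans[OF _ B(5)])
      then have "\<bar>d * v\<bar> = d * \<bar>v\<bar>" "\<bar>q * u\<bar> = q * \<bar>u\<bar>" using B(3) by (simp_all add: abs_mult)
      moreover have "(U + 1) * q = q * U + q" by (simp add: algebra_simps)
      ultimately show ?thesis using B(5) by linarith
    qed
    have Q0: "Q \<noteq> 0" using Qge B(3) by auto
    have Qle: "\<bar>Q\<bar> \<le> D * q"
    proof -
      have "0 \<le> d" using B(3,5) U(1) by (auto intro: order_trans[OF _ B(5)])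
      have "\<bar>Q\<bar> \<le> q * \<bar>u\<bar> + d * \<bar>v\<bar>" unfolding Q_def using abs_triangle_ineq[of "q * u" "d * v"] B(3) \<open>0 \<le> d\<close> by (simp add: abs_mult)
      also have "\<dots> \<le> q * U + ((U + 1 + 1) * q) * U" using uv B(3,6) \<open>0 \<le> d\<close> U(1) by (intro add_mono mult_mono) auto
      also have "\<dots> = D * q" by (simp add: D_def algebra_simps)
      finally show ?thesis .
    qed
    define \<rho> where "\<rho> = Fract P Q"
    have cX: "cusp_of X = Some \<rho>" using Q0 by (simp add: Xeq cusp_of_def \<rho>_def)
    have den: "snd (quotient_of \<rho>) = \<bar>Q\<bar>" and val: "(of_rat \<rho> :: real) = of_int P / of_int Q"
      using quotient_of_cusp[OF XSL[unfolded Xeq] Q0] by (simp_all add: \<rho>_def)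
    have q0: "0 < real_of_int q" using B(3) by simp
    have q1: "1 \<le> real_of_int q" using B(3) by linarith
    have QR: "of_int q \<le> \<bar>real_of_int Q\<bar>" "\<bar>real_of_int Q\<bar> \<le> of_int D * of_int q"
    proof -
      show "of_int q \<le> \<bar>real_of_int Q\<bar>" using Qge by linarith
      have "real_of_int \<bar>Q\<bar> \<le> real_of_int (D * q)" using Qle by (simp only: of_int_le_iff)
      then show "\<bar>real_of_int Q\<bar> \<le> of_int D * of_int q" by simp
    qed
    have Qpos: "0 < \<bar>real_of_int Q\<bar>" using Q0 by simp
    \<comment> \<open>The numerator pQ - qP of the difference collapses to v times the
      determinant.\<close>
    have d1: "\<bar>of_int p / of_int q - of_rat \<rho>\<bar> = \<bar>of_int v\<bar> / (of_int q * \<bar>real_of_int Q\<bar>)"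
    proof -
      have "p * Q - q * P = v * (p * d - b * q)" by (simp add: P_def Q_def algebra_simps)
      then have "p * Q - q * P = v" using B(1) by (simp add: SL2Z_iff)
      then have "real_of_int p * of_int Q - of_int q * of_int P = of_int v" by (metis of_int_diff of_int_mult)
      then have "of_int p / of_int q - of_int P / of_int Q = of_int v / (of_int q * real_of_int Q)"
        using q0 Q0 by (simp add: diff_frac_eq mult.commute)
      then show ?thesis using q0 by (simp add: val abs_mult)
    qed
    have bd: "\<bar>x - of_rat \<rho>\<bar> \<le> 1 / (of_int q)\<^sup>2 + of_int U / (of_int q * \<bar>real_of_int Q\<bar>)"
    proof -
      have "\<bar>real_of_int v\<bar> \<le> of_int U" using uv by linarith
      then have "\<bar>of_int v\<bar> / (of_int q * \<bar>real_of_int Q\<bar>) \<le> of_int U / (of_int q * \<bar>real_of_int Q\<bar>)"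
        using q0 Qpos by (intro divide_right_mono) auto
      moreover have "\<bar>x - of_rat \<rho>\<bar> \<le> \<bar>x - of_int p / of_int q\<bar> + \<bar>of_int p / of_int q - of_rat \<rho>\<bar>"
        using abs_triangle_ineq[of "x - of_int p / of_int q" "of_int p / of_int q - of_rat \<rho>"] by simp
      ultimately show ?thesis using B(4) unfolding d1 by (meson add_mono order_trans)
    qed
    have "1 / (of_int q)\<^sup>2 + of_int U / (of_int q * \<bar>real_of_int Q\<bar>) \<le> C * \<bar>real_of_int Q\<bar> powr (- 2)"
    proof -
      have "\<bar>real_of_int Q\<bar>\<^sup>2 \<le> (of_int D * of_int q)\<^sup>2" using QR by (intro power_mono) auto
      then have 1: "1 / (real_of_int q)\<^sup>2 \<le> (of_int D)\<^sup>2 / \<bar>real_of_int Q\<bar>\<^sup>2" using q0 Qpos by (simp add: field_simps power_mult_distrib)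
      have "\<bar>real_of_int Q\<bar> * \<bar>real_of_int Q\<bar> \<le> of_int D * of_int q * \<bar>real_of_int Q\<bar>" using QR by (intro mult_right_mono) auto
      moreover have aux: "1 / (k * a) \<le> e' / a\<^sup>2" if "0 < a" "0 < k" "a * a \<le> e' * k * a" for a k e' :: real
        using that by (simp add: field_simps power2_eq_square)
      ultimately have "1 / (of_int q * \<bar>real_of_int Q\<bar>) \<le> of_int D / \<bar>real_of_int Q\<bar>\<^sup>2" using aux[OF Qpos q0] by simp
      then have "of_int U * (1 / (of_int q * \<bar>real_of_int Q\<bar>)) \<le> of_int U * (of_int D / \<bar>real_of_int Q\<bar>\<^sup>2)"
        using U(1) by (intro mult_left_mono) auto
      with 1 have "1 / (of_int q)\<^sup>2 + of_int U / (of_int q * \<bar>real_of_int Q\<bar>) \<le> C / \<bar>real_of_int Q\<bar>\<^sup>2"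
        by (simp add: C_def add_divide_distrib)
      also have "\<dots> = C * \<bar>real_of_int Q\<bar> powr (- 2)" using Qpos by (simp add: powr_minus_divide)
      finally show ?thesis .
    qed
    then have "\<rho> \<in> S" using bd Xnc cX by (simp add: S_def den)
    moreover have "\<bar>x - of_rat \<rho>\<bar> < e"
    proof -
      have "1 / (of_int q)\<^sup>2 \<le> 1 / real_of_int q"
        using q1 by (intro divide_left_mono) (auto simp: power2_eq_square)
      moreover have "of_int U / (of_int q * \<bar>real_of_int Q\<bar>) \<le> of_int U / (of_int q * 1)"
        using q1 QR Qpos U(1) by (intro divide_left_mono mult_left_mono mult_pos_pos) auto
      ultimately have "\<bar>x - of_rat \<rho>\<bar> \<le> (1 + of_int U) / of_int q" using bd by (simp add: add_divide_distrib)
      also have "\<dots> < e"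
      proof -
        have "(1 + of_int U) / e < of_int q" using B(2) unfolding N_def by linarith
        then show ?thesis using q0 e by (simp add: field_simps)
      qed
      finally show ?thesis .
    qed
    ultimately show ?thesis by blast
  qed
  have "infinite S" by (rule infinite_rational_approx[OF x close])
  then show thesis using that[OF C0] close unfolding S_def by blast
qed

text \<open>If non-cuspidal p/q never come closer to \<open>x\<close> than
  \<open>c * q powr (-t)\<close>, those near x + h must have large q, and then J = |qz - p| is at
  least a multiple of \<open>y * \<delta> powr (-1/t)\<close> with
  \<open>\<delta> = |h| + y\<close>. The hypothesis t >= 2 makes the other alternative
  \<open>y powr (-(r/2))\<close> no worse than the claimed bound.\<close>

lemma approximation_bound:
  assumes t: "2 \<le> t" and c: "0 < c" and H: "\<And>\<rho>. \<not> cuspidal_at f r \<Gamma> (Some \<rho>) \<Longrightarrow> c * real_of_int (snd (quotient_of \<rho>)) powr (- t) \<le> \<bar>x - of_rat \<rho>\<bar>"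
  obtains C where "0 \<le> C" "\<And>h y. 0 < y \<Longrightarrow> y \<le> 1 \<Longrightarrow> norm (f (Complex (x + h) y)) \<le> C * y powr (- r) * (\<bar>h\<bar> + y) powr (r / t)"
proof -
  obtain C where C: "0 \<le> C" "\<And>z. 0 < Im z \<Longrightarrow> Im z \<le> 1 \<Longrightarrow> norm (f z) \<le> C * Im z powr (- (r/2)) \<or>
    (\<exists>p b q d. (p,b,q,d) \<in> carrier SL2Z \<and> 0 < q \<and> \<not> cuspidal_at f r \<Gamma> (cusp_of (p,b,q,d)) \<and>
       norm (f z) \<le> C * norm (of_int q * z - of_int p) powr (- r))"
    by (rule f_bound_dichotomy) (rule that)
  define k where "k = (2 / c) powr (- (1 / t))"
  have k: "0 < k" using c by (simp add: k_def)
  have t0: "0 < t" using t by simp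
  have main: "norm (f (Complex (x + h) y)) \<le> (C * (1 + k powr (- r))) * y powr (- r) * (\<bar>h\<bar> + y) powr (r / t)" if y: "0 < y" "y \<le> 1" for h y
  proof -
    define z where "z = Complex (x + h) y"
    define \<delta> where "\<delta> = \<bar>h\<bar> + y"
    have d: "0 < \<delta>" "y \<le> \<delta>" using y by (auto simp: \<delta>_def)
    have z: "0 < Im z" "Im z \<le> 1" using y by (auto simp: z_def)
    from C(2)[OF z] show ?thesis
    proof (elim disjE exE conjE)
      assume "norm (f z) \<le> C * Im z powr (- (r/2))"
      also have "Im z powr (- (r/2)) = y powr (- r) * y powr (r/2)" by (simp add: z_def flip: powr_add)
      also have "\<dots> \<le> y powr (- r) * \<delta> powr (r/t)"
      proof (intro mult_left_mono)
        have "y powr (r/2) \<le> y powr (r/t)" using y t r_pos by (intro powr_mono') (auto simp: field_simps)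
        also have "\<dots> \<le> \<delta> powr (r/t)" using d y t0 r_pos by (intro powr_mono2) auto
        finally show "y powr (r/2) \<le> \<delta> powr (r/t)" .
      qed simp
      finally have "norm (f z) \<le> C * (y powr (- r) * \<delta> powr (r/t))" using C(1) by (simp add: mult_left_mono)
      also have "\<dots> \<le> (C * (1 + k powr (- r))) * (y powr (- r) * \<delta> powr (r/t))"
        using C(1) by (intro mult_right_mono) (auto simp: mult_le_cancel_left1)
      finally show ?thesis by (simp add: z_def \<delta>_def mult.assoc)
    next
      fix p b q d' assume A: "(p,b,q,d') \<in> carrier SL2Z" "0 < q" "\<not> cuspidal_at f r \<Gamma> (cusp_of (p,b,q,d'))"
        and le: "norm (f z) \<le> C * norm (of_int q * z - of_int p) powr (- r)"
      define \<rho> where "\<rho> = Fract p q"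
      have q: "0 < real_of_int q" using A(2) by simp
      have cs: "cusp_of (p,b,q,d') = Some \<rho>" using A(2) by (simp add: cusp_of_def \<rho>_def)
      have den: "snd (quotient_of \<rho>) = q" and val: "(of_rat \<rho> :: real) = of_int p / of_int q"
        using quotient_of_cusp[OF A(1)] A(2) by (auto simp: \<rho>_def)
      define J where "J = norm (of_int q * z - of_int p)"
      have Jy: "of_int q * y \<le> J" using abs_Im_le_cmod[of "of_int q * z - of_int p"] q y by (simp add: J_def z_def)
      \<comment> \<open>The distance from \<open>x\<close> to p/q is at most 2E, whence q >= k
        \<open>E powr (-1/t)\<close>. If the first entry dominates, J >= qy is used; otherwise J =
        qE and y <= \<open>\<delta>\<close> <= E.\<close>
      define E where "E = max \<delta> (J / of_int q)"
      have E: "\<delta> \<le> E" "J / of_int q \<le> E" "0 < E" using d by (auto simp: E_def)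
      have "\<bar>x - of_rat \<rho>\<bar> \<le> 2 * E"
      proof -
        have "J / of_int q = norm (z - of_int p / of_int q)"
        proof -
          have "of_int q * z - of_int p = of_int q * (z - of_int p / of_int q)" using A(2) by (simp add: right_diff_distrib)
          then show ?thesis using q by (simp add: J_def norm_mult)
        qed
        then have "\<bar>x + h - of_int p / of_int q\<bar> \<le> J / of_int q"
          using abs_Re_le_cmod[of "z - of_int p / of_int q"] by (simp add: z_def)
        then show ?thesis using E y unfolding val \<delta>_def by linarith
      qed
      then have "c * of_int q powr (- t) \<le> 2 * E" using H[of \<rho>] A(3) cs den by simp
      then have "of_int q powr (- t) \<le> 2 / c * E" using c by (simp add: field_simps)
      then have "(2 / c * E) powr (- (1/t)) \<le> (of_int q powr (- t)) powr (- (1/t))"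
        using q t0 by (intro powr_mono2') auto
      also have "\<dots> = of_int q" using q t0 by (simp add: powr_powr)
      finally have qE: "k * E powr (- (1/t)) \<le> of_int q" unfolding k_def using c E by (subst (asm) powr_mult) auto
      have "k * (y * \<delta> powr (- (1/t))) \<le> J"
      proof (cases "J / of_int q \<le> \<delta>")
        case True
        then have "E = \<delta>" by (simp add: E_def)
        then have "y * (k * \<delta> powr (- (1/t))) \<le> y * of_int q" using qE y by (intro mult_left_mono) auto
        then show ?thesis using Jy by (simp add: mult_ac)
      next
        case False
        then have EJ: "J = of_int q * E" using q by (simp add: E_def)
        have "y * \<delta> powr (- (1/t)) \<le> \<delta> * \<delta> powr (- (1/t))" using d by (intro mult_right_mono) auto
        also have "\<dots> = \<delta> powr (1 - 1/t)" using d by (simp add: powr_diff powr_minus field_simps)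
        also have "\<dots> \<le> E powr (1 - 1/t)" using E d t by (intro powr_mono2) (auto simp: field_simps)
        also have "\<dots> = E * E powr (- (1/t))" using E by (simp add: powr_diff powr_minus field_simps)
        finally have "k * (y * \<delta> powr (- (1/t))) \<le> k * (E * E powr (- (1/t)))" using k by (intro mult_left_mono) auto
        also have "\<dots> \<le> E * of_int q" using mult_left_mono[OF qE, of E] E(3) by (simp add: mult_ac)
        finally show ?thesis by (simp add: EJ mult.commute)
      qed
      then have "J powr (- r) \<le> (k * (y * \<delta> powr (- (1/t)))) powr (- r)"
        using k y d r_pos by (intro powr_mono2') auto
      also have "\<dots> = k powr (- r) * (y powr (- r) * \<delta> powr (r/t))"
        using k y d by (subst powr_mult; (subst powr_mult)?) (auto simp: powr_mult powr_powr)
      finally have "norm (f z) \<le> C * (k powr (- r) * (y powr (- r) * \<delta> powr (r/t)))"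
        using le mult_left_mono[OF _ C(1)] unfolding J_def by fastforce
      also have "\<dots> = (C * k powr (- r)) * (y powr (- r) * \<delta> powr (r/t))" by simp
      also have "\<dots> \<le> (C * (1 + k powr (- r))) * (y powr (- r) * \<delta> powr (r/t))"
        using C(1) by (intro mult_right_mono mult_left_mono) auto
      finally show ?thesis by (simp add: z_def \<delta>_def mult.assoc)
    qed
  qed
  show thesis by (rule that[OF _ main]) (use C(1) in auto)
qed

end

section \<open>Pointwise and uniform Hoelder exponents\<close>

lemma poly_antiderivative:
  fixes P :: "complex poly"
  obtains Q where "pderiv Q = P" "poly Q 0 = 0" "degree Q \<le> Suc (degree P)"
proof -
  define Q where "Q = (\<Sum>i\<le>degree P. monom (coeff P i / of_nat (Suc i)) (Suc i))"
  show thesis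
  proof (rule that[of Q])
    have "pderiv Q = (\<Sum>i\<le>degree P. monom (coeff P i) i)"
      unfolding Q_def higher_pderiv_sum[of 1, simplified] by (intro sum.cong refl) (simp add: pderiv_monom del: of_nat_Suc)
    then show "pderiv Q = P" by (simp add: poly_as_sum_of_monoms)
    show "poly Q 0 = 0" by (simp add: Q_def poly_sum poly_monom)
    show "degree Q \<le> Suc (degree P)"
      unfolding Q_def by (intro degree_sum_le order_trans[OF degree_monom_le]) auto
  qed
qed

lemma holder_pt_iff:
  "holder_pt g x0 s \<longleftrightarrow> (\<exists>P C d. (P = 0 \<or> real (degree P) < s) \<and> 0 < d \<and> 0 \<le> C \<and>
     (\<forall>x. x \<noteq> x0 \<and> \<bar>x - x0\<bar> < d \<longrightarrow> norm (g x - poly P (of_real (x - x0))) \<le> C * \<bar>x - x0\<bar> powr s))"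
proof
  assume "holder_pt g x0 s"
  then obtain P C where P: "P = 0 \<or> real (degree P) < s"
    "eventually (\<lambda>x. norm (g x - poly P (of_real (x - x0))) \<le> C * \<bar>x - x0\<bar> powr s) (at x0)"
    unfolding holder_pt_def by blast
  then obtain d where d: "0 < d" "\<And>x. x \<noteq> x0 \<Longrightarrow> dist x x0 < d \<Longrightarrow> norm (g x - poly P (of_real (x - x0))) \<le> C * \<bar>x - x0\<bar> powr s"
    unfolding eventually_at by auto
  have "norm (g x - poly P (of_real (x - x0))) \<le> max C 0 * \<bar>x - x0\<bar> powr s" if "x \<noteq> x0" "\<bar>x - x0\<bar> < d" for x
    using d(2)[of x] that by (smt (verit, ccfv_threshold) dist_real_def max.cobounded1 mult_right_mono powr_ge_zero)
  then show "\<exists>P C d. (P = 0 \<or> real (degree P) < s) \<and> 0 < d \<and> 0 \<le> C \<and>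
     (\<forall>x. x \<noteq> x0 \<and> \<bar>x - x0\<bar> < d \<longrightarrow> norm (g x - poly P (of_real (x - x0))) \<le> C * \<bar>x - x0\<bar> powr s)"
    using P(1) d(1) by (intro exI[of _ P] exI[of _ "max C 0"] exI[of _ d]) auto
next
  assume "\<exists>P C d. (P = 0 \<or> real (degree P) < s) \<and> 0 < d \<and> 0 \<le> C \<and>
     (\<forall>x. x \<noteq> x0 \<and> \<bar>x - x0\<bar> < d \<longrightarrow> norm (g x - poly P (of_real (x - x0))) \<le> C * \<bar>x - x0\<bar> powr s)"
  then obtain P C d where P: "P = 0 \<or> real (degree P) < s" "0 < d"
     "\<And>x. x \<noteq> x0 \<Longrightarrow> \<bar>x - x0\<bar> < d \<Longrightarrow> norm (g x - poly P (of_real (x - x0))) \<le> C * \<bar>x - x0\<bar> powr s" by blast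
  then have "eventually (\<lambda>x. norm (g x - poly P (of_real (x - x0))) \<le> C * \<bar>x - x0\<bar> powr s) (at x0)"
    unfolding eventually_at by (intro exI[of _ d]) (auto simp: dist_real_def)
  then show "holder_pt g x0 s" using P(1) unfolding holder_pt_def by blast
qed

lemma holder_pt_cong:
  assumes "0 < d" "\<And>x. \<bar>x - x0\<bar> < d \<Longrightarrow> g x = h x" "holder_pt g x0 s"
  shows "holder_pt h x0 s"
proof -
  obtain P C e where P: "P = 0 \<or> real (degree P) < s" "0 < e" "0 \<le> C"
     "\<And>x. x \<noteq> x0 \<Longrightarrow> \<bar>x - x0\<bar> < e \<Longrightarrow> norm (g x - poly P (of_real (x - x0))) \<le> C * \<bar>x - x0\<bar> powr s"
    using assms(3) unfolding holder_pt_iff by blast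
  have "norm (h x - poly P (of_real (x - x0))) \<le> C * \<bar>x - x0\<bar> powr s" if "x \<noteq> x0" "\<bar>x - x0\<bar> < min d e" for x
    using P(4)[of x] assms(2)[of x] that by simp
  moreover have "0 < min d e" using P(2) assms(1) by simp
  ultimately show ?thesis unfolding holder_pt_iff using P(1,3) by blast
qed

text \<open>Subtract an antiderivative of the approximating polynomial, with the right value at
  \<open>x0\<close>; the mean value inequality then gains one power of the distance, and the degree
  grows by one along with the exponent.\<close>

lemma holder_pt_integrate:
  assumes d: "0 < d" "\<And>t. \<bar>t - x0\<bar> < d \<Longrightarrow> (D has_vector_derivative D' t) (at t)"
    and h: "holder_pt D' x0 s" and s: "0 \<le> s"
  shows "holder_pt D x0 (s + 1)"
proof -
  obtain P C e where P: "P = 0 \<or> real (degree P) < s" "0 < e" "0 \<le> C"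
     "\<And>x. x \<noteq> x0 \<Longrightarrow> \<bar>x - x0\<bar> < e \<Longrightarrow> norm (D' x - poly P (of_real (x - x0))) \<le> C * \<bar>x - x0\<bar> powr s"
    using h unfolding holder_pt_iff by blast
  obtain Q where Q: "pderiv Q = P" "poly Q 0 = 0" "degree Q \<le> Suc (degree P)" using poly_antiderivative by blast
  define R where "R = [:D x0:] + Q"
  have degR: "real (degree R) < s + 1"
  proof (cases "P = 0")
    case True
    then have "degree Q = 0" using Q(1) pderiv_eq_0_iff[of Q] by simp
    then show ?thesis using s degree_add_le[of "[:D x0:]" 0 Q] by (simp add: R_def)
  next
    case False
    have "degree R \<le> Suc (degree P)" unfolding R_def using Q(3) by (intro degree_add_le) auto
    then show ?thesis using P(1) False by linarith
  qed
  define \<phi> where "\<phi> t = D t - poly R (of_real (t - x0))" for t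
  have der: "(\<phi> has_vector_derivative (D' t - poly P (of_real (t - x0)))) (at t)" if "\<bar>t - x0\<bar> < d" for t
  proof -
    have "((\<lambda>z. poly R (z - of_real x0)) has_field_derivative poly (pderiv R) (of_real t - of_real x0)) (at (of_real t))"
      by (auto intro!: derivative_eq_intros poly_DERIV[THEN DERIV_chain2])
    from has_vector_derivative_real_field[OF this]
    have "((\<lambda>t. poly R (of_real (t - x0))) has_vector_derivative poly P (of_real (t - x0))) (at t)"
      by (simp add: R_def pderiv_add pderiv_pCons Q(1))
    then show ?thesis unfolding \<phi>_def using d(2)[OF that] by (rule has_vector_derivative_diff[rotated])
  qed
  have \<phi>0: "\<phi> x0 = 0" by (simp add: \<phi>_def R_def Q(2))
  \<comment> \<open>Only interior points of the segment enter, so having \<open>x0\<close> as an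
    endpoint is harmless although the estimate for \<open>D'\<close> is silent at
    \<open>x0\<close>.\<close>
  have seg: "norm (\<phi> b - \<phi> a) \<le> C * M powr s * (b - a)"
    if ab: "a < b" and M: "\<And>t. a < t \<Longrightarrow> t < b \<Longrightarrow> t \<noteq> x0 \<and> \<bar>t - x0\<bar> \<le> M" and near: "\<And>t. a \<le> t \<Longrightarrow> t \<le> b \<Longrightarrow> \<bar>t - x0\<bar> < min d e" for a b M
  proof -
    have "\<exists>t\<in>{a<..<b}. norm (\<phi> b - \<phi> a) \<le> norm ((b - a) *\<^sub>R (D' t - poly P (of_real (t - x0))))"
    proof (rule mvt_general[OF ab])
      have "isCont \<phi> t" if "t \<in> {a..b}" for t
        using der[of t] near[of t] that by (auto intro: has_vector_derivative_continuous)
      then show "continuous_on {a..b} \<phi>" by (simp add: continuous_at_imp_continuous_on)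
      show "(\<phi> has_derivative (\<lambda>h. h *\<^sub>R (D' t - poly P (of_real (t - x0))))) (at t)" if "a < t" "t < b" for t
        using der[of t] near[of t] that by (simp add: has_vector_derivative_def)
    qed
    then obtain t where t: "a < t" "t < b" "norm (\<phi> b - \<phi> a) \<le> (b - a) * norm (D' t - poly P (of_real (t - x0)))"
      using ab by auto
    have "norm (D' t - poly P (of_real (t - x0))) \<le> C * \<bar>t - x0\<bar> powr s"
      using P(4)[of t] M[of t] near[of t] t by simp
    also have "\<dots> \<le> C * M powr s" using M[of t] t s P(3) by (intro mult_left_mono powr_mono2) auto
    finally have "(b - a) * norm (D' t - poly P (of_real (t - x0))) \<le> (b - a) * (C * M powr s)"
      using ab by (intro mult_left_mono) auto
    then show ?thesis using t(3) by (simp add: mult_ac)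
  qed
  have "norm (D x - poly R (of_real (x - x0))) \<le> C * \<bar>x - x0\<bar> powr (s + 1)" if x: "x \<noteq> x0" "\<bar>x - x0\<bar> < min d e" for x
  proof -
    have "norm (\<phi> x) \<le> C * \<bar>x - x0\<bar> powr s * \<bar>x - x0\<bar>"
    proof (cases "x0 < x")
      case True
      have "norm (\<phi> x - \<phi> x0) \<le> C * \<bar>x - x0\<bar> powr s * (x - x0)"
        by (rule seg) (use True x in auto)
      then show ?thesis using True by (simp add: \<phi>0)
    next
      case False
      then have "x < x0" using x by simp
      have "norm (\<phi> x0 - \<phi> x) \<le> C * \<bar>x - x0\<bar> powr s * (x0 - x)"
        by (rule seg) (use \<open>x < x0\<close> x in auto)
      then show ?thesis using \<open>x < x0\<close> by (simp add: \<phi>0)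
    qed
    then show ?thesis using x by (simp add: \<phi>_def powr_add mult_ac)
  qed
  then show ?thesis unfolding holder_pt_iff using degR P(2,3) d(1)
    by (intro exI[of _ R] exI[of _ C] exI[of _ "min d e"]) auto
qed

text \<open>Integrating down the chain of derivatives adds 1 to the exponent at each step;
  consequently \<open>holder_beta_star\<close> never exceeds \<open>holder_beta\<close>.\<close>

lemma holder_ks_pt_imp_holder_pt:
  assumes "holder_ks_pt g x0 k s"
  shows "holder_pt g x0 (real k + s)"
proof -
  obtain \<delta> D where s: "0 \<le> s" and d: "0 < \<delta>" "derivs_on g k D {x0 - \<delta><..<x0 + \<delta>}" "holder_pt (D k) x0 s"
    using assms unfolding holder_ks_pt_def by blast
  have "j \<le> k \<Longrightarrow> holder_pt (D (k - j)) x0 (real j + s)" for j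
  proof (induction j)
    case 0
    then show ?case using d by simp
  next
    case (Suc j)
    have "holder_pt (D (k - Suc j)) x0 ((real j + s) + 1)"
    proof (rule holder_pt_integrate[OF d(1) _ _])
      fix t assume "\<bar>t - x0\<bar> < \<delta>"
      then have "t \<in> {x0 - \<delta><..<x0 + \<delta>}" by (auto simp: abs_less_iff)
      moreover have "Suc (k - Suc j) = k - j" using Suc by simp
      ultimately show "(D (k - Suc j) has_vector_derivative D (k - j) t) (at t)"
        using d(2) Suc unfolding derivs_on_def by (metis diff_less_Suc less_le_trans Suc_le_eq diff_less zero_less_Suc)
    qed (use Suc s in auto)
    then show ?case by (simp add: add_ac)
  qed
  from this[of k] have "holder_pt (D 0) x0 (real k + s)" by simp
  then show ?thesis
    by (rule holder_pt_cong[OF d(1), rotated]) (use d(2) in \<open>auto simp: derivs_on_def abs_less_iff\<close>)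
qed

lemma holder_ks_int_imp_pt:
  assumes h: "holder_ks_int g {a<..<b} k s" and x: "a < x0" "x0 < b"
  shows "holder_ks_pt g x0 k s"
proof -
  obtain D where s: "0 \<le> s" "s \<le> 1" and D: "derivs_on g k D {a<..<b}" "\<And>K. compact K \<Longrightarrow> K \<subseteq> {a<..<b} \<Longrightarrow> unif_holder (D k) K s"
    using h unfolding holder_ks_int_def by blast
  define \<delta> where "\<delta> = min (x0 - a) (b - x0) / 2"
  have d: "0 < \<delta>" "a < x0 - \<delta>" "x0 + \<delta> < b" using x by (auto simp: \<delta>_def min_def field_simps)
  have "unif_holder (D k) {x0 - \<delta>..x0 + \<delta>} s" by (rule D(2)) (use d in auto)
  then obtain C where C: "\<And>x y. x \<in> {x0 - \<delta>..x0 + \<delta>} \<Longrightarrow> y \<in> {x0 - \<delta>..x0 + \<delta>} \<Longrightarrow> norm (D k x - D k y) \<le> C * \<bar>x - y\<bar> powr s"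
    unfolding unif_holder_def by blast
  have "holder_pt (D k) x0 s"
  \<comment> \<open>For s = 0 a nonzero constant is not an admissible polynomial, its degree not
    being below 0, so boundedness near \<open>x0\<close> has to be shown with the zero
    polynomial.\<close>
  proof (cases "s = 0")
    case False
    show ?thesis unfolding holder_pt_def
    proof (intro exI conjI)
      show "[:D k x0:] = 0 \<or> real (degree [:D k x0:]) < s" using False s by simp
      show "\<forall>\<^sub>F x in at x0. cmod (D k x - poly [:D k x0:] (complex_of_real (x - x0))) \<le> C * \<bar>x - x0\<bar> powr s"
        unfolding eventually_at using d C by (intro exI[of _ \<delta>]) (auto simp: dist_real_def abs_less_iff)
    qed
  next
    case True
    show ?thesis unfolding holder_pt_def
    proof (intro exI conjI)
      show "(0::complex poly) = 0 \<or> real (degree (0::complex poly)) < s" by simp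
      show "\<forall>\<^sub>F x in at x0. cmod (D k x - poly 0 (complex_of_real (x - x0))) \<le> (C + norm (D k x0)) * \<bar>x - x0\<bar> powr s"
        unfolding eventually_at
      proof (intro exI[of _ \<delta>] conjI ballI impI d)
        fix x assume x: "x \<noteq> x0 \<and> dist x x0 < \<delta>"
        then have "norm (D k x - D k x0) \<le> C * \<bar>x - x0\<bar> powr s" using d by (intro C) (auto simp: dist_real_def abs_less_iff)
        then have "norm (D k x - D k x0) \<le> C" using x True by simp
        then have "norm (D k x) \<le> C + norm (D k x0)" using norm_triangle_sub[of "D k x" "D k x0"] by simp
        then show "cmod (D k x - poly 0 (complex_of_real (x - x0))) \<le> (C + norm (D k x0)) * \<bar>x - x0\<bar> powr s" using x True by simp
      qed
    qed
  qed
  moreover have "derivs_on g k D {x0 - \<delta><..<x0 + \<delta>}" using D(1) d unfolding derivs_on_def by auto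
  ultimately show ?thesis using s d unfolding holder_ks_pt_def by blast
qed

text \<open>The chain in the Hoelder classes is an arbitrary witness; on an open interval it is
  forced, which later identifies it with \<open>mixd\<close>.\<close>

lemma derivs_on_unique:
  assumes D: "derivs_on g k D {a<..<b}" and E: "derivs_on g k E {a<..<b}" and j: "j \<le> k" and x: "x \<in> {a<..<b}"
  shows "D j x = E j x"
  using j x
proof (induction j arbitrary: x)
  case 0
  then show ?case using D E by (simp add: derivs_on_def)
next
  case (Suc j)
  have 1: "(D j has_vector_derivative D (Suc j) x) (at x)" "(E j has_vector_derivative E (Suc j) x) (at x)"
    using D E Suc.prems by (auto simp: derivs_on_def)
  have "(D j has_vector_derivative E (Suc j) x) (at x)"
    by (rule has_vector_derivative_transform_within_open[OF 1(2), of "{a<..<b}"]) (use Suc in auto)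
  then show ?case using 1(1) vector_derivative_unique_at by blast
qed

text \<open>In both cases of the theorem the supremum is the same for all small intervals around the
  point, so the limit is that of an eventually constant function.\<close>

lemma holder_beta_2star_eqI:
  assumes "\<And>a b. a < x \<Longrightarrow> x < b \<Longrightarrow> Sup {ereal (real k + s) | k s. holder_ks_int g {a<..<b} k s} = L"
  shows "holder_beta_2star g x = L"
proof -
  have "eventually (\<lambda>p. (\<lambda>(a,b). Sup {ereal (real k + s) | k s. holder_ks_int g {a<..<b} k s}) p = L) (at_left x \<times>\<^sub>F at_right x)"
  proof -
    have "eventually (\<lambda>a. a < x) (at_left x)" "eventually (\<lambda>b. x < b) (at_right x)"
      by (auto simp: eventually_at_filter)
    then have "eventually (\<lambda>p. fst p < x \<and> x < snd p) (at_left x \<times>\<^sub>F at_right x)"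
      by (rule eventually_prodI)
    then show ?thesis by eventually_elim (auto simp: assms)
  qed
  then have "((\<lambda>(a,b). Sup {ereal (real k + s) | k s. holder_ks_int g {a<..<b} k s}) \<longlongrightarrow> L) (at_left x \<times>\<^sub>F at_right x)"
    by (rule tendsto_eventually)
  then show ?thesis unfolding holder_beta_2star_def
    by (rule tendsto_Lim[rotated]) (simp add: prod_filter_eq_bot)
qed

text \<open>After multiplication by \<open>y powr e1\<close> the right-hand side would tend to 0
  with \<open>y\<close> if e2 < e1, whereas the left-hand side stays equal to c. Arbitrarily small
  \<open>y\<close> suffice, so lower bounds along a sequence can be used.\<close>

lemma powr_comparison:
  fixes c K B e1 e2 :: real
  assumes c: "0 < c" and e: "0 < e1" and H: "\<And>\<eta>. 0 < \<eta> \<Longrightarrow> \<exists>y. 0 < y \<and> y \<le> \<eta> \<and> c * y powr (-e1) \<le> K * y powr (-e2) + B"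
  shows "e1 \<le> e2"
proof (rule ccontr)
  assume "\<not> e1 \<le> e2"
  then have e12: "0 < e1 - e2" by simp
  have "((\<lambda>y. K * y powr (e1 - e2) + B * y powr e1) \<longlongrightarrow> K * 0 + B * 0) (at_right 0)"
  proof (intro tendsto_intros)
    show "((\<lambda>y::real. y powr (e1 - e2)) \<longlongrightarrow> 0) (at_right 0)"
      by (rule tendsto_zero_powrI[OF tendsto_ident_at tendsto_const _ e12]) (auto simp: eventually_at_right_field intro: exI[of _ 1])
    show "((\<lambda>y::real. y powr e1) \<longlongrightarrow> 0) (at_right 0)"
      by (rule tendsto_zero_powrI[OF tendsto_ident_at tendsto_const _ e]) (auto simp: eventually_at_right_field intro: exI[of _ 1])
  qed
  then have "eventually (\<lambda>y. K * y powr (e1 - e2) + B * y powr e1 < c) (at_right 0)"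
    using c by (auto dest: order_tendstoD(2))
  then obtain d where d: "0 < d" "\<And>y. 0 < y \<Longrightarrow> y < d \<Longrightarrow> K * y powr (e1 - e2) + B * y powr e1 < c"
    unfolding eventually_at_right_field by auto
  obtain y where y: "0 < y" "y \<le> d / 2" "c * y powr (-e1) \<le> K * y powr (-e2) + B" using H[of "d/2"] d(1) by auto
  have "c * y powr (-e1) * y powr e1 \<le> (K * y powr (-e2) + B) * y powr e1" by (rule mult_right_mono[OF y(3)]) simp
  moreover have "c * y powr (-e1) * y powr e1 = c" using y by (simp add: powr_minus)
  moreover have "(K * y powr (-e2) + B) * y powr e1 = K * y powr (e1 - e2) + B * y powr e1"
    using y by (simp add: distrib_right powr_diff powr_minus field_simps)
  ultimately show False using d(2)[of y] y d(1) by simp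
qed

lemma finite_rationals_bounded_denominator:
  fixes x C :: real and N :: int
  shows "finite {\<rho>::rat. \<bar>x - of_rat \<rho>\<bar> \<le> C \<and> snd (quotient_of \<rho>) \<le> N}"
proof -
  define K where "K = \<lceil>\<bar>x\<bar> + \<bar>C\<bar>\<rceil>"
  have "quotient_of ` {\<rho>::rat. \<bar>x - of_rat \<rho>\<bar> \<le> C \<and> snd (quotient_of \<rho>) \<le> N} \<subseteq> {- (K * \<bar>N\<bar>)..K * \<bar>N\<bar>} \<times> {0..\<bar>N\<bar>}"
  proof
    fix u assume "u \<in> quotient_of ` {\<rho>::rat. \<bar>x - of_rat \<rho>\<bar> \<le> C \<and> snd (quotient_of \<rho>) \<le> N}"
    then obtain \<rho> :: rat where \<rho>: "u = quotient_of \<rho>" and le: "\<bar>x - of_rat \<rho>\<bar> \<le> C" "snd (quotient_of \<rho>) \<le> N" by blast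
    obtain p q where H: "(p, q) = quotient_of \<rho>" by (metis surj_pair)
    have q: "0 < q" "q \<le> N" "(of_rat \<rho> :: real) = of_int p / of_int q"
      using quotient_of_denom_pos[OF H[symmetric]] le(2) H[symmetric] quotient_of_div[OF H[symmetric]] by (simp_all add: of_rat_divide)
    have "\<bar>real_of_int p\<bar> / of_int q \<le> \<bar>x\<bar> + \<bar>C\<bar>" using le(1) q by (simp add: q(3) abs_divide[symmetric])
    then have "\<bar>real_of_int p\<bar> / of_int q \<le> of_int K" unfolding K_def by linarith
    then have "\<bar>real_of_int p\<bar> \<le> of_int K * of_int q" using q(1) by (simp add: field_simps)
    also have "\<dots> \<le> of_int K * of_int \<bar>N\<bar>"
    proof (rule mult_left_mono)
      have "0 \<le> K" unfolding K_def by (rule order_trans[OF _ ceiling_mono[of 0]]) auto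
      then show "0 \<le> real_of_int K" by simp
    qed (use q in simp)
    finally have "\<bar>p\<bar> \<le> K * \<bar>N\<bar>" by (metis of_int_abs of_int_le_iff of_int_mult)
    then show "u \<in> {- (K * \<bar>N\<bar>)..K * \<bar>N\<bar>} \<times> {0..\<bar>N\<bar>}" using q by (simp add: \<rho> H[symmetric] abs_le_iff)
  qed
  moreover have "inj_on quotient_of S" for S by (rule inj_onI) (simp add: quotient_of_inject)
  ultimately show ?thesis by (meson finite_SigmaI finite_atLeastAtMost_int finite_imageD finite_subset)
qed

text \<open>Lowering the exponent may make the old polynomial inadmissible. For 0 < s <= 1 it is
  truncated to its constant term, the discarded part being O(|h|).\<close>

lemma holder_pt_lower_exponent:
  assumes h: "holder_pt g x0 s0" and s: "0 < s" "s \<le> 1" "s \<le> s0"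
  shows "holder_pt g x0 s"
proof -
  obtain P C d where P: "0 < d" "0 \<le> C"
     "\<And>x. x \<noteq> x0 \<Longrightarrow> \<bar>x - x0\<bar> < d \<Longrightarrow> norm (g x - poly P (of_real (x - x0))) \<le> C * \<bar>x - x0\<bar> powr s0"
    using h unfolding holder_pt_iff by blast
  obtain a R where aR: "P = pCons a R" by (cases P)
  have "bounded (poly R ` cball 0 1)"
    by (intro compact_imp_bounded compact_continuous_image continuous_intros) auto
  then obtain B where B: "0 < B" "\<And>z. z \<in> cball 0 1 \<Longrightarrow> norm (poly R z) \<le> B" unfolding bounded_pos by auto
  have "norm (g x - poly [:a:] (of_real (x - x0))) \<le> (C + B) * \<bar>x - x0\<bar> powr s" if x: "x \<noteq> x0" "\<bar>x - x0\<bar> < min d 1" for x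
  proof -
    define h where "h = x - x0"
    have h: "0 < \<bar>h\<bar>" "\<bar>h\<bar> \<le> 1" using x by (auto simp: h_def)
    have "norm (g x - poly P (of_real h)) \<le> C * \<bar>h\<bar> powr s0" using P(3)[of x] x by (simp add: h_def)
    also have "\<dots> \<le> C * \<bar>h\<bar> powr s" using h s P(2) by (intro mult_left_mono powr_mono') auto
    finally have 1: "norm (g x - poly P (of_real h)) \<le> C * \<bar>h\<bar> powr s" .
    have "norm (of_real h * poly R (of_real h)) \<le> \<bar>h\<bar> * B"
      unfolding norm_mult using B(2)[of "of_real h"] h by (intro mult_mono) auto
    also have "\<bar>h\<bar> * B \<le> \<bar>h\<bar> powr s * B"
      using powr_mono'[of s 1 "\<bar>h\<bar>"] h s B(1) by (intro mult_right_mono) auto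
    finally have 2: "norm (of_real h * poly R (of_real h)) \<le> B * \<bar>h\<bar> powr s" by (simp add: mult.commute)
    have "g x - poly [:a:] (of_real h) = (g x - poly P (of_real h)) + of_real h * poly R (of_real h)"
      by (simp add: aR)
    then have "norm (g x - poly [:a:] (of_real h)) \<le> C * \<bar>h\<bar> powr s + B * \<bar>h\<bar> powr s"
      using norm_triangle_le[OF add_mono[OF 1 2]] by (simp only:)
    then show ?thesis by (simp add: h_def distrib_right)
  qed
  then show ?thesis unfolding holder_pt_iff using P(1,2) B(1) s(1)
    by (intro exI[of _ "[:a:]"] exI[of _ "C + B"] exI[of _ "min d 1"]) auto
qed

lemma differentiable_imp_holder_pt_1:
  assumes "(g has_vector_derivative D) (at x0)"
  shows "holder_pt g x0 1"
proof -
  have "\<forall>e>0. \<exists>d>0. \<forall>y. norm (y - x0) < d \<longrightarrow> norm (g y - g x0 - (y - x0) *\<^sub>R D) \<le> e * norm (y - x0)"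
    using assms unfolding has_vector_derivative_def has_derivative_at_alt by blast
  from this[rule_format, OF zero_less_one] obtain d where d: "0 < d" "\<And>y. \<bar>y - x0\<bar> < d \<Longrightarrow> norm (g y - g x0 - (y - x0) *\<^sub>R D) \<le> \<bar>y - x0\<bar>" by auto
  have "norm (g y - poly [:g x0:] (of_real (y - x0))) \<le> (1 + norm D) * \<bar>y - x0\<bar> powr 1" if "y \<noteq> x0" "\<bar>y - x0\<bar> < d" for y
  proof -
    have "norm (g y - g x0) \<le> norm (g y - g x0 - (y - x0) *\<^sub>R D) + norm ((y - x0) *\<^sub>R D)"
      by (metis diff_add_cancel norm_triangle_ineq)
    also have "\<dots> \<le> \<bar>y - x0\<bar> + \<bar>y - x0\<bar> * norm D" using d(2)[OF that(2)] by simp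
    finally show ?thesis by (simp add: algebra_simps)
  qed
  then show ?thesis unfolding holder_pt_iff using d(1)
    by (intro exI[of _ "[:g x0:]"] exI[of _ "1 + norm D"] exI[of _ d]) auto
qed

text \<open>Suprema of exponents can be approached through non-integers, the only values for which
  \<open>bdry_taylor\<close> is available.\<close>

lemma nonint_between:
  fixes a b :: real
  assumes "a < b"
  obtains s where "a < s" "s < b" "s \<notin> \<int>"
proof -
  define c where "c = min b (of_int \<lfloor>a\<rfloor> + 1)"
  have c: "a < c" "c \<le> b" "c \<le> of_int \<lfloor>a\<rfloor> + 1" using assms by (auto simp: c_def)
  show thesis
  proof (rule that[of "(a + c) / 2"])
    show "(a + c) / 2 \<notin> \<int>"
    proof
      assume "(a + c) / 2 \<in> \<int>"
      then obtain n where n: "(a + c) / 2 = of_int n" by (auto elim: Ints_cases)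
      have "a < real_of_int n" "real_of_int n < c" unfolding n[symmetric] using c(1) by simp_all
      then have "\<lfloor>a\<rfloor> < n" "n < \<lfloor>a\<rfloor> + 1" using c(3) by linarith+
      then show False by linarith
    qed
  qed (use c in auto)
qed

section \<open>Regularity of \<open>mix\<close> against growth of \<open>\<Phi>\<close>\<close>

context boundary_series begin

text \<open>This class contains \<open>g\<close>, \<open>Re g\<close> and \<open>Im g\<close> and is closed under differentiation.\<close>
definition mix :: "real \<Rightarrow> complex \<Rightarrow> complex \<Rightarrow> real \<Rightarrow> real \<Rightarrow> complex" where
  "mix \<alpha> l1 l2 \<omega> t = l1 * bdry \<alpha> (\<omega> * t) + l2 * cnj (bdry \<alpha> (\<omega> * t))"

definition mixd :: "real \<Rightarrow> complex \<Rightarrow> complex \<Rightarrow> real \<Rightarrow> nat \<Rightarrow> real \<Rightarrow> complex" where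
  "mixd \<alpha> l1 l2 \<omega> j = mix (\<alpha> - real j) ((\<i> * of_real \<omega>) ^ j * l1) ((- \<i> * of_real \<omega>) ^ j * l2) \<omega>"

lemma mix_has_vector_derivative:
  assumes "\<rho> < \<alpha> - 1"
  shows "(mix \<alpha> l1 l2 \<omega> has_vector_derivative mix (\<alpha> - 1) (\<i> * of_real \<omega> * l1) (- \<i> * of_real \<omega> * l2) \<omega> t) (at t)"
proof -
  have 1: "((\<lambda>t. \<omega> * t) has_vector_derivative \<omega>) (at t)"
    by (auto intro!: derivative_eq_intros simp flip: has_real_derivative_iff_has_vector_derivative)
  have 2: "((\<lambda>t. bdry \<alpha> (\<omega> * t)) has_vector_derivative (\<omega> *\<^sub>R (\<i> * bdry (\<alpha> - 1) (\<omega> * t)))) (at t)"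
    using vector_diff_chain_at[OF 1 bdry_has_vector_derivative[OF assms]] by (simp add: o_def)
  have 3: "((\<lambda>t. cnj (bdry \<alpha> (\<omega> * t))) has_vector_derivative cnj (\<omega> *\<^sub>R (\<i> * bdry (\<alpha> - 1) (\<omega> * t)))) (at t)"
    by (rule has_vector_derivative_cnj[OF 2])
  have "((\<lambda>t. l1 * bdry \<alpha> (\<omega> * t) + l2 * cnj (bdry \<alpha> (\<omega> * t))) has_vector_derivative
     (l1 * (\<omega> *\<^sub>R (\<i> * bdry (\<alpha> - 1) (\<omega> * t))) + l2 * cnj (\<omega> *\<^sub>R (\<i> * bdry (\<alpha> - 1) (\<omega> * t))))) (at t)"
    by (intro has_vector_derivative_add has_vector_derivative_mult_right 2 3)
  then show ?thesis by (simp add: mix_def[abs_def] scaleR_conv_of_real mult_ac)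
qed

lemma derivs_on_mix:
  assumes "\<rho> < \<alpha> - real k"
  shows "derivs_on (mix \<alpha> l1 l2 \<omega>) k (mixd \<alpha> l1 l2 \<omega>) I"
  unfolding derivs_on_def
proof (intro conjI allI impI ballI)
  show "mixd \<alpha> l1 l2 \<omega> 0 x = mix \<alpha> l1 l2 \<omega> x" for x by (simp add: mixd_def)
  fix j x assume j: "j < k"
  have "\<rho> < (\<alpha> - real j) - 1" using j assms by (simp add: of_nat_less_iff[symmetric] del: of_nat_less_iff)
  from mix_has_vector_derivative[OF this, of "(\<i> * of_real \<omega>) ^ j * l1" "(- \<i> * of_real \<omega>) ^ j * l2" \<omega> x]
  show "(mixd \<alpha> l1 l2 \<omega> j has_vector_derivative mixd \<alpha> l1 l2 \<omega> (Suc j) x) (at x)"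
    by (simp add: mixd_def algebra_simps)
qed

text \<open>The increment \<open>h\<close> is real, so the conjugate of a Taylor polynomial in
  \<open>h\<close> is again a polynomial in \<open>h\<close>, and one polynomial serves both
  summands.\<close>

lemma mix_holder_pt:
  assumes \<alpha>: "\<rho> < \<alpha>" "\<sigma> < \<alpha>" and \<sigma>: "0 < \<sigma>" and \<theta>: "0 \<le> \<theta>" and s: "s = \<alpha> - \<sigma> + \<theta>" "s \<notin> \<int>"
    and g: "local_growth (\<omega> * x) C \<sigma> \<theta>" and C: "0 \<le> C"
  shows "holder_pt (mix \<alpha> l1 l2 \<omega>) x s"
proof -
  have s0: "0 < s" using \<alpha> \<theta> s by simp
  define k where "k = nat \<lfloor>s\<rfloor>"
  have k: "real k < s" "s < real k + 1"
  proof -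
    have "real k = of_int \<lfloor>s\<rfloor>" using s0 by (simp add: k_def)
    moreover have "of_int \<lfloor>s\<rfloor> \<noteq> s" using s(2) by (metis Ints_of_int)
    ultimately show "real k < s" "s < real k + 1" using of_int_floor_le[of s] by linarith+
  qed
  obtain M where M: "0 \<le> M" "\<And>x C. 0 \<le> C \<Longrightarrow> local_growth x C \<sigma> \<theta> \<Longrightarrow>
     \<exists>p. p 0 = bdry \<alpha> x \<and> (\<forall>h. norm (bdry \<alpha> (x + h) - (\<Sum>i\<le>k. p i * of_real h ^ i)) \<le> M * C * \<bar>h\<bar> powr s)"
    using bdry_taylor[OF \<alpha> \<sigma> \<theta> s(1) k] by metis
  obtain p where p: "\<And>h. norm (bdry \<alpha> (\<omega> * x + h) - (\<Sum>i\<le>k. p i * of_real h ^ i)) \<le> M * C * \<bar>h\<bar> powr s"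
    using M(2)[OF C g] by blast
  define P where "P = (\<Sum>i\<le>k. monom ((l1 * p i + l2 * cnj (p i)) * of_real \<omega> ^ i) i)"
  have "degree P \<le> k" unfolding P_def by (intro degree_sum_le order_trans[OF degree_monom_le]) auto
  then have dP: "real (degree P) < s" using k by linarith
  have "norm (mix \<alpha> l1 l2 \<omega> t - poly P (of_real (t - x))) \<le> (norm l1 + norm l2) * (M * C) * \<bar>\<omega>\<bar> powr s * \<bar>t - x\<bar> powr s" for t
  proof -
    define h where "h = \<omega> * (t - x)"
    define S where "S = (\<Sum>i\<le>k. p i * of_real h ^ i)"
    have b: "bdry \<alpha> (\<omega> * t) = bdry \<alpha> (\<omega> * x + h)" by (simp add: h_def algebra_simps)
    have pw: "complex_of_real h ^ i = of_real \<omega> ^ i * of_real (t - x) ^ i" for i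
      by (simp add: h_def power_mult_distrib)
    have "poly P (of_real (t - x)) = l1 * S + l2 * cnj S"
      unfolding P_def S_def poly_sum cnj_sum sum_distrib_left sum.distrib[symmetric]
      by (intro sum.cong refl) (simp add: poly_monom pw ring_distribs mult_ac del: of_real_diff)
    then have "mix \<alpha> l1 l2 \<omega> t - poly P (of_real (t - x)) = l1 * (bdry \<alpha> (\<omega> * x + h) - S) + l2 * cnj (bdry \<alpha> (\<omega> * x + h) - S)"
      by (simp add: mix_def b algebra_simps)
    then have "norm (mix \<alpha> l1 l2 \<omega> t - poly P (of_real (t - x))) \<le> norm l1 * norm (bdry \<alpha> (\<omega> * x + h) - S) + norm l2 * norm (bdry \<alpha> (\<omega> * x + h) - S)"
      using norm_triangle_ineq[of "l1 * (bdry \<alpha> (\<omega> * x + h) - S)" "l2 * cnj (bdry \<alpha> (\<omega> * x + h) - S)"]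
      by (simp only: norm_mult complex_mod_cnj)
    also have "\<dots> = (norm l1 + norm l2) * norm (bdry \<alpha> (\<omega> * x + h) - S)" by (simp add: distrib_right)
    also have "\<dots> \<le> (norm l1 + norm l2) * (M * C * \<bar>h\<bar> powr s)" using p[of h] by (intro mult_left_mono) (auto simp: S_def)
    also have "\<bar>h\<bar> powr s = \<bar>\<omega>\<bar> powr s * \<bar>t - x\<bar> powr s" by (simp add: h_def abs_mult powr_mult)
    finally show ?thesis by (simp add: mult_ac)
  qed
  then show ?thesis unfolding holder_pt_def using dP by (blast intro: always_eventually)
qed

text \<open>For s < 1 the Taylor polynomial is just the value \<open>p 0 = bdry \<alpha> x\<close>,
  so the expansion is an increment estimate; it is uniform because neither \<open>C\<close> nor the
  Taylor constant depends on the point.\<close>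

lemma mix_unif_holder:
  assumes \<alpha>: "\<rho> < \<alpha>" "\<sigma> < \<alpha>" and \<sigma>: "0 < \<sigma>" and s: "s = \<alpha> - \<sigma>" "s < 1"
    and g: "\<And>x. local_growth x C \<sigma> 0" and C: "0 \<le> C"
  shows "unif_holder (mix \<alpha> l1 l2 \<omega>) S s"
proof -
  have s0: "real 0 < s" "s < real 0 + 1" "s = \<alpha> - \<sigma> + 0" using \<alpha> s by simp_all
  obtain M where M: "0 \<le> M" "\<And>x C. 0 \<le> C \<Longrightarrow> local_growth x C \<sigma> 0 \<Longrightarrow>
     \<exists>p. p 0 = bdry \<alpha> x \<and> (\<forall>h. norm (bdry \<alpha> (x + h) - (\<Sum>i\<le>0. p i * of_real h ^ i)) \<le> M * C * \<bar>h\<bar> powr s)"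
    using bdry_taylor[OF \<alpha> \<sigma> order.refl s0(3,1,2)] by metis
  have b: "norm (bdry \<alpha> (x + h) - bdry \<alpha> x) \<le> M * C * \<bar>h\<bar> powr s" for x h
    using M(2)[OF C g[of x]] by auto
  have "norm (mix \<alpha> l1 l2 \<omega> x - mix \<alpha> l1 l2 \<omega> y) \<le> (norm l1 + norm l2) * (M * C) * \<bar>\<omega>\<bar> powr s * \<bar>x - y\<bar> powr s" for x y
  proof -
    define h where "h = \<omega> * (x - y)"
    have e: "bdry \<alpha> (\<omega> * x) = bdry \<alpha> (\<omega> * y + h)" by (simp add: h_def algebra_simps)
    define D where "D = bdry \<alpha> (\<omega> * y + h) - bdry \<alpha> (\<omega> * y)"
    have "mix \<alpha> l1 l2 \<omega> x - mix \<alpha> l1 l2 \<omega> y = l1 * D + l2 * cnj D"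
      by (simp add: mix_def e D_def algebra_simps)
    then have "norm (mix \<alpha> l1 l2 \<omega> x - mix \<alpha> l1 l2 \<omega> y) \<le> norm l1 * norm D + norm l2 * norm D"
      using norm_triangle_ineq[of "l1 * D" "l2 * cnj D"] by (simp only: norm_mult complex_mod_cnj)
    also have "\<dots> = (norm l1 + norm l2) * norm D" by (simp add: distrib_right)
    also have "\<dots> \<le> (norm l1 + norm l2) * (M * C * \<bar>h\<bar> powr s)" unfolding D_def by (intro mult_left_mono b) auto
    also have "\<bar>h\<bar> powr s = \<bar>\<omega>\<bar> powr s * \<bar>x - y\<bar> powr s" by (simp add: h_def abs_mult powr_mult)
    finally show ?thesis by (simp add: mult_ac)
  qed
  then show ?thesis unfolding unif_holder_def by blast
qed

text \<open>The exponent \<open>s\<close> may be \<open>\<alpha>\<close> or more, while the kernel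
  estimate needs one below \<open>\<alpha>\<close>. Passing to s' is free because that estimate does
  not restrict the degree of the polynomial; composing with 1/\<open>\<omega>\<close> accounts for
  the rescaled variable.\<close>

lemma Phi_bound_of_holder:
  assumes \<alpha>: "\<rho> < \<alpha>" and l1: "l1 \<noteq> 0" and \<omega>: "0 < \<omega>" and h: "holder_pt (mix \<alpha> l1 l2 \<omega>) x s"
    and s': "0 \<le> s'" "s' \<le> s" "s' < \<alpha>" and A: "0 \<le> A"
  obtains M B \<delta> where "0 < \<delta>" "\<And>u y. 0 < y \<Longrightarrow> y \<le> \<delta> \<Longrightarrow> \<bar>u\<bar> \<le> A * y \<Longrightarrow> norm (\<Phi> (Complex (\<omega> * x + u) y)) \<le> M * y powr (s' - \<alpha>) + B"
proof -
  obtain K0 where K0: "0 \<le> K0"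
    "\<And>x P w \<delta> l1 l2. 0 < w \<Longrightarrow> 0 < \<delta> \<Longrightarrow>
      (\<forall>h. h \<noteq> 0 \<and> \<bar>h\<bar> < \<delta> \<longrightarrow> norm (l1 * bdry \<alpha> (x + h) + l2 * cnj (bdry \<alpha> (x + h)) - poly P (of_real h)) \<le> w * \<bar>h\<bar> powr s')
      \<Longrightarrow> \<exists>B \<delta>'. 0 < \<delta>' \<and> (\<forall>u y. 0 < y \<and> y \<le> \<delta>' \<and> \<bar>u\<bar> \<le> A * y \<longrightarrow>
         norm l1 * norm (\<Phi> (Complex (x + u) y)) \<le> K0 * w * y powr (s' - \<alpha>) + B)"
    by (rule holder_imp_Phi_bound[OF \<alpha> s'(1) s'(3) A]) (rule that)
  obtain P C d where P: "0 < d" "0 \<le> C"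
     "\<And>t. t \<noteq> x \<Longrightarrow> \<bar>t - x\<bar> < d \<Longrightarrow> norm (mix \<alpha> l1 l2 \<omega> t - poly P (of_real (t - x))) \<le> C * \<bar>t - x\<bar> powr s"
    using h unfolding holder_pt_iff by blast
  define w where "w = C * (1/\<omega>) powr s' + 1"
  have w: "0 < w" using P(2) by (simp add: w_def add_nonneg_pos)
  have "norm (l1 * bdry \<alpha> (\<omega> * x + h) + l2 * cnj (bdry \<alpha> (\<omega> * x + h)) - poly (pcompose P [:0, 1 / of_real \<omega>:]) (of_real h)) \<le> w * \<bar>h\<bar> powr s'"
    if h: "h \<noteq> 0" "\<bar>h\<bar> < \<omega> * min d 1" for h
  proof -
    define t where "t = x + h / \<omega>"
    have t: "t - x = h / \<omega>" "\<omega> * t = \<omega> * x + h" using \<omega> by (auto simp: t_def field_simps)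
    have abs: "\<bar>t - x\<bar> = \<bar>h\<bar> * (1/\<omega>)" using \<omega> by (simp add: t)
    have small: "\<bar>t - x\<bar> < min d 1" using h(2) \<omega> unfolding abs by (simp add: field_simps min_def split: if_splits)
    have "norm (mix \<alpha> l1 l2 \<omega> t - poly P (of_real (t - x))) \<le> C * \<bar>t - x\<bar> powr s"
      by (rule P(3)) (use small h \<omega> t in auto)
    also have "\<dots> \<le> C * \<bar>t - x\<bar> powr s'" using small s' P(2) by (intro mult_left_mono powr_mono') auto
    also have "\<dots> = C * (1/\<omega>) powr s' * \<bar>h\<bar> powr s'" using \<omega> by (simp only: abs powr_mult mult_ac)
    also have "\<dots> \<le> w * \<bar>h\<bar> powr s'" by (intro mult_right_mono) (auto simp: w_def)
    finally show ?thesis by (simp add: mix_def t poly_pcompose)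
  qed
  moreover have "0 < \<omega> * min d 1" using P(1) \<omega> by simp
  ultimately obtain B \<delta> where B': "0 < \<delta>" "\<forall>u y. 0 < y \<and> y \<le> \<delta> \<and> \<bar>u\<bar> \<le> A * y \<longrightarrow> norm l1 * norm (\<Phi> (Complex (\<omega> * x + u) y)) \<le> K0 * w * y powr (s' - \<alpha>) + B"
    using K0(2)[OF w, of "\<omega> * min d 1" l1 "\<omega> * x" l2 "pcompose P [:0, 1 / of_real \<omega>:]"] by blast
  have B: "norm l1 * norm (\<Phi> (Complex (\<omega> * x + u) y)) \<le> K0 * w * y powr (s' - \<alpha>) + B"
    if "0 < y" "y \<le> \<delta>" "\<bar>u\<bar> \<le> A * y" for u y
    using B'(2) that by blast
  show thesis
  proof (rule that[OF B'(1)])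
    fix u y :: real assume "0 < y" "y \<le> \<delta>" "\<bar>u\<bar> \<le> A * y"
    from B[OF this] show "norm (\<Phi> (Complex (\<omega> * x + u) y)) \<le> (K0 * w / norm l1) * y powr (s' - \<alpha>) + B / norm l1"
      using l1 by (simp add: field_simps)
  qed
qed

text \<open>Differentiability bounds the remainder by an arbitrarily small multiple of |h|, and the
  kernel estimate is linear in that multiple. The result is an o-bound, sharper than exponent 1
  would give. With A = 0 only the vertical line over the point is considered.\<close>

lemma Phi_bound_of_derivative:
  assumes \<alpha>: "\<rho> < \<alpha>" "1 < \<alpha>" and l1: "l1 \<noteq> 0" and \<omega>: "0 < \<omega>" and D: "(mix \<alpha> l1 l2 \<omega> has_vector_derivative D) (at x)" and \<eta>: "0 < \<eta>"
  obtains B \<delta> where "0 < \<delta>" "\<And>y. 0 < y \<Longrightarrow> y \<le> \<delta> \<Longrightarrow> norm (\<Phi> (Complex (\<omega> * x) y)) \<le> \<eta> * y powr (1 - \<alpha>) + B"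
proof -
  obtain K0 where K0: "0 \<le> K0"
    "\<And>x P w \<delta> l1 l2. 0 < w \<Longrightarrow> 0 < \<delta> \<Longrightarrow>
      (\<forall>h. h \<noteq> 0 \<and> \<bar>h\<bar> < \<delta> \<longrightarrow> norm (l1 * bdry \<alpha> (x + h) + l2 * cnj (bdry \<alpha> (x + h)) - poly P (of_real h)) \<le> w * \<bar>h\<bar> powr 1)
      \<Longrightarrow> \<exists>B \<delta>'. 0 < \<delta>' \<and> (\<forall>u y. 0 < y \<and> y \<le> \<delta>' \<and> \<bar>u\<bar> \<le> 0 * y \<longrightarrow>
         norm l1 * norm (\<Phi> (Complex (x + u) y)) \<le> K0 * w * y powr (1 - \<alpha>) + B)"
    by (rule holder_imp_Phi_bound[OF \<alpha>(1) zero_le_one \<alpha>(2) order.refl]) (rule that)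
  define w where "w = \<eta> * norm l1 / (K0 + 1)"
  have w: "0 < w" using \<eta> l1 K0(1) by (simp add: w_def)
  have "0 < w * \<omega>" using w \<omega> by simp
  then have "\<exists>d>0. \<forall>y. norm (y - x) < d \<longrightarrow> norm (mix \<alpha> l1 l2 \<omega> y - mix \<alpha> l1 l2 \<omega> x - (y - x) *\<^sub>R D) \<le> (w * \<omega>) * norm (y - x)"
    using D unfolding has_vector_derivative_def has_derivative_at_alt by blast
  then obtain d where d: "0 < d" "\<And>t. \<bar>t - x\<bar> < d \<Longrightarrow> norm (mix \<alpha> l1 l2 \<omega> t - mix \<alpha> l1 l2 \<omega> x - (t - x) *\<^sub>R D) \<le> (w * \<omega>) * \<bar>t - x\<bar>" by auto
  define P where "P = [:mix \<alpha> l1 l2 \<omega> x, D / of_real \<omega>:]"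
  have "norm (l1 * bdry \<alpha> (\<omega> * x + h) + l2 * cnj (bdry \<alpha> (\<omega> * x + h)) - poly P (of_real h)) \<le> w * \<bar>h\<bar> powr 1"
    if h: "h \<noteq> 0" "\<bar>h\<bar> < \<omega> * d" for h
  proof -
    define t where "t = x + h / \<omega>"
    have t: "t - x = h / \<omega>" "\<omega> * t = \<omega> * x + h" using \<omega> by (auto simp: t_def field_simps)
    have "\<bar>t - x\<bar> < d" using h(2) \<omega> by (simp add: t field_simps)
    from d(2)[OF this] have "norm (mix \<alpha> l1 l2 \<omega> t - mix \<alpha> l1 l2 \<omega> x - (t - x) *\<^sub>R D) \<le> w * \<bar>h\<bar>" using \<omega> by (simp add: t)
    moreover have "mix \<alpha> l1 l2 \<omega> t - mix \<alpha> l1 l2 \<omega> x - (t - x) *\<^sub>R D = l1 * bdry \<alpha> (\<omega> * x + h) + l2 * cnj (bdry \<alpha> (\<omega> * x + h)) - poly P (of_real h)"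
      by (simp add: P_def t scaleR_conv_of_real) (simp add: mix_def t)
    ultimately show ?thesis by simp
  qed
  moreover have "0 < \<omega> * d" using d(1) \<omega> by simp
  ultimately obtain B \<delta> where B': "0 < \<delta>" "\<forall>u y. 0 < y \<and> y \<le> \<delta> \<and> \<bar>u\<bar> \<le> 0 * y \<longrightarrow> norm l1 * norm (\<Phi> (Complex (\<omega> * x + u) y)) \<le> K0 * w * y powr (1 - \<alpha>) + B"
    using K0(2)[OF w, of "\<omega> * d" l1 "\<omega> * x" l2 P] by blast
  have B: "norm l1 * norm (\<Phi> (Complex (\<omega> * x) y)) \<le> K0 * w * y powr (1 - \<alpha>) + B" if "0 < y" "y \<le> \<delta>" for y
    using B'(2)[rule_format, of y 0] that by simp
  show thesis
  proof (rule that[OF B'(1)])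
    fix y :: real assume y: "0 < y" "y \<le> \<delta>"
    have "K0 * w \<le> \<eta> * norm l1" using K0(1) \<eta> by (simp add: w_def field_simps)
    then have "K0 * w * y powr (1 - \<alpha>) \<le> \<eta> * norm l1 * y powr (1 - \<alpha>)" by (rule mult_right_mono) simp
    then have "norm l1 * norm (\<Phi> (Complex (\<omega> * x) y)) \<le> \<eta> * norm l1 * y powr (1 - \<alpha>) + B" using B[OF y] by linarith
    then show "norm (\<Phi> (Complex (\<omega> * x) y)) \<le> \<eta> * y powr (1 - \<alpha>) + B / norm l1" using l1 by (simp add: field_simps)
  qed
qed

end

text \<open>Take the height y = |x - rho|, so that the point above rho lies in the sector |u| <= y
  at \<open>x\<close>. From q^t <= C/y one gets qy <=
  \<open>C powr (1/t) * y powr (1 - 1/t)\<close>, which is the exponent r - r/t. As t > 2, q^2 y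
  tends to 0 with growing q and \<open>noncuspidal_lower_bound\<close> applies.\<close>

lemma (in modform) liouville_lower_bound:
  assumes x: "x \<notin> \<rat>" and t: "2 < t" and C: "0 < C"
    and inf: "infinite {\<rho>. \<not> cuspidal_at f r \<Gamma> (Some \<rho>) \<and> \<bar>x - of_rat \<rho>\<bar> \<le> C * real_of_int (snd (quotient_of \<rho>)) powr (- t)}"
  obtains c where "0 < c" "\<And>\<eta>. 0 < \<eta> \<Longrightarrow> \<exists>u y. 0 < y \<and> y \<le> \<eta> \<and> \<bar>u\<bar> \<le> 1 * y \<and> c * y powr (- (r - r / t)) \<le> norm (f (Complex (x + u) y))"
proof -
  obtain l c1 where lc: "0 < l" "0 < c1" "\<And>\<rho> y. \<not> cuspidal_at f r \<Gamma> (Some \<rho>) \<Longrightarrow> 0 < y \<Longrightarrow>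
     (of_int (snd (quotient_of \<rho>)))\<^sup>2 * y \<le> c1 \<Longrightarrow> l * (of_int (snd (quotient_of \<rho>)) * y) powr (- r) \<le> norm (f (Complex (of_rat \<rho>) y))"
    by (rule noncuspidal_lower_bound) (rule that)
  show thesis
  proof (rule that[of "l * C powr (- (r / t))"])
    show "0 < l * C powr (- (r / t))" using lc(1) C by simp
    fix \<eta> :: real assume \<eta>: "0 < \<eta>"
    \<comment> \<open>Denominators beyond N give a height of at most \<open>\<eta>\<close> (second
      entry) and q^2 y at most \<open>c1\<close> (third entry).\<close>
    define N where "N = \<lceil>max 1 (max (C / \<eta>) ((C / c1) powr (1 / (t - 2))))\<rceil>"
    have N: "1 \<le> real_of_int N" "C / \<eta> \<le> of_int N" "(C / c1) powr (1 / (t - 2)) \<le> of_int N"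
      unfolding N_def using le_of_int_ceiling[of "max 1 (max (C / \<eta>) ((C / c1) powr (1 / (t - 2))))"] by linarith+
    have "\<exists>\<rho>. \<not> cuspidal_at f r \<Gamma> (Some \<rho>) \<and> \<bar>x - of_rat \<rho>\<bar> \<le> C * real_of_int (snd (quotient_of \<rho>)) powr (- t) \<and> N < snd (quotient_of \<rho>)"
    proof (rule ccontr)
      assume neg: "\<not> ?thesis"
      have "{\<rho>. \<not> cuspidal_at f r \<Gamma> (Some \<rho>) \<and> \<bar>x - of_rat \<rho>\<bar> \<le> C * real_of_int (snd (quotient_of \<rho>)) powr (- t)}
         \<subseteq> {\<rho>. \<bar>x - of_rat \<rho>\<bar> \<le> C \<and> snd (quotient_of \<rho>) \<le> N}"
      proof clarify
        fix \<rho> assume nc: "\<not> cuspidal_at f r \<Gamma> (Some \<rho>)" and le: "\<bar>x - of_rat \<rho>\<bar> \<le> C * real_of_int (snd (quotient_of \<rho>)) powr (- t)"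
        have "0 < snd (quotient_of \<rho>)" by (metis prod.collapse quotient_of_denom_pos)
        then have "1 \<le> real_of_int (snd (quotient_of \<rho>))" by linarith
        then have "real_of_int (snd (quotient_of \<rho>)) powr (- t) \<le> 1" using t powr_mono[of "-t" 0 "real_of_int (snd (quotient_of \<rho>))"] by simp
        then have "C * real_of_int (snd (quotient_of \<rho>)) powr (- t) \<le> C * 1" using C by (intro mult_left_mono) auto
        then show "\<bar>x - of_rat \<rho>\<bar> \<le> C \<and> snd (quotient_of \<rho>) \<le> N" using le neg nc by force
      qed
      then show False using inf finite_rationals_bounded_denominator finite_subset by blast
    qed
    then obtain \<rho> where \<rho>: "\<not> cuspidal_at f r \<Gamma> (Some \<rho>)" "\<bar>x - of_rat \<rho>\<bar> \<le> C * real_of_int (snd (quotient_of \<rho>)) powr (- t)" "N < snd (quotient_of \<rho>)" by blast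
    define q where "q = real_of_int (snd (quotient_of \<rho>))"
    define y where "y = \<bar>x - of_rat \<rho>\<bar>"
    have y0: "0 < y" using x by (auto simp: y_def)
    have yq: "y \<le> C * q powr (- t)" using \<rho>(2) by (simp add: y_def q_def)
    have qN: "of_int N < q" using \<rho>(3) by (simp add: q_def)
    have q1: "1 < q" using qN N by linarith
    have "y \<le> \<eta>"
    proof -
      have "q powr (- t) \<le> q powr (- 1)" using q1 t by (intro powr_mono) auto
      then have "y \<le> C * q powr (- 1)" using yq C mult_left_mono[of "q powr (- t)" "q powr (- 1)" C] by linarith
      also have "\<dots> = C / q" using q1 by (simp add: powr_minus_divide)
      also have "\<dots> \<le> \<eta>" using N(2) qN \<eta> q1 by (simp add: field_simps) (smt (verit) mult_left_mono)
      finally show ?thesis .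
    qed
    moreover have "q\<^sup>2 * y \<le> c1"
    proof -
      have "q\<^sup>2 * y \<le> q powr 2 * (C * q powr (- t))" using yq q1 y0 by (intro mult_mono) auto
      also have "\<dots> = C * q powr (- (t - 2))" by (simp add: mult.left_commute flip: powr_add)
      also have "\<dots> \<le> C * ((C / c1) powr (1 / (t - 2))) powr (- (t - 2))"
        using N(3) qN C lc(2) t by (intro mult_left_mono powr_mono2') auto
      also have "((C / c1) powr (1 / (t - 2))) powr (- (t - 2)) = (C / c1) powr (- 1)"
        unfolding powr_powr using t by (simp add: divide_minus_right[symmetric] del: minus_diff_eq)
      also have "C * (C / c1) powr (- 1) = c1" using C lc(2) by (simp add: powr_minus_divide)
      finally show ?thesis .
    qed
    ultimately have low: "l * (q * y) powr (- r) \<le> norm (f (Complex (of_rat \<rho>) y))"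
      using lc(3)[OF \<rho>(1) y0] by (simp add: q_def)
    have "C powr (- (r / t)) * y powr (- (r - r / t)) \<le> (q * y) powr (- r)"
    proof -
      have "q powr t * y \<le> q powr t * (C * q powr (- t))" using yq by (intro mult_left_mono) auto
      also have "\<dots> = C" using q1 by (simp add: powr_minus)
      finally have "q powr t \<le> C / y" using y0 by (simp add: field_simps)
      then have "(q powr t) powr (1 / t) \<le> (C / y) powr (1 / t)" using t by (intro powr_mono2) auto
      then have "q \<le> (C / y) powr (1 / t)" using t q1 by (simp add: powr_powr)
      then have "((C / y) powr (1 / t) * y) powr (- r) \<le> (q * y) powr (- r)"
        using y0 q1 r_pos by (intro powr_mono2' mult_right_mono) auto
      moreover have "((C / y) powr (1 / t) * y) powr (- r) = C powr (- (r / t)) * y powr (- (r - r / t))"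
      proof -
        have "((C / y) powr (1 / t) * y) powr (- r) = (C / y) powr (- (r / t)) * y powr (- r)"
          by (simp add: powr_mult powr_powr)
        also have "(C / y) powr (- (r / t)) = C powr (- (r / t)) * y powr (r / t)"
          by (simp add: powr_divide powr_minus_divide)
        finally show ?thesis by (simp add: mult.assoc flip: powr_add)
      qed
      ultimately show ?thesis by simp
    qed
    then have "l * (C powr (- (r / t)) * y powr (- (r - r / t))) \<le> l * (q * y) powr (- r)"
      using lc(1) by (intro mult_left_mono) auto
    then have "l * C powr (- (r / t)) * y powr (- (r - r / t)) \<le> norm (f (Complex (x + (of_rat \<rho> - x)) y))"
      using low by simp
    moreover have "\<bar>of_rat \<rho> - x\<bar> \<le> 1 * y" by (simp add: y_def)
    ultimately show "\<exists>u y. 0 < y \<and> y \<le> \<eta> \<and> \<bar>u\<bar> \<le> 1 * y \<and> l * C powr (- (r / t)) * y powr (- (r - r / t)) \<le> norm (f (Complex (x + u) y))"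
      using y0 \<open>y \<le> \<eta>\<close> by blast
  qed
qed

lemma (in modform) noncuspidal_rational_lower_bound:
  assumes "\<not> cuspidal_at f r \<Gamma> (Some \<rho>)"
  obtains c \<eta>0 where "0 < c" "0 < \<eta>0" "\<And>y. 0 < y \<Longrightarrow> y \<le> \<eta>0 \<Longrightarrow> c * y powr (- r) \<le> norm (f (Complex (of_rat \<rho>) y))"
proof -
  obtain l c1 where lc: "0 < l" "0 < c1" "\<And>\<rho> y. \<not> cuspidal_at f r \<Gamma> (Some \<rho>) \<Longrightarrow> 0 < y \<Longrightarrow>
     (of_int (snd (quotient_of \<rho>)))\<^sup>2 * y \<le> c1 \<Longrightarrow> l * (of_int (snd (quotient_of \<rho>)) * y) powr (- r) \<le> norm (f (Complex (of_rat \<rho>) y))"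
    by (rule noncuspidal_lower_bound) (rule that)
  define q where "q = real_of_int (snd (quotient_of \<rho>))"
  have q: "0 < q" unfolding q_def by (metis of_int_0_less_iff prod.collapse quotient_of_denom_pos)
  show thesis
  proof (rule that[of "l * q powr (- r)" "c1 / q\<^sup>2"])
    show "0 < l * q powr (- r)" "0 < c1 / q\<^sup>2" using lc q by auto
    fix y :: real assume y: "0 < y" "y \<le> c1 / q\<^sup>2"
    then have "q\<^sup>2 * y \<le> c1" using q by (simp add: field_simps)
    then have "l * (q * y) powr (- r) \<le> norm (f (Complex (of_rat \<rho>) y))" using lc(3)[OF assms y(1)] by (simp add: q_def)
    then show "l * q powr (- r) * y powr (- r) \<le> norm (f (Complex (of_rat \<rho>) y))" using q y by (simp add: powr_mult mult.assoc)
  qed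
qed

text \<open>The scale \<open>\<omega>\<close> turns the frequencies into integers and
  \<open>a00\<close> is the removed constant term. Separate constants \<open>K\<close> and
  \<open>K1\<close> are kept because the growth of \<open>\<Phi>\<close> and of \<open>f\<close> is
  stated up to height 1 in different variables.\<close>

locale modular_boundary = modform \<Gamma> \<mu> r f + boundary_series c \<rho> K
  for \<Gamma> :: "mat2 set" and \<mu> and r :: real and f and c :: "nat \<Rightarrow> complex" and \<rho> K :: real +
  fixes \<omega> K1 :: real and a00 :: complex
  assumes omega: "0 < \<omega>"
    and f_eq: "\<And>z. 0 < Im z \<Longrightarrow> f z = a00 + boundary_series.\<Phi> c (of_real \<omega> * z)"
    and f_growth: "\<And>z. 0 < Im z \<Longrightarrow> Im z \<le> 1 \<Longrightarrow> norm (f z) \<le> K1 * Im z powr (- \<rho>)"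
    and K1: "0 \<le> K1"
begin

lemma f_Complex: "0 < y \<Longrightarrow> f (Complex x y) = a00 + \<Phi> (Complex (\<omega> * x) (\<omega> * y))"
proof -
  assume "0 < y"
  moreover have "of_real \<omega> * Complex x y = Complex (\<omega> * x) (\<omega> * y)" by (simp add: complex_eq_iff)
  ultimately show ?thesis using f_eq[of "Complex x y"] by simp
qed

text \<open>A larger exponent would admit s' strictly between \<open>\<alpha> - e1\<close> and the
  minimum of s and \<open>\<alpha>\<close>, making \<open>f\<close> of order
  \<open>y powr (s' - \<alpha>)\<close> in the sector, against the lower bound along the sequence.
  The constants \<open>a00\<close> and \<open>B\<close> are harmless because e1 > 0.\<close>

lemma holder_exponent_upper:
  assumes \<alpha>: "\<rho> < \<alpha>" and l1: "l1 \<noteq> 0" and h: "holder_pt (mix \<alpha> l1 l2 \<omega>) x s" and A: "0 \<le> A" and cc: "0 < cc"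
    and e1: "0 < e1" "e1 \<le> \<alpha>"
    and H: "\<And>\<eta>. 0 < \<eta> \<Longrightarrow> \<exists>u y. 0 < y \<and> y \<le> \<eta> \<and> \<bar>u\<bar> \<le> A * y \<and> cc * y powr (- e1) \<le> norm (f (Complex (x + u) y))"
  shows "s \<le> \<alpha> - e1"
proof (rule ccontr)
  assume "\<not> s \<le> \<alpha> - e1"
  then have s: "\<alpha> - e1 < s" by simp
  define s' where "s' = (\<alpha> - e1 + min s \<alpha>) / 2"
  have s': "\<alpha> - e1 < s'" "s' \<le> s" "s' < \<alpha>" "0 \<le> s'" using s e1 by (auto simp: s'_def min_def field_simps)
  obtain M B \<delta> where B: "0 < \<delta>" "\<And>u y. 0 < y \<Longrightarrow> y \<le> \<delta> \<Longrightarrow> \<bar>u\<bar> \<le> A * y \<Longrightarrow> norm (\<Phi> (Complex (\<omega> * x + u) y)) \<le> M * y powr (s' - \<alpha>) + B"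
    by (rule Phi_bound_of_holder[OF \<alpha> l1 omega h s'(4,2,3) A]) (rule that)
  have "e1 \<le> \<alpha> - s'"
  proof (rule powr_comparison[OF cc e1(1), where K="M * \<omega> powr (s' - \<alpha>)" and B="norm a00 + B"])
    fix \<eta> :: real assume \<eta>: "0 < \<eta>"
    obtain u y where uy: "0 < y" "y \<le> min \<eta> (\<delta> / \<omega>)" "\<bar>u\<bar> \<le> A * y" "cc * y powr (- e1) \<le> norm (f (Complex (x + u) y))"
      using H[of "min \<eta> (\<delta> / \<omega>)"] \<eta> B(1) omega by auto
    have "norm (\<Phi> (Complex (\<omega> * x + \<omega> * u) (\<omega> * y))) \<le> M * (\<omega> * y) powr (s' - \<alpha>) + B"
    proof (rule B(2))
      show "\<omega> * y \<le> \<delta>" using uy(2) omega by (simp add: field_simps)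
      show "\<bar>\<omega> * u\<bar> \<le> A * (\<omega> * y)" using mult_left_mono[OF uy(3), of \<omega>] omega by (simp add: abs_mult mult_ac)
    qed (use uy omega in auto)
    moreover have "norm (f (Complex (x + u) y)) \<le> norm a00 + norm (\<Phi> (Complex (\<omega> * x + \<omega> * u) (\<omega> * y)))"
      using norm_triangle_ineq[of a00] uy(1) by (simp add: f_Complex distrib_left)
    moreover have "(\<omega> * y) powr (s' - \<alpha>) = \<omega> powr (s' - \<alpha>) * y powr (- (\<alpha> - s'))" by (simp add: powr_mult)
    ultimately have "cc * y powr (- e1) \<le> M * \<omega> powr (s' - \<alpha>) * y powr (- (\<alpha> - s')) + (norm a00 + B)"
      using uy(4) by (simp add: mult.assoc)
    then show "\<exists>y. 0 < y \<and> y \<le> \<eta> \<and> cc * y powr (- e1) \<le> M * \<omega> powr (s' - \<alpha>) * y powr (- (\<alpha> - s')) + (norm a00 + B)"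
      using uy by auto
  qed
  then show False using s'(1) by linarith
qed

lemma holder_upper_irrational:
  assumes "\<rho> < \<alpha>" "r/2 \<le> \<rho>" "l1 \<noteq> 0" "x \<notin> \<rat>" "holder_pt (mix \<alpha> l1 l2 \<omega>) x s"
  shows "s \<le> \<alpha> - r/2"
proof -
  obtain A cc where Ac: "0 \<le> A" "0 < cc" "\<And>\<eta>. 0 < \<eta> \<Longrightarrow>
     \<exists>u y. 0 < y \<and> y \<le> \<eta> \<and> \<bar>u\<bar> \<le> A * y \<and> cc * y powr (- (r/2)) \<le> norm (f (Complex (x + u) y))"
    by (rule irrational_lower_bound[OF assms(4)]) (rule that)
  show ?thesis
    by (rule holder_exponent_upper[OF assms(1,3,5) Ac(1,2) _ _ Ac(3)]) (use assms r_pos in auto)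
qed

lemma holder_upper_liouville:
  assumes "\<rho> < \<alpha>" "r \<le> \<rho>" "l1 \<noteq> 0" "x \<notin> \<rat>" "holder_pt (mix \<alpha> l1 l2 \<omega>) x s" and t: "2 < t" "0 < C"
    "infinite {\<rho>. \<not> cuspidal_at f r \<Gamma> (Some \<rho>) \<and> \<bar>x - of_rat \<rho>\<bar> \<le> C * real_of_int (snd (quotient_of \<rho>)) powr (- t)}"
  shows "s \<le> \<alpha> - r + r / t"
proof -
  obtain cc where cc: "0 < cc" "\<And>\<eta>. 0 < \<eta> \<Longrightarrow> \<exists>u y. 0 < y \<and> y \<le> \<eta> \<and> \<bar>u\<bar> \<le> 1 * y \<and> cc * y powr (- (r - r / t)) \<le> norm (f (Complex (x + u) y))"
    by (rule liouville_lower_bound[OF assms(4) t]) (rule that)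
  have rt: "0 < r / t" "r / t < r" using r_pos t(1) by (auto simp: field_simps)
  have "s \<le> \<alpha> - (r - r / t)"
    by (rule holder_exponent_upper[OF assms(1,3,5) zero_le_one cc(1) _ _ cc(2)]) (use rt assms in auto)
  then show ?thesis by simp
qed

lemma holder_upper_noncuspidal:
  assumes "\<rho> < \<alpha>" "r \<le> \<rho>" "l1 \<noteq> 0" "\<not> cuspidal_at f r \<Gamma> (Some p)" "holder_pt (mix \<alpha> l1 l2 \<omega>) (of_rat p) s"
  shows "s \<le> \<alpha> - r"
proof -
  obtain cc \<eta>0 where cc: "0 < cc" "0 < \<eta>0" "\<And>y. 0 < y \<Longrightarrow> y \<le> \<eta>0 \<Longrightarrow> cc * y powr (- r) \<le> norm (f (Complex (of_rat p) y))"
    by (rule noncuspidal_rational_lower_bound[OF assms(4)]) (rule that)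
  show ?thesis
  proof (rule holder_exponent_upper[OF assms(1,3,5) order.refl cc(1)])
    fix \<eta> :: real assume "0 < \<eta>"
    then show "\<exists>u y. 0 < y \<and> y \<le> \<eta> \<and> \<bar>u\<bar> \<le> 0 * y \<and> cc * y powr (- r) \<le> norm (f (Complex (of_rat p + u) y))"
      using cc by (intro exI[of _ 0] exI[of _ "min \<eta> \<eta>0"]) auto
  qed (use r_pos assms in auto)
qed

text \<open>Here exponent 1 equals \<open>\<alpha> - r\<close>, so
  \<open>holder_exponent_upper\<close> gives no contradiction. The o-bound is used with half the
  constant of the lower bound, rescaled by \<open>\<omega> powr r\<close>; the other half then
  forces \<open>y powr (-r)\<close> to stay bounded.\<close>

lemma not_differentiable_noncuspidal:
  assumes "\<rho> < \<alpha>" "\<alpha> = r + 1" "l1 \<noteq> 0" "\<not> cuspidal_at f r \<Gamma> (Some p)"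
  shows "\<not> (mix \<alpha> l1 l2 \<omega> has_vector_derivative D) (at (of_rat p))"
proof
  assume D: "(mix \<alpha> l1 l2 \<omega> has_vector_derivative D) (at (of_rat p))"
  obtain cc \<eta>0 where cc: "0 < cc" "0 < \<eta>0" "\<And>y. 0 < y \<Longrightarrow> y \<le> \<eta>0 \<Longrightarrow> cc * y powr (- r) \<le> norm (f (Complex (of_rat p) y))"
    by (rule noncuspidal_rational_lower_bound[OF assms(4)]) (rule that)
  define \<eta> where "\<eta> = cc / 2 * \<omega> powr r"
  have \<eta>: "0 < \<eta>" using cc omega by (simp add: \<eta>_def)
  have a1: "1 < \<alpha>" using assms r_pos by simp
  obtain B \<delta> where B: "0 < \<delta>" "\<And>y. 0 < y \<Longrightarrow> y \<le> \<delta> \<Longrightarrow> norm (\<Phi> (Complex (\<omega> * of_rat p) y)) \<le> \<eta> * y powr (1 - \<alpha>) + B"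
    by (rule Phi_bound_of_derivative[OF assms(1) a1 assms(3) omega D \<eta>]) (rule that)
  have "r \<le> 0"
  proof (rule powr_comparison[of "cc/2" r "norm a00 + B" 0 0])
    fix e :: real assume e: "0 < e"
    define y where "y = min e (min \<eta>0 (\<delta> / \<omega>))"
    have y: "0 < y" "y \<le> e" "y \<le> \<eta>0" "y \<le> \<delta> / \<omega>" using e cc B(1) omega by (auto simp: y_def)
    have "cc * y powr (- r) \<le> norm (f (Complex (of_rat p) y))" using cc(3) y by blast
    also have "\<dots> \<le> norm a00 + norm (\<Phi> (Complex (\<omega> * of_rat p) (\<omega> * y)))"
      using y(1) by (simp add: f_Complex norm_triangle_ineq)
    also have "norm (\<Phi> (Complex (\<omega> * of_rat p) (\<omega> * y))) \<le> \<eta> * (\<omega> * y) powr (1 - \<alpha>) + B"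
      by (rule B(2)) (use y omega in \<open>auto simp: field_simps\<close>)
    also have "\<eta> * (\<omega> * y) powr (1 - \<alpha>) = cc / 2 * y powr (- r)"
      using omega by (simp add: \<eta>_def assms(2) powr_mult powr_minus)
    finally have "cc / 2 * y powr (- r) \<le> (norm a00 + B) * y powr (- 0) + 0" using y(1) by simp
    then show "\<exists>y. 0 < y \<and> y \<le> e \<and> cc / 2 * y powr (- r) \<le> (norm a00 + B) * y powr (- 0) + 0" using y by blast
  qed (use cc r_pos in auto)
  then show False using r_pos by simp
qed

text \<open>Passing from \<open>f\<close> to \<open>\<Phi>\<close> must absorb the constant term:
  since \<open>\<theta> \<le> \<sigma>\<close>, the target bound is at least the fixed multiple
  \<open>y powr (\<theta> - \<sigma>)\<close>, which is at least 1. Heights y >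
  \<open>\<omega>\<close> correspond to heights above 1 for \<open>f\<close> and use the growth of
  \<open>\<Phi>\<close> directly.\<close>

lemma local_growth_transfer:
  assumes C: "0 \<le> C" and e: "e \<le> \<sigma>" and \<sigma>: "0 < \<sigma>" and \<theta>: "0 \<le> \<theta>" "\<theta> \<le> \<sigma>"
  obtains C' where "0 \<le> C'" "\<And>x. (\<forall>h y. 0 < y \<longrightarrow> y \<le> 1 \<longrightarrow> norm (f (Complex (x + h) y)) \<le> C * y powr (- e) * (\<bar>h\<bar> + y) powr \<theta>) \<Longrightarrow> local_growth (\<omega> * x) C' \<sigma> \<theta>"
proof -
  define C1 where "C1 = C * (1/\<omega>) powr (- e) * (1/\<omega>) powr \<theta> + norm a00"
  define C2 where "C2 = K * \<omega> powr (- \<rho>) * \<omega> powr (- \<theta>)"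
  have C1: "0 \<le> C1" using C by (simp add: C1_def)
  have C2: "0 \<le> C2" using K_nonneg by (simp add: C2_def)
  obtain C' where C': "0 \<le> C'" "\<And>x. (\<forall>h y. 0 < y \<longrightarrow> y \<le> 1 \<longrightarrow>
     norm (\<Phi> (Complex (x + h) y)) \<le> (C1 + C2) * y powr (-\<sigma>) * (\<bar>h\<bar> + y) powr \<theta>) \<Longrightarrow> local_growth x C' \<sigma> \<theta>"
    by (rule local_growthI[OF add_nonneg_nonneg[OF C1 C2] \<sigma> \<theta>(1)]) (rule that)
  show thesis
  proof (rule that[OF C'(1)], rule C'(2), intro allI impI)
    fix x h y :: real
    assume H: "\<forall>h y. 0 < y \<longrightarrow> y \<le> 1 \<longrightarrow> norm (f (Complex (x + h) y)) \<le> C * y powr (- e) * (\<bar>h\<bar> + y) powr \<theta>"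
      and y: "0 < y" "y \<le> 1"
    define Z where "Z = y powr (- \<sigma>) * (\<bar>h\<bar> + y) powr \<theta>"
    have Z0: "0 \<le> Z" by (simp add: Z_def)
    show "norm (\<Phi> (Complex (\<omega> * x + h) y)) \<le> (C1 + C2) * y powr (-\<sigma>) * (\<bar>h\<bar> + y) powr \<theta>"
    proof (cases "y \<le> \<omega>")
      case True
      have "f (Complex (x + h / \<omega>) (y / \<omega>)) = a00 + \<Phi> (Complex (\<omega> * x + h) y)"
        using f_Complex[of "y / \<omega>" "x + h / \<omega>"] y omega by (simp add: distrib_left)
      then have "norm (\<Phi> (Complex (\<omega> * x + h) y)) \<le> norm (f (Complex (x + h / \<omega>) (y / \<omega>))) + norm a00"
        by (metis add_diff_cancel_left' norm_triangle_ineq4)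
      also have "norm (f (Complex (x + h / \<omega>) (y / \<omega>))) \<le> C * (y / \<omega>) powr (- e) * (\<bar>h / \<omega>\<bar> + y / \<omega>) powr \<theta>"
        using H[rule_format, of "y / \<omega>" "h / \<omega>"] True y omega by simp
      also have "\<dots> = C * (1/\<omega>) powr (- e) * (1/\<omega>) powr \<theta> * (y powr (- e) * (\<bar>h\<bar> + y) powr \<theta>)"
      proof -
        have "(y / \<omega>) powr (- e) = (1/\<omega>) powr (- e) * y powr (- e)" by (metis mult.left_neutral powr_mult times_divide_eq_left)
        moreover have "\<bar>h / \<omega>\<bar> + y / \<omega> = (1/\<omega>) * (\<bar>h\<bar> + y)" using omega by (simp add: add_divide_distrib)
        ultimately show ?thesis by (simp only: powr_mult mult_ac)
      qed
      also have "\<dots> \<le> C * (1/\<omega>) powr (- e) * (1/\<omega>) powr \<theta> * Z"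
        unfolding Z_def using C e y by (intro mult_left_mono mult_right_mono powr_mono') auto
      also have "norm a00 \<le> norm a00 * Z"
      proof -
        have "1 \<le> y powr (\<theta> - \<sigma>)" using y \<theta> powr_mono'[of "\<theta> - \<sigma>" 0 y] by simp
        also have "\<dots> = y powr (- \<sigma>) * y powr \<theta>" by (simp flip: powr_add)
        also have "\<dots> \<le> Z" unfolding Z_def using y \<theta> by (intro mult_left_mono powr_mono2) auto
        finally show ?thesis by (simp add: mult_le_cancel_left1)
      qed
      finally have "norm (\<Phi> (Complex (\<omega> * x + h) y)) \<le> C1 * Z" by (simp add: C1_def distrib_right)
      also have "\<dots> \<le> (C1 + C2) * Z" using C2 Z0 by (intro mult_right_mono) auto
      finally show ?thesis by (simp add: Z_def mult.assoc)
    next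
      case False
      have "norm (\<Phi> (Complex (\<omega> * x + h) y)) \<le> K * y powr (- \<rho>)" using norm_Phi_le[of "Complex (\<omega> * x + h) y"] y by simp
      also have "\<dots> \<le> K * \<omega> powr (- \<rho>)" using False omega rho_pos K_nonneg by (intro mult_left_mono powr_mono2') auto
      also have "\<dots> = C2 * \<omega> powr \<theta>" using omega by (simp add: C2_def powr_minus)
      also have "\<dots> \<le> C2 * Z"
      proof (intro mult_left_mono C2)
        have "1 * \<omega> powr \<theta> \<le> y powr (- \<sigma>) * (\<bar>h\<bar> + y) powr \<theta>"
        proof (intro mult_mono)
          show "1 \<le> y powr (- \<sigma>)" using y \<sigma> powr_mono'[of "- \<sigma>" 0 y] by simp
          show "\<omega> powr \<theta> \<le> (\<bar>h\<bar> + y) powr \<theta>" using False omega \<theta> by (intro powr_mono2) auto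
        qed auto
        then show "\<omega> powr \<theta> \<le> Z" by (simp add: Z_def)
      qed
      also have "\<dots> \<le> (C1 + C2) * Z" using C1 Z0 by (intro mult_right_mono) auto
      finally show ?thesis by (simp add: Z_def mult.assoc)
    qed
  qed
qed

lemma unif_holder_mix:
  assumes \<alpha>: "\<rho> < \<alpha>" and s: "0 < s" "s < 1" "s \<le> \<alpha> - \<rho>"
  shows "unif_holder (mix \<alpha> l1 l2 \<omega>) S s"
proof -
  define \<sigma> where "\<sigma> = \<alpha> - s"
  have \<sigma>: "\<rho> \<le> \<sigma>" "0 < \<sigma>" "\<sigma> < \<alpha>" "s = \<alpha> - \<sigma>" using s rho_pos by (auto simp: \<sigma>_def)
  obtain C' where C': "0 \<le> C'" "\<And>x. (\<forall>h y. 0 < y \<longrightarrow> y \<le> 1 \<longrightarrow> norm (f (Complex (x + h) y)) \<le> K1 * y powr (- \<rho>) * (\<bar>h\<bar> + y) powr 0) \<Longrightarrow> local_growth (\<omega> * x) C' \<sigma> 0"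
    by (rule local_growth_transfer[OF K1 \<sigma>(1,2) order.refl less_imp_le[OF \<sigma>(2)]]) (rule that)
  have "local_growth (\<omega> * x) C' \<sigma> 0" for x
  proof (rule C'(2), intro allI impI)
    fix h y :: real assume "0 < y" "y \<le> 1"
    then show "norm (f (Complex (x + h) y)) \<le> K1 * y powr (- \<rho>) * (\<bar>h\<bar> + y) powr 0"
      using f_growth[of "Complex (x + h) y"] by simp
  qed
  then have "local_growth x C' \<sigma> 0" for x
    by (metis omega less_irrefl nonzero_mult_div_cancel_left times_divide_eq_right)
  from mix_unif_holder[OF \<alpha> \<sigma>(3,2,4) s(2) this C'(1)] show ?thesis .
qed

lemma holder_ks_int_mix:
  assumes k: "\<rho> < \<alpha> - real k" and s: "0 < s" "s < 1" "s \<le> \<alpha> - real k - \<rho>"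
  shows "holder_ks_int (mix \<alpha> l1 l2 \<omega>) I k s"
  unfolding holder_ks_int_def
proof (intro conjI exI allI impI)
  show "derivs_on (mix \<alpha> l1 l2 \<omega>) k (mixd \<alpha> l1 l2 \<omega>) I" by (rule derivs_on_mix[OF k])
  show "unif_holder (mixd \<alpha> l1 l2 \<omega> k) S s" for S
    unfolding mixd_def by (rule unif_holder_mix[OF k s])
qed (use s in auto)

text \<open>Take k as the largest integer strictly below \<open>\<alpha> - \<rho>\<close> and s in
  (0,1) close to the remainder. When \<open>\<alpha> - \<rho>\<close> is an integer the remainder is
  1; it is then only approached, which suffices for the supremum.\<close>

lemma Sup_holder_ks_int_ge:
  assumes \<alpha>: "\<rho> < \<alpha>"
  shows "ereal (\<alpha> - \<rho>) \<le> Sup {ereal (real k + s) | k s. holder_ks_int (mix \<alpha> l1 l2 \<omega>) I k s}"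
proof (rule dense_le)
  fix v assume v: "v < ereal (\<alpha> - \<rho>)"
  define E where "E = \<alpha> - \<rho>"
  have E: "0 < E" using \<alpha> by (simp add: E_def)
  define k where "k = nat (\<lceil>E\<rceil> - 1)"
  have k: "real k < E" "E \<le> real k + 1"
  proof -
    have "0 \<le> \<lceil>E\<rceil> - 1" using E by linarith
    then have "real k = of_int \<lceil>E\<rceil> - 1" by (simp add: k_def)
    then show "real k < E" "E \<le> real k + 1" using ceiling_correct[of E] by linarith+
  qed
  obtain w where w: "v \<le> ereal w" "w < E"
    using v by (cases v) (auto simp: E_def intro: that[of "\<alpha> - \<rho> - 1"])
  define s where "s = max (w - real k) ((E - real k) / 2)"
  have sw: "w - real k \<le> s" "(E - real k) / 2 \<le> s" "s < E - real k" using k w by (auto simp: s_def)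
  have s: "0 < s" "s < 1" "s \<le> \<alpha> - real k - \<rho>" "w \<le> real k + s"
    using sw k by (simp_all add: E_def)
  have "holder_ks_int (mix \<alpha> l1 l2 \<omega>) I k s"
    by (rule holder_ks_int_mix) (use k s in \<open>auto simp: E_def\<close>)
  then have "ereal (real k + s) \<le> Sup {ereal (real k + s) | k s. holder_ks_int (mix \<alpha> l1 l2 \<omega>) I k s}"
    by (intro Sup_upper) blast
  moreover have "v \<le> ereal (real k + s)" using w(1) s(4) by (meson ereal_less_eq(3) order_trans)
  ultimately show "v \<le> Sup {ereal (real k + s) | k s. holder_ks_int (mix \<alpha> l1 l2 \<omega>) I k s}" by (rule order_trans[rotated])
qed

end

section \<open>Comparison of the three exponents\<close>

lemma Sup_ereal_image_eqI:
  fixes S :: "real set"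
  assumes "\<And>s. s \<in> S \<Longrightarrow> s \<le> L" "\<And>v. v < L \<Longrightarrow> \<exists>s\<in>S. v \<le> s"
  shows "Sup (ereal ` S) = ereal L"
proof (rule antisym)
  show "Sup (ereal ` S) \<le> ereal L" using assms(1) by (auto intro: Sup_least)
  show "ereal L \<le> Sup (ereal ` S)"
  proof (rule dense_le)
    fix v assume v: "v < ereal L"
    obtain w where w: "v \<le> ereal w" "w < L" using v by (cases v) (auto intro: that[of "L - 1"])
    then obtain s where "s \<in> S" "w \<le> s" using assms(2) by blast
    then show "v \<le> Sup (ereal ` S)" using w(1) by (meson Sup_upper ereal_less_eq(3) image_eqI order_trans)
  qed
qed

lemma holder_beta_star_le: "holder_beta_star g x \<le> holder_beta g x"
  unfolding holder_beta_star_def holder_beta_def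
  using holder_ks_pt_imp_holder_pt by (intro Sup_subset_mono) blast

lemma Sup_holder_ks_int_le:
  assumes "a < x" "x < b"
  shows "Sup {ereal (real k + s) | k s. holder_ks_int g {a<..<b} k s} \<le> holder_beta_star g x"
  unfolding holder_beta_star_def
  using holder_ks_int_imp_pt[OF _ assms] by (intro Sup_subset_mono) blast

section \<open>The exponents at irrational points\<close>

context modular_boundary begin

text \<open>All three exponents are squeezed: uniform regularity on intervals gives at least
  \<open>\<alpha> - r/2\<close>, each exponent bounds the next stricter one, and
  \<open>holder_beta\<close> is at most \<open>\<alpha> - r/2\<close> at an irrational
  point.\<close>

lemma cusp_case:
  assumes \<alpha>: "\<rho> < \<alpha>" and \<rho>: "\<rho> = r / 2" and l1: "l1 \<noteq> 0" and x: "x \<notin> \<rat>"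
  shows "holder_beta (mix \<alpha> l1 l2 \<omega>) x = ereal (\<alpha> - r/2)"
    and "holder_beta_star (mix \<alpha> l1 l2 \<omega>) x = ereal (\<alpha> - r/2)"
    and "holder_beta_2star (mix \<alpha> l1 l2 \<omega>) x = ereal (\<alpha> - r/2)"
proof -
  define g where "g = mix \<alpha> l1 l2 \<omega>"
  have up: "holder_beta g x \<le> ereal (\<alpha> - r/2)"
    unfolding holder_beta_def g_def using holder_upper_irrational[OF \<alpha> _ l1 x] \<rho> by (auto intro!: Sup_least)
  have low: "ereal (\<alpha> - r/2) \<le> Sup {ereal (real k + s) | k s. holder_ks_int g {a<..<b} k s}" for a b
    using Sup_holder_ks_int_ge[OF \<alpha>, of l1 l2 "{a<..<b}"] by (simp add: g_def \<rho>)
  have mid: "Sup {ereal (real k + s) | k s. holder_ks_int g {a<..<b} k s} \<le> holder_beta_star g x" if "a < x" "x < b" for a b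
    by (rule Sup_holder_ks_int_le[OF that])
  have x1: "x - 1 < x" "x < x + 1" by simp_all
  show "holder_beta (mix \<alpha> l1 l2 \<omega>) x = ereal (\<alpha> - r/2)" "holder_beta_star (mix \<alpha> l1 l2 \<omega>) x = ereal (\<alpha> - r/2)"
    using up low[of "x-1" "x+1"] mid[OF x1] holder_beta_star_le[of g x] unfolding g_def[symmetric]
    by (meson antisym order_trans)+
  show "holder_beta_2star (mix \<alpha> l1 l2 \<omega>) x = ereal (\<alpha> - r/2)" unfolding g_def[symmetric]
  proof (rule holder_beta_2star_eqI)
    fix a b assume ab: "a < x" "x < b"
    show "Sup {ereal (real k + s) | k s. holder_ks_int g {a<..<b} k s} = ereal (\<alpha> - r/2)"
      using up low[of a b] mid[OF ab] holder_beta_star_le[of g x] by (meson antisym order_trans)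
  qed
qed

lemma noncusp_pointwise_lower:
  assumes \<rho>: "\<rho> = r" and \<alpha>: "r < \<alpha>" and s: "0 < s" "s < \<alpha> - r" "s \<notin> \<int>"
  shows "holder_pt (mix \<alpha> l1 l2 \<omega>) x s"
proof -
  define \<sigma> where "\<sigma> = \<alpha> - s"
  have \<sigma>: "r \<le> \<sigma>" "0 < \<sigma>" "\<sigma> < \<alpha>" "s = \<alpha> - \<sigma> + 0" using s r_pos by (auto simp: \<sigma>_def)
  obtain C' where C': "0 \<le> C'" "\<And>x. (\<forall>h y. 0 < y \<longrightarrow> y \<le> 1 \<longrightarrow> norm (f (Complex (x + h) y)) \<le> K1 * y powr (- r) * (\<bar>h\<bar> + y) powr 0) \<Longrightarrow> local_growth (\<omega> * x) C' \<sigma> 0"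
    by (rule local_growth_transfer[OF K1 \<sigma>(1,2) order.refl less_imp_le[OF \<sigma>(2)]]) (rule that)
  have "local_growth (\<omega> * x) C' \<sigma> 0"
  proof (rule C'(2), intro allI impI)
    fix h y :: real assume "0 < y" "y \<le> 1"
    then show "norm (f (Complex (x + h) y)) \<le> K1 * y powr (- r) * (\<bar>h\<bar> + y) powr 0"
      using f_growth[of "Complex (x + h) y"] \<rho> by simp
  qed
  then show ?thesis using mix_holder_pt[OF _ \<sigma>(3,2) order.refl \<sigma>(4) s(3) _ C'(1)] \<alpha> \<rho> by simp
qed

text \<open>\<open>approximation_bound\<close> supplies a local gain \<open>\<theta> = r/t\<close>
  at \<open>x\<close>. The condition r/t < s is what keeps \<open>\<sigma>\<close> below
  \<open>\<alpha>\<close>, as the Taylor lemma demands.\<close>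

lemma noncusp_pointwise_lower_approx:
  assumes \<rho>: "\<rho> = r" and \<alpha>: "r < \<alpha>" and t: "2 \<le> t" and cc: "0 < cc"
    and H: "\<And>p. \<not> cuspidal_at f r \<Gamma> (Some p) \<Longrightarrow> cc * real_of_int (snd (quotient_of p)) powr (- t) \<le> \<bar>x - of_rat p\<bar>"
    and s: "r / t < s" "s < \<alpha> - r + r / t" "s \<notin> \<int>"
  shows "holder_pt (mix \<alpha> l1 l2 \<omega>) x s"
proof -
  obtain C where C: "0 \<le> C" "\<And>h y. 0 < y \<Longrightarrow> y \<le> 1 \<Longrightarrow> norm (f (Complex (x + h) y)) \<le> C * y powr (- r) * (\<bar>h\<bar> + y) powr (r / t)"
    by (rule approximation_bound[OF t cc H]) (assumption, rule that)
  have rt: "0 < r / t" "r / t \<le> r / 2" using r_pos t by (auto simp: field_simps)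
  define \<sigma> where "\<sigma> = \<alpha> + r / t - s"
  have \<sigma>: "r \<le> \<sigma>" "0 < \<sigma>" "\<sigma> < \<alpha>" "s = \<alpha> - \<sigma> + r / t" "r / t \<le> \<sigma>" using s(1,2) r_pos rt unfolding \<sigma>_def by linarith+
  obtain C' where C': "0 \<le> C'" "\<And>x. (\<forall>h y. 0 < y \<longrightarrow> y \<le> 1 \<longrightarrow> norm (f (Complex (x + h) y)) \<le> C * y powr (- r) * (\<bar>h\<bar> + y) powr (r / t)) \<Longrightarrow> local_growth (\<omega> * x) C' \<sigma> (r / t)"
    by (rule local_growth_transfer[OF C(1) \<sigma>(1,2) less_imp_le[OF rt(1)] \<sigma>(5)]) (rule that)
  have "local_growth (\<omega> * x) C' \<sigma> (r / t)" by (rule C'(2)) (use C(2) in blast)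
  then show ?thesis using mix_holder_pt[OF _ \<sigma>(3,2) less_imp_le[OF rt(1)] \<sigma>(4) s(3) _ C'(1)] \<alpha> \<rho> by simp
qed

text \<open>\<open>v\<close> is the reciprocal of tau, with value 0 for infinite tau. Quantifying
  over all \<open>\<alpha>\<close> and all coefficients after \<open>v\<close> makes the same number
  available for the derivatives of \<open>mix\<close>.\<close>

lemma noncusp_exponent:
  assumes \<rho>: "\<rho> = r" and nc: "\<not> cusp_form f r \<Gamma>" and x: "x \<notin> \<rat>"
  obtains v where "inverse (tau_exp f r \<Gamma> x) = ereal v" "0 \<le> v"
    "\<And>\<alpha> l1 l2 s. r < \<alpha> \<Longrightarrow> l1 \<noteq> 0 \<Longrightarrow> holder_pt (mix \<alpha> l1 l2 \<omega>) x s \<Longrightarrow> s \<le> \<alpha> - r + v * r"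
    "\<And>\<alpha> l1 l2 s. r < \<alpha> \<Longrightarrow> v * r < s \<Longrightarrow> s < \<alpha> - r + v * r \<Longrightarrow> s \<notin> \<int> \<Longrightarrow> holder_pt (mix \<alpha> l1 l2 \<omega>) x s"
proof -
  define S where "S C t = {p::rat. \<not> cuspidal_at f r \<Gamma> (Some p) \<and> \<bar>x - of_rat p\<bar> \<le> C * real_of_int (snd (quotient_of p)) powr (- t)}" for C t
  define T where "T = {t. \<exists>C>0. infinite (S C t)}"
  define \<tau> where "\<tau> = tau_exp f r \<Gamma> x"
  have tauT: "\<tau> = Sup (ereal ` T)"
    unfolding \<tau>_def tau_exp_def T_def S_def by (rule arg_cong[of _ _ Sup]) auto
  obtain C2 where "0 < C2" "infinite (S C2 2)"
    by (rule noncuspidal_approximations[OF x nc]) (rule that, unfold S_def, assumption+)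
  then have "2 \<in> T" by (auto simp: T_def)
  then have tau2: "ereal 2 \<le> \<tau>" unfolding tauT by (intro Sup_upper) auto
  have up1: "s \<le> \<alpha> - r / 2" if "r < \<alpha>" "l1 \<noteq> 0" "holder_pt (mix \<alpha> l1 l2 \<omega>) x s" for \<alpha> l1 l2 s
    by (rule holder_upper_irrational[OF _ _ that(2) x that(3)]) (use that \<rho> r_pos in auto)
  have up2: "s \<le> \<alpha> - r + r / t" if "r < \<alpha>" "l1 \<noteq> 0" "holder_pt (mix \<alpha> l1 l2 \<omega>) x s" "t \<in> T" "2 < t" for \<alpha> l1 l2 s t
  proof -
    obtain C where "0 < C" "infinite (S C t)" using \<open>t \<in> T\<close> by (auto simp: T_def)
    then show ?thesis unfolding S_def
      by (intro holder_upper_liouville[OF _ _ that(2) x that(3,5)]) (use that \<rho> in auto)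
  qed
  have exT: "\<exists>t\<in>T. M < t" if "ereal M < \<tau>" for M
    using that unfolding tauT less_Sup_iff by auto
  show thesis
  proof (cases \<tau>)
    case PInf
    show thesis
    proof (rule that[of 0])
      show "inverse (tau_exp f r \<Gamma> x) = ereal 0" using PInf by (simp add: \<tau>_def zero_ereal_def)
      show "s \<le> \<alpha> - r + 0 * r" if h: "r < \<alpha>" "l1 \<noteq> 0" "holder_pt (mix \<alpha> l1 l2 \<omega>) x s" for \<alpha> l1 l2 s
      proof (rule ccontr)
        assume "\<not> s \<le> \<alpha> - r + 0 * r"
        then have d: "0 < s - (\<alpha> - r)" by simp
        have "ereal (max 2 (r / (s - (\<alpha> - r)))) < \<tau>" unfolding PInf by (rule less_ereal.simps(4)[THEN iffD2]) simp
        then obtain t where t: "t \<in> T" "max 2 (r / (s - (\<alpha> - r))) < t" using exT by blast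
        have "r / t < s - (\<alpha> - r)" using t d r_pos by (simp add: field_simps)
        then show False using up2[OF h t(1)] t(2) by simp
      qed
      show "holder_pt (mix \<alpha> l1 l2 \<omega>) x s" if "r < \<alpha>" "0 * r < s" "s < \<alpha> - r + 0 * r" "s \<notin> \<int>" for \<alpha> l1 l2 s
        by (rule noncusp_pointwise_lower[OF \<rho>]) (use that in auto)
    qed simp
  next
    case (real \<tau>')
    have t2: "2 \<le> \<tau>'" using tau2 real by simp
    then have t0: "0 < \<tau>'" by simp
    show thesis
    proof (rule that[of "1 / \<tau>'"])
      show "inverse (tau_exp f r \<Gamma> x) = ereal (1 / \<tau>')" using real t0 by (simp add: \<tau>_def[symmetric] divide_inverse)
      show "s \<le> \<alpha> - r + 1 / \<tau>' * r" if h: "r < \<alpha>" "l1 \<noteq> 0" "holder_pt (mix \<alpha> l1 l2 \<omega>) x s" for \<alpha> l1 l2 s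
      \<comment> \<open>The Liouville bound requires t > 2 and may have no admissible t when tau is
        2; then the bound \<open>\<alpha> - r/2\<close>, valid at every irrational, is already the
        desired one.\<close>
      proof (cases "\<tau>' = 2")
        case True
        then show ?thesis using up1[OF h] by simp
      next
        case False
        show ?thesis
        proof (rule ccontr)
          assume neg: "\<not> s \<le> \<alpha> - r + 1 / \<tau>' * r"
          define d where "d = s - (\<alpha> - r)"
          have d: "r / \<tau>' < d" using neg by (simp add: d_def)
          have d0: "0 < d" using d r_pos t0 by (meson divide_pos_pos less_trans)
          have "max 2 (r / d) < \<tau>'" using d d0 t0 False t2 by (simp add: field_simps)
          then have "ereal (max 2 (r / d)) < \<tau>" unfolding real by (simp only: less_ereal.simps)
          then obtain t where t: "t \<in> T" "max 2 (r / d) < t" using exT by blast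
          have "r / t < d" using t d0 r_pos by (simp add: field_simps)
          then show False using up2[OF h t(1)] t(2) by (simp add: d_def)
        qed
      qed
      show "holder_pt (mix \<alpha> l1 l2 \<omega>) x s" if h: "r < \<alpha>" "1 / \<tau>' * r < s" "s < \<alpha> - r + 1 / \<tau>' * r" "s \<notin> \<int>" for \<alpha> l1 l2 s
      proof -
        define d where "d = s - (\<alpha> - r)"
        have d: "d < r / \<tau>'" using h by (simp add: d_def)
        \<comment> \<open>An exponent slightly above tau is attained only by finitely many
          rationals, yet r/t still exceeds the required gain \<open>d\<close>.\<close>
        obtain t where t: "\<tau>' < t" "d < r / t"
        proof (cases "d \<le> 0")
          case True
          then show thesis using that[of "\<tau>' + 1"] t0 r_pos by (smt (verit) divide_pos_pos)
        next
          case False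
          then have "\<tau>' < r / d" using d t0 by (simp add: field_simps)
          then obtain t where "\<tau>' < t" "t < r / d" using dense by blast
          then show thesis using that[of t] False t0 by (simp add: field_simps)
        qed
        have tt: "2 \<le> t" using t t2 by simp
        have "t \<notin> T"
        proof
          assume "t \<in> T"
          then have "ereal t \<le> \<tau>" unfolding tauT by (intro Sup_upper) auto
          then show False using real t by simp
        qed
        then have fin: "finite (S 1 t)" unfolding T_def using zero_less_one by blast
        \<comment> \<open>The finitely many exceptional rationals are at positive distance from the
          irrational \<open>x\<close>; all others satisfy the inequality with constant 1.\<close>
        define cc where "cc = Min (insert 1 ((\<lambda>p. \<bar>x - of_rat p\<bar> * real_of_int (snd (quotient_of p)) powr t) ` S 1 t))"
        have den: "0 < real_of_int (snd (quotient_of p))" for p by (metis of_int_0_less_iff prod.collapse quotient_of_denom_pos)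
        have irr: "0 < \<bar>x - of_rat p\<bar>" for p using x by auto
        have "0 < \<bar>x - of_rat p\<bar> * real_of_int (snd (quotient_of p)) powr t" for p using irr[of p] den[of p] by simp
        then have cc: "0 < cc" unfolding cc_def using fin by (subst Min_gr_iff) auto
        have "cc * real_of_int (snd (quotient_of p)) powr (- t) \<le> \<bar>x - of_rat p\<bar>" if "\<not> cuspidal_at f r \<Gamma> (Some p)" for p
        proof (cases "p \<in> S 1 t")
          case True
          then have "cc \<le> \<bar>x - of_rat p\<bar> * real_of_int (snd (quotient_of p)) powr t" unfolding cc_def using fin by (intro Min_le) auto
          then have "cc * real_of_int (snd (quotient_of p)) powr (- t) \<le> (\<bar>x - of_rat p\<bar> * real_of_int (snd (quotient_of p)) powr t) * real_of_int (snd (quotient_of p)) powr (- t)"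
            by (rule mult_right_mono) simp
          also have "\<dots> = \<bar>x - of_rat p\<bar>" using den[of p] by (simp add: powr_minus)
          finally show ?thesis .
        next
          case False
          then have "real_of_int (snd (quotient_of p)) powr (- t) < \<bar>x - of_rat p\<bar>" using that by (simp add: S_def)
          moreover have "cc \<le> 1" unfolding cc_def using fin by (intro Min_le) auto
          then have "cc * real_of_int (snd (quotient_of p)) powr (- t) \<le> 1 * real_of_int (snd (quotient_of p)) powr (- t)"
            by (intro mult_right_mono) auto
          ultimately show ?thesis by simp
        qed
        moreover have "r / t < s"
        proof -
          have "r / t \<le> r / \<tau>'" using t t0 r_pos by (intro divide_left_mono) auto
          then show ?thesis using h(2) by simp
        qed
        ultimately show ?thesis
          by (intro noncusp_pointwise_lower_approx[OF \<rho> h(1) tt cc _ _ _ h(4)]) (use t(2) in \<open>auto simp: d_def\<close>)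
      qed
    qed (use t0 in simp)
  next
    case MInf
    then show thesis using tau2 by simp
  qed
qed

text \<open>Every neighbourhood of \<open>x\<close> contains non-cuspidal rationals, which cap the
  uniform exponent at \<open>\<alpha> - r\<close> and forbid high derivatives. For
  \<open>holder_beta_star\<close> what remains is the last existing derivative, again a
  \<open>mix\<close>, whose pointwise exponent at \<open>x\<close> is known from \<open>v\<close>
  and counts only up to 1.\<close>

lemma noncusp_case:
  assumes \<rho>: "\<rho> = r" and \<alpha>: "r < \<alpha>" and l1: "l1 \<noteq> 0" and nc: "\<not> cusp_form f r \<Gamma>" and x: "x \<notin> \<rat>"
  shows "holder_beta (mix \<alpha> l1 l2 \<omega>) x = ereal \<alpha> - (1 - inverse (tau_exp f r \<Gamma> x)) * ereal r"
    and "holder_beta_star (mix \<alpha> l1 l2 \<omega>) x =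
              (if \<alpha> - r \<notin> \<int>
               then ereal (of_int \<lfloor>\<alpha> - r\<rfloor>) + min 1 (ereal (frac (\<alpha> - r)) + ereal r * inverse (tau_exp f r \<Gamma> x))
               else ereal (\<alpha> - r))"
    and "holder_beta_2star (mix \<alpha> l1 l2 \<omega>) x = ereal (\<alpha> - r)"
proof -
  define g where "g = mix \<alpha> l1 l2 \<omega>"
  obtain v where v: "inverse (tau_exp f r \<Gamma> x) = ereal v" "0 \<le> v"
    "\<And>\<alpha> l1 l2 s. r < \<alpha> \<Longrightarrow> l1 \<noteq> 0 \<Longrightarrow> holder_pt (mix \<alpha> l1 l2 \<omega>) x s \<Longrightarrow> s \<le> \<alpha> - r + v * r"
    "\<And>\<alpha> l1 l2 s. r < \<alpha> \<Longrightarrow> v * r < s \<Longrightarrow> s < \<alpha> - r + v * r \<Longrightarrow> s \<notin> \<int> \<Longrightarrow> holder_pt (mix \<alpha> l1 l2 \<omega>) x s"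
    by (rule noncusp_exponent[OF \<rho> nc x]) (rule that)
  have vr: "0 \<le> v * r" using v(2) r_pos by simp
  have Sup_ks: "Sup {ereal (real k + s) | k s. P k s} = Sup (ereal ` {real k + s | k s. P k s})" for P
    by (rule arg_cong[of _ _ Sup]) auto
  have noncusp_in: "\<exists>p. \<not> cuspidal_at f r \<Gamma> (Some p) \<and> a < of_rat p \<and> of_rat p < b" if "a < x" "x < b" for a b
  proof -
    have "\<exists>p. \<not> cuspidal_at f r \<Gamma> (Some p) \<and> \<bar>x - of_rat p\<bar> < e" if "0 < e" for e
      by (rule noncuspidal_approximations[OF x nc]) (use that in blast)
    from this[of "min (x - a) (b - x)"] obtain p where "\<not> cuspidal_at f r \<Gamma> (Some p)" "\<bar>x - of_rat p\<bar> < min (x - a) (b - x)"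
      using \<open>a < x\<close> \<open>x < b\<close> by auto
    then show ?thesis by (intro exI[of _ p]) auto
  qed
  have "holder_beta g x = ereal (\<alpha> - r + v * r)"
    unfolding holder_beta_def
  proof (rule Sup_ereal_image_eqI)
    show "s \<le> \<alpha> - r + v * r" if "s \<in> {s. holder_pt g x s}" for s using v(3)[OF \<alpha> l1] that by (simp add: g_def)
    fix w assume "w < \<alpha> - r + v * r"
    then have "max w (v * r) < \<alpha> - r + v * r" using \<alpha> by simp
    then obtain s where s: "max w (v * r) < s" "s < \<alpha> - r + v * r" "s \<notin> \<int>" by (rule nonint_between)
    then show "\<exists>s\<in>{s. holder_pt g x s}. w \<le> s" using v(4)[OF \<alpha>, of s] by (intro bexI[of _ s]) (auto simp: g_def)
  qed
  then show "holder_beta (mix \<alpha> l1 l2 \<omega>) x = ereal \<alpha> - (1 - inverse (tau_exp f r \<Gamma> x)) * ereal r"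
    unfolding v(1) g_def by (simp add: one_ereal_def algebra_simps)
  have int_up: "real k + s \<le> \<alpha> - r" if ab: "a < x" "x < b" and h: "holder_ks_int g {a<..<b} k s" for a b k s
  proof -
    obtain p where p: "\<not> cuspidal_at f r \<Gamma> (Some p)" "a < of_rat p" "of_rat p < b" using noncusp_in[OF ab] by blast
    show ?thesis using holder_upper_noncuspidal[OF _ _ l1 p(1)] holder_ks_pt_imp_holder_pt[OF holder_ks_int_imp_pt[OF h p(2,3)]] \<alpha> \<rho>
      by (simp add: g_def)
  qed
  have int_Sup: "Sup {ereal (real k + s) | k s. holder_ks_int g {a<..<b} k s} = ereal (\<alpha> - r)" if ab: "a < x" "x < b" for a b
  proof (rule antisym)
    show "Sup {ereal (real k + s) | k s. holder_ks_int g {a<..<b} k s} \<le> ereal (\<alpha> - r)"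
      using int_up[OF ab] by (auto intro!: Sup_least)
    show "ereal (\<alpha> - r) \<le> Sup {ereal (real k + s) | k s. holder_ks_int g {a<..<b} k s}"
      using Sup_holder_ks_int_ge[of \<alpha> l1 l2 "{a<..<b}"] \<alpha> \<rho> by (simp add: g_def)
  qed
  then show "holder_beta_2star (mix \<alpha> l1 l2 \<omega>) x = ereal (\<alpha> - r)"
    unfolding g_def[symmetric] by (rule holder_beta_2star_eqI)
  have unique: "\<exists>d>0. \<forall>t. \<bar>t - x\<bar> < d \<longrightarrow> (\<forall>j\<le>n. j \<le> k \<longrightarrow> D j t = mixd \<alpha> l1 l2 \<omega> j t) \<and> (n < k \<longrightarrow> (D n has_vector_derivative D (Suc n) t) (at t))"
    if D: "0 < \<delta>" "derivs_on g k D {x - \<delta><..<x + \<delta>}" and n: "r < \<alpha> - real n" for D \<delta> k n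
  proof (intro exI[of _ \<delta>] conjI allI impI D(1))
    fix t assume "\<bar>t - x\<bar> < \<delta>"
    then have t: "t \<in> {x - \<delta><..<x + \<delta>}" by (auto simp: abs_less_iff)
    show "D j t = mixd \<alpha> l1 l2 \<omega> j t" if "j \<le> n" "j \<le> k" for j
    proof -
      have "derivs_on g j D {x - \<delta><..<x + \<delta>}" using D(2) that unfolding derivs_on_def by auto
      moreover have "derivs_on g j (mixd \<alpha> l1 l2 \<omega>) {x - \<delta><..<x + \<delta>}"
        unfolding g_def by (rule derivs_on_mix) (use n that \<rho> in simp)
      ultimately show ?thesis using t by (rule derivs_on_unique[OF _ _ order.refl])
    qed
    show "(D n has_vector_derivative D (Suc n) t) (at t)" if "n < k" using D(2) t that by (auto simp: derivs_on_def)
  qed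
  \<comment> \<open>Here \<open>n\<close> is the last order with r < \<open>\<alpha>\<close> - n.
    One more derivative would make the n-th one differentiable at a non-cuspidal rational near
    \<open>x\<close>: for \<open>\<alpha> - n < r + 1\<close> exponent 1 is too large, and for
    equality the o-argument is needed.\<close>
  have no_deriv: False if D: "0 < \<delta>" "derivs_on g k D {x - \<delta><..<x + \<delta>}" and n: "r < \<alpha> - real n" "\<alpha> - real n \<le> r + 1" "n < k" for D \<delta> k n
  proof -
    obtain d where d: "0 < d" "\<And>t. \<bar>t - x\<bar> < d \<Longrightarrow> D n t = mixd \<alpha> l1 l2 \<omega> n t" "\<And>t. \<bar>t - x\<bar> < d \<Longrightarrow> (D n has_vector_derivative D (Suc n) t) (at t)"
      using unique[OF D n(1)] n(3) by auto
    obtain p where p: "\<not> cuspidal_at f r \<Gamma> (Some p)" "x - d < of_rat p" "of_rat p < x + d" using noncusp_in[of "x - d" "x + d"] d(1) by auto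
    have "(mixd \<alpha> l1 l2 \<omega> n has_vector_derivative D (Suc n) (of_rat p)) (at (of_rat p))"
      by (rule has_vector_derivative_transform_within_open[OF d(3), of _ "{x - d<..<x + d}"]) (use p d(2) in \<open>auto simp: abs_less_iff\<close>)
    then have der: "(mix (\<alpha> - real n) ((\<i> * of_real \<omega>) ^ n * l1) ((- \<i> * of_real \<omega>) ^ n * l2) \<omega> has_vector_derivative D (Suc n) (of_rat p)) (at (of_rat p))"
      by (simp add: mixd_def)
    have l1': "(\<i> * of_real \<omega>) ^ n * l1 \<noteq> 0" using l1 omega by simp
    show False
    proof (cases "\<alpha> - real n = r + 1")
      case True
      then show False using not_differentiable_noncuspidal[OF _ True l1' p(1)] der n(1) \<rho> by blast
    next
      case False
      have "1 \<le> \<alpha> - real n - r"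
        by (rule holder_upper_noncuspidal[OF _ _ l1' p(1) differentiable_imp_holder_pt_1[OF der]]) (use n \<rho> in auto)
      then show False using n(2) False by simp
    qed
  qed
  show "holder_beta_star (mix \<alpha> l1 l2 \<omega>) x =
              (if \<alpha> - r \<notin> \<int>
               then ereal (of_int \<lfloor>\<alpha> - r\<rfloor>) + min 1 (ereal (frac (\<alpha> - r)) + ereal r * inverse (tau_exp f r \<Gamma> x))
               else ereal (\<alpha> - r))"
  proof (cases "\<alpha> - r \<in> \<int>")
    case True
    then obtain N where N: "\<alpha> - r = of_int N" by (auto elim: Ints_cases)
    then have N0: "0 < N" using \<alpha> by (metis diff_gt_0_iff_gt of_int_0_less_iff)
    \<comment> \<open>For integral \<open>\<alpha> - r\<close> the last order is one less than this
      integer, so k <= n and s <= 1 give at most \<open>\<alpha> - r\<close>, regardless of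
      tau.\<close>
    define n where "n = nat (N - 1)"
    have n: "real n = \<alpha> - r - 1" using N N0 by (simp add: n_def)
    have "holder_beta_star g x \<le> ereal (\<alpha> - r)"
      unfolding holder_beta_star_def
    proof (rule Sup_least, clarify)
      fix k s assume h: "holder_ks_pt g x k s"
      then obtain \<delta> D where D: "s \<le> 1" "0 < \<delta>" "derivs_on g k D {x - \<delta><..<x + \<delta>}" unfolding holder_ks_pt_def by blast
      have "k \<le> n" using no_deriv[OF D(2,3), of n] n by (intro leI notI) simp
      then show "ereal (real k + s) \<le> ereal (\<alpha> - r)" using D(1) n by simp
    qed
    moreover have "ereal (\<alpha> - r) \<le> holder_beta_star g x"
      using int_Sup[of "x - 1" "x + 1"] Sup_holder_ks_int_le[of "x - 1" x "x + 1" g] by simp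
    ultimately show ?thesis using True by (simp add: g_def)
  next
    case False
    define e where "e = frac (\<alpha> - r)"
    define n where "n = nat \<lfloor>\<alpha> - r\<rfloor>"
    have n: "real n = of_int \<lfloor>\<alpha> - r\<rfloor>" using \<alpha> by (simp add: n_def)
    have e: "0 < e" "e < 1" "\<alpha> - r = real n + e"
      using False frac_gt_0_iff[of "\<alpha> - r"] frac_lt_1[of "\<alpha> - r"] by (auto simp: e_def n frac_def)
    have an: "r < \<alpha> - real n" "\<alpha> - real n - r = e" using e by linarith+
    define l1' l2' where "l1' = (\<i> * of_real \<omega>) ^ n * l1" and "l2' = (- \<i> * of_real \<omega>) ^ n * l2"
    have l1': "l1' \<noteq> 0" using l1 omega by (simp add: l1'_def)
    have md: "mixd \<alpha> l1 l2 \<omega> n = mix (\<alpha> - real n) l1' l2' \<omega>" by (simp add: mixd_def l1'_def l2'_def)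
    have "holder_beta_star g x = ereal (real n + min 1 (e + v * r))"
      unfolding holder_beta_star_def Sup_ks
    proof (rule Sup_ereal_image_eqI)
      fix u assume "u \<in> {real k + s | k s. holder_ks_pt g x k s}"
      then obtain k s where u: "u = real k + s" and h: "holder_ks_pt g x k s" by blast
      obtain \<delta> D where D: "s \<le> 1" "0 < \<delta>" "derivs_on g k D {x - \<delta><..<x + \<delta>}" "holder_pt (D k) x s" using h unfolding holder_ks_pt_def by blast
      have kn: "k \<le> n" using no_deriv[OF D(2,3) an(1)] an e by (intro leI notI) simp
      show "u \<le> real n + min 1 (e + v * r)"
      proof (cases "k = n")
        case True
        obtain d where d: "0 < d" "\<And>t. \<bar>t - x\<bar> < d \<Longrightarrow> D n t = mixd \<alpha> l1 l2 \<omega> n t"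
          using unique[OF D(2,3) an(1)] True by auto
        have "holder_pt (mix (\<alpha> - real n) l1' l2' \<omega>) x s"
          unfolding md[symmetric] by (rule holder_pt_cong[OF d(1,2)]) (use D(4) True in auto)
        then have "s \<le> \<alpha> - real n - r + v * r" by (rule v(3)[OF an(1) l1'])
        then show ?thesis using D(1) an True by (simp add: u)
      next
        case False
        then have "real k + 1 \<le> real n" using kn by linarith
        moreover have "0 \<le> min 1 (e + v * r)" using e vr by simp
        ultimately show ?thesis using D(1) by (simp add: u)
      qed
    next
      fix w assume "w < real n + min 1 (e + v * r)"
      \<comment> \<open>Strictly between 0 and min(1, e + vr) and at least w - n, hence usable as
        the exponent of the n-th derivative.\<close>
      define s where "s = max (w - real n) (min 1 (e + v * r) / 2)"
      have m0: "0 < min 1 (e + v * r)" using e vr by simp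
      have s1: "w - real n \<le> s" "min 1 (e + v * r) / 2 \<le> s" "s < min 1 (e + v * r)"
        using m0 \<open>w < real n + min 1 (e + v * r)\<close> by (auto simp: s_def)
      have s: "0 < s" "s < 1" "s < e + v * r" "w \<le> real n + s"
        using s1 m0 min.cobounded1[of 1 "e + v * r"] min.cobounded2[of 1 "e + v * r"] by simp_all
      \<comment> \<open>A detour through a non-integral s0 above both s and vr: the pointwise result
        holds only in that range, and the exponent is lowered to s afterwards.\<close>
      have "max s (v * r) < e + v * r" using s e by simp
      then obtain s0 where s0: "max s (v * r) < s0" "s0 < e + v * r" "s0 \<notin> \<int>" by (rule nonint_between)
      have "holder_pt (mix (\<alpha> - real n) l1' l2' \<omega>) x s0"
        by (rule v(4)[OF an(1)]) (use s0 an in auto)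
      then have hp: "holder_pt (mixd \<alpha> l1 l2 \<omega> n) x s"
        unfolding md by (rule holder_pt_lower_exponent) (use s s0 in auto)
      have "derivs_on g n (mixd \<alpha> l1 l2 \<omega>) {x - 1<..<x + 1}" unfolding g_def by (rule derivs_on_mix) (use an \<rho> in simp)
      then have "holder_ks_pt g x n s" unfolding holder_ks_pt_def using hp s
        by (intro conjI exI[of _ "1::real"] exI[of _ "mixd \<alpha> l1 l2 \<omega>"]) auto
      then show "\<exists>u\<in>{real k + s | k s. holder_ks_pt g x k s}. w \<le> u" using s(4) by blast
    qed
    also have "\<dots> = ereal (of_int \<lfloor>\<alpha> - r\<rfloor>) + min 1 (ereal (frac (\<alpha> - r)) + ereal r * inverse (tau_exp f r \<Gamma> x))"
      unfolding v(1) by (simp add: n e_def[symmetric] one_ereal_def ereal_min mult.commute min_def)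
    finally show ?thesis using False by (simp add: g_def)
  qed
qed

end

text \<open>With kappa = p/Q one has n + kappa = (nQ + p)/Q, so the expansion becomes a power series
  in one exponential with exponents nQ + p, other coefficients being 0. The common denominator turns
  up as the factor \<open>Q powr \<alpha>\<close> in \<open>f_alpha\<close>.\<close>

lemma (in modform) boundary_series_of_expansion:
  fixes \<kappa> :: real and a :: "nat \<Rightarrow> complex"
  defines "m \<equiv> cusp_width \<Gamma> (1,0,0,1)"
  assumes \<kappa>: "0 \<le> \<kappa>" "\<kappa> < 1" "\<kappa> \<in> \<rat>"
    and series: "\<And>z. 0 < Im z \<Longrightarrow> (\<lambda>n. a n * exp (2 * pi * \<i> * complex_of_real (real n + \<kappa>) * z)) sums f (of_nat m * z)"
    and \<rho>: "0 < \<rho>" and K1: "0 \<le> K1" "\<And>z. 0 < Im z \<Longrightarrow> Im z \<le> 1 \<Longrightarrow> norm (f z) \<le> K1 * Im z powr (- \<rho>)"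
  obtains c K \<omega> a00 Q where "modular_boundary \<Gamma> \<mu> r f c \<rho> K \<omega> K1 a00" "0 < Q"
    "\<And>\<alpha> t. \<rho> < \<alpha> \<Longrightarrow> f_alpha m \<kappa> a \<alpha> t = of_real (Q powr \<alpha>) * boundary_series.bdry c \<alpha> (\<omega> * t)"
proof -
  have m: "0 < real m" unfolding m_def using cusp_width_props(1)[OF finite_index one_in_SL2Z] by simp
  obtain p Q :: nat where Q: "Q \<noteq> 0" "\<bar>\<kappa>\<bar> = real p / real Q" by (rule Rats_abs_nat_div_natE[OF \<kappa>(3)]) (rule that)
  have kQ: "\<kappa> = real p / real Q" "0 < real Q" using Q \<kappa>(1) by auto
  define idx where "idx n = n * Q + p" for n
  have idx_mono: "strict_mono idx" using Q(1) by (auto simp: idx_def strict_mono_def)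
  have idxQ: "real n + \<kappa> = real (idx n) / real Q" for n using kQ by (simp add: idx_def field_simps)
  define \<omega> where "\<omega> = 2 * pi / (real m * real Q)"
  have \<omega>: "0 < \<omega>" using m kQ by (simp add: \<omega>_def)
  \<comment> \<open>Suppresses the term n = 0 exactly when kappa = 0, which is the constant term
    stored in \<open>a00\<close> and omitted by \<open>f_alpha\<close>.\<close>
  define a' where "a' n = (if 0 < real n + \<kappa> then a n else 0)" for n
  define c where "c j = (if j \<in> range idx then a' (inv_into UNIV idx j) else 0)" for j
  have cidx: "c (idx n) = a' n" for n
    using strict_mono_imp_inj_on[OF idx_mono] by (simp add: c_def inv_into_f_f)
  have reindex: "(\<lambda>j. c j * h j) sums S \<longleftrightarrow> (\<lambda>n. a' n * h (idx n)) sums S" for h S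
    using sums_mono_reindex[OF idx_mono, of "\<lambda>j. c j * h j" S] by (simp add: cidx) (simp add: c_def)
  define a00 where "a00 = (if \<kappa> = 0 then a 0 else 0)"
  have c0: "c 0 = 0"
  proof (cases "0 \<in> range idx")
    case True
    then obtain n where n: "idx n = 0" by (metis imageE)
    then have "n = 0" "p = 0" using Q(1) by (auto simp: idx_def)
    then show ?thesis using cidx[of n] n kQ by (simp add: a'_def)
  qed (simp add: c_def)
  have ex: "exp (2 * pi * \<i> * complex_of_real (real n + \<kappa>) * (z / of_nat m)) = exp (\<i> * (of_real \<omega> * z)) ^ idx n" for n z
  proof -
    have "2 * pi * \<i> * complex_of_real (real n + \<kappa>) * (z / of_nat m) = of_nat (idx n) * (\<i> * (of_real \<omega> * z))"
      unfolding idxQ using m kQ(2) by (simp add: \<omega>_def mult_ac)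
    then show ?thesis by (simp only: exp_of_nat_mult)
  qed
  have F: "(\<lambda>j. c j * exp (\<i> * (of_real \<omega> * z)) ^ j) sums (f z - a00)" if z: "0 < Im z" for z
  proof -
    have "0 < Im (z / of_nat m)" using z m by simp
    from series[OF this] have "(\<lambda>n. a n * exp (\<i> * (of_real \<omega> * z)) ^ idx n) sums f z"
      unfolding ex using m by simp
    moreover have "(\<lambda>n. if n = 0 then a00 else 0) sums a00" using sums_single[of 0 "\<lambda>_. a00"] by simp
    ultimately have "(\<lambda>n. a n * exp (\<i> * (of_real \<omega> * z)) ^ idx n - (if n = 0 then a00 else 0)) sums (f z - a00)"
      by (rule sums_diff)
    moreover have "a n * exp (\<i> * (of_real \<omega> * z)) ^ idx n - (if n = 0 then a00 else 0) = a' n * exp (\<i> * (of_real \<omega> * z)) ^ idx n" for n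
    proof (cases "n = 0 \<and> \<kappa> = 0")
      case True
      then have "idx n = 0" using kQ Q(1) by (simp add: idx_def)
      then show ?thesis using True by (simp add: a'_def a00_def)
    next
      case False
      then have "0 < real n + \<kappa>" using \<kappa>(1) by (cases "n = 0") auto
      then show ?thesis using False by (auto simp: a'_def a00_def)
    qed
    ultimately show ?thesis unfolding reindex by simp
  qed
  have summ: "summable (\<lambda>j. c j * q ^ j)" if q: "norm q < 1" for q
  proof (cases "q = 0")
    case False
    define z where "z = - \<i> * Ln q / of_real \<omega>"
    then have "Im z = - Re (Ln q) / \<omega>" by (simp only: Im_divide_of_real) simp
    then have "0 < Im z" using q False \<omega> by (simp add: Re_Ln divide_neg_pos)
    moreover have "exp (\<i> * (of_real \<omega> * z)) = q" using \<omega> False by (simp add: z_def)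
    ultimately show ?thesis using F[of z] by (simp add: sums_iff)
  qed simp
  \<comment> \<open>The sum of moduli at height \<open>\<omega>\<close>: it controls heights between
    \<open>\<omega>\<close> and 1, which lie outside the range of the growth bound for
    \<open>f\<close>.\<close>
  define Bd where "Bd = (\<Sum>j. norm (c j) * exp (- \<omega>) ^ j)"
  have sB: "summable (\<lambda>j. norm (c j) * exp (- \<omega>) ^ j)"
  proof -
    have "summable (\<lambda>j. norm (c j * of_real (exp (- \<omega>)) ^ j))"
      by (rule powser_insidea[OF summ[of "of_real (exp (- (\<omega>/2)))"]]) (use \<omega> in auto)
    then show ?thesis by (simp add: norm_mult norm_power)
  qed
  have Bd0: "0 \<le> Bd" unfolding Bd_def by (rule suminf_nonneg[OF sB]) simp
  define K where "K = K1 * (1/\<omega>) powr (- \<rho>) + norm a00 + Bd"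
  have growth: "norm (\<Sum>j. c j * exp (\<i> * w) ^ j) \<le> K * Im w powr (- \<rho>)" if w: "0 < Im w" "Im w \<le> 1" for w
  proof -
    have one: "1 \<le> Im w powr (- \<rho>)" using w \<rho> powr_mono'[of "- \<rho>" 0 "Im w"] by simp
    show ?thesis
    proof (cases "Im w \<le> \<omega>")
      case True
      define z where "z = w / of_real \<omega>"
      have z: "Im z = Im w / \<omega>" "of_real \<omega> * z = w" using \<omega> by (auto simp: z_def)
      have z1: "0 < Im z" "Im z \<le> 1" using w \<omega> True by (auto simp: z)
      have "(\<Sum>j. c j * exp (\<i> * w) ^ j) = f z - a00" using F[OF z1(1)] by (simp add: z sums_iff)
      then have "norm (\<Sum>j. c j * exp (\<i> * w) ^ j) \<le> norm (f z) + norm a00" by (simp add: norm_triangle_ineq4)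
      also have "norm (f z) \<le> K1 * Im z powr (- \<rho>)" by (rule K1(2)[OF z1])
      also have "K1 * Im z powr (- \<rho>) = K1 * (1/\<omega>) powr (- \<rho>) * Im w powr (- \<rho>)"
        unfolding z by (metis mult.assoc mult.commute mult.left_neutral powr_mult times_divide_eq_left)
      also have "norm a00 \<le> norm a00 * Im w powr (- \<rho>)" using one by (simp add: mult_le_cancel_left1)
      finally have "norm (\<Sum>j. c j * exp (\<i> * w) ^ j) \<le> (K1 * (1/\<omega>) powr (- \<rho>) + norm a00) * Im w powr (- \<rho>)"
        by (simp add: distrib_right)
      also have "\<dots> \<le> K * Im w powr (- \<rho>)" using Bd0 by (intro mult_right_mono) (auto simp: K_def)
      finally show ?thesis .
    next
      case False
      have le: "norm (c j * exp (\<i> * w) ^ j) \<le> norm (c j) * exp (- \<omega>) ^ j" for j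
        unfolding norm_mult norm_power using False by (intro mult_left_mono power_mono) auto
      have sm: "summable (\<lambda>j. norm (c j * exp (\<i> * w) ^ j))" by (rule summable_comparison_test'[OF sB]) (use le in simp)
      have "norm (\<Sum>j. c j * exp (\<i> * w) ^ j) \<le> Bd"
        unfolding Bd_def using summable_norm[OF sm] suminf_le[OF le sm sB] by linarith
      also have "\<dots> \<le> K * 1" using K1(1) by (simp add: K_def)
      also have "\<dots> \<le> K * Im w powr (- \<rho>)" using one K1(1) Bd0 by (intro mult_left_mono) (auto simp: K_def)
      finally show ?thesis .
    qed
  qed
  have bs: "boundary_series c \<rho> K"
    by unfold_locales (use c0 summ \<rho> growth in auto)
  interpret B: boundary_series c \<rho> K by (rule bs)
  have mb: "modular_boundary \<Gamma> \<mu> r f c \<rho> K \<omega> K1 a00"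
  proof (intro modular_boundary.intro modform_axioms bs modular_boundary_axioms.intro \<omega> K1)
    fix z :: complex assume "0 < Im z"
    from F[OF this] show "f z = a00 + B.\<Phi> (of_real \<omega> * z)" by (simp add: B.\<Phi>_def sums_iff)
  qed
  have fa: "f_alpha m \<kappa> a \<alpha> t = of_real (real Q powr \<alpha>) * B.bdry \<alpha> (\<omega> * t)" if "\<rho> < \<alpha>" for \<alpha> t
  proof -
    have "(\<lambda>j. c j * (of_real (real j powr (- \<alpha>)) * cis (\<omega> * t) ^ j)) sums B.bdry \<alpha> (\<omega> * t)"
      using B.bdry_sums[OF that] by (simp add: mult.assoc)
    then have "(\<lambda>n. a' n * (of_real (real (idx n) powr (- \<alpha>)) * cis (\<omega> * t) ^ idx n)) sums B.bdry \<alpha> (\<omega> * t)"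
      unfolding reindex .
    then have "(\<lambda>n. of_real (real Q powr \<alpha>) * (a' n * (of_real (real (idx n) powr (- \<alpha>)) * cis (\<omega> * t) ^ idx n))) sums (of_real (real Q powr \<alpha>) * B.bdry \<alpha> (\<omega> * t))"
      by (rule sums_mult)
    moreover have "of_real (real Q powr \<alpha>) * (a' n * (of_real (real (idx n) powr (- \<alpha>)) * cis (\<omega> * t) ^ idx n)) =
      (if 0 < real n + \<kappa> then a n * complex_of_real ((real n + \<kappa>) powr (- \<alpha>)) * exp (2 * pi * \<i> * complex_of_real ((real n + \<kappa>) * (t / real m))) else 0)" for n
    proof -
      have 1: "(real n + \<kappa>) powr (- \<alpha>) = real Q powr \<alpha> * real (idx n) powr (- \<alpha>)"
        unfolding idxQ using kQ by (simp add: powr_divide powr_minus_divide)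
      have "exp (2 * pi * \<i> * complex_of_real ((real n + \<kappa>) * (t / real m))) = exp (2 * pi * \<i> * complex_of_real (real n + \<kappa>) * (of_real t / of_nat m))"
        by (simp add: mult.assoc)
      also have "\<dots> = cis (\<omega> * t) ^ idx n" unfolding ex by (simp add: cis_conv_exp)
      finally have 2: "exp (2 * pi * \<i> * complex_of_real ((real n + \<kappa>) * (t / real m))) = cis (\<omega> * t) ^ idx n" .
      show ?thesis unfolding 1 2 a'_def by simp
    qed
    ultimately show ?thesis unfolding f_alpha_def by (simp only: sums_iff)
  qed
  show thesis by (rule that[OF mb kQ(2) fa])
qed

theorem theorem3:
  fixes \<Gamma> :: "mat2 set" and \<mu> :: "mat2 \<Rightarrow> complex" and r :: real
    and f :: "complex \<Rightarrow> complex" and \<kappa> :: real and a :: "nat \<Rightarrow> complex"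
    and \<alpha> :: real and x :: real and g :: "real \<Rightarrow> complex"
  assumes mf: "modular_form \<Gamma> \<mu> r f"
    and nonzero: "\<exists>z. 0 < Im z \<and> f z \<noteq> 0"
    and kappa_rat: "\<forall>\<gamma>\<in>carrier SL2Z. \<forall>k b. fourier_expansion_at f r \<Gamma> \<gamma> k b \<longrightarrow> k \<in> \<rat>"
    and exp_inf: "0 \<le> \<kappa>" "\<kappa> < 1"
      "\<forall>z. 0 < Im z \<longrightarrow> (\<lambda>n. a n * exp (2 * pi * \<i> * complex_of_real (real n + \<kappa>) * z))
            sums f (of_nat (cusp_width \<Gamma> (1,0,0,1)) * z)"
    and alpha: "\<alpha> > (if cusp_form f r \<Gamma> then r / 2 else r)"
    and irr: "x \<notin> \<rat>"
    and g: "g \<in> {f_alpha (cusp_width \<Gamma> (1,0,0,1)) \<kappa> a \<alpha>,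
               (\<lambda>t. complex_of_real (Re (f_alpha (cusp_width \<Gamma> (1,0,0,1)) \<kappa> a \<alpha> t))),
               (\<lambda>t. complex_of_real (Im (f_alpha (cusp_width \<Gamma> (1,0,0,1)) \<kappa> a \<alpha> t)))}"
  shows "(cusp_form f r \<Gamma> \<longrightarrow>
            holder_beta g x = ereal (\<alpha> - r / 2) \<and>
            holder_beta_star g x = ereal (\<alpha> - r / 2) \<and>
            holder_beta_2star g x = ereal (\<alpha> - r / 2))
       \<and> (\<not> cusp_form f r \<Gamma> \<longrightarrow>
            holder_beta g x = ereal \<alpha> - (1 - inverse (tau_exp f r \<Gamma> x)) * ereal r \<and>
            holder_beta_star g x =
              (if \<alpha> - r \<notin> \<int>
               then ereal (of_int \<lfloor>\<alpha> - r\<rfloor>) + min 1 (ereal (frac (\<alpha> - r)) + ereal r * inverse (tau_exp f r \<Gamma> x))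
               else ereal (\<alpha> - r)) \<and>
            holder_beta_2star g x = ereal (\<alpha> - r))"
proof -
  define m where "m = cusp_width \<Gamma> (1,0,0,1)"
  have fin: "finite_index_subgroup \<Gamma>" and r0: "0 < r" using mf by (auto simp: modular_form_def)
  have m: "0 < m" unfolding m_def by (rule cusp_width_props(1)[OF fin one_in_SL2Z])
  \<comment> \<open>The slash by the scaling matrix at infinity contains the constant factor 1/sqrt
    m to the power r, so the coefficients of f(mz) and those of \<open>fourier_expansion_at\<close>
    differ by \<open>D\<close>.\<close>
  define D where "D = complex_of_real (1 / sqrt (real m)) powr complex_of_real r"
  have fs: "f_sigma f r (1,0,0,1) m z = f (of_nat m * z) / D" for z by (simp add: f_sigma_def D_def)
  have expansion: "fourier_expansion_at f r \<Gamma> (1,0,0,1) \<kappa> (\<lambda>n. a n / D)"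
    unfolding fourier_expansion_at_def m_def[symmetric]
  proof (intro conjI exp_inf allI impI)
    fix z :: complex assume "0 < Im z"
    then have "(\<lambda>n. a n * exp (2 * pi * \<i> * complex_of_real (real n + \<kappa>) * z)) sums f (of_nat m * z)" using exp_inf(3) by (simp add: m_def)
    from sums_divide[OF this, of D]
    show "(\<lambda>n. a n / D * exp (2 * pi * \<i> * complex_of_real (real n + \<kappa>) * z)) sums f_sigma f r (1,0,0,1) m z"
      unfolding fs by simp
  qed
  interpret modform \<Gamma> \<mu> r f
    by unfold_locales (use mf nonzero expansion in auto)
  have krat: "\<kappa> \<in> \<rat>" using kappa_rat expansion one_in_SL2Z by blast
  have series: "(\<lambda>n. a n * exp (2 * pi * \<i> * complex_of_real (real n + \<kappa>) * z)) sums f (of_nat (cusp_width \<Gamma> (1,0,0,1)) * z)" if "0 < Im z" for z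
    using exp_inf(3) that by blast
  have mixE: "\<exists>l1 l2. l1 \<noteq> 0 \<and> g = boundary_series.mix c \<alpha> l1 l2 \<omega>"
    if mb: "modular_boundary \<Gamma> \<mu> r f c \<rho> K \<omega> K1 a00" and Q: "0 < Q" and fa: "\<And>t. f_alpha (cusp_width \<Gamma> (1,0,0,1)) \<kappa> a \<alpha> t = of_real (Q powr \<alpha>) * boundary_series.bdry c \<alpha> (\<omega> * t)"
    for c \<rho> K \<omega> K1 a00 Q
  proof -
    interpret B: modular_boundary \<Gamma> \<mu> r f c \<rho> K \<omega> K1 a00 by (rule mb)
    define q where "q = complex_of_real (Q powr \<alpha>)"
    have q: "q \<noteq> 0" "cnj q = q" using Q by (auto simp: q_def)
    have fa': "f_alpha (cusp_width \<Gamma> (1,0,0,1)) \<kappa> a \<alpha> t = q * B.bdry \<alpha> (\<omega> * t)" for t by (simp add: fa q_def)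
    \<comment> \<open>Re z = (z + cnj z)/2 and Im z = (z - cnj z)/(2i). In all three cases the
      coefficient of the unconjugated part is nonzero, which is all the exponent bounds
      require.\<close>
    have "g = B.mix \<alpha> q 0 \<omega> \<or> g = B.mix \<alpha> (q / 2) (q / 2) \<omega> \<or> g = B.mix \<alpha> (q / (2 * \<i>)) (- q / (2 * \<i>)) \<omega>"
    proof -
      have re: "complex_of_real (Re z) = (z + cnj z) / 2" and im: "complex_of_real (Im z) = (z - cnj z) / (2 * \<i>)" for z
        by (simp_all add: complex_eq_iff)
      have "q * z = q * z + 0 * cnj z" "(q * z + cnj (q * z)) / 2 = q / 2 * z + q / 2 * cnj z"
        "(q * z - cnj (q * z)) / (2 * \<i>) = q / (2 * \<i>) * z + - q / (2 * \<i>) * cnj z" for z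
        by (simp_all add: q(2) field_simps)
      with g show ?thesis unfolding re im fa' B.mix_def by blast
    qed
    moreover have "q / 2 \<noteq> 0" "q / (2 * \<i>) \<noteq> 0" using q by auto
    ultimately show ?thesis using q(1) by blast
  qed
  show ?thesis
  proof (cases "cusp_form f r \<Gamma>")
    case True
    then have a2: "r / 2 < \<alpha>" using alpha by simp
    obtain K1 where K1: "0 \<le> K1" "\<And>z. 0 < Im z \<Longrightarrow> Im z \<le> 1 \<Longrightarrow> norm (f z) \<le> K1 * Im z powr (- (r/2))"
      by (rule cusp_form_bound[OF True]) (rule that)
    have r2: "0 < r / 2" using r0 by simp
    obtain c K \<omega> a00 Q where B: "modular_boundary \<Gamma> \<mu> r f c (r/2) K \<omega> K1 a00" "0 < Q"
      "\<And>\<alpha> t. r/2 < \<alpha> \<Longrightarrow> f_alpha (cusp_width \<Gamma> (1,0,0,1)) \<kappa> a \<alpha> t = of_real (Q powr \<alpha>) * boundary_series.bdry c \<alpha> (\<omega> * t)"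
      by (rule boundary_series_of_expansion[OF exp_inf(1,2) krat series r2 K1]) (assumption+, rule that)
    obtain l1 l2 where l: "l1 \<noteq> 0" "g = boundary_series.mix c \<alpha> l1 l2 \<omega>" using mixE[OF B(1,2) B(3)[OF a2]] by blast
    show ?thesis using modular_boundary.cusp_case[OF B(1) a2 refl l(1) irr] True unfolding l(2) by blast
  next
    case False
    then have a2: "r < \<alpha>" using alpha by simp
    obtain K1 where K1: "0 \<le> K1" "\<And>z. 0 < Im z \<Longrightarrow> Im z \<le> 1 \<Longrightarrow> norm (f z) \<le> K1 * Im z powr (- r)"
      by (rule noncusp_bound) (rule that)
    obtain c K \<omega> a00 Q where B: "modular_boundary \<Gamma> \<mu> r f c r K \<omega> K1 a00" "0 < Q"
      "\<And>\<alpha> t. r < \<alpha> \<Longrightarrow> f_alpha (cusp_width \<Gamma> (1,0,0,1)) \<kappa> a \<alpha> t = of_real (Q powr \<alpha>) * boundary_series.bdry c \<alpha> (\<omega> * t)"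
      by (rule boundary_series_of_expansion[OF exp_inf(1,2) krat series r0 K1]) (assumption+, rule that)
    obtain l1 l2 where l: "l1 \<noteq> 0" "g = boundary_series.mix c \<alpha> l1 l2 \<omega>" using mixE[OF B(1,2) B(3)[OF a2]] by blast
    show ?thesis using modular_boundary.noncusp_case[OF B(1) refl a2 l(1) False irr] False unfolding l(2) by blast
  qed
qed

end
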